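(* Let $n\ge2$ and let $Q$ be the affine quiver of type $\widetilde{A}_{2n-1,1}$, with $\mathcal{A}_q(Q)$, $X_?$, $X_\delta$, $F_m$, $M_i(l)$, $N_i(l)$ as in the context. In $\mathcal{A}_q(Q)$, for $m\ge1$ we have: (1) $F_m(X_\delta)X_{I_1[-1]}=q^{\frac m2}X_{M_1(m-1)}+q^{-\frac m2}X_{N_{2n}(m-2)}$, where $N_{2n}(-1)=I_{2n}[-1]$; (2) $F_m(X_\delta)X_{I_i[-1]}=q^{\frac m2}X_{M_i(m-1)}+q^{-\frac m2}X_{N_i(m-1)}$ for $2\le i\le 2n-1$; (3) $F_m(X_\delta)X_{I_{2n}[-1]}=q^{\frac m2}X_{M_1(m-2)}+q^{-\frac m2}X_{N_{2n}(m-1)}$, where $M_1(-1)=I_1[-1]$.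
   Context: Fix $n\ge2$. $\Lambda$ is the skew-symmetric $2n\times 2n$ integer matrix with $\Lambda_{ij}=1$ for $i<j$ with $j-i$ odd and $\Lambda_{ij}=0$ for $i<j$ with $j-i$ even; write $\Lambda(\mathbf e,\mathbf f)=\mathbf e^{tr}\Lambda\mathbf f$. $B=(b_{ij})$ is the skew-symmetric $2n\times2n$ matrix with $b_{i,i+1}=1$ ($1\le i\le 2n-1$), $b_{1,2n}=1$, and all other entries above the diagonal $0$. $\mathbb F$ is a finite field with $q$ elements. The quantum torus is the $\mathbb Z[q^{\pm\frac12}]$-algebra with basis $\{X^{\mathbf e}:\mathbf e\in\mathbb Z^{2n}\}$ and product $X^{\mathbf e}X^{\mathbf f}=q^{\Lambda(\mathbf e,\mathbf f)/2}X^{\mathbf e+\mathbf f}$; put $X_i=X^{\mathbf e_i}$. The quantum cluster algebra $\mathcal A_q(Q)$ with initial quantum seed $(\Lambda,B,\{X_i\})$ is a subalgebra of this torus; the identities are identities in the torus. $Q$ is the quiver with vertices $1,\dots,2n$ and arrows $i\to i+1$ ($1\le i\le 2n-1$) and $1\to 2n$. Let $k$ be the degree-$2$ extension of $\mathbb F$. Representations are finite-dimensional representations of $Q$ over $k$; $\mathbf{dim}$ is the dimension vector over $k$; $P_i,I_i$ are the projective and injective representations at vertex $i$. $R=(r_{ij})$ with $r_{ij}$ the number of arrows $j\to i$. The Euler form is $\langle \mathbf v,\mathbf w\rangle=2\mathbf v^{tr}(\mathbf I-R^{tr})\mathbf w$. $\mathcal C_Q$ is the cluster category of $Q$ over $k$,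 with shift $[1]$; each object is uniquely $V\oplus P[1]$ with $V$ a representation and $P$ a projective representation, and $I_i[-1]\cong P_i[1]$. For $V$ a representation with $\mathbf v=\mathbf{dim}\,V$ and $P$ projective, $$X_{V\oplus P[1]}=\sum_{\mathbf e}|\mathrm{Gr}_{\mathbf e}V|\,q^{-\frac12\langle\mathbf e,\mathbf v-\mathbf e\rangle}X^{-B\mathbf e-(\mathbf I-R^{tr})\mathbf v+\mathbf t_P},\qquad \mathbf t_P=\mathbf{dim}(P/\mathrm{rad}P),$$ where $\mathrm{Gr}_{\mathbf e}V$ is the set of subrepresentations of $V$ of dimension vector $\mathbf e$. In particular $X_{I_i[-1]}=X_{P_i[1]}=X_i$. $\delta=(1,\dots,1)$. For $\lambda\in k$, $E(\lambda)$ is the representation with $k$ at each vertex, identity maps on the arrows $i\to i+1$ and multiplication by $\lambda$ on $1\to 2n$; $X_\delta:=X_{E(\lambda)}$ (independent of $\lambda$). For $1\le i\le 2n-1$, $l\ge0$, $M_i(l)$ is the indecomposable preprojective representation with $\mathbf{dim}\,M_i(l)=\mathbf{dim}\,P_{i+1}+l\delta$. For $2\le i\le 2n$, $l\ge0$, $N_i(l)$ is the indecomposable preinjective representation with $\mathbf{dim}\,N_i(l)=\mathbf{dim}\,I_{i-1}+l\delta$. Chebyshev polynomials of the first kind: $F_0(x)=1$, $F_1(x)=x$, $F_2(x)=x^2-2$, $F_{m+1}(x)=F_m(x)x-F_{m-1}(x)$ for $m\ge2$. *)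

theory Defs
  imports
    Complex_Main
    "HOL-Algebra.Module"
    "HOL-Library.Poly_Mapping"
    "HOL-Library.Function_Algebras"
    "HOL-Library.FuncSet"
begin

section \<open>The quiver and its matrices\<close>

text \<open>
  There are no parallel arrows when \<open>n \<ge> 2\<close>, so an arrow is identified with the pair
  (source, target).  Vectors indexed by the vertices are functions on \<open>nat\<close> that vanish
  outside \<open>{1..2*n}\<close>.
\<close>

definition vertices :: "nat \<Rightarrow> nat set" where
  "vertices n = {1..2*n}"

definition arrows :: "nat \<Rightarrow> (nat \<times> nat) set" where
  "arrows n = {(i, i + 1) | i. 1 \<le> i \<and> i \<le> 2*n - 1} \<union> {(1, 2*n)}"

definition Lambda_mat :: "nat \<Rightarrow> nat \<Rightarrow> int" where
  "Lambda_mat i j =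
     (if i < j \<and> odd (j - i) then 1 else if j < i \<and> odd (i - j) then -1 else 0)"

definition B_mat :: "nat \<Rightarrow> nat \<Rightarrow> nat \<Rightarrow> int" where
  "B_mat n i j =
     (let up = (\<lambda>i j. (1 \<le> i \<and> i \<le> 2*n - 1 \<and> j = i + 1) \<or> (i = 1 \<and> j = 2*n))
      in if up i j then 1 else if up j i then -1 else 0)"

definition R_mat :: "nat \<Rightarrow> nat \<Rightarrow> nat \<Rightarrow> int" where
  "R_mat n i j = int (card {a \<in> arrows n. a = (j, i)})"

definition I_minus_Rtr :: "nat \<Rightarrow> nat \<Rightarrow> nat \<Rightarrow> int" where
  "I_minus_Rtr n i j = (if i = j then 1 else 0) - R_mat n j i"

definition mat_vec :: "nat \<Rightarrow> (nat \<Rightarrow> nat \<Rightarrow> int) \<Rightarrow> (nat \<Rightarrow> int) \<Rightarrow> (nat \<Rightarrow> int)" where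
  "mat_vec n A v = (\<lambda>i. if i \<in> vertices n then \<Sum>j\<in>vertices n. A i j * v j else 0)"

definition bilin :: "nat \<Rightarrow> (nat \<Rightarrow> nat \<Rightarrow> int) \<Rightarrow> (nat \<Rightarrow> int) \<Rightarrow> (nat \<Rightarrow> int) \<Rightarrow> int" where
  "bilin n A v w = (\<Sum>i\<in>vertices n. \<Sum>j\<in>vertices n. v i * A i j * w j)"

text \<open>The factor 2 is the degree of the field of coefficients over the base field.\<close>

definition euler_form :: "nat \<Rightarrow> (nat \<Rightarrow> int) \<Rightarrow> (nat \<Rightarrow> int) \<Rightarrow> int" where
  "euler_form n v w = 2 * bilin n (I_minus_Rtr n) v w"

definition delta :: "nat \<Rightarrow> nat \<Rightarrow> int" where
  "delta n = (\<lambda>i. if i \<in> vertices n then 1 else 0)"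


section \<open>The quantum torus\<close>

text \<open>The subring of the reals generated by the integers and \<open>q\<close> to the powers \<open>1/2\<close>, \<open>-1/2\<close>.\<close>

inductive_set half_power_coeffs :: "nat \<Rightarrow> real set" for q :: nat where
  monom: "of_int c * real q powr (of_int k / 2) \<in> half_power_coeffs q"
| add: "x \<in> half_power_coeffs q \<Longrightarrow> y \<in> half_power_coeffs q \<Longrightarrow> x + y \<in> half_power_coeffs q"

text \<open>A torus element is its finitely supported family of coefficients in the basis \<open>X\<^sup>e\<close>.\<close>

type_synonym torus_elem = "(nat \<Rightarrow> int) \<Rightarrow>\<^sub>0 real"

definition torus_mult :: "nat \<Rightarrow> nat \<Rightarrow> torus_elem \<Rightarrow> torus_elem \<Rightarrow> torus_elem" where
  "torus_mult n q f g =
     (\<Sum>d\<in>Poly_Mapping.keys f. \<Sum>e\<in>Poly_Mapping.keys g.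
        Poly_Mapping.single (d + e)
          (Poly_Mapping.lookup f d * Poly_Mapping.lookup g e
            * real q powr (of_int (bilin n Lambda_mat d e) / 2)))"

definition quantum_torus :: "nat \<Rightarrow> nat \<Rightarrow> (real, torus_elem) module" where
  "quantum_torus n q =
     \<lparr>carrier = {f. (\<forall>e\<in>Poly_Mapping.keys f. \<forall>i. i \<notin> vertices n \<longrightarrow> e i = 0)
                  \<and> (\<forall>e. Poly_Mapping.lookup f e \<in> half_power_coeffs q)},
      mult = torus_mult n q, one = Poly_Mapping.single 0 1, zero = 0, add = (+),
      smult = (\<lambda>c. Poly_Mapping.map ((*) c))\<rparr>"

definition torus_monom :: "(nat \<Rightarrow> int) \<Rightarrow> torus_elem" where
  "torus_monom e = Poly_Mapping.single e 1"

text \<open>Chebyshev polynomials of the first kind, evaluated at an element of a ring.\<close>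

fun chebyshev_F :: "('a, 'b) ring_scheme \<Rightarrow> nat \<Rightarrow> 'a \<Rightarrow> 'a" where
  "chebyshev_F R 0 x = \<one>\<^bsub>R\<^esub>"
| "chebyshev_F R (Suc 0) x = x"
| "chebyshev_F R (Suc (Suc 0)) x = x \<otimes>\<^bsub>R\<^esub> x \<ominus>\<^bsub>R\<^esub> (\<one>\<^bsub>R\<^esub> \<oplus>\<^bsub>R\<^esub> \<one>\<^bsub>R\<^esub>)"
| "chebyshev_F R (Suc (Suc (Suc m))) x =
     chebyshev_F R (Suc (Suc m)) x \<otimes>\<^bsub>R\<^esub> x \<ominus>\<^bsub>R\<^esub> chebyshev_F R (Suc m) x"


section \<open>Finite-dimensional representations\<close>

text \<open>
  All vector spaces are finite-dimensional subspaces of one fixed infinite-dimensional ambient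
  space, so every finite-dimensional representation occurs up to isomorphism.
  Lists of vertices are used as coordinates so that the path spaces of the quiver are literally
  subspaces of the ambient space.
\<close>

type_synonym 'k kvec = "nat list \<Rightarrow> 'k"

definition kscale :: "'k::field \<Rightarrow> 'k kvec \<Rightarrow> 'k kvec" where
  "kscale c v = (\<lambda>p. c * v p)"

global_interpretation kv: vector_space "kscale :: 'k::field \<Rightarrow> 'k kvec \<Rightarrow> 'k kvec"
  by unfold_locales (auto simp: kscale_def fun_eq_iff algebra_simps)

definition linear_on :: "'k::field kvec set \<Rightarrow> 'k kvec set \<Rightarrow> ('k kvec \<Rightarrow> 'k kvec) \<Rightarrow> bool" where
  "linear_on S T f \<longleftrightarrow> f \<in> S \<rightarrow> T \<and> (\<forall>x\<in>S. \<forall>y\<in>S. f (x + y) = f x + f y)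
     \<and> (\<forall>c. \<forall>x\<in>S. f (kscale c x) = kscale c (f x))"

record 'k rep =
  space :: "nat \<Rightarrow> 'k kvec set"
  arr :: "nat \<times> nat \<Rightarrow> 'k kvec \<Rightarrow> 'k kvec"

definition is_rep :: "nat \<Rightarrow> 'k::field rep \<Rightarrow> bool" where
  "is_rep n V \<longleftrightarrow> (\<forall>i\<in>vertices n. \<exists>S. finite S \<and> space V i = kv.span S)
     \<and> (\<forall>(i, j)\<in>arrows n. linear_on (space V i) (space V j) (arr V (i, j)))"

definition dimvec :: "nat \<Rightarrow> 'k::field rep \<Rightarrow> nat \<Rightarrow> int" where
  "dimvec n V = (\<lambda>i. if i \<in> vertices n then int (kv.dim (space V i)) else 0)"

definition zero_rep :: "'k::field rep" where
  "zero_rep = \<lparr>space = (\<lambda>_. {0}), arr = (\<lambda>_ _. 0)\<rparr>"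

definition rep_hom ::
  "nat \<Rightarrow> 'k::field rep \<Rightarrow> 'k rep \<Rightarrow> (nat \<Rightarrow> 'k kvec \<Rightarrow> 'k kvec) \<Rightarrow> bool" where
  "rep_hom n V W f \<longleftrightarrow> (\<forall>i\<in>vertices n. linear_on (space V i) (space W i) (f i))
     \<and> (\<forall>(i, j)\<in>arrows n. \<forall>x\<in>space V i. f j (arr V (i, j) x) = arr W (i, j) (f i x))"

definition rep_mono :: "nat \<Rightarrow> 'k::field rep \<Rightarrow> 'k rep \<Rightarrow> (nat \<Rightarrow> 'k kvec \<Rightarrow> 'k kvec) \<Rightarrow> bool" where
  "rep_mono n V W f \<longleftrightarrow> rep_hom n V W f \<and> (\<forall>i\<in>vertices n. inj_on (f i) (space V i))"

definition rep_epi :: "nat \<Rightarrow> 'k::field rep \<Rightarrow> 'k rep \<Rightarrow> (nat \<Rightarrow> 'k kvec \<Rightarrow> 'k kvec) \<Rightarrow> bool" where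
  "rep_epi n V W f \<longleftrightarrow> rep_hom n V W f \<and> (\<forall>i\<in>vertices n. f i ` space V i = space W i)"

definition split_mono :: "nat \<Rightarrow> 'k::field rep \<Rightarrow> 'k rep \<Rightarrow> (nat \<Rightarrow> 'k kvec \<Rightarrow> 'k kvec) \<Rightarrow> bool" where
  "split_mono n V W f \<longleftrightarrow> rep_hom n V W f
     \<and> (\<exists>r. rep_hom n W V r \<and> (\<forall>i\<in>vertices n. \<forall>x\<in>space V i. r i (f i x) = x))"

definition split_epi :: "nat \<Rightarrow> 'k::field rep \<Rightarrow> 'k rep \<Rightarrow> (nat \<Rightarrow> 'k kvec \<Rightarrow> 'k kvec) \<Rightarrow> bool" where
  "split_epi n V W f \<longleftrightarrow> rep_hom n V W f
     \<and> (\<exists>s. rep_hom n W V s \<and> (\<forall>i\<in>vertices n. \<forall>y\<in>space W i. f i (s i y) = y))"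

text \<open>
  A subrepresentation is a family of subspaces; extensionality makes such families correspond
  one-to-one to subrepresentations, so that they can be counted.
\<close>

definition subrep :: "nat \<Rightarrow> 'k::field rep \<Rightarrow> (nat \<Rightarrow> 'k kvec set) \<Rightarrow> bool" where
  "subrep n V N \<longleftrightarrow> N \<in> extensional (vertices n)
     \<and> (\<forall>i\<in>vertices n. kv.subspace (N i) \<and> N i \<subseteq> space V i)
     \<and> (\<forall>(i, j)\<in>arrows n. arr V (i, j) ` N i \<subseteq> N j)"

definition Gr :: "nat \<Rightarrow> 'k::field rep \<Rightarrow> (nat \<Rightarrow> int) \<Rightarrow> (nat \<Rightarrow> 'k kvec set) set" where
  "Gr n V e = {N. subrep n V N \<and> (\<forall>i\<in>vertices n. int (kv.dim (N i)) = e i)}"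

definition maximal_subrep :: "nat \<Rightarrow> 'k::field rep \<Rightarrow> (nat \<Rightarrow> 'k kvec set) \<Rightarrow> bool" where
  "maximal_subrep n V N \<longleftrightarrow> subrep n V N \<and> (\<exists>i\<in>vertices n. N i \<noteq> space V i)
     \<and> (\<forall>N'. subrep n V N' \<and> (\<forall>i\<in>vertices n. N i \<subseteq> N' i)
           \<longrightarrow> N' = N \<or> (\<forall>i\<in>vertices n. N' i = space V i))"

definition rad :: "nat \<Rightarrow> 'k::field rep \<Rightarrow> nat \<Rightarrow> 'k kvec set" where
  "rad n V i = {x \<in> space V i. \<forall>N. maximal_subrep n V N \<longrightarrow> x \<in> N i}"

text \<open>The dimension vector of \<open>P/rad P\<close>.\<close>

definition top_dimvec :: "nat \<Rightarrow> 'k::field rep \<Rightarrow> nat \<Rightarrow> int" where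
  "top_dimvec n P =
     (\<lambda>i. if i \<in> vertices n then int (kv.dim (space P i)) - int (kv.dim (rad n P i)) else 0)"

definition indecomposable :: "nat \<Rightarrow> 'k::field rep \<Rightarrow> bool" where
  "indecomposable n V \<longleftrightarrow> (\<exists>i\<in>vertices n. space V i \<noteq> {0})
     \<and> (\<forall>N N'. subrep n V N \<and> subrep n V N'
          \<and> (\<forall>i\<in>vertices n. {x + y | x y. x \<in> N i \<and> y \<in> N' i} = space V i \<and> N i \<inter> N' i = {0})
          \<longrightarrow> (\<forall>i\<in>vertices n. N i = {0}) \<or> (\<forall>i\<in>vertices n. N' i = {0}))"

definition projective :: "nat \<Rightarrow> 'k::field rep \<Rightarrow> bool" where
  "projective n P \<longleftrightarrow> is_rep n P
     \<and> (\<forall>V W g h. is_rep n V \<and> is_rep n W \<and> rep_epi n V W g \<and> rep_hom n P W h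
          \<longrightarrow> (\<exists>h'. rep_hom n P V h' \<and> (\<forall>i\<in>vertices n. \<forall>x\<in>space P i. g i (h' i x) = h i x)))"

definition injective :: "nat \<Rightarrow> 'k::field rep \<Rightarrow> bool" where
  "injective n I \<longleftrightarrow> is_rep n I
     \<and> (\<forall>V W f h. is_rep n V \<and> is_rep n W \<and> rep_mono n V W f \<and> rep_hom n V I h
          \<longrightarrow> (\<exists>h'. rep_hom n W I h' \<and> (\<forall>i\<in>vertices n. \<forall>x\<in>space V i. h' i (f i x) = h i x)))"

text \<open>
  A path is recorded as the list of vertices it visits.  \<open>P_rep n i\<close> has at \<open>j\<close> the space with
  basis the paths from \<open>i\<close> to \<open>j\<close>, an arrow acting by appending itself to a path; \<open>I_rep n i\<close> has
  at \<open>j\<close> the dual of the space with basis the paths from \<open>j\<close> to \<open>i\<close>.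
\<close>

definition is_path :: "nat \<Rightarrow> nat \<Rightarrow> nat \<Rightarrow> nat list \<Rightarrow> bool" where
  "is_path n i j p \<longleftrightarrow> p \<noteq> [] \<and> hd p = i \<and> last p = j \<and> set p \<subseteq> vertices n
     \<and> successively (\<lambda>x y. (x, y) \<in> arrows n) p"

definition P_rep :: "nat \<Rightarrow> nat \<Rightarrow> 'k::field rep" where
  "P_rep n i = \<lparr>space = (\<lambda>j. {v. \<forall>p. \<not> is_path n i j p \<longrightarrow> v p = 0}),
     arr = (\<lambda>(j, j') v p. if p \<noteq> [] \<and> last p = j' then v (butlast p) else 0)\<rparr>"

definition I_rep :: "nat \<Rightarrow> nat \<Rightarrow> 'k::field rep" where
  "I_rep n i = \<lparr>space = (\<lambda>j. {v. \<forall>p. \<not> is_path n j i p \<longrightarrow> v p = 0}),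
     arr = (\<lambda>(j, j') v p. if p \<noteq> [] \<and> hd p = j' then v (j # p) else 0)\<rparr>"

text \<open>Each vertex of \<open>E_rep n c\<close> carries the line of vectors supported at the coordinate \<open>[]\<close>.\<close>

definition E_rep :: "nat \<Rightarrow> 'k::field \<Rightarrow> 'k rep" where
  "E_rep n c = \<lparr>space = (\<lambda>_. {v. \<forall>p. p \<noteq> [] \<longrightarrow> v p = 0}),
     arr = (\<lambda>a. if a = (1, 2*n) then kscale c else id)\<rparr>"

text \<open>
  Almost split (Auslander--Reiten) sequences \<open>0 \<rightarrow> U \<rightarrow> E \<rightarrow> V \<rightarrow> 0\<close>; in such a sequence
  \<open>U\<close> is the Auslander--Reiten translate of \<open>V\<close>.
\<close>

definition almost_split ::
  "nat \<Rightarrow> 'k::field rep \<Rightarrow> (nat \<Rightarrow> 'k kvec \<Rightarrow> 'k kvec) \<Rightarrow> 'k rep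
     \<Rightarrow> (nat \<Rightarrow> 'k kvec \<Rightarrow> 'k kvec) \<Rightarrow> 'k rep \<Rightarrow> bool" where
  "almost_split n U f E g V \<longleftrightarrow>
     is_rep n U \<and> is_rep n E \<and> is_rep n V \<and> rep_mono n U E f \<and> rep_epi n E V g
     \<and> (\<forall>i\<in>vertices n. f i ` space U i = {x \<in> space E i. g i x = 0})
     \<and> \<not> split_mono n U E f \<and> \<not> split_epi n E V g
     \<and> (\<forall>W h. is_rep n W \<and> rep_hom n U W h \<and> \<not> split_mono n U W h
          \<longrightarrow> (\<exists>h'. rep_hom n E W h' \<and> (\<forall>i\<in>vertices n. \<forall>x\<in>space U i. h' i (f i x) = h i x)))
     \<and> (\<forall>W h. is_rep n W \<and> rep_hom n W V h \<and> \<not> split_epi n W V h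
          \<longrightarrow> (\<exists>h'. rep_hom n W E h' \<and> (\<forall>i\<in>vertices n. \<forall>x\<in>space W i. g i (h' i x) = h i x)))"

text \<open>
  The indecomposable preprojective representations are the \<open>\<tau>\<^sup>-\<^sup>t P\<close> with \<open>P\<close> indecomposable
  projective, the indecomposable preinjective ones the \<open>\<tau>\<^sup>t I\<close> with \<open>I\<close> indecomposable injective
  (\<open>t \<ge> 0\<close>).
\<close>

inductive indec_preprojective :: "nat \<Rightarrow> 'k::field rep \<Rightarrow> bool" for n :: nat where
  proj: "projective n P \<Longrightarrow> indecomposable n P \<Longrightarrow> indec_preprojective n P"
| tau_inv: "indec_preprojective n U \<Longrightarrow> almost_split n U f E g V \<Longrightarrow> indec_preprojective n V"

inductive indec_preinjective :: "nat \<Rightarrow> 'k::field rep \<Rightarrow> bool" for n :: nat where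
  inj: "injective n I \<Longrightarrow> indecomposable n I \<Longrightarrow> indec_preinjective n I"
| tau: "indec_preinjective n V \<Longrightarrow> almost_split n U f E g V \<Longrightarrow> indec_preinjective n U"

definition is_M :: "nat \<Rightarrow> nat \<Rightarrow> nat \<Rightarrow> 'k::field rep \<Rightarrow> bool" where
  "is_M n i l V \<longleftrightarrow> is_rep n V \<and> indecomposable n V \<and> indec_preprojective n V
     \<and> dimvec n V = dimvec n (P_rep n (i + 1) :: 'k rep) + (\<lambda>j. int l * delta n j)"

definition is_N :: "nat \<Rightarrow> nat \<Rightarrow> nat \<Rightarrow> 'k::field rep \<Rightarrow> bool" where
  "is_N n i l V \<longleftrightarrow> is_rep n V \<and> indecomposable n V \<and> indec_preinjective n V
     \<and> dimvec n V = dimvec n (I_rep n (i - 1) :: 'k rep) + (\<lambda>j. int l * delta n j)"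


section \<open>Objects of the cluster category and the map \<open>X\<close>\<close>

text \<open>The pair \<open>(V, P)\<close> stands for the object \<open>V \<oplus> P[1]\<close>, where \<open>P\<close> is projective.\<close>

type_synonym 'k cluster_obj = "'k rep \<times> 'k rep"

definition of_rep :: "'k::field rep \<Rightarrow> 'k cluster_obj" where
  "of_rep V = (V, zero_rep)"

text \<open>\<open>I\<^sub>i[-1]\<close>, which is isomorphic to \<open>P\<^sub>i[1]\<close> in the cluster category.\<close>

definition I_shift :: "nat \<Rightarrow> nat \<Rightarrow> 'k::field cluster_obj" where
  "I_shift n i = (zero_rep, P_rep n i)"

text \<open>The sum may be restricted to \<open>e \<le> dim V\<close>, the Grassmannians being empty for other \<open>e\<close>.\<close>

definition sub_dimvecs :: "nat \<Rightarrow> (nat \<Rightarrow> int) \<Rightarrow> (nat \<Rightarrow> int) set" where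
  "sub_dimvecs n v =
     {e. (\<forall>i\<in>vertices n. 0 \<le> e i \<and> e i \<le> v i) \<and> (\<forall>i. i \<notin> vertices n \<longrightarrow> e i = 0)}"

definition X_char :: "nat \<Rightarrow> nat \<Rightarrow> 'k::field cluster_obj \<Rightarrow> torus_elem" where
  "X_char n q = (\<lambda>(V, P). let v = dimvec n V; T = quantum_torus n q in
     \<Oplus>\<^bsub>T\<^esub>e\<in>sub_dimvecs n v.
       (real (card (Gr n V e)) * real q powr (- of_int (euler_form n e (v - e)) / 2))
         \<odot>\<^bsub>T\<^esub> torus_monom
             (- mat_vec n (B_mat n) e - mat_vec n (I_minus_Rtr n) v + top_dimvec n P))"


section \<open>The extension of fields\<close>

definition degree_two_extension :: "('f::field \<Rightarrow> 'k::field) \<Rightarrow> bool" where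
  "degree_two_extension h \<longleftrightarrow> h 1 = 1 \<and> (\<forall>x y. h (x + y) = h x + h y)
     \<and> (\<forall>x y. h (x * y) = h x * h y)
     \<and> vector_space.dim (\<lambda>c x. h c * x) (UNIV :: 'k set) = 2"

end

theory Submission
  imports Defs "HOL-Library.Cardinality" "HOL-Library.Product_Plus"
begin

text \<open>Reflection at the sink shows by induction that \<open>M\<^sub>i(l)\<close> is isomorphic to the string representation
  with space \<open>k[x]\<^bsub><d\<^esub>\<close> at each vertex, where \<open>d = l\<close> at the vertices up to \<open>i\<close> and \<open>d = l + 1\<close> beyond, with
  inclusions along the path and multiplication by \<open>x\<close> on the remaining arrow. A subrepresentation \<open>U\<close> of
  \<open>M\<^sub>i(l+1)\<close> is determined by \<open>{u. x u \<in> U}\<close>, a subrepresentation of \<open>M\<^sub>i(l)\<close>, together with the first vertex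
  at which an element of \<open>U\<close> has nonzero constant term and one such element. Counting these gives
  \<open>X\<^sub>\<delta> X\<^bsub>M(l)\<^esub> = q\<^sup>1\<^sup>/\<^sup>2 X\<^bsub>M(l+1)\<^esub> + q\<^sup>-\<^sup>1\<^sup>/\<^sup>2 X\<^bsub>M(l-1)\<^esub>\<close>, and associativity turns this into the recursion for
  \<open>X\<^bsub>M(l)\<^esub> X\<^sub>\<delta>\<close>. Vector space duality together with the reversal of the vertices is an anti-automorphism of
  the torus that fixes \<open>X\<^sub>\<delta>\<close> and exchanges the \<open>M\<close> and the \<open>N\<close>, so the \<open>X\<^bsub>N(l)\<^esub>\<close> satisfy the recursion with
  \<open>q\<close> inverted. The two sides of each identity then agree for \<open>m = 1, 2\<close> and obey the recursion of the \<open>F\<^sub>m\<close>.\<close>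

section \<open>Linear algebra over a finite field\<close>

text \<open>The terms of X_delta are indexed by the same s as the possible first vertices of a
  nonzero constant term, with s = 2n + 1 if there is none; the powers of q in the torus product,
  with the change of the Euler form, account for the choices of a generator. The match fails only at
  s = 1: the long arrow forces the generator into the lower part at the vertex 2n, which is
  impossible if that part has no nonzero constant term, that is, comes from M(l-1). The missing
  terms give the second summand of the recursion.

  An anti-automorphism turns left into right multiplication, so the N require the recursion for
  right multiplication of the M. Associativity propagates it only after two initial products, those
  of X_i and of M_i(0) with X_delta; the second needs an explicit commutator.

  As there is no M_{2n} and no N_1, (1) and (3) use sequences prolonged backwards by one term: the
  product of X_delta with X_1 contains X_{2n} as a summand and conversely, so X_1, X_{2n},
  N_{2n}(0), ... and X_{2n}, X_1, M_1(0), ... satisfy the same recursions.\<close>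

global_interpretation kvp: vector_space_pair "kscale :: 'k::field \<Rightarrow> _" "kscale :: 'k \<Rightarrow> _"
  by unfold_locales

lemma card_field_ge_2: "2 \<le> CARD('k::{field,finite})"
proof -
  have "card {0, 1::'k} \<le> CARD('k)" by (rule card_mono) auto
  then show ?thesis by simp
qed

text \<open>Dimensions are compared through cardinalities throughout; this turns an equation between
  cardinalities back into one between dimensions.\<close>

lemma card_field_power_eq_iff: "CARD('k::{field,finite}) ^ a = CARD('k) ^ b \<longleftrightarrow> a = b"
  using card_field_ge_2[where ?'k='k] by simp

lemma kscale_apply: "kscale c v p = c * v p"
  by (simp add: kscale_def)

section \<open>Dimension read off from cardinality\<close>

context vector_space begin

lemma finite_span_finite:
  assumes "finite (UNIV :: 'a set)" "finite B" shows "finite (span B)"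
  using assms(2)
proof induction
  case empty
  then show ?case by simp
next
  case (insert a B)
  have "span (insert a B) \<subseteq> (\<lambda>(c, y). y + scale c a) ` (UNIV \<times> span B)"
  proof
    fix x assume "x \<in> span (insert a B)"
    then obtain c where "x - scale c a \<in> span B" by (auto simp: span_insert)
    then show "x \<in> (\<lambda>(c, y). y + scale c a) ` (UNIV \<times> span B)"
      by (intro image_eqI[of _ _ "(c, x - scale c a)"]) auto
  qed
  then show ?case using insert assms(1) by (meson finite_SigmaI finite_imageI finite_subset)
qed

text \<open>Proved for an abstract vector space because two are meant: the ambient space over k, and
  k itself as a space over the subfield, where it yields the order of k.\<close>

lemma card_span_independent:
  assumes "finite B" "independent B"
  shows "card (span B) = CARD('a) ^ card B"
  using assms
proof (induction B rule: finite_induct)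
  case empty
  then show ?case by simp
next
  case (insert a B)
  have a: "a \<notin> span B" and B: "independent B"
    using insert.prems insert.hyps by (auto simp: independent_insert)
  have "bij_betw (\<lambda>(c, y). y + scale c a) (UNIV \<times> span B) (span (insert a B))"
  proof (rule bij_betw_imageI)
    show "inj_on (\<lambda>(c, y). y + scale c a) (UNIV \<times> span B)"
    proof (intro inj_onI, clarify)
      fix c y c' y' assume y: "y \<in> span B" "y' \<in> span B"
        and eq: "y + scale c a = y' + scale c' a"
      have "scale (c - c') a = y' - y"
        using eq by (simp add: scale_left_diff_distrib algebra_simps)
      then have s: "scale (c - c') a \<in> span B" using y by (simp add: span_diff)
      have "c = c'"
      proof (rule ccontr)
        assume "c \<noteq> c'"
        then have "scale (inverse (c - c')) (scale (c - c') a) = a" by simp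
        then show False using a s by (metis span_scale)
      qed
      then show "c = c' \<and> y = y'" using eq by simp
    qed
    show "(\<lambda>(c, y). y + scale c a) ` (UNIV \<times> span B) = span (insert a B)"
    proof (intro equalityI subsetI)
      fix x assume "x \<in> span (insert a B)"
      then obtain c where "x - scale c a \<in> span B" by (auto simp: span_insert)
      then show "x \<in> (\<lambda>(c, y). y + scale c a) ` (UNIV \<times> span B)"
        by (intro image_eqI[of _ _ "(c, x - scale c a)"]) auto
    next
      fix x assume "x \<in> (\<lambda>(c, y). y + scale c a) ` (UNIV \<times> span B)"
      then obtain c y where "x = y + scale c a" "y \<in> span B" by auto
      then show "x \<in> span (insert a B)"
        unfolding span_insert by (intro CollectI exI[of _ c]) simp
    qed
  qed
  from bij_betw_same_card[OF this] show ?case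
    using insert.IH[OF B] insert.hyps by (simp add: card_cartesian_product)
qed

end

lemma finite_span:
  fixes B :: "'k::{field,finite} kvec set"
  assumes "finite B" shows "finite (kv.span B)"
  by (rule kv.finite_span_finite[OF finite assms])

lemma finite_subspace_basis:
  fixes S :: "'k::{field,finite} kvec set"
  assumes "kv.subspace S" "finite S"
  obtains B where "finite B" "B \<subseteq> S" "kv.independent B" "kv.span B = S" "card B = kv.dim S"
proof -
  obtain B where B: "B \<subseteq> S" "kv.independent B" "S \<subseteq> kv.span B" "card B = kv.dim S"
    using kv.basis_exists by blast
  moreover have "kv.span B = S"
    using B assms by (simp add: kv.span_minimal subset_antisym)
  ultimately show ?thesis using that[of B] assms finite_subset by blast
qed

lemma card_subspace:
  fixes S :: "'k::{field,finite} kvec set"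
  assumes "kv.subspace S" "finite S"
  shows "card S = CARD('k) ^ kv.dim S"
  using finite_subspace_basis[OF assms] kv.card_span_independent by metis

text \<open>Replaces spanning sets by finiteness of the space as a set, a property that subspaces
  inherit without choosing a basis.\<close>

lemma finitely_spanned_iff:
  fixes S :: "'k::{field,finite} kvec set"
  shows "(\<exists>B. finite B \<and> S = kv.span B) \<longleftrightarrow> kv.subspace S \<and> finite S"
  by (metis finite_span finite_subspace_basis kv.subspace_span)

lemma dim_eqI:
  fixes S T :: "'k::{field,finite} kvec set"
  assumes "kv.subspace S" "finite S" "kv.subspace T" "finite T" "card S = card T"
  shows "kv.dim S = kv.dim T"
  using card_subspace[OF assms(1,2)] card_subspace[OF assms(3,4)] assms(5)
  by (metis card_field_power_eq_iff)

lemma dim_eq_card_power: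
  fixes S :: "'k::{field,finite} kvec set"
  assumes "kv.subspace S" "finite S" "card S = CARD('k) ^ d"
  shows "kv.dim S = d"
  using card_subspace[OF assms(1,2)] assms(3) by (metis card_field_power_eq_iff)

lemma dim_zero_subspace_iff:
  fixes S :: "'k::{field,finite} kvec set"
  assumes "kv.subspace S" "finite S"
  shows "kv.dim S = 0 \<longleftrightarrow> S = {0}"
proof
  assume "kv.dim S = 0"
  then have "card S = 1" using card_subspace[OF assms] by simp
  then show "S = {0}" using kv.subspace_0[OF assms(1)] by (metis card_1_singletonE singletonD)
qed (use assms dim_eq_card_power[of S 0] in simp)

lemma subspace_dim_mono:
  fixes S T :: "'k::{field,finite} kvec set"
  assumes "kv.subspace S" "kv.subspace T" "finite T" "S \<subseteq> T"
  shows "kv.dim S \<le> kv.dim T"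
proof -
  have "card S \<le> card T" using assms by (simp add: card_mono)
  moreover have "finite S" using assms finite_subset by blast
  ultimately show ?thesis using assms card_subspace[of S] card_subspace[of T]
      card_field_ge_2[where ?'k='k] by simp
qed

lemma subspace_eq_if_dim_eq:
  fixes S T :: "'k::{field,finite} kvec set"
  assumes "kv.subspace S" "kv.subspace T" "finite T" "S \<subseteq> T" "kv.dim S = kv.dim T"
  shows "S = T"
  using assms card_subspace[of S] card_subspace[of T] by (metis card_subset_eq finite_subset)

section \<open>Fibres of additive maps\<close>

lemma sum_fibres:
  assumes "finite S"
  shows "card S = (\<Sum>y\<in>f ` S. card {x \<in> S. f x = y})"
  using sum.image_gen[OF assms, of "\<lambda>_. 1::nat" f] by simp

text \<open>Arbitrary groups are allowed because the lemma serves both functionals with values in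
  the field and a map out of a product of two spaces.\<close>

lemma card_kernel_image:
  fixes f :: "'a::ab_group_add \<Rightarrow> 'b::ab_group_add"
  assumes fin: "finite S" and zero: "0 \<in> S"
    and diff: "\<And>x y. x \<in> S \<Longrightarrow> y \<in> S \<Longrightarrow> x - y \<in> S"
    and add: "\<And>x y. x \<in> S \<Longrightarrow> y \<in> S \<Longrightarrow> f (x + y) = f x + f y"
  shows card_fibre: "z \<in> S \<Longrightarrow> card {x \<in> S. f x = f z} = card {x \<in> S. f x = 0}"
    and "card S = card {x \<in> S. f x = 0} * card (f ` S)"
proof -
  have cl_add: "x + y \<in> S" if "x \<in> S" "y \<in> S" for x y
    using diff[OF that(1) diff[OF zero that(2)]] by simp
  have f_diff: "f (x - y) = f x - f y" if "x \<in> S" "y \<in> S" for x y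
    using add[of "x - y" y] that diff by (simp add: algebra_simps)
  show *: "card {x \<in> S. f x = f z} = card {x \<in> S. f x = 0}" if z: "z \<in> S" for z
  proof (rule bij_betw_same_card[of "\<lambda>x. x - z"], rule bij_betwI[of _ _ _ "\<lambda>x. x + z"])
    show "(\<lambda>x. x - z) \<in> {x \<in> S. f x = f z} \<rightarrow> {x \<in> S. f x = 0}"
      using z by (auto simp: diff f_diff)
    show "(\<lambda>x. x + z) \<in> {x \<in> S. f x = 0} \<rightarrow> {x \<in> S. f x = f z}"
      using z by (auto simp: cl_add add)
  qed auto
  have "(\<Sum>y\<in>f ` S. card {x \<in> S. f x = y}) = (\<Sum>y\<in>f ` S. card {x \<in> S. f x = 0})"
    using * by (intro sum.cong) auto
  then show "card S = card {x \<in> S. f x = 0} * card (f ` S)"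
    using sum_fibres[OF fin, of f] by simp
qed

text \<open>The fibres of a nonzero functional are translates of its kernel. The functionals meant
  are the constant term of a polynomial and a pairing with one argument fixed.\<close>

lemma card_functional_fibre:
  fixes S :: "'k::{field,finite} kvec set" and f :: "'k kvec \<Rightarrow> 'k"
  assumes S: "kv.subspace S" and fin: "finite S"
    and add: "\<And>x y. x \<in> S \<Longrightarrow> y \<in> S \<Longrightarrow> f (x + y) = f x + f y"
    and sc: "\<And>c x. x \<in> S \<Longrightarrow> f (kscale c x) = c * f x"
    and nz: "x0 \<in> S" "f x0 \<noteq> 0"
  shows "card {x \<in> S. f x = c} * CARD('k) = card S"
proof -
  have surj: "\<exists>x\<in>S. f x = c" for c
    using sc[OF nz(1), of "c / f x0"] nz kv.subspace_scale[OF S nz(1)] by fastforce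
  then have im: "f ` S = UNIV" by (metis UNIV_eq_I image_eqI)
  obtain z where z: "z \<in> S" "f z = c" using surj by blast
  have D: "x - y \<in> S" if "x \<in> S" "y \<in> S" for x y using kv.subspace_diff[OF S that] .
  show ?thesis
    using card_fibre[where f = f, OF fin kv.subspace_0[OF S] D add z(1)]
      card_kernel_image(2)[where f = f, OF fin kv.subspace_0[OF S] D add] z im by simp
qed

section \<open>Maps that are linear on a subspace\<close>

lemma linear_on_0:
  fixes f :: "'k::field kvec \<Rightarrow> 'k kvec"
  assumes "linear_on S T f" "kv.subspace S" shows "f 0 = 0"
proof -
  have "f (0 + 0) = f 0 + f 0" using assms unfolding linear_on_def by (metis kv.subspace_0)
  then show ?thesis by simp
qed

lemma linear_on_diff:
  fixes f :: "'k::field kvec \<Rightarrow> 'k kvec"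
  assumes "linear_on S T f" "kv.subspace S" "x \<in> S" "y \<in> S" shows "f (x - y) = f x - f y"
proof -
  have "f (x - y + y) = f (x - y) + f y"
    using assms unfolding linear_on_def by (metis kv.subspace_diff)
  then show ?thesis by (simp add: algebra_simps)
qed

lemma linear_on_image_subspace:
  fixes f :: "'k::field kvec \<Rightarrow> 'k kvec"
  assumes f: "linear_on S T f" and U: "kv.subspace U" "U \<subseteq> S" and S: "kv.subspace S"
  shows "kv.subspace (f ` U)"
  unfolding kv.subspace_def
proof (intro conjI ballI allI)
  have z: "0 \<in> U" using U kv.subspace_0 by blast
  have "f 0 = 0" using linear_on_0[OF f S] .
  with z show "0 \<in> f ` U" by force
next
  fix x y assume "x \<in> f ` U" "y \<in> f ` U"
  then obtain a b where "a \<in> U" "b \<in> U" "x = f a" "y = f b" by auto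
  moreover have "f (a + b) = f a + f b" using f U calculation unfolding linear_on_def by blast
  ultimately show "x + y \<in> f ` U" using kv.subspace_add[OF U(1)] by (metis image_eqI)
next
  fix x c assume "x \<in> f ` U"
  then obtain a where "a \<in> U" "x = f a" by auto
  moreover have "f (kscale c a) = kscale c (f a)" using f U calculation unfolding linear_on_def by blast
  ultimately show "kscale c x \<in> f ` U" using kv.subspace_scale[OF U(1)] by (metis image_eqI)
qed

text \<open>The complement is the kernel, inside \<open>V\<close>, of a projection of the whole
  space onto \<open>I\<close>. It will be split off as a direct summand at the sink.\<close>

lemma subspace_complement:
  fixes I V :: "'k::field kvec set"
  assumes I: "kv.subspace I" and V: "kv.subspace V" and IV: "I \<subseteq> V"
  obtains C where "kv.subspace C" "C \<subseteq> V" "{x + y |x y. x \<in> C \<and> y \<in> I} = V" "C \<inter> I = {0}"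
proof -
  obtain B where B: "B \<subseteq> I" "kv.independent B" "I \<subseteq> kv.span B"
    by (rule kv.basis_exists)
  have "\<exists>p. Vector_Spaces.linear kscale kscale p \<and> (\<forall>x\<in>B. p x = id x) \<and> range p = kv.span (id ` B)"
    by (rule kvp.linear_independent_extend_subspace[OF B(2)])
  then obtain p where p: "Vector_Spaces.linear kscale kscale p" "\<forall>x\<in>B. p x = x" "range p = kv.span B"
    unfolding id_apply image_id by blast
  have spB: "kv.span B = I" using B I by (simp add: kv.span_minimal subset_antisym)
  have pI: "p x = x" if "x \<in> I" for x
    using kvp.linear_eq_on[OF p(1) kv.linear_id, of x B] that p(2) spB by simp
  have pV: "p x \<in> I" for x using p(3) spB by auto
  define C where "C = {x \<in> V. p x = 0}"
  interpret p: Vector_Spaces.linear "kscale :: 'k \<Rightarrow> _" kscale p by (rule p(1))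
  show ?thesis
  proof
    show "kv.subspace C"
    proof (rule kv.subspaceI)
      show "0 \<in> C" using kv.subspace_0[OF V] p.zero by (simp add: C_def)
      show "x + y \<in> C" if "x \<in> C" "y \<in> C" for x y
        using that kv.subspace_add[OF V] by (simp add: C_def p.add)
      show "kscale c x \<in> C" if "x \<in> C" for c x
        using that kv.subspace_scale[OF V] by (simp add: C_def p.scale)
    qed
    show "C \<subseteq> V" by (auto simp: C_def)
    show "{x + y |x y. x \<in> C \<and> y \<in> I} = V"
    proof (intro equalityI subsetI)
      fix x assume x: "x \<in> V"
      have "x - p x \<in> V" using x pV IV by (meson kv.subspace_diff[OF V] subsetD)
      moreover have "p (x - p x) = 0" using pI[OF pV[of x]] by (simp only: p.diff) simp
      ultimately have "x - p x \<in> C" by (simp add: C_def)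
      then show "x \<in> {x + y |x y. x \<in> C \<and> y \<in> I}"
        using pV[of x] by (intro CollectI exI[of _ "x - p x"] exI[of _ "p x"]) simp
    next
      fix z assume "z \<in> {x + y |x y. x \<in> C \<and> y \<in> I}"
      then obtain x y where "z = x + y" "x \<in> C" "y \<in> I" by blast
      then show "z \<in> V" using IV kv.subspace_add[OF V] by (auto simp: C_def)
    qed
    show "C \<inter> I = {0}"
    proof (intro equalityI subsetI)
      fix x assume "x \<in> C \<inter> I"
      then show "x \<in> {0}" using pI[of x] by (simp add: C_def)
    next
      fix x :: "'k kvec" assume "x \<in> {0}"
      then show "x \<in> C \<inter> I"
        using kv.subspace_0[OF V] kv.subspace_0[OF I] p.zero by (simp add: C_def)
    qed
  qed
qed

section \<open>Representations and their isomorphisms\<close>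

lemma vertices_iff [simp]: "j \<in> vertices n \<longleftrightarrow> 1 \<le> j \<and> j \<le> 2 * n"
  by (auto simp: vertices_def)

text \<open>The long arrow from 1 to 2n acts differently from the arrows of the path, so every
  condition on arrows is split in this way.\<close>

lemma ball_arrows:
  assumes "n \<ge> 1"
  shows "(\<forall>a\<in>arrows n. P a) \<longleftrightarrow> (\<forall>j. 1 \<le> j \<and> j < 2 * n \<longrightarrow> P (j, Suc j)) \<and> P (1, 2 * n)"
proof -
  have "arrows n = (\<lambda>j. (j, Suc j)) ` {1..<2 * n} \<union> {(1, 2 * n)}"
    using assms unfolding arrows_def by force
  then show ?thesis by auto
qed

lemma is_rep_iff:
  fixes V :: "'k::{field,finite} rep"
  assumes "n \<ge> 1"
  shows "is_rep n V \<longleftrightarrow> (\<forall>j\<in>vertices n. kv.subspace (space V j) \<and> finite (space V j))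
    \<and> (\<forall>j. 1 \<le> j \<and> j < 2 * n \<longrightarrow> linear_on (space V j) (space V (Suc j)) (arr V (j, Suc j)))
    \<and> linear_on (space V 1) (space V (2 * n)) (arr V (1, 2 * n))"
  using ball_arrows[OF assms, of "\<lambda>(i, j). linear_on (space V i) (space V j) (arr V (i, j))"]
  unfolding is_rep_def finitely_spanned_iff by simp

lemma subrep_iff:
  assumes "n \<ge> 1"
  shows "subrep n V N \<longleftrightarrow> N \<in> extensional (vertices n)
     \<and> (\<forall>i\<in>vertices n. kv.subspace (N i) \<and> N i \<subseteq> space V i)
     \<and> (\<forall>j. 1 \<le> j \<and> j < 2 * n \<longrightarrow> arr V (j, Suc j) ` N j \<subseteq> N (Suc j))
     \<and> arr V (1, 2 * n) ` N 1 \<subseteq> N (2 * n)"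
  using ball_arrows[OF assms, of "\<lambda>(i, j). arr V (i, j) ` N i \<subseteq> N j"]
  unfolding subrep_def by simp

lemma rep_hom_iff:
  assumes "n \<ge> 1"
  shows "rep_hom n V W f \<longleftrightarrow> (\<forall>i\<in>vertices n. linear_on (space V i) (space W i) (f i))
     \<and> (\<forall>j. 1 \<le> j \<and> j < 2 * n \<longrightarrow>
          (\<forall>x\<in>space V j. f (Suc j) (arr V (j, Suc j) x) = arr W (j, Suc j) (f j x)))
     \<and> (\<forall>x\<in>space V 1. f (2 * n) (arr V (1, 2 * n) x) = arr W (1, 2 * n) (f 1 x))"
  using ball_arrows[OF assms,
      of "\<lambda>(i, j). \<forall>x\<in>space V i. f j (arr V (i, j) x) = arr W (i, j) (f i x)"]
  unfolding rep_hom_def by simp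

definition rep_iso ::
  "nat \<Rightarrow> 'k::field rep \<Rightarrow> 'k rep \<Rightarrow> (nat \<Rightarrow> 'k kvec \<Rightarrow> 'k kvec) \<Rightarrow> bool" where
  "rep_iso n V W f \<longleftrightarrow> rep_hom n V W f \<and> (\<forall>j\<in>vertices n. bij_betw (f j) (space V j) (space W j))"

lemma linear_on_vimage_subspace:
  fixes f :: "'k::field kvec \<Rightarrow> 'k kvec"
  assumes f: "linear_on S T f" and U: "kv.subspace U" and S: "kv.subspace S"
  shows "kv.subspace {x \<in> S. f x \<in> U}"
proof (rule kv.subspaceI)
  show "0 \<in> {x \<in> S. f x \<in> U}" using linear_on_0[OF f S] U S by (simp add: kv.subspace_0)
next
  fix x y assume "x \<in> {x \<in> S. f x \<in> U}" "y \<in> {x \<in> S. f x \<in> U}"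
  then show "x + y \<in> {x \<in> S. f x \<in> U}"
    using f kv.subspace_add[OF S] kv.subspace_add[OF U] by (simp add: linear_on_def)
next
  fix c x assume "x \<in> {x \<in> S. f x \<in> U}"
  then show "kscale c x \<in> {x \<in> S. f x \<in> U}"
    using f kv.subspace_scale[OF S] kv.subspace_scale[OF U] by (simp add: linear_on_def)
qed

lemma Gr_iso_card:
  fixes V W :: "'k::{field,finite} rep"
  assumes n: "n \<ge> 1" and V: "is_rep n V" and W: "is_rep n W" and iso: "rep_iso n V W f"
  shows "card (Gr n V e) = card (Gr n W e)"
proof -
  have lin: "linear_on (space V j) (space W j) (f j)"
    and bij: "bij_betw (f j) (space V j) (space W j)"
    and subV: "kv.subspace (space V j)" and finV: "finite (space V j)"
    and subW: "kv.subspace (space W j)" and finW: "finite (space W j)" if "j \<in> vertices n" for j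
    using that iso V W unfolding rep_iso_def rep_hom_def is_rep_iff[OF n] by blast+
  have comm1: "f (Suc j) (arr V (j, Suc j) x) = arr W (j, Suc j) (f j x)"
    if "1 \<le> j" "j < 2 * n" "x \<in> space V j" for j x
    using that iso unfolding rep_iso_def rep_hom_iff[OF n] by blast
  have comm2: "f (2 * n) (arr V (1, 2 * n) x) = arr W (1, 2 * n) (f 1 x)"
    if "x \<in> space V 1" for x
    using that iso unfolding rep_iso_def rep_hom_iff[OF n] by blast
  have arrV1: "arr V (j, Suc j) x \<in> space V (Suc j)" if "1 \<le> j" "j < 2 * n" "x \<in> space V j" for j x
    using that V unfolding is_rep_iff[OF n] linear_on_def by blast
  have arrV2: "arr V (1, 2 * n) x \<in> space V (2 * n)" if "x \<in> space V 1" for x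
    using that V unfolding is_rep_iff[OF n] linear_on_def by blast
  define F where "F = (\<lambda>N. restrict (\<lambda>j. f j ` N j) (vertices n))"
  define H where "H = (\<lambda>N. restrict (\<lambda>j. {x \<in> space V j. f j x \<in> N j}) (vertices n))"
  have imdim: "kv.dim (f j ` U) = kv.dim U"
    if "j \<in> vertices n" "kv.subspace U" "U \<subseteq> space V j" for j U
  proof -
    have "card (f j ` U) = card U"
      using bij[OF that(1)] that(3) by (meson bij_betw_def card_image inj_on_subset)
    then show ?thesis
      using that finV finite_subset linear_on_image_subspace[OF lin that(2,3) subV]
      by (intro dim_eqI) blast+
  qed
  have HF: "{x \<in> space V j. f j x \<in> f j ` U} = U" if "j \<in> vertices n" "U \<subseteq> space V j" for j U
    using bij[OF that(1)] that(2) unfolding bij_betw_def by (auto dest: inj_onD)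
  have FH: "f j ` {x \<in> space V j. f j x \<in> U} = U" if "j \<in> vertices n" "U \<subseteq> space W j" for j U
    using bij[OF that(1)] that(2) unfolding bij_betw_def by auto
  have "bij_betw F (Gr n V e) (Gr n W e)"
  proof (rule bij_betw_byWitness[where f' = H])
    show "\<forall>N\<in>Gr n V e. H (F N) = N"
    proof
      fix N assume N: "N \<in> Gr n V e"
      show "H (F N) = N"
      proof
        fix j
        show "H (F N) j = N j"
        proof (cases "j \<in> vertices n")
          case True
          then show ?thesis using N HF unfolding H_def F_def Gr_def subrep_def by simp
        next
          case False
          then show ?thesis using N unfolding H_def Gr_def subrep_def
            by (auto simp: extensional_def)
        qed
      qed
    qed
    show "\<forall>N\<in>Gr n W e. F (H N) = N"
    proof
      fix N assume N: "N \<in> Gr n W e"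
      show "F (H N) = N"
      proof
        fix j
        show "F (H N) j = N j"
        proof (cases "j \<in> vertices n")
          case True
          then show ?thesis using N FH unfolding H_def F_def Gr_def subrep_def by simp
        next
          case False
          then show ?thesis using N unfolding F_def Gr_def subrep_def
            by (auto simp: extensional_def)
        qed
      qed
    qed
    show "F ` Gr n V e \<subseteq> Gr n W e"
    proof
      fix M assume "M \<in> F ` Gr n V e"
      then obtain N where M: "M = F N" and N: "N \<in> Gr n V e" by blast
      have sub: "kv.subspace (N j)" "N j \<subseteq> space V j" "int (kv.dim (N j)) = e j"
        if "j \<in> vertices n" for j
        using that N unfolding Gr_def subrep_def by blast+
      have a1: "arr V (j, Suc j) ` N j \<subseteq> N (Suc j)" if "1 \<le> j" "j < 2 * n" for j
        using N that unfolding Gr_def subrep_iff[OF n] by blast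
      have a2: "arr V (1, 2 * n) ` N 1 \<subseteq> N (2 * n)"
        using N unfolding Gr_def subrep_iff[OF n] by blast
      have "arr W (j, Suc j) ` F N j \<subseteq> F N (Suc j)" if j: "1 \<le> j" "j < 2 * n" for j
      proof
        fix y assume "y \<in> arr W (j, Suc j) ` F N j"
        then obtain x where x: "x \<in> N j" "y = arr W (j, Suc j) (f j x)" using j by (auto simp: F_def)
        then have "y = f (Suc j) (arr V (j, Suc j) x)" using comm1 j sub(2)[of j] by auto
        then show "y \<in> F N (Suc j)" using a1[OF j] x(1) j by (auto simp: F_def)
      qed
      moreover have "arr W (1, 2 * n) ` F N 1 \<subseteq> F N (2 * n)"
      proof
        fix y assume "y \<in> arr W (1, 2 * n) ` F N 1"
        then obtain x where x: "x \<in> N 1" "y = arr W (1, 2 * n) (f 1 x)" using n by (auto simp: F_def)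
        then have "y = f (2 * n) (arr V (1, 2 * n) x)" using comm2 n sub(2)[of 1] by auto
        then show "y \<in> F N (2 * n)" using a2 x(1) n by (auto simp: F_def)
      qed
      moreover have "kv.subspace (F N j) \<and> F N j \<subseteq> space W j \<and> kv.dim (F N j) = kv.dim (N j)"
        if j: "j \<in> vertices n" for j
        using linear_on_image_subspace[OF lin[OF j] sub(1,2)[OF j] subV[OF j]]
          imdim[OF j sub(1,2)[OF j]] j bij[OF j] sub(2)[OF j]
        by (auto simp: F_def bij_betw_def)
      ultimately show "M \<in> Gr n W e"
        using sub(3) unfolding M Gr_def subrep_iff[OF n] by (simp add: F_def)
    qed
    show "H ` Gr n W e \<subseteq> Gr n V e"
    proof
      fix M assume "M \<in> H ` Gr n W e"
      then obtain N where M: "M = H N" and N: "N \<in> Gr n W e" by blast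
      have sub: "kv.subspace (N j)" "N j \<subseteq> space W j" "int (kv.dim (N j)) = e j"
        if "j \<in> vertices n" for j
        using that N unfolding Gr_def subrep_def by blast+
      have a1: "arr W (j, Suc j) ` N j \<subseteq> N (Suc j)" if "1 \<le> j" "j < 2 * n" for j
        using N that unfolding Gr_def subrep_iff[OF n] by blast
      have a2: "arr W (1, 2 * n) ` N 1 \<subseteq> N (2 * n)"
        using N unfolding Gr_def subrep_iff[OF n] by blast
      have "arr V (j, Suc j) ` H N j \<subseteq> H N (Suc j)" if j: "1 \<le> j" "j < 2 * n" for j
      proof
        fix y assume "y \<in> arr V (j, Suc j) ` H N j"
        then obtain x where x: "x \<in> space V j" "f j x \<in> N j" "y = arr V (j, Suc j) x"
          using j by (auto simp: H_def)
        then show "y \<in> H N (Suc j)" using a1[OF j] j comm1[OF j x(1)] arrV1[OF j x(1)]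
          by (auto simp: H_def)
      qed
      moreover have "arr V (1, 2 * n) ` H N 1 \<subseteq> H N (2 * n)"
      proof
        fix y assume "y \<in> arr V (1, 2 * n) ` H N 1"
        then obtain x where x: "x \<in> space V 1" "f 1 x \<in> N 1" "y = arr V (1, 2 * n) x"
          using n by (auto simp: H_def)
        then show "y \<in> H N (2 * n)" using a2 n comm2[OF x(1)] arrV2[OF x(1)]
          by (auto simp: H_def)
      qed
      moreover have "kv.subspace (H N j) \<and> H N j \<subseteq> space V j \<and> kv.dim (H N j) = kv.dim (N j)"
        if j: "j \<in> vertices n" for j
      proof -
        have s: "kv.subspace (H N j)" "H N j \<subseteq> space V j"
          using linear_on_vimage_subspace[OF lin[OF j] sub(1)[OF j] subV[OF j]] j
          by (auto simp: H_def)
        have "f j ` H N j = N j" using FH[OF j sub(2)[OF j]] j by (simp add: H_def)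
        then show ?thesis using imdim[OF j s] s by simp
      qed
      ultimately show "M \<in> Gr n V e"
        using sub(3) unfolding M Gr_def subrep_iff[OF n] by (simp add: H_def)
    qed
  qed
  then show ?thesis by (rule bij_betw_same_card)
qed

section \<open>Coordinate spaces and the string representations\<close>

text \<open>The polynomials of degree below \<open>d\<close>: the coordinate \<open>[t]\<close> is
  the coefficient of the t-th power of x. Singleton lists are used since the ambient space has lists
  as coordinates.\<close>

definition coord_space :: "nat \<Rightarrow> 'k::field kvec set" where
  "coord_space d = {v. \<forall>p. p \<notin> (\<lambda>t. [t]) ` {..<d} \<longrightarrow> v p = 0}"

lemma coord_space_subspace [simp]: "kv.subspace (coord_space d)"
  by (rule kv.subspaceI) (simp_all add: coord_space_def kscale_apply)

lemma coord_space_eqI: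
  assumes "v \<in> coord_space d" "w \<in> coord_space d'" "\<And>t. v [t] = w [t]"
  shows "v = w"
proof
  fix p show "v p = w p"
  proof (cases "p \<in> range (\<lambda>t. [t])")
    case False
    then have "v p = 0" "w p = 0" using assms(1,2) unfolding coord_space_def by blast+
    then show ?thesis by simp
  qed (use assms(3) in auto)
qed

lemma coord_space_iff:
  "v \<in> coord_space d \<longleftrightarrow> v [] = 0 \<and> (\<forall>t. d \<le> t \<longrightarrow> v [t] = 0) \<and> (\<forall>a b p. v (a # b # p) = 0)"
  (is "_ = ?R")
proof
  assume ?R
  \<comment> \<open>The case rule of \<open>remdups_adj\<close> separates lists of length 0, of
    length 1 and of length at least 2.\<close>
  then have "v p = 0" if "p \<notin> (\<lambda>t. [t]) ` {..<d}" for p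
    using that by (cases p rule: remdups_adj.cases) (simp_all add: image_iff)
  then show "v \<in> coord_space d" by (simp add: coord_space_def)
qed (simp add: coord_space_def image_iff)

lemma bij_betw_coord_space:
  "bij_betw (\<lambda>v. \<lambda>t\<in>{..<d}. v [t]) (coord_space d :: 'k::field kvec set) ({..<d} \<rightarrow>\<^sub>E UNIV)"
proof (rule bij_betwI[where g = "\<lambda>f p. case p of [t] \<Rightarrow> if t < d then f t else 0 | _ \<Rightarrow> 0"])
  fix v :: "'k kvec" assume v: "v \<in> coord_space d"
  show "(\<lambda>p. case p of [t] \<Rightarrow> if t < d then (\<lambda>t\<in>{..<d}. v [t]) t else 0 | _ \<Rightarrow> 0) = v"
  proof
    fix p
    show "(case p of [t] \<Rightarrow> if t < d then (\<lambda>t\<in>{..<d}. v [t]) t else 0 | _ \<Rightarrow> 0) = v p"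
      using v by (cases p rule: remdups_adj.cases) (simp_all add: coord_space_iff)
  qed
next
  show "(\<lambda>f p. case p of [t] \<Rightarrow> if t < d then f t else 0 | _ \<Rightarrow> 0)
      \<in> ({..<d} \<rightarrow>\<^sub>E UNIV) \<rightarrow> (coord_space d :: 'k kvec set)"
    by (simp add: coord_space_iff)
next
  fix f :: "nat \<Rightarrow> 'k" assume f: "f \<in> {..<d} \<rightarrow>\<^sub>E UNIV"
  show "(\<lambda>t\<in>{..<d}. case [t] of [t] \<Rightarrow> if t < d then f t else 0 | _ \<Rightarrow> 0) = f"
  proof
    fix t show "(\<lambda>t\<in>{..<d}. case [t] of [t] \<Rightarrow> if t < d then f t else 0 | _ \<Rightarrow> 0) t = f t"
      by (cases "t < d") (simp_all add: PiE_arb[OF f])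
  qed
next
  show "(\<lambda>v. \<lambda>t\<in>{..<d}. v [t]) \<in> coord_space d \<rightarrow> {..<d} \<rightarrow>\<^sub>E (UNIV :: 'k set)"
    by (rule Pi_I, rule PiE_I) simp_all
qed

lemma finite_coord_space [simp]: "finite (coord_space d :: 'k::{field,finite} kvec set)"
  using bij_betw_finite[OF bij_betw_coord_space[where ?'k='k and d=d]] by (simp add: finite_PiE)

lemma card_coord_space: "card (coord_space d :: 'k::{field,finite} kvec set) = CARD('k) ^ d"
  using bij_betw_same_card[OF bij_betw_coord_space[where ?'k='k and d=d]] by (simp add: card_PiE)

lemma dim_coord_space: "kv.dim (coord_space d :: 'k::{field,finite} kvec set) = d"
  by (intro dim_eq_card_power card_coord_space) auto

lemma coord_space_mono: "d \<le> d' \<Longrightarrow> coord_space d \<subseteq> coord_space d'"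
  by (auto simp: coord_space_iff)

lemma coord_space_0: "coord_space 0 = {0}"
  by (auto simp: coord_space_def)

text \<open>Multiplication by x; its partner \<open>unshift\<close> drops the constant term and
  divides by x.\<close>

definition shift :: "'k::field kvec \<Rightarrow> 'k kvec" where
  "shift v = (\<lambda>p. case p of [Suc t] \<Rightarrow> v [t] | _ \<Rightarrow> 0)"

definition unshift :: "'k::field kvec \<Rightarrow> 'k kvec" where
  "unshift v = (\<lambda>p. case p of [t] \<Rightarrow> v [Suc t] | _ \<Rightarrow> 0)"

lemma shift_simps [simp]:
  "shift v [] = 0" "shift v [0] = 0" "shift v [Suc t] = v [t]" "shift v (a # b # p) = 0"
  by (simp_all add: shift_def split: nat.split)

lemma unshift_simps [simp]:
  "unshift v [] = 0" "unshift v [t] = v [Suc t]" "unshift v (a # b # p) = 0"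
  by (simp_all add: unshift_def)

lemma kvec_eqI:
  assumes "v [] = w []" "\<And>t. v [t] = w [t]" "\<And>a b p. v (a # b # p) = w (a # b # p)"
  shows "v = w"
proof
  fix p show "v p = w p" by (cases p rule: remdups_adj.cases) (simp_all add: assms)
qed

lemma shift_add: "shift (v + w) = shift v + shift w"
proof (rule kvec_eqI)
  fix t show "shift (v + w) [t] = (shift v + shift w) [t]" by (cases t) simp_all
qed simp_all

lemma shift_scale: "shift (kscale c v) = kscale c (shift v)"
proof (rule kvec_eqI)
  fix t show "shift (kscale c v) [t] = kscale c (shift v) [t]"
    by (cases t) (simp_all add: kscale_apply)
qed (simp_all add: kscale_apply)

lemma unshift_add: "unshift (v + w) = unshift v + unshift w"
  by (rule kvec_eqI) simp_all

lemma unshift_scale: "unshift (kscale c v) = kscale c (unshift v)"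
  by (rule kvec_eqI) (simp_all add: kscale_apply)

lemma shift_coord_space:
  assumes "v \<in> coord_space d" shows "shift v \<in> coord_space (Suc d)"
proof -
  have "shift v [t] = 0" if "Suc d \<le> t" for t
    using assms that by (cases t) (simp_all add: coord_space_iff)
  then show ?thesis by (simp add: coord_space_iff)
qed

lemma unshift_coord_space: "v \<in> coord_space d \<Longrightarrow> unshift v \<in> coord_space (d - 1)"
  by (simp add: coord_space_iff)

lemma unshift_shift: "v \<in> coord_space d \<Longrightarrow> unshift (shift v) = v"
  by (rule kvec_eqI) (simp_all add: coord_space_iff)

lemma shift_unshift:
  assumes "v \<in> coord_space d" "v [0] = 0" shows "shift (unshift v) = v"
proof (rule kvec_eqI)
  fix t show "shift (unshift v) [t] = v [t]" using assms(2) by (cases t) simp_all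
qed (use assms(1) in \<open>simp_all add: coord_space_iff\<close>)

lemma shift_inj: "v \<in> coord_space d \<Longrightarrow> w \<in> coord_space d' \<Longrightarrow> shift v = shift w \<Longrightarrow> v = w"
  by (metis unshift_shift)

definition string_dim :: "nat \<Rightarrow> nat \<Rightarrow> nat \<Rightarrow> nat" where
  "string_dim i l j = (if j \<le> i then l else Suc l)"

definition string_rep :: "nat \<Rightarrow> nat \<Rightarrow> nat \<Rightarrow> 'k::field rep" where
  "string_rep n i l = \<lparr>space = (\<lambda>j. coord_space (string_dim i l j)),
     arr = (\<lambda>a. if a = (1, 2 * n) then shift else id)\<rparr>"

lemma string_rep_is_rep:
  assumes "n \<ge> 2" "1 \<le> i" "i < 2 * n"
  shows "is_rep n (string_rep n i l :: 'k::{field,finite} rep)"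
proof -
  have "string_dim i l j \<le> string_dim i l (Suc j)" for j by (simp add: string_dim_def)
  then have "coord_space (string_dim i l j) \<subseteq> coord_space (string_dim i l (Suc j))" for j
    by (rule coord_space_mono)
  then have "linear_on (coord_space (string_dim i l j)) (coord_space (string_dim i l (Suc j)) :: 'k kvec set) id" for j
    unfolding linear_on_def id_apply by blast
  \<comment> \<open>Because 1 \<le> i < 2n, the degree bound at the vertex 2n exceeds the one at the
    vertex 1 by exactly one, which leaves room for multiplication by x.\<close>
  moreover have "linear_on (coord_space (string_dim i l 1)) (coord_space (string_dim i l (2 * n)) :: 'k kvec set) shift"
    using assms by (auto simp: linear_on_def shift_add shift_scale string_dim_def intro: shift_coord_space)
  ultimately show ?thesis
    using assms by (subst is_rep_iff) (auto simp: string_rep_def)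
qed

section \<open>Reflection at the sink\<close>

text \<open>A pair of vectors is coded as one vector by prefixing 0 or 1 to the coordinates, since a
  fibre product of two spaces must again be a subspace of the one ambient space.\<close>

definition kpair :: "'k::field kvec \<Rightarrow> 'k kvec \<Rightarrow> 'k kvec" where
  "kpair y z = (\<lambda>p. case p of [] \<Rightarrow> 0 | a # q \<Rightarrow> if a = 0 then y q else if a = 1 then z q else 0)"

definition kfst :: "'k::field kvec \<Rightarrow> 'k kvec" where "kfst w = (\<lambda>q. w (0 # q))"

definition ksnd :: "'k::field kvec \<Rightarrow> 'k kvec" where "ksnd w = (\<lambda>q. w (1 # q))"

lemma kfst_kpair [simp]: "kfst (kpair y z) = y"
  and ksnd_kpair [simp]: "ksnd (kpair y z) = z"
  by (simp_all add: kfst_def ksnd_def kpair_def)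

lemma kpair_add: "kpair (y + y') (z + z') = kpair y z + kpair y' z'"
  by (rule ext) (simp add: kpair_def split: list.split)

lemma kpair_scale: "kpair (kscale c y) (kscale c z) = kscale c (kpair y z)"
  by (rule ext) (simp add: kpair_def kscale_apply split: list.split)

lemma kpair_0: "kpair 0 0 = 0"
  by (rule ext) (simp add: kpair_def split: list.split)

lemma kpair_eq_iff: "kpair y z = kpair y' z' \<longleftrightarrow> y = y' \<and> z = z'"
  by (metis kfst_kpair ksnd_kpair)

lemma kfst_add: "kfst (v + w) = kfst v + kfst w" and kfst_scale: "kfst (kscale c w) = kscale c (kfst w)"
  and ksnd_add: "ksnd (v + w) = ksnd v + ksnd w" and ksnd_scale: "ksnd (kscale c w) = kscale c (ksnd w)"
  by (simp_all add: kfst_def ksnd_def fun_eq_iff kscale_apply)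

text \<open>Up to the sign of the second component, the kernel of the map from the sum of the two
  neighbouring spaces to the space at the sink.\<close>

definition fibre_product :: "nat \<Rightarrow> 'k::field rep \<Rightarrow> 'k kvec set" where
  "fibre_product n V = {kpair y z |y z. y \<in> space V 1 \<and> z \<in> space V (2 * n - 1)
     \<and> arr V (1, 2 * n) y = arr V (2 * n - 1, 2 * n) z}"

text \<open>Reflecting at the sink \<open>2 * n\<close> turns it into a source; renumbering the vertices cyclically
  gives a representation of the original quiver.\<close>

definition reflect :: "nat \<Rightarrow> 'k::field rep \<Rightarrow> 'k rep" where
  "reflect n V = \<lparr>space = (\<lambda>j. if j = 1 then fibre_product n V else space V (j - 1)),
     arr = (\<lambda>a. if a = (1, 2) then kfst else if a = (1, 2 * n) then ksnd
                else arr V (fst a - 1, snd a - 1))\<rparr>"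

lemma subrep_zero: "subrep n V N \<Longrightarrow> j \<in> vertices n \<Longrightarrow> 0 \<in> N j"
  unfolding subrep_def using kv.subspace_0 by blast

lemma indecomposableD:
  assumes "indecomposable n V" "subrep n V N" "subrep n V N'"
    and "\<And>i. i \<in> vertices n \<Longrightarrow> {x + y |x y. x \<in> N i \<and> y \<in> N' i} = space V i"
    and "\<And>i. i \<in> vertices n \<Longrightarrow> N i \<inter> N' i = {0}"
  shows "(\<forall>i\<in>vertices n. N i = {0}) \<or> (\<forall>i\<in>vertices n. N' i = {0})"
proof -
  have "\<forall>N N'. subrep n V N \<and> subrep n V N'
          \<and> (\<forall>i\<in>vertices n. {x + y | x y. x \<in> N i \<and> y \<in> N' i} = space V i \<and> N i \<inter> N' i = {0})
          \<longrightarrow> (\<forall>i\<in>vertices n. N i = {0}) \<or> (\<forall>i\<in>vertices n. N' i = {0})"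
    using assms(1) unfolding indecomposable_def by (rule conjunct2)
  then show ?thesis by (elim allE[of _ N] allE[of _ N'] mp) (intro conjI ballI assms(2-))
qed

text \<open>Surjectivity of the two maps into the sink excludes a simple direct summand there; under
  it the reflection changes dimensions by the simple reflection and loses no information.\<close>

locale sink_rep =
  fixes n :: nat and V :: "'k::{field,finite} rep"
  assumes n2: "n \<ge> 2" and V: "is_rep n V"
    and onto: "\<And>x. x \<in> space V (2 * n) \<Longrightarrow> \<exists>y\<in>space V 1. \<exists>z\<in>space V (2 * n - 1).
      x = arr V (1, 2 * n) y + arr V (2 * n - 1, 2 * n) z"
begin

lemma n1: "n \<ge> 1" using n2 by simp

lemma sub: "j \<in> vertices n \<Longrightarrow> kv.subspace (space V j)"
  and fin: "j \<in> vertices n \<Longrightarrow> finite (space V j)"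
  and lin: "1 \<le> j \<Longrightarrow> j < 2 * n \<Longrightarrow> linear_on (space V j) (space V (Suc j)) (arr V (j, Suc j))"
  using V unfolding is_rep_iff[OF n1] by blast+

definition "a = arr V (2 * n - 1, 2 * n)"
definition "b = arr V (1, 2 * n)"

lemma lin_a: "linear_on (space V (2 * n - 1)) (space V (2 * n)) a"
  using lin[of "2 * n - 1"] n2 by (simp add: a_def)

lemma lin_b: "linear_on (space V 1) (space V (2 * n)) b"
  using V unfolding is_rep_iff[OF n1] b_def by blast

lemma onto': "x \<in> space V (2 * n) \<Longrightarrow> \<exists>y\<in>space V 1. \<exists>z\<in>space V (2 * n - 1). x = b y + a z"
  using onto unfolding a_def b_def .

lemma add_a: "x \<in> space V (2 * n - 1) \<Longrightarrow> y \<in> space V (2 * n - 1) \<Longrightarrow> a (x + y) = a x + a y"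
  and scale_a: "x \<in> space V (2 * n - 1) \<Longrightarrow> a (kscale c x) = kscale c (a x)"
  and in_a: "x \<in> space V (2 * n - 1) \<Longrightarrow> a x \<in> space V (2 * n)"
  using lin_a unfolding linear_on_def by blast+

lemma add_b: "x \<in> space V 1 \<Longrightarrow> y \<in> space V 1 \<Longrightarrow> b (x + y) = b x + b y"
  and scale_b: "x \<in> space V 1 \<Longrightarrow> b (kscale c x) = kscale c (b x)"
  and in_b: "x \<in> space V 1 \<Longrightarrow> b x \<in> space V (2 * n)"
  using lin_b unfolding linear_on_def by blast+

lemma sub1: "kv.subspace (space V 1)" and sub2: "kv.subspace (space V (2 * n - 1))"
  and sub3: "kv.subspace (space V (2 * n))"
  and fin1: "finite (space V 1)" and fin2: "finite (space V (2 * n - 1))"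
  and fin3: "finite (space V (2 * n))"
  using n2 by (auto intro!: sub fin)

lemma in_fibre_product: "kpair y z \<in> fibre_product n V \<longleftrightarrow>
    y \<in> space V 1 \<and> z \<in> space V (2 * n - 1) \<and> b y = a z"
  unfolding fibre_product_def a_def b_def by (auto simp: kpair_eq_iff)

lemma fibre_productE:
  assumes "w \<in> fibre_product n V"
  obtains y z where "w = kpair y z" "y \<in> space V 1" "z \<in> space V (2 * n - 1)" "b y = a z"
  using assms unfolding fibre_product_def a_def b_def by blast

lemma fibre_product_subspace: "kv.subspace (fibre_product n V)"
proof (rule kv.subspaceI)
  have "kpair 0 0 \<in> fibre_product n V"
    using kv.subspace_0[OF sub1] kv.subspace_0[OF sub2] linear_on_0[OF lin_a sub2]
      linear_on_0[OF lin_b sub1] unfolding in_fibre_product by simp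
  then show "0 \<in> fibre_product n V" by (simp add: kpair_0)
next
  fix w w' assume "w \<in> fibre_product n V" "w' \<in> fibre_product n V"
  then show "w + w' \<in> fibre_product n V"
    using kv.subspace_add[OF sub1] kv.subspace_add[OF sub2]
    by (elim fibre_productE) (simp add: kpair_add[symmetric] in_fibre_product add_a add_b)
next
  fix c w assume "w \<in> fibre_product n V"
  then show "kscale c w \<in> fibre_product n V"
    using kv.subspace_scale[OF sub1] kv.subspace_scale[OF sub2]
    by (elim fibre_productE) (simp add: kpair_scale[symmetric] in_fibre_product scale_a scale_b)
qed

lemma fibre_product_finite: "finite (fibre_product n V)"
proof (rule finite_subset)
  show "fibre_product n V \<subseteq> (\<lambda>(y, z). kpair y z) ` (space V 1 \<times> space V (2 * n - 1))"
    unfolding fibre_product_def by blast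
qed (use fin1 fin2 in simp)

text \<open>Kernel and image of \<open>(y, z) \<mapsto> b y - a z\<close>, which is surjective by
  the assumption on the sink.\<close>

lemma card_fibre_product:
  "card (fibre_product n V) * card (space V (2 * n)) = card (space V 1) * card (space V (2 * n - 1))"
proof -
  let ?S = "space V 1 \<times> space V (2 * n - 1)"
  define f where "f = (\<lambda>(y, z). b y - a z)"
  have diff: "x - x' \<in> ?S" if "x \<in> ?S" "x' \<in> ?S" for x x'
    using that kv.subspace_diff[OF sub1] kv.subspace_diff[OF sub2]
    by (cases x; cases x') (simp add: minus_prod_def)
  have add: "f (x + x') = f x + f x'" if "x \<in> ?S" "x' \<in> ?S" for x x'
    using that by (cases x; cases x') (simp add: f_def plus_prod_def add_a add_b algebra_simps)
  have ker: "{x \<in> ?S. f x = 0} = (\<lambda>w. (kfst w, ksnd w)) ` fibre_product n V"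
  proof (intro equalityI subsetI)
    fix x assume "x \<in> {x \<in> ?S. f x = 0}"
    then show "x \<in> (\<lambda>w. (kfst w, ksnd w)) ` fibre_product n V"
      by (intro image_eqI[of _ _ "kpair (fst x) (snd x)"])
         (auto simp: f_def in_fibre_product)
  next
    fix x assume "x \<in> (\<lambda>w. (kfst w, ksnd w)) ` fibre_product n V"
    then show "x \<in> {x \<in> ?S. f x = 0}"
      by (auto simp: f_def elim!: fibre_productE)
  qed
  have inj: "inj_on (\<lambda>w. (kfst w, ksnd w)) (fibre_product n V)"
    by (rule inj_onI) (auto elim!: fibre_productE)
  have im: "f ` ?S = space V (2 * n)"
  proof (intro equalityI subsetI)
    fix x assume "x \<in> f ` ?S"
    then show "x \<in> space V (2 * n)"
      using kv.subspace_diff[OF sub3] in_a in_b by (auto simp: f_def)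
  next
    fix x assume "x \<in> space V (2 * n)"
    then obtain y z where yz: "y \<in> space V 1" "z \<in> space V (2 * n - 1)" "x = b y + a z"
      using onto' by blast
    have "a (- z) = - a z" using scale_a[OF yz(2), of "-1"] by simp
    moreover have "- z \<in> space V (2 * n - 1)" using kv.subspace_neg[OF sub2 yz(2)] .
    ultimately show "x \<in> f ` ?S" using yz by (intro image_eqI[of _ _ "(y, - z)"]) (auto simp: f_def)
  qed
  have "card ?S = card {x \<in> ?S. f x = 0} * card (f ` ?S)"
    using diff add kv.subspace_0[OF sub1] kv.subspace_0[OF sub2] fin1 fin2
    by (intro card_kernel_image) (auto simp: zero_prod_def)
  then show ?thesis unfolding ker im card_image[OF inj] by (simp add: card_cartesian_product)
qed

lemma dim_fibre_product:
  "kv.dim (fibre_product n V) + kv.dim (space V (2 * n)) = kv.dim (space V 1) + kv.dim (space V (2 * n - 1))"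
  using card_fibre_product
  unfolding card_subspace[OF fibre_product_subspace fibre_product_finite]
    card_subspace[OF sub1 fin1] card_subspace[OF sub2 fin2] card_subspace[OF sub3 fin3]
    power_add[symmetric] card_field_power_eq_iff .

lemma reflect_space [simp]: "space (reflect n V) (Suc 0) = fibre_product n V"
  "1 \<le> j \<Longrightarrow> space (reflect n V) (Suc j) = space V j"
  by (simp_all add: reflect_def)

lemma reflect_arr [simp]: "arr (reflect n V) (Suc 0, Suc (Suc 0)) = kfst"
  "arr (reflect n V) (Suc 0, 2 * n) = ksnd"
  "2 \<le> j \<Longrightarrow> arr (reflect n V) (j, Suc j) = arr V (j - 1, j)"
  using n2 by (auto simp: reflect_def numeral_2_eq_2)

lemma reflect_is_rep: "is_rep n (reflect n V)"
proof -
  have "kv.subspace (space (reflect n V) j) \<and> finite (space (reflect n V) j)" if "j \<in> vertices n" for j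
  proof (cases "j = 1")
    case True
    then show ?thesis using fibre_product_subspace fibre_product_finite by simp
  next
    case False
    then have "j - 1 \<in> vertices n" using that by auto
    then show ?thesis using False sub fin by (simp add: reflect_def)
  qed
  moreover have "linear_on (space (reflect n V) j) (space (reflect n V) (Suc j)) (arr (reflect n V) (j, Suc j))"
    if j: "1 \<le> j" "j < 2 * n" for j
  proof (cases "j = 1")
    case True
    then show ?thesis
      using n2 by (auto simp: linear_on_def kfst_add kfst_scale elim!: fibre_productE)
  next
    case False
    then obtain i where "j = Suc i" "1 \<le> i" using j by (cases j) auto
    then show ?thesis using lin[of i] j by simp
  qed
  moreover have "linear_on (space (reflect n V) 1) (space (reflect n V) (2 * n)) (arr (reflect n V) (1, 2 * n))"
  proof -
    have "space (reflect n V) (2 * n) = space V (2 * n - 1)" using n2 by (simp add: reflect_def)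
    moreover have "ksnd \<in> fibre_product n V \<rightarrow> space V (2 * n - 1)"
      by (rule Pi_I) (elim fibre_productE, simp)
    ultimately show ?thesis
      using reflect_space(1) reflect_arr(2) by (simp add: linear_on_def ksnd_add ksnd_scale)
  qed
  ultimately show ?thesis unfolding is_rep_iff[OF n1] by blast
qed

text \<open>Away from the sink a decomposition of the reflection is one of \<open>V\<close>; at the sink one takes
  images.\<close>

lemma reflect_indecomposable:
  assumes ind: "indecomposable n V"
  shows "indecomposable n (reflect n V)"
  unfolding indecomposable_def
proof (intro conjI allI impI)
  obtain j where j: "j \<in> vertices n" "space V j \<noteq> {0}" using ind unfolding indecomposable_def by blast
  \<comment> \<open>Were \<open>V\<close> supported at the sink alone, surjectivity would make it
    zero there as well.\<close>
  have "\<exists>j. 1 \<le> j \<and> j < 2 * n \<and> space V j \<noteq> {0}"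
  proof (rule ccontr)
    assume neg: "\<nexists>j. 1 \<le> j \<and> j < 2 * n \<and> space V j \<noteq> {0}"
    then have z: "space V 1 = {0}" "space V (2 * n - 1) = {0}" using n2 by auto
    have "x = 0" if "x \<in> space V (2 * n)" for x
      using onto'[OF that] z linear_on_0[OF lin_a sub2] linear_on_0[OF lin_b sub1] by auto
    then have "space V (2 * n) = {0}" using kv.subspace_0[OF sub3] by blast
    then show False using neg j n2 by (metis le_neq_implies_less vertices_iff)
  qed
  then obtain j where "1 \<le> j" "j < 2 * n" "space V j \<noteq> {0}" by blast
  then show "\<exists>i\<in>vertices n. space (reflect n V) i \<noteq> {0}" by (intro bexI[of _ "Suc j"]) auto
next
  fix A B
  assume asm: "subrep n (reflect n V) A \<and> subrep n (reflect n V) B \<and>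
    (\<forall>i\<in>vertices n. {x + y |x y. x \<in> A i \<and> y \<in> B i} = space (reflect n V) i \<and> A i \<inter> B i = {0})"
  then have sA: "subrep n (reflect n V) A" and sB: "subrep n (reflect n V) B"
    and sum: "\<And>i. i \<in> vertices n \<Longrightarrow> {x + y |x y. x \<in> A i \<and> y \<in> B i} = space (reflect n V) i"
    and int: "\<And>i. i \<in> vertices n \<Longrightarrow> A i \<inter> B i = {0}" by blast+
  have sumV: "{x + y |x y. x \<in> A (Suc j) \<and> y \<in> B (Suc j)} = space V j" if "1 \<le> j" "j < 2 * n" for j
    using sum[of "Suc j"] that by simp
  define D where "D = (\<lambda>A. \<lambda>j\<in>vertices n. if j = 2 * n
      then {b y + a z |y z. y \<in> A 2 \<and> z \<in> A (2 * n)} else A (Suc j))"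
  have key: "subrep n V (D C) \<and> kv.subspace (C 2) \<and> kv.subspace (C (2 * n))
      \<and> C 2 \<subseteq> space V 1 \<and> C (2 * n) \<subseteq> space V (2 * n - 1)"
    if C: "subrep n (reflect n V) C" for C
  proof -
    have C1: "kv.subspace (C j)" "C j \<subseteq> space (reflect n V) j" if "j \<in> vertices n" for j
      using C that unfolding subrep_iff[OF n1] by blast+
    have C2: "arr (reflect n V) (j, Suc j) ` C j \<subseteq> C (Suc j)" if "1 \<le> j" "j < 2 * n" for j
      using C that unfolding subrep_iff[OF n1] by blast
    have s2: "kv.subspace (C 2)" "kv.subspace (C (2 * n))" using C1(1) n2 by auto
    have c2: "C 2 \<subseteq> space V 1" "C (2 * n) \<subseteq> space V (2 * n - 1)"
      using C1(2)[of 2] C1(2)[of "2 * n"] n2 by (auto simp: reflect_def)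
    have "kv.subspace {b y + a z |y z. y \<in> C 2 \<and> z \<in> C (2 * n)}"
    proof -
      have "{b y + a z |y z. y \<in> C 2 \<and> z \<in> C (2 * n)} = {x + y |x y. x \<in> b ` C 2 \<and> y \<in> a ` C (2 * n)}"
        by blast
      then show ?thesis
        by (simp only:) (rule kv.subspace_sums[OF linear_on_image_subspace[OF lin_b s2(1) c2(1) sub1]
          linear_on_image_subspace[OF lin_a s2(2) c2(2) sub2]])
    qed
    moreover have "{b y + a z |y z. y \<in> C 2 \<and> z \<in> C (2 * n)} \<subseteq> space V (2 * n)"
      using c2 in_a in_b kv.subspace_add[OF sub3] by blast
    moreover have "kv.subspace (C (Suc j)) \<and> C (Suc j) \<subseteq> space V j" if "1 \<le> j" "j < 2 * n" for j
      using C1[of "Suc j"] that by simp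
    ultimately have D1: "kv.subspace (D C j) \<and> D C j \<subseteq> space V j" if "j \<in> vertices n" for j
      using that by (simp add: D_def)
    have D2: "arr V (j, Suc j) ` D C j \<subseteq> D C (Suc j)" if j: "1 \<le> j" "j < 2 * n" for j
    proof (cases "Suc j = 2 * n")
      case True
      then have jj: "j = 2 * n - 1" by simp
      have "a z \<in> {b y + a z |y z. y \<in> C 2 \<and> z \<in> C (2 * n)}" if "z \<in> C (2 * n)" for z
        using that kv.subspace_0[OF s2(1)] linear_on_0[OF lin_b sub1]
        by (intro CollectI exI[of _ 0] exI[of _ z]) simp
      then have "a ` C (2 * n) \<subseteq> {b y + a z |y z. y \<in> C 2 \<and> z \<in> C (2 * n)}" by blast
      moreover have "arr V (j, Suc j) = a" unfolding a_def True using jj by simp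
      moreover have "D C j = C (2 * n)" using j by (simp add: D_def True)
      moreover have "D C (Suc j) = {b y + a z |y z. y \<in> C 2 \<and> z \<in> C (2 * n)}"
        using True n2 by (simp add: D_def)
      ultimately show ?thesis by simp
    next
      case False
      then show ?thesis using C2[of "Suc j"] j by (simp add: D_def)
    qed
    have "b y \<in> {b y + a z |y z. y \<in> C 2 \<and> z \<in> C (2 * n)}" if "y \<in> C 2" for y
      using that kv.subspace_0[OF s2(2)] linear_on_0[OF lin_a sub2]
      by (intro CollectI exI[of _ y] exI[of _ 0]) simp
    then have "b ` C 2 \<subseteq> {b y + a z |y z. y \<in> C 2 \<and> z \<in> C (2 * n)}" by blast
    moreover have "D C 1 = C 2" "D C (2 * n) = {b y + a z |y z. y \<in> C 2 \<and> z \<in> C (2 * n)}"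
      using n2 by (simp_all add: D_def numeral_2_eq_2[symmetric])
    ultimately have D3: "arr V (1, 2 * n) ` D C 1 \<subseteq> D C (2 * n)" unfolding b_def[symmetric] by simp
    have "D C \<in> extensional (vertices n)" by (simp add: D_def)
    then have "subrep n V (D C)" using D1 D2 D3 unfolding subrep_iff[OF n1] by blast
    then show ?thesis using s2 c2 by blast
  qed
  have legs: "kfst u \<in> C 2 \<and> ksnd u \<in> C (2 * n)" if C: "subrep n (reflect n V) C" and u: "u \<in> C 1" for C u
  proof -
    have "1 < 2 * n" using n2 by simp
    then have "arr (reflect n V) (1, Suc 1) ` C 1 \<subseteq> C (Suc 1)" "arr (reflect n V) (1, 2 * n) ` C 1 \<subseteq> C (2 * n)"
      using C unfolding subrep_iff[OF n1] by blast+
    then show ?thesis using u reflect_arr(1,2) by (simp add: numeral_2_eq_2[symmetric] image_subset_iff)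
  qed
  have in_fp: "u \<in> fibre_product n V" if C: "subrep n (reflect n V) C" and u: "u \<in> C 1" for C u
  proof -
    have "1 \<in> vertices n" using n2 by simp
    then have "C 1 \<subseteq> space (reflect n V) 1" using C unfolding subrep_def by blast
    then show ?thesis using u by (simp add: subset_iff)
  qed
  note kA = key[OF sA] and kB = key[OF sB]
  have split1: "\<exists>y1\<in>A 2. \<exists>y2\<in>B 2. y = y1 + y2" if "y \<in> space V 1" for y
  proof -
    have "{x + y |x y. x \<in> A 2 \<and> y \<in> B 2} = space V 1"
      using sumV[of 1] n2 by (simp add: numeral_2_eq_2[symmetric])
    then show ?thesis using that by blast
  qed
  have split2: "\<exists>z1\<in>A (2 * n). \<exists>z2\<in>B (2 * n). z = z1 + z2" if "z \<in> space V (2 * n - 1)" for z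
  proof -
    have "{x + y |x y. x \<in> A (2 * n) \<and> y \<in> B (2 * n)} = space V (2 * n - 1)"
      using sumV[of "2 * n - 1"] n2 by simp
    then show ?thesis using that by blast
  qed
  have sum': "{x + y |x y. x \<in> D A j \<and> y \<in> D B j} = space V j" if j: "j \<in> vertices n" for j
  proof (cases "j = 2 * n")
    case True
    show ?thesis
    proof (intro equalityI subsetI)
      fix x assume "x \<in> {x + y |x y. x \<in> D A j \<and> y \<in> D B j}"
      then obtain u v where "x = u + v" "u \<in> D A j" "v \<in> D B j" by blast
      moreover have "D A j \<subseteq> space V j" "D B j \<subseteq> space V j" using kA kB j unfolding subrep_def by blast+
      ultimately show "x \<in> space V j" using kv.subspace_add[OF sub[OF j]] by blast
    next
      fix x assume "x \<in> space V j"
      then obtain y z where yz: "y \<in> space V 1" "z \<in> space V (2 * n - 1)" "x = b y + a z"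
        using onto' True by blast
      obtain y1 y2 where y: "y1 \<in> A 2" "y2 \<in> B 2" "y = y1 + y2" using split1[OF yz(1)] by blast
      obtain z1 z2 where z: "z1 \<in> A (2 * n)" "z2 \<in> B (2 * n)" "z = z1 + z2" using split2[OF yz(2)] by blast
      have "y1 \<in> space V 1" "y2 \<in> space V 1" "z1 \<in> space V (2 * n - 1)" "z2 \<in> space V (2 * n - 1)"
        using y z kA kB by blast+
      then have "x = (b y1 + a z1) + (b y2 + a z2)"
        using yz(3) y(3) z(3) by (simp add: add_a add_b algebra_simps)
      moreover have "b y1 + a z1 \<in> D A j" "b y2 + a z2 \<in> D B j" using y z True j unfolding D_def by auto
      ultimately show "x \<in> {x + y |x y. x \<in> D A j \<and> y \<in> D B j}" by blast
    qed
  next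
    case False
    then show ?thesis using sumV[of j] j by (simp add: D_def)
  qed
  have int': "D A j \<inter> D B j = {0}" if j: "j \<in> vertices n" for j
  proof (cases "j = 2 * n")
    case True
    have "x = 0" if xA: "x \<in> D A j" and xB: "x \<in> D B j" for x
    proof -
      obtain y1 z1 where 1: "y1 \<in> A 2" "z1 \<in> A (2 * n)" "x = b y1 + a z1"
        using xA True j unfolding D_def by auto
      obtain y2 z2 where 2: "y2 \<in> B 2" "z2 \<in> B (2 * n)" "x = b y2 + a z2"
        using xB True j unfolding D_def by auto
      have m: "y1 \<in> space V 1" "y2 \<in> space V 1" "z1 \<in> space V (2 * n - 1)" "z2 \<in> space V (2 * n - 1)"
        using 1 2 kA kB by blast+
      \<comment> \<open>The difference of the two expressions for \<open>x\<close> lies in the fibre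
        product and splits as \<open>u + v\<close> along \<open>A 1\<close> and \<open>B 1\<close>.
        Comparing legs puts \<open>y1 - kfst u\<close> into both \<open>A 2\<close> and
        \<open>B 2\<close>, so it vanishes; likewise \<open>z1 + ksnd u\<close>. Then
        \<open>x\<close> is the difference of the two images of \<open>u\<close> at the sink, which
        is 0.\<close>
      have "b (y1 - y2) = a (z2 - z1)"
      proof -
        have "b y1 + a z1 = b y2 + a z2" using 1(3) 2(3) by simp
        then have "b y1 - b y2 = a z2 - a z1" by (simp add: algebra_simps)
        then show ?thesis
          unfolding linear_on_diff[OF lin_b sub1 m(1,2)] linear_on_diff[OF lin_a sub2 m(4,3)] .
      qed
      then have "kpair (y1 - y2) (z2 - z1) \<in> fibre_product n V"
        using m kv.subspace_diff[OF sub1] kv.subspace_diff[OF sub2] by (simp add: in_fibre_product)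
      moreover have "{x + y |x y. x \<in> A 1 \<and> y \<in> B 1} = fibre_product n V"
        using sum[of 1] n2 by simp
      ultimately have "kpair (y1 - y2) (z2 - z1) \<in> {x + y |x y. x \<in> A 1 \<and> y \<in> B 1}" by blast
      then obtain u v where uv: "kpair (y1 - y2) (z2 - z1) = u + v" "u \<in> A 1" "v \<in> B 1" by blast
      have uf: "u \<in> fibre_product n V" using in_fp[OF sA uv(2)] .
      have kA1: "kfst u \<in> A 2" "ksnd u \<in> A (2 * n)" using legs[OF sA uv(2)] by auto
      have kB1: "kfst v \<in> B 2" "ksnd v \<in> B (2 * n)" using legs[OF sB uv(3)] by auto
      have e1: "y1 - y2 = kfst u + kfst v" and e2: "z2 - z1 = ksnd u + ksnd v"
        using arg_cong[OF uv(1), of kfst] arg_cong[OF uv(1), of ksnd] by (simp_all add: kfst_add ksnd_add)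
      have "y1 - kfst u \<in> A 2" using kv.subspace_diff 1 kA1 kA by blast
      moreover have "y1 - kfst u = y2 + kfst v" using e1 by (simp add: algebra_simps)
      moreover have "y2 + kfst v \<in> B 2" using kv.subspace_add 2 kB1 kB by blast
      moreover have "A 2 \<inter> B 2 = {0}" using int[of 2] n2 by simp
      ultimately have "y1 - kfst u = 0" by (metis Int_iff singletonD)
      then have y: "y1 = kfst u" by simp
      have "z1 + ksnd u \<in> A (2 * n)" using kv.subspace_add 1 kA1 kA by blast
      moreover have "z1 + ksnd u = z2 - ksnd v" using e2 by (simp add: algebra_simps)
      moreover have "z2 - ksnd v \<in> B (2 * n)" using kv.subspace_diff 2 kB1 kB by blast
      moreover have "A (2 * n) \<inter> B (2 * n) = {0}" using int[of "2 * n"] n2 by simp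
      ultimately have "z1 + ksnd u = 0" by (metis Int_iff singletonD)
      then have z: "z1 = - ksnd u" by (simp add: add_eq_0_iff2)
      obtain yu zu where "u = kpair yu zu" "b yu = a zu" "zu \<in> space V (2 * n - 1)"
        using uf by (elim fibre_productE)
      then show "x = 0" using 1(3) y z scale_a[of zu "-1"] by simp
    qed
    moreover have "0 \<in> D A j" "0 \<in> D B j"
      using kA kB subrep_zero[OF _ j] by blast+
    ultimately show ?thesis by blast
  next
    case False
    then show ?thesis using int[of "Suc j"] j by (simp add: D_def)
  qed
  have fin: "\<forall>i\<in>vertices n. C i = {0}" if C: "subrep n (reflect n V) C" "\<forall>i\<in>vertices n. D C i = {0}" for C
  proof -
    \<comment> \<open>Away from the new source \<open>C\<close> is visible in \<open>D C\<close>; at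
      the source it vanishes because an element of the fibre product is determined by its two
      legs.\<close>
    have *: "C (Suc j) = {0}" if "1 \<le> j" "j < 2 * n" for j
      using bspec[OF C(2), of j] that by (simp add: D_def)
    have "u = 0" if u: "u \<in> C 1" for u
    proof -
      have "u \<in> fibre_product n V" using in_fp[OF C(1) u] .
      then obtain y z where yz: "u = kpair y z" by (elim fibre_productE)
      have "y = 0" using legs[OF C(1) u] *[of 1] n2 yz by (simp add: numeral_2_eq_2[symmetric])
      have "z = 0" using legs[OF C(1) u] *[of "2 * n - 1"] n2 yz by simp
      with \<open>y = 0\<close> show ?thesis using yz by (simp add: kpair_0)
    qed
    moreover have "1 \<in> vertices n" using n2 by simp
    then have "0 \<in> C 1" using subrep_zero[OF C(1)] by blast
    ultimately have "C 1 = {0}" by blast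
    show ?thesis
    proof
      fix i assume i: "i \<in> vertices n"
      show "C i = {0}"
      proof (cases "i = 1")
        case False
        then have "1 \<le> i - 1" "i - 1 < 2 * n" "Suc (i - 1) = i" using i by auto
        then show ?thesis using * by metis
      qed (use \<open>C 1 = {0}\<close> in simp)
    qed
  qed
  have "(\<forall>i\<in>vertices n. D A i = {0}) \<or> (\<forall>i\<in>vertices n. D B i = {0})"
    by (rule indecomposableD[OF ind conjunct1[OF kA] conjunct1[OF kB] sum' int'])
  then show "(\<forall>i\<in>vertices n. A i = {0}) \<or> (\<forall>i\<in>vertices n. B i = {0})"
    using fin[OF sA] fin[OF sB] by blast
qed

end

section \<open>Classification of the indecomposables with the dimension vectors in question\<close>

text \<open>A complement of the sum of the two images at the sink is a direct summand concentrated
  there. As \<open>V\<close> is nonzero at another vertex, indecomposability forces this summand to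
  vanish.\<close>

lemma indecomposable_sink_rep:
  fixes V :: "'k::{field,finite} rep"
  assumes n2: "n \<ge> 2" and V: "is_rep n V" and ind: "indecomposable n V"
    and j: "1 \<le> j" "j < 2 * n" "space V j \<noteq> {0}"
  shows "sink_rep n V"
proof -
  have n1: "n \<ge> 1" using n2 by simp
  let ?a = "arr V (2 * n - 1, 2 * n)" and ?b = "arr V (1, 2 * n)"
  have sub: "kv.subspace (space V j)" if "j \<in> vertices n" for j
    using V that unfolding is_rep_iff[OF n1] by blast
  have lin: "linear_on (space V j) (space V (Suc j)) (arr V (j, Suc j))" if "1 \<le> j" "j < 2 * n" for j
    using V that unfolding is_rep_iff[OF n1] by blast
  have lin_a: "linear_on (space V (2 * n - 1)) (space V (2 * n)) ?a"
    using lin[of "2 * n - 1"] n2 by simp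
  have lin_b: "linear_on (space V 1) (space V (2 * n)) ?b"
    using V unfolding is_rep_iff[OF n1] by blast
  have sub1: "kv.subspace (space V 1)" and sub2: "kv.subspace (space V (2 * n - 1))"
    and sub3: "kv.subspace (space V (2 * n))" using n2 by (auto intro!: sub)
  define I where "I = {x + y |x y. x \<in> ?b ` space V 1 \<and> y \<in> ?a ` space V (2 * n - 1)}"
  have I: "kv.subspace I" unfolding I_def
    by (rule kv.subspace_sums[OF linear_on_image_subspace[OF lin_b sub1 _ sub1]
          linear_on_image_subspace[OF lin_a sub2 _ sub2]]) simp_all
  have IV: "I \<subseteq> space V (2 * n)"
    using lin_a lin_b kv.subspace_add[OF sub3] unfolding I_def linear_on_def by blast
  have aI: "?a ` space V (2 * n - 1) \<subseteq> I"
  proof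
    fix x assume "x \<in> ?a ` space V (2 * n - 1)"
    moreover have "0 \<in> ?b ` space V 1" using linear_on_0[OF lin_b sub1] kv.subspace_0[OF sub1] by force
    ultimately show "x \<in> I" unfolding I_def by (metis (mono_tags, lifting) add_0 mem_Collect_eq)
  qed
  have bI: "?b ` space V 1 \<subseteq> I"
  proof
    fix x assume "x \<in> ?b ` space V 1"
    moreover have "0 \<in> ?a ` space V (2 * n - 1)" using linear_on_0[OF lin_a sub2] kv.subspace_0[OF sub2] by force
    ultimately show "x \<in> I" unfolding I_def by (metis (mono_tags, lifting) add.right_neutral mem_Collect_eq)
  qed
  obtain C where C: "kv.subspace C" "C \<subseteq> space V (2 * n)"
    "{x + y |x y. x \<in> C \<and> y \<in> I} = space V (2 * n)" "C \<inter> I = {0}"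
    by (rule subspace_complement[OF I sub3 IV])
  define N where "N = (\<lambda>j\<in>vertices n. if j = 2 * n then C else {0})"
  define N' where "N' = (\<lambda>j\<in>vertices n. if j = 2 * n then I else space V j)"
  have z0: "arr V (j, Suc j) 0 = 0" if "1 \<le> j" "j < 2 * n" for j
    using linear_on_0[OF lin[OF that]] sub[of j] that by simp
  have sN: "subrep n V N" unfolding subrep_iff[OF n1]
  proof (intro conjI ballI allI impI)
    fix j assume "j \<in> vertices n"
    then show "kv.subspace (N j)" "N j \<subseteq> space V j"
      using C kv.subspace_0[OF sub[of j]] by (simp_all add: N_def)
  next
    fix j assume "1 \<le> j \<and> j < 2 * n"
    then show "arr V (j, Suc j) ` N j \<subseteq> N (Suc j)"
      using z0[of j] kv.subspace_0[OF C(1)] by (simp add: N_def)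
  next
    show "?b ` N 1 \<subseteq> N (2 * n)"
      using linear_on_0[OF lin_b sub1] kv.subspace_0[OF C(1)] n2 by (simp add: N_def)
  qed (simp add: N_def)
  have sN': "subrep n V N'" unfolding subrep_iff[OF n1]
  proof (intro conjI ballI allI impI)
    fix j assume "j \<in> vertices n"
    then show "kv.subspace (N' j)" "N' j \<subseteq> space V j"
      using I IV sub[of j] by (simp_all add: N'_def)
  next
    fix j assume j: "1 \<le> j \<and> j < 2 * n"
    show "arr V (j, Suc j) ` N' j \<subseteq> N' (Suc j)"
    proof (cases "Suc j = 2 * n")
      case True
      then have "j = 2 * n - 1" by simp
      then show ?thesis using aI True j by (simp add: N'_def)
    next
      case False
      then show ?thesis using lin[of j] j by (auto simp: N'_def linear_on_def)
    qed
  next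
    show "?b ` N' 1 \<subseteq> N' (2 * n)" using bI n2 by (simp add: N'_def)
  qed (simp add: N'_def)
  have dec: "{x + y |x y. x \<in> N i \<and> y \<in> N' i} = space V i" "N i \<inter> N' i = {0}" if i: "i \<in> vertices n" for i
    using C(3,4) i kv.subspace_0[OF sub[OF i]] by (auto simp: N_def N'_def)
  have "(\<forall>i\<in>vertices n. N i = {0}) \<or> (\<forall>i\<in>vertices n. N' i = {0})"
    by (rule indecomposableD[OF ind sN sN' dec])
  moreover have "N' j = space V j" using j by (simp add: N'_def)
  moreover have "j \<in> vertices n" "2 * n \<in> vertices n" using j n2 by auto
  ultimately have "N (2 * n) = {0}" using j(3) by metis
  then have "C = {0}" using n2 by (simp add: N_def)
  then have "space V (2 * n) = I" using C(3) by simp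
  then show ?thesis by unfold_locales (use n2 V in \<open>auto simp: I_def\<close>)
qed

lemma constant_part_coord_space:
  "v \<in> coord_space d \<Longrightarrow> v = (\<lambda>p. if p = [0] then v [0] else 0) + shift (unshift v)"
proof (rule kvec_eqI)
  fix t show "v [t] = ((\<lambda>p. if p = [0] then v [0] else 0) + shift (unshift v)) [t]" by (cases t) simp_all
qed (simp_all add: coord_space_iff)

text \<open>\<open>V\<close> at the sink is recovered from its reflection as a pushout. For
  polynomials the two legs are inclusion and multiplication by x, so the map at the sink sends the
  constant term through the path arrow and the remainder, divided by x, through the long arrow. The
  equations \<open>dd\<close> say that the string data with primes have the reflected dimension
  vector.\<close>

lemma (in sink_rep) reflect_iso_string_rep:
  assumes i: "1 \<le> i" "i < 2 * n" and d: "\<And>j. j \<in> vertices n \<Longrightarrow> kv.dim (space V j) = string_dim i l j"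
    and i': "1 \<le> i'" "i' < 2 * n"
    and dd: "\<And>j. 1 \<le> j \<Longrightarrow> j < 2 * n \<Longrightarrow> string_dim i' l' (Suc j) = string_dim i l j"
      "Suc (string_dim i' l' 1) = string_dim i l (2 * n - 1)"
    and iso: "rep_iso n (string_rep n i' l') (reflect n V) f"
  shows "\<exists>g. rep_iso n (string_rep n i l) V g"
proof -
  let ?D = "\<lambda>j. coord_space (string_dim i l j) :: 'k kvec set"
  let ?D' = "\<lambda>j. coord_space (string_dim i' l' j) :: 'k kvec set"
  have bij: "bij_betw (f (Suc j)) (?D j) (space V j)" if "1 \<le> j" "j < 2 * n" for j
  proof -
    have "Suc j \<in> vertices n" using that by simp
    then have "bij_betw (f (Suc j)) (space (string_rep n i' l') (Suc j)) (space (reflect n V) (Suc j))"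
      using iso unfolding rep_iso_def by blast
    then show ?thesis using that dd by (simp add: string_rep_def)
  qed
  have lf: "linear_on (?D j) (space V j) (f (Suc j))" if "1 \<le> j" "j < 2 * n" for j
  proof -
    have "Suc j \<in> vertices n" using that by simp
    then have "linear_on (space (string_rep n i' l') (Suc j)) (space (reflect n V) (Suc j)) (f (Suc j))"
      using iso unfolding rep_iso_def rep_hom_def by blast
    then show ?thesis using that dd by (simp add: string_rep_def)
  qed
  have f_in: "f (Suc j) x \<in> space V j" if "1 \<le> j" "j < 2 * n" "x \<in> ?D j" for j x
    using lf[OF that(1,2)] that(3) unfolding linear_on_def by blast
  have f1_in: "f 1 x \<in> fibre_product n V" if "x \<in> ?D' 1" for x
  proof -
    have "1 \<in> vertices n" using n2 by simp
    then have "linear_on (space (string_rep n i' l') 1) (space (reflect n V) 1) (f 1)"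
      using iso unfolding rep_iso_def rep_hom_def by blast
    then show ?thesis using that unfolding linear_on_def by (auto simp: string_rep_def)
  qed
  have comm: "f (Suc (Suc j)) x = arr V (j, Suc j) (f (Suc j) x)" if j: "1 \<le> j" "Suc j < 2 * n" "x \<in> ?D j" for j x
  proof -
    have "\<forall>x\<in>space (string_rep n i' l') (Suc j).
        f (Suc (Suc j)) (arr (string_rep n i' l') (Suc j, Suc (Suc j)) x) = arr (reflect n V) (Suc j, Suc (Suc j)) (f (Suc j) x)"
      using iso j unfolding rep_iso_def rep_hom_iff[OF n1] by (metis le_SucI)
    then show ?thesis using j dd by (simp add: string_rep_def)
  qed
  have legs: "kfst (f 1 x) = f 2 x" "ksnd (f 1 x) = f (2 * n) (shift x)" if x: "x \<in> ?D' 1" for x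
  proof -
    have "1 < 2 * n" using n2 by simp
    then have "\<forall>x\<in>space (string_rep n i' l') 1.
        f (Suc 1) (arr (string_rep n i' l') (1, Suc 1) x) = arr (reflect n V) (1, Suc 1) (f 1 x)"
      "\<forall>x\<in>space (string_rep n i' l') 1.
        f (2 * n) (arr (string_rep n i' l') (1, 2 * n) x) = arr (reflect n V) (1, 2 * n) (f 1 x)"
      using iso unfolding rep_iso_def rep_hom_iff[OF n1] by blast+
    then show "kfst (f 1 x) = f 2 x" "ksnd (f 1 x) = f (2 * n) (shift x)"
      using x n2 reflect_arr(1,2) by (auto simp: string_rep_def numeral_2_eq_2[symmetric])
  qed
  have m1: "1 \<le> 2 * n - 1" "2 * n - 1 < 2 * n" and sm: "Suc (2 * n - 1) = 2 * n" using n2 by auto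
  have dm: "string_dim i l (2 * n) = Suc (string_dim i l 1)" using i by (simp add: string_dim_def)
  have sub_a: "?D' 1 \<subseteq> ?D 1"
    using dd(1)[of 1] n2 by (intro coord_space_mono) (simp add: string_dim_def split: if_splits)
  \<comment> \<open>The defining relation of the fibre product, transported to polynomials. It makes
    \<open>F\<close> agree with the path arrow on all of \<open>?D (2 * n - 1)\<close>, not only on
    constants.\<close>
  have pb: "b (f 2 x) = a (f (2 * n) (shift x))" if x: "x \<in> ?D' 1" for x
    using f1_in[OF x] legs[OF x] by (auto elim!: fibre_productE)
  define c0 where "c0 = (\<lambda>v :: 'k kvec. \<lambda>p. if p = [0::nat] then v [0] else 0)"
  have c0_add: "c0 (v + w) = c0 v + c0 w" for v w by (auto simp: c0_def fun_eq_iff)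
  have c0_scale: "c0 (kscale c v) = kscale c (c0 v)" for c v by (auto simp: c0_def fun_eq_iff kscale_apply)
  have c0_in: "c0 v \<in> ?D (2 * n - 1)" for v
    unfolding dd(2)[symmetric] by (simp add: c0_def coord_space_iff)
  have un_in: "unshift v \<in> ?D 1" if "v \<in> ?D (2 * n)" for v
    using unshift_coord_space[OF that] dm by simp
  define F where "F = (\<lambda>v. a (f (2 * n) (c0 v)) + b (f 2 (unshift v)))"
  have lin2: "linear_on (?D (2 * n - 1)) (space V (2 * n - 1)) (f (2 * n))" using lf[OF m1] sm by simp
  have lin1: "linear_on (?D 1) (space V 1) (f 2)" using lf[of 1] n2 by (simp add: numeral_2_eq_2[symmetric])
  have in2: "f (2 * n) x \<in> space V (2 * n - 1)" if "x \<in> ?D (2 * n - 1)" for x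
    using lin2 that unfolding linear_on_def by blast
  have in1: "f 2 x \<in> space V 1" if "x \<in> ?D 1" for x
    using lin1 that unfolding linear_on_def by blast
  have add2: "f (2 * n) (x + y) = f (2 * n) x + f (2 * n) y" "f (2 * n) (kscale c x) = kscale c (f (2 * n) x)"
    if "x \<in> ?D (2 * n - 1)" "y \<in> ?D (2 * n - 1)" for x y c
    using lin2 that unfolding linear_on_def by blast+
  have add1: "f 2 (x + y) = f 2 x + f 2 y" "f 2 (kscale c x) = kscale c (f 2 x)"
    if "x \<in> ?D 1" "y \<in> ?D 1" for x y c
    using lin1 that unfolding linear_on_def by blast+
  have F_lin: "linear_on (?D (2 * n)) (space V (2 * n)) F"
    unfolding linear_on_def
  proof (intro conjI ballI allI Pi_I)
    fix v assume v: "v \<in> ?D (2 * n)"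
    show "F v \<in> space V (2 * n)"
      unfolding F_def using in_a[OF in2[OF c0_in]] in_b[OF in1[OF un_in[OF v]]]
      by (rule kv.subspace_add[OF sub3])
    show "F (kscale c v) = kscale c (F v)" for c
      unfolding F_def c0_scale unshift_scale add2(2)[OF c0_in c0_in] add1(2)[OF un_in[OF v] un_in[OF v]]
        scale_a[OF in2[OF c0_in]] scale_b[OF in1[OF un_in[OF v]]] by (rule kv.scale_right_distrib[symmetric])
    fix w assume w: "w \<in> ?D (2 * n)"
    show "F (v + w) = F v + F w"
      unfolding F_def c0_add unshift_add add2(1)[OF c0_in c0_in] add1(1)[OF un_in[OF v] un_in[OF w]]
        add_a[OF in2[OF c0_in] in2[OF c0_in]] add_b[OF in1[OF un_in[OF v]] in1[OF un_in[OF w]]]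
      by (simp add: add_ac)
  qed
  have F_b: "F (shift v) = b (f 2 v)" if v: "v \<in> ?D 1" for v
  proof -
    have "c0 (shift v) = 0" by (simp add: c0_def fun_eq_iff)
    then show ?thesis
      using linear_on_0[OF lin2] linear_on_0[OF lin_a sub2] unshift_shift[OF v] by (simp add: F_def)
  qed
  have F_a: "F v = a (f (2 * n) v)" if v: "v \<in> ?D (2 * n - 1)" for v
  proof -
    have u: "unshift v \<in> ?D' 1" using unshift_coord_space[OF v] dd(2) by (metis diff_Suc_1)
    have "shift (unshift v) \<in> ?D (2 * n - 1)" using shift_coord_space[OF u] dd(2) by simp
    then have "f (2 * n) v = f (2 * n) (c0 v) + f (2 * n) (shift (unshift v))"
      using constant_part_coord_space[OF v] add2(1)[OF c0_in] unfolding c0_def by metis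
    moreover have "f (2 * n) (shift (unshift v)) \<in> space V (2 * n - 1)" by (rule in2) fact
    ultimately show ?thesis unfolding F_def pb[OF u] using add_a[OF in2[OF c0_in]] by simp
  qed
  have F_surj: "F ` ?D (2 * n) = space V (2 * n)"
  proof (intro equalityI subsetI)
    fix x assume "x \<in> F ` ?D (2 * n)"
    then show "x \<in> space V (2 * n)" using F_lin unfolding linear_on_def by blast
  next
    fix x assume "x \<in> space V (2 * n)"
    then obtain y z where yz: "y \<in> space V 1" "z \<in> space V (2 * n - 1)" "x = b y + a z" using onto' by blast
    have "bij_betw (f 2) (?D 1) (space V 1)" using bij[of 1] n2 by (simp add: numeral_2_eq_2[symmetric])
    then obtain y' where y': "y' \<in> ?D 1" "y = f 2 y'" using yz(1) unfolding bij_betw_def by blast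
    have "bij_betw (f (2 * n)) (?D (2 * n - 1)) (space V (2 * n - 1))" using bij[OF m1] sm by simp
    then obtain z' where z': "z' \<in> ?D (2 * n - 1)" "z = f (2 * n) z'" using yz(2) unfolding bij_betw_def by blast
    have s: "shift y' \<in> ?D (2 * n)" using shift_coord_space[OF y'(1)] dm by simp
    have "?D (2 * n - 1) \<subseteq> ?D (2 * n)" by (rule coord_space_mono) (use i in \<open>auto simp: string_dim_def\<close>)
    then have z'': "z' \<in> ?D (2 * n)" using z' by blast
    have "x = F (shift y' + z')"
      using F_lin s z'' F_b[OF y'(1)] F_a[OF z'(1)] y' z' yz(3) unfolding linear_on_def by simp
    then show "x \<in> F ` ?D (2 * n)" using kv.subspace_add[OF coord_space_subspace s z''] by blast
  qed
  \<comment> \<open>Injectivity of \<open>F\<close> follows from surjectivity, because the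
    dimensions at the sink agree.\<close>
  have "2 * n \<in> vertices n" using n2 by simp
  then have "card (?D (2 * n)) = card (space V (2 * n))"
    using d[of "2 * n"] by (simp add: card_coord_space card_subspace[OF sub3 fin3])
  then have "inj_on F (?D (2 * n))" using F_surj by (intro eq_card_imp_inj_on) simp_all
  then have F_bij: "bij_betw F (?D (2 * n)) (space V (2 * n))" using F_surj by (simp add: bij_betw_def)
  define g where "g = (\<lambda>j. if j = 2 * n then F else f (Suc j))"
  have "rep_iso n (string_rep n i l) V g"
    unfolding rep_iso_def rep_hom_iff[OF n1]
  proof (intro conjI ballI allI impI)
    fix j assume "j \<in> vertices n"
    then show "linear_on (space (string_rep n i l) j) (space V j) (g j)"
      "bij_betw (g j) (space (string_rep n i l) j) (space V j)"
      using F_lin F_bij lf[of j] bij[of j] by (auto simp: g_def string_rep_def)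
  next
    fix j and x :: "'k kvec" assume j: "1 \<le> j \<and> j < 2 * n" and x: "x \<in> space (string_rep n i l) j"
    have x': "x \<in> ?D j" using x by (simp add: string_rep_def)
    have st: "arr (string_rep n i l) (j, Suc j) x = x"
      using n2 by (auto simp: string_rep_def)
    show "g (Suc j) (arr (string_rep n i l) (j, Suc j) x) = arr V (j, Suc j) (g j x)"
    proof (cases "Suc j = 2 * n")
      case True
      then have jj: "j = 2 * n - 1" by simp
      have "g (Suc j) x = F x" "g j x = f (2 * n) x" using True j by (simp_all add: g_def)
      moreover have "arr V (j, Suc j) = a" unfolding a_def True using jj by simp
      ultimately show ?thesis using F_a x' jj unfolding st by simp
    next
      case False
      then show ?thesis using comm[of j x] j x' unfolding st by (simp add: g_def)
    qed
  next
    fix x :: "'k kvec" assume x: "x \<in> space (string_rep n i l) 1"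
    have "g (2 * n) (arr (string_rep n i l) (1, 2 * n) x) = F (shift x)" by (simp add: g_def string_rep_def)
    moreover have "g 1 x = f 2 x" using n2 by (simp add: g_def numeral_2_eq_2[symmetric])
    ultimately show "g (2 * n) (arr (string_rep n i l) (1, 2 * n) x) = arr V (1, 2 * n) (g 1 x)"
      using F_b x unfolding b_def by (simp add: string_rep_def)
  qed
  then show ?thesis by blast
qed

text \<open>Reflection permutes the string dimension vectors: \<open>(i, l)\<close> becomes
  \<open>(i + 1, l)\<close>, or \<open>(1, l - 1)\<close> if i = 2n - 1. The measure decreases each
  time, and the descent ends at the simple representation at the sink.\<close>

theorem indecomposable_iso_string_rep:
  fixes V :: "'k::{field,finite} rep"
  assumes n2: "n \<ge> 2" and i: "1 \<le> i" "i < 2 * n" and V: "is_rep n V" and ind: "indecomposable n V"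
    and d: "\<And>j. j \<in> vertices n \<Longrightarrow> kv.dim (space V j) = string_dim i l j"
  shows "\<exists>f. rep_iso n (string_rep n i l) V f"
  using V ind d i
proof (induction "2 * n * l + (2 * n - 1 - i)" arbitrary: V i l rule: less_induct)
  case less
  have n1: "n \<ge> 1" using n2 by simp
  note V = less.prems(1) and ind = less.prems(2) and d = less.prems(3) and i = less.prems(4,5)
  have sub: "kv.subspace (space V j)" and fin: "finite (space V j)" if "j \<in> vertices n" for j
    using that V unfolding is_rep_iff[OF n1] by blast+
  show ?case
  proof (cases "l = 0 \<and> i = 2 * n - 1")
    \<comment> \<open>The simple representation at the sink, which a reflection would annihilate;
      any nonzero vector \<open>w\<close> gives the isomorphism.\<close>
    case True
    have z: "space V j = {0}" if "1 \<le> j" "j < 2 * n" for j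
    proof -
      have "j \<in> vertices n" "j \<le> i" using that True by auto
      then show ?thesis using dim_zero_subspace_iff[OF sub fin, of j] d[of j] True by (simp add: string_dim_def)
    qed
    have v: "2 * n \<in> vertices n" using n2 by simp
    have cV: "card (space V (2 * n)) = CARD('k)"
      using card_subspace[OF sub[OF v] fin[OF v]] d[OF v] True n2 by (simp add: string_dim_def)
    obtain w where w: "w \<in> space V (2 * n)" "w \<noteq> 0"
    proof -
      have "\<not> space V (2 * n) \<subseteq> {0}"
        using cV card_field_ge_2[where ?'k='k] card_mono[of "{0::'k kvec}" "space V (2 * n)"] by auto
      then show ?thesis using that by blast
    qed
    define F where "F = (\<lambda>v :: 'k kvec. kscale (v [0]) w)"
    have F_in: "F v \<in> space V (2 * n)" for v
      unfolding F_def by (rule kv.subspace_scale[OF sub[OF v] w(1)])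
    have inj: "inj_on F (coord_space 1)"
    proof (rule inj_onI)
      fix x y :: "'k kvec" assume xy: "x \<in> coord_space 1" "y \<in> coord_space 1" "F x = F y"
      then have "x [0] = y [0]" using w(2) by (simp add: F_def)
      then have "x [t] = y [t]" for t using xy(1,2) by (cases t) (simp_all add: coord_space_iff)
      then show "x = y" by (rule coord_space_eqI[OF xy(1,2)])
    qed
    have "F ` coord_space 1 = space V (2 * n)"
      using F_in cV card_image[OF inj] fin[OF v] by (intro card_subset_eq) (auto simp: card_coord_space)
    then have bij: "bij_betw F (coord_space 1) (space V (2 * n))" using inj by (simp add: bij_betw_def)
    have lin: "linear_on (coord_space 1) (space V (2 * n)) F"
      using F_in by (auto simp: linear_on_def F_def kv.scale_left_distrib kscale_apply)
    define g where "g = (\<lambda>j. if j = 2 * n then F else (\<lambda>x. x))"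
    have D: "space (string_rep n i l :: 'k rep) j = {0}" if "1 \<le> j" "j < 2 * n" for j
    proof -
      have "j \<le> i" using that True by auto
      then show ?thesis using True by (simp add: string_rep_def string_dim_def coord_space_0)
    qed
    have "\<not> 2 * n \<le> i" using True n2 by auto
    then have D': "space (string_rep n i l :: 'k rep) (2 * n) = coord_space 1"
      using True by (simp add: string_rep_def string_dim_def)
    have az: "arr V (j, Suc j) 0 = 0" if "1 \<le> j" "j < 2 * n" for j
      using V sub[of j] that linear_on_0 unfolding is_rep_iff[OF n1] by (metis less_imp_le vertices_iff)
    have bz: "arr V (1, 2 * n) 0 = 0"
      using V sub[of 1] n2 linear_on_0 unfolding is_rep_iff[OF n1]
      by (metis One_nat_def Suc_1 mult_is_0 not_less_eq_eq vertices_iff le_refl n1 nat_0_less_mult_iff Suc_leI pos2 zero_less_iff_neq_zero)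
    have F0: "F 0 = 0" by (simp add: F_def)
    have "rep_iso n (string_rep n i l) V g"
      unfolding rep_iso_def rep_hom_iff[OF n1]
    proof (intro conjI ballI allI impI)
      fix j assume j: "j \<in> vertices n"
      have "linear_on (space (string_rep n i l) j) (space V j) (g j)
        \<and> bij_betw (g j) (space (string_rep n i l) j) (space V j)"
      proof (cases "j = 2 * n")
        case True
        then show ?thesis using lin bij D' by (simp add: g_def)
      next
        case False
        then have "1 \<le> j" "j < 2 * n" using j by auto
        then show ?thesis unfolding D[OF \<open>1 \<le> j\<close> \<open>j < 2 * n\<close>] z[OF \<open>1 \<le> j\<close> \<open>j < 2 * n\<close>]
          by (simp add: g_def linear_on_def bij_betw_def)
      qed
      then show "linear_on (space (string_rep n i l) j) (space V j) (g j)"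
        "bij_betw (g j) (space (string_rep n i l) j) (space V j)" by blast+
    next
      fix j and x :: "'k kvec" assume j: "1 \<le> j \<and> j < 2 * n" and x: "x \<in> space (string_rep n i l) j"
      have "x = 0" using x D j by simp
      then show "g (Suc j) (arr (string_rep n i l) (j, Suc j) x) = arr V (j, Suc j) (g j x)"
        using az[of j] j F0 n2 by (simp add: g_def string_rep_def)
    next
      fix x :: "'k kvec" assume x: "x \<in> space (string_rep n i l) 1"
      have "x = 0" using x D[of 1] n2 by simp
      moreover have "shift 0 = (0 :: 'k kvec)" using shift_scale[of 0 0] by simp
      ultimately show "g (2 * n) (arr (string_rep n i l) (1, 2 * n) x) = arr V (1, 2 * n) (g 1 x)"
        using bz F0 n2 by (simp add: g_def string_rep_def)
    qed
    then show ?thesis by blast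
  next
    case False
    \<comment> \<open>\<open>V\<close> is nonzero next to the sink, so it has no simple summand at
      the sink and may be reflected.\<close>
    have "string_dim i l (2 * n - 1) \<noteq> 0" using False i by (auto simp: string_dim_def)
    moreover have v: "2 * n - 1 \<in> vertices n" using n2 by simp
    ultimately have "space V (2 * n - 1) \<noteq> {0}"
      using dim_zero_subspace_iff[OF sub[OF v] fin[OF v]] d[OF v] by simp
    then interpret sink_rep n V
      using indecomposable_sink_rep[OF n2 V ind, of "2 * n - 1"] n2 by simp
    have dim1: "kv.dim (space (reflect n V) 1) + string_dim i l (2 * n) = string_dim i l 1 + string_dim i l (2 * n - 1)"
      using dim_fibre_product d[of 1] d[of "2 * n - 1"] d[of "2 * n"] n2 by simp
    have dimj: "kv.dim (space (reflect n V) (Suc j)) = string_dim i l j" if "1 \<le> j" "j < 2 * n" for j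
      using that d[of j] by simp
    obtain i' l' where i': "1 \<le> i'" "i' < 2 * n"
      and dd: "\<And>j. 1 \<le> j \<Longrightarrow> j < 2 * n \<Longrightarrow> string_dim i' l' (Suc j) = string_dim i l j"
        "Suc (string_dim i' l' 1) = string_dim i l (2 * n - 1)"
      and less': "2 * n * l' + (2 * n - 1 - i') < 2 * n * l + (2 * n - 1 - i)"
    proof (cases "i = 2 * n - 1")
      case True
      then obtain k where k: "l = Suc k" using False by (cases l) auto
      show ?thesis
        by (rule that[of 1 k]) (use True k n2 in \<open>auto simp: string_dim_def\<close>)
    next
      case False
      show ?thesis
        by (rule that[of "Suc i" l]) (use False i in \<open>auto simp: string_dim_def\<close>)
    qed
    have "kv.dim (space (reflect n V) j) = string_dim i' l' j" if j: "j \<in> vertices n" for j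
    proof (cases "j = 1")
      case True
      have "string_dim i l (2 * n) = Suc (string_dim i l 1)" using i by (simp add: string_dim_def)
      then show ?thesis using dim1 dd(2) True by simp
    next
      case False
      then have "1 \<le> j - 1" "j - 1 < 2 * n" "Suc (j - 1) = j" using j by auto
      then show ?thesis using dimj[of "j - 1"] dd(1)[of "j - 1"] by simp
    qed
    then obtain f where "rep_iso n (string_rep n i' l') (reflect n V) f"
      using less.hyps[OF less' reflect_is_rep reflect_indecomposable[OF ind] _ i'] by blast
    then show ?thesis using reflect_iso_string_rep[OF i d i' dd] by blast
  qed
qed

section \<open>Counting subrepresentations\<close>

definition tail_vec :: "nat \<Rightarrow> nat \<Rightarrow> nat \<Rightarrow> int" where
  "tail_vec n s = (\<lambda>j. if s \<le> j \<and> j \<in> vertices n then 1 else 0)"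

text \<open>The argument \<open>ty\<close> carries the field, which neither the indices nor the
  resulting number mention.\<close>

definition string_count :: "'k::field itself \<Rightarrow> nat \<Rightarrow> nat \<Rightarrow> nat \<Rightarrow> (nat \<Rightarrow> int) \<Rightarrow> real" where
  "string_count (ty :: 'k itself) n i l e = real (card (Gr n (string_rep n i l :: 'k rep) e))"

lemma Gr_string_rep_iff:
  fixes N :: "nat \<Rightarrow> 'k::{field,finite} kvec set"
  assumes n2: "n \<ge> 2"
  shows "N \<in> Gr n (string_rep n i l) e \<longleftrightarrow> N \<in> extensional (vertices n)
     \<and> (\<forall>j\<in>vertices n. kv.subspace (N j) \<and> N j \<subseteq> coord_space (string_dim i l j) \<and> int (kv.dim (N j)) = e j)
     \<and> (\<forall>j. 1 \<le> j \<and> j < 2 * n \<longrightarrow> N j \<subseteq> N (Suc j))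
     \<and> shift ` N 1 \<subseteq> N (2 * n)"
proof -
  have n1: "n \<ge> 1" using n2 by simp
  have "arr (string_rep n i l) (j, Suc j) ` N j = N j" for j
    using n2 by (auto simp: string_rep_def)
  then show ?thesis unfolding Gr_def subrep_iff[OF n1] by (auto simp: string_rep_def)
qed

lemma finite_Gr_string_rep:
  assumes n2: "n \<ge> 2"
  shows "finite (Gr n (string_rep n i l :: 'k::{field,finite} rep) e)"
proof (rule finite_subset)
  show "Gr n (string_rep n i l :: 'k rep) e \<subseteq> (\<Pi>\<^sub>E j\<in>vertices n. Pow (coord_space (string_dim i l j)))"
    by (rule subsetI) (simp add: PiE_iff Gr_string_rep_iff[OF n2])
  show "finite (\<Pi>\<^sub>E j\<in>vertices n. Pow (coord_space (string_dim i l j) :: 'k kvec set))"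
    by (intro finite_PiE) (auto simp: vertices_def)
qed

section \<open>Lower parts, lifts and generators\<close>

locale string_step =
  fixes n i l :: nat and ty :: "'k::{field,finite} itself"
  assumes n2: "n \<ge> 2" and i: "1 \<le> i" "i < 2 * n"
begin

abbreviation "d \<equiv> string_dim i l"
abbreviation "D j \<equiv> coord_space (d j) :: 'k kvec set"
abbreviation "D' j \<equiv> coord_space (Suc (d j)) :: 'k kvec set"

lemma string_dim_Suc: "string_dim i (Suc l) j = Suc (d j)"
  by (simp add: string_dim_def)

definition active :: "(nat \<Rightarrow> 'k kvec set) \<Rightarrow> nat \<Rightarrow> bool" where
  "active N j \<longleftrightarrow> (\<exists>x\<in>N j. x [0] \<noteq> 0)"

text \<open>Here \<open>s\<close> is the first vertex with a nonzero constant term, and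
  \<open>s = Suc (2 * n)\<close> means that there is none. The active vertices form a final segment
  because the arrows of the path are inclusions.\<close>

definition level :: "(nat \<Rightarrow> int) \<Rightarrow> nat \<Rightarrow> (nat \<Rightarrow> 'k kvec set) set" where
  "level e s = {N \<in> Gr n (string_rep n i (Suc l)) e. \<forall>j\<in>vertices n. active N j \<longleftrightarrow> s \<le> j}"

definition lower :: "(nat \<Rightarrow> 'k kvec set) \<Rightarrow> nat \<Rightarrow> 'k kvec set" where
  "lower N = (\<lambda>j\<in>vertices n. {u \<in> D j. shift u \<in> N j})"

text \<open>The subrepresentation spanned by the multiples x A and, from the vertex \<open>s\<close>
  on, by \<open>w\<close>. The condition on \<open>c\<close> lets one formula cover the vertices on
  both sides of \<open>s\<close>.\<close>

definition lift :: "nat \<Rightarrow> (nat \<Rightarrow> 'k kvec set) \<Rightarrow> 'k kvec \<Rightarrow> nat \<Rightarrow> 'k kvec set" where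
  "lift s A w = (\<lambda>j\<in>vertices n. {x. \<exists>u\<in>A j. \<exists>c. x = shift u + kscale c w \<and> (c \<noteq> 0 \<longrightarrow> s \<le> j)})"

text \<open>The constant term is normalised to 1. For \<open>s = 1\<close> the long arrow sends
  \<open>w\<close> to \<open>shift w\<close> at the vertex 2n, whose constant term is 0, so
  \<open>w\<close> itself must belong to the lower part there.\<close>

definition generators :: "nat \<Rightarrow> (nat \<Rightarrow> 'k kvec set) \<Rightarrow> 'k kvec set" where
  "generators s A = {w \<in> D' s. w [0] = 1 \<and> (s = 1 \<longrightarrow> w \<in> A (2 * n))}"

lemma Gr_D:
  fixes N :: "nat \<Rightarrow> 'k kvec set"
  assumes "N \<in> Gr n (string_rep n i m) e"
  shows "j \<in> vertices n \<Longrightarrow> kv.subspace (N j)" "j \<in> vertices n \<Longrightarrow> N j \<subseteq> coord_space (string_dim i m j)"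
    "j \<in> vertices n \<Longrightarrow> int (kv.dim (N j)) = e j" "x \<in> N 1 \<Longrightarrow> shift x \<in> N (2 * n)"
    "N \<in> extensional (vertices n)"
  using assms unfolding Gr_string_rep_iff[OF n2] by blast+

lemma Gr_mono:
  fixes N :: "nat \<Rightarrow> 'k kvec set"
  assumes N: "N \<in> Gr n (string_rep n i m) e" and j: "1 \<le> j" "j \<le> j'" "j' \<le> 2 * n"
  shows "N j \<subseteq> N j'"
  using j(2,3)
proof (induction j' rule: dec_induct)
  case (step m)
  then have "N m \<subseteq> N (Suc m)" using N j(1) unfolding Gr_string_rep_iff[OF n2] by auto
  then show ?case using step by auto
qed simp

lemma card_constant_one:
  assumes "kv.subspace S" "finite S" "x \<in> S" "x [0] \<noteq> (0::'k)"
  shows "card {x \<in> S. x [0] = 1} * CARD('k) = card S" "card {x \<in> S. x [0] = 0} * CARD('k) = card S"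
  using card_functional_fibre[where f = "\<lambda>x. x [0]", OF assms(1,2) _ _ assms(3,4)]
  by (simp_all add: kscale_apply)

lemma D_subspace: "kv.subspace (D j)" and D_finite: "finite (D j)" by simp_all

lemma shift_linear_on: "linear_on (D j) (D' j) shift"
  by (simp add: linear_on_def shift_add shift_scale shift_coord_space Pi_iff)

lemma shift_image_subspace: "kv.subspace S \<Longrightarrow> S \<subseteq> D j \<Longrightarrow> kv.subspace (shift ` S)"
  by (rule linear_on_image_subspace[OF shift_linear_on _ _ D_subspace])

lemma inj_on_shift: "S \<subseteq> D j \<Longrightarrow> inj_on shift S"
  by (rule inj_onI) (meson shift_inj subsetD)

lemma shift_lower:
  assumes N: "N \<in> Gr n (string_rep n i (Suc l)) e" and j: "j \<in> vertices n"
  shows "shift ` lower N j = {x \<in> N j. x [0] = 0}"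
proof (intro equalityI subsetI)
  fix x assume x: "x \<in> {x \<in> N j. x [0] = 0}"
  then have "x \<in> D' j" using Gr_D(2)[OF N j] string_dim_Suc by auto
  then have "unshift x \<in> D j" "shift (unshift x) = x"
    using unshift_coord_space[of x "Suc (d j)"] shift_unshift x by auto
  then show "x \<in> shift ` lower N j" using x j unfolding lower_def
    by (intro image_eqI[of _ _ "unshift x"]) auto
qed (use j in \<open>auto simp: lower_def\<close>)

lemma lower_subspace:
  assumes N: "N \<in> Gr n (string_rep n i (Suc l)) e" and j: "j \<in> vertices n"
  shows "kv.subspace (lower N j)"
  using linear_on_vimage_subspace[OF shift_linear_on Gr_D(1)[OF N j] D_subspace] j
  by (simp add: lower_def)

text \<open>Multiples of x in \<open>N j\<close> are the kernel of the constant term, hence of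
  codimension 1 at the active vertices and everything elsewhere; the lower part is their quotient by
  x.\<close>

lemma lower_in_Gr:
  assumes N: "N \<in> level e s"
  shows "lower N \<in> Gr n (string_rep n i l) (e - tail_vec n s)"
proof -
  have G: "N \<in> Gr n (string_rep n i (Suc l)) e" and act: "\<And>j. j \<in> vertices n \<Longrightarrow> active N j \<longleftrightarrow> s \<le> j"
    using N by (auto simp: level_def)
  have dim: "int (kv.dim (lower N j)) = e j - tail_vec n s j" if j: "j \<in> vertices n" for j
  proof -
    have fN: "finite (N j)" using Gr_D(2)[OF G j] finite_subset by fastforce
    have low: "lower N j \<subseteq> D j" using j by (auto simp: lower_def)
    have c: "card (lower N j) = card {x \<in> N j. x [0] = 0}"
      unfolding shift_lower[OF G j, symmetric] by (rule card_image[OF inj_on_shift[OF low], symmetric])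
    have cl: "card (lower N j) = CARD('k) ^ kv.dim (lower N j)"
      by (rule card_subspace[OF lower_subspace[OF G j] finite_subset[OF low]]) simp
    have cN: "card (N j) = CARD('k) ^ kv.dim (N j)" by (rule card_subspace[OF Gr_D(1)[OF G j] fN])
    show ?thesis
    proof (cases "s \<le> j")
      case True
      then obtain x where "x \<in> N j" "x [0] \<noteq> 0" using act[OF j] by (auto simp: active_def)
      from card_constant_one(2)[OF Gr_D(1)[OF G j] fN this]
      have "CARD('k) ^ Suc (kv.dim (lower N j)) = CARD('k) ^ kv.dim (N j)"
        using c cl cN by (simp add: mult.commute)
      then have "Suc (kv.dim (lower N j)) = kv.dim (N j)" unfolding card_field_power_eq_iff .
      then show ?thesis using True j Gr_D(3)[OF G j] by (simp add: tail_vec_def)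
    next
      case False
      then have "{x \<in> N j. x [0] = 0} = N j" using act[OF j] by (auto simp: active_def)
      then have "CARD('k) ^ kv.dim (lower N j) = CARD('k) ^ kv.dim (N j)" using c cl cN by simp
      then have "kv.dim (lower N j) = kv.dim (N j)" unfolding card_field_power_eq_iff .
      then show ?thesis using False Gr_D(3)[OF G j] by (simp add: tail_vec_def)
    qed
  qed
  have mono: "lower N j \<subseteq> lower N (Suc j)" if j: "1 \<le> j" "j < 2 * n" for j
  proof -
    have "N j \<subseteq> N (Suc j)" using Gr_mono[OF G, of j "Suc j"] j by simp
    moreover have "D j \<subseteq> D (Suc j)" by (rule coord_space_mono) (simp add: string_dim_def)
    ultimately show ?thesis using j by (auto simp: lower_def)
  qed
  have "shift ` lower N 1 \<subseteq> lower N (2 * n)"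
  proof
    fix x assume "x \<in> shift ` lower N 1"
    then obtain u where u: "u \<in> D 1" "shift u \<in> N 1" "x = shift u" using n2 by (auto simp: lower_def)
    have "shift u \<in> D (2 * n)" using shift_coord_space[OF u(1)] i by (simp add: string_dim_def)
    then show "x \<in> lower N (2 * n)" using Gr_D(4)[OF G u(2)] u(3) n2 by (simp add: lower_def)
  qed
  then show ?thesis
    using dim mono lower_subspace[OF G] unfolding Gr_string_rep_iff[OF n2]
    by (auto simp: lower_def)
qed

lemma lift_eq:
  assumes A: "A \<in> Gr n (string_rep n i l) a" and j: "j \<in> vertices n"
  shows "\<not> s \<le> j \<Longrightarrow> lift s A w j = shift ` A j"
    and "s \<le> j \<Longrightarrow> lift s A w j = {x + y |x y. x \<in> shift ` A j \<and> y \<in> range (\<lambda>c. kscale c w)}"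
  using j by (auto simp: lift_def)

lemma range_scale_subspace: "kv.subspace (range (\<lambda>c. kscale c (w :: 'k kvec)))"
  using kv.subspace_span[of "{w}"] unfolding kv.span_singleton .

text \<open>The premise on \<open>w\<close> is conditional so that the case
  \<open>s = Suc (2 * n)\<close>, in which no generator is chosen, is covered too.\<close>

lemma lift_in_level:
  assumes A: "A \<in> Gr n (string_rep n i l) a" and s: "1 \<le> s"
    and w: "s \<le> 2 * n \<Longrightarrow> w \<in> generators s A"
  shows "lift s A w \<in> level (a + tail_vec n s) s" "lower (lift s A w) = A"
    "s \<le> 2 * n \<Longrightarrow> w \<in> lift s A w s"
proof -
  let ?U = "lift s A w"
  have subA: "kv.subspace (shift ` A j)" if j: "j \<in> vertices n" for j
    using shift_image_subspace[OF Gr_D(1)[OF A j]] Gr_D(2)[OF A j] .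
  have subU: "kv.subspace (?U j)" if j: "j \<in> vertices n" for j
    using lift_eq[OF A j] subA[OF j] kv.subspace_sums[OF subA[OF j] range_scale_subspace]
    by (cases "s \<le> j") simp_all
  have sA: "shift ` A j \<subseteq> ?U j" if j: "j \<in> vertices n" for j
  proof
    fix x assume "x \<in> shift ` A j"
    then obtain u where "u \<in> A j" "x = shift u + kscale 0 w" by auto
    then have "\<exists>u\<in>A j. \<exists>c. x = shift u + kscale c w \<and> (c \<noteq> 0 \<longrightarrow> s \<le> j)" by blast
    then show "x \<in> ?U j" using j by (simp add: lift_def)
  qed
  have U_D: "?U j \<subseteq> D' j" if j: "j \<in> vertices n" for j
  proof
    fix x assume "x \<in> ?U j"
    then obtain u c where u: "u \<in> A j" "x = shift u + kscale c w" "c \<noteq> 0 \<longrightarrow> s \<le> j"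
      using j by (auto simp: lift_def)
    have "shift u \<in> D' j" using Gr_D(2)[OF A j] u(1) shift_coord_space by blast
    moreover have "kscale c w \<in> D' j"
    proof (cases "c = 0")
      case True
      then show ?thesis using kv.subspace_0[of "D' j"] by simp
    next
      case False
      then have "s \<le> j" using u by simp
      then have "w \<in> D' s" using w j by (simp add: generators_def)
      moreover have "D' s \<subseteq> D' j"
        using \<open>s \<le> j\<close> by (intro coord_space_mono) (simp add: string_dim_def)
      ultimately show ?thesis using kv.subspace_scale[of "D' j"] by auto
    qed
    ultimately show "x \<in> D' j" using u(2) kv.subspace_add[of "D' j"] by simp
  qed
  have U0: "{x \<in> ?U j. x [0] = 0} = shift ` A j" if j: "j \<in> vertices n" for j
  proof (intro equalityI subsetI)
    fix x assume x: "x \<in> {x \<in> ?U j. x [0] = 0}"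
    then obtain u c where u: "u \<in> A j" "x = shift u + kscale c w" "c \<noteq> 0 \<longrightarrow> s \<le> j"
      using j by (auto simp: lift_def)
    have "c = 0"
    proof (rule ccontr)
      assume "c \<noteq> 0"
      then have "w [0] = 1" using w u(3) j by (simp add: generators_def)
      then have "x [0] = c" using u(2) by (simp add: kscale_apply)
      then show False using x \<open>c \<noteq> 0\<close> by simp
    qed
    then show "x \<in> shift ` A j" using u by simp
  next
    fix x assume "x \<in> shift ` A j"
    then show "x \<in> {x \<in> ?U j. x [0] = 0}" using sA[OF j] by auto
  qed
  have w_in: "w \<in> ?U j" if j: "j \<in> vertices n" "s \<le> j" for j
  proof -
    have "0 \<in> A j" using kv.subspace_0[OF Gr_D(1)[OF A j(1)]] .
    moreover have "shift 0 = (0 :: 'k kvec)" using shift_scale[of 0 0] by simp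
    ultimately have "\<exists>u\<in>A j. \<exists>c. w = shift u + kscale c w \<and> (c \<noteq> 0 \<longrightarrow> s \<le> j)"
      using j by (intro bexI[of _ 0] exI[of _ 1]) auto
    then show ?thesis using j by (simp add: lift_def)
  qed
  have act: "active ?U j \<longleftrightarrow> s \<le> j" if j: "j \<in> vertices n" for j
  proof
    assume "s \<le> j"
    then have "w [0] = 1" using w j by (simp add: generators_def)
    then show "active ?U j" using w_in[OF j \<open>s \<le> j\<close>] unfolding active_def by (metis zero_neq_one)
  next
    assume "active ?U j"
    then obtain x where "x \<in> ?U j" "x [0] \<noteq> 0" by (auto simp: active_def)
    then show "s \<le> j" using lift_eq(1)[OF A j, of s w] by fastforce
  qed
  have dim: "int (kv.dim (?U j)) = a j + tail_vec n s j" if j: "j \<in> vertices n" for j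
  proof -
    have fU: "finite (?U j)" using U_D[OF j] finite_subset by fastforce
    have fA: "finite (A j)" using Gr_D(2)[OF A j] finite_subset by fastforce
    have c: "card {x \<in> ?U j. x [0] = 0} = CARD('k) ^ kv.dim (A j)"
      unfolding U0[OF j] card_image[OF inj_on_shift[OF Gr_D(2)[OF A j]]]
      by (rule card_subspace[OF Gr_D(1)[OF A j] fA])
    have cU: "card (?U j) = CARD('k) ^ kv.dim (?U j)" by (rule card_subspace[OF subU[OF j] fU])
    show ?thesis
    proof (cases "s \<le> j")
      case True
      then obtain x where "x \<in> ?U j" "x [0] \<noteq> 0" using act[OF j] by (auto simp: active_def)
      from card_constant_one(2)[OF subU[OF j] fU this]
      have "CARD('k) ^ Suc (kv.dim (A j)) = CARD('k) ^ kv.dim (?U j)"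
        using c cU by (simp add: mult.commute)
      then have "Suc (kv.dim (A j)) = kv.dim (?U j)" unfolding card_field_power_eq_iff .
      then show ?thesis using True j Gr_D(3)[OF A j] by (simp add: tail_vec_def)
    next
      case False
      then have "{x \<in> ?U j. x [0] = 0} = ?U j" using act[OF j] by (auto simp: active_def)
      then have "CARD('k) ^ kv.dim (A j) = CARD('k) ^ kv.dim (?U j)" using c cU by simp
      then have "kv.dim (A j) = kv.dim (?U j)" unfolding card_field_power_eq_iff .
      then show ?thesis using False Gr_D(3)[OF A j] by (simp add: tail_vec_def)
    qed
  qed
  have mono: "?U j \<subseteq> ?U (Suc j)" if j: "1 \<le> j" "j < 2 * n" for j
  proof
    fix x assume "x \<in> ?U j"
    then obtain u c where u: "u \<in> A j" "x = shift u + kscale c w" "c \<noteq> 0 \<longrightarrow> s \<le> j"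
      using j by (auto simp: lift_def)
    moreover have "u \<in> A (Suc j)" using Gr_mono[OF A, of j "Suc j"] u(1) j by auto
    moreover have "c \<noteq> 0 \<longrightarrow> s \<le> Suc j" using u(3) by auto
    ultimately have "\<exists>u\<in>A (Suc j). \<exists>c. x = shift u + kscale c w \<and> (c \<noteq> 0 \<longrightarrow> s \<le> Suc j)" by blast
    then show "x \<in> ?U (Suc j)" using j by (simp add: lift_def)
  qed
  have sh: "shift ` ?U 1 \<subseteq> ?U (2 * n)"
  proof
    have v: "1 \<in> vertices n" "2 * n \<in> vertices n" using n2 by auto
    fix y assume "y \<in> shift ` ?U 1"
    then obtain x where x: "x \<in> ?U 1" "y = shift x" by auto
    then obtain u c where u: "u \<in> A 1" "x = shift u + kscale c w" "c \<noteq> 0 \<longrightarrow> s \<le> 1"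
      using v by (auto simp: lift_def)
    have sub: "kv.subspace (A (2 * n))" by (rule Gr_D(1)[OF A v(2)])
    \<comment> \<open>A nonzero \<open>c\<close> forces \<open>s = 1\<close>, and then the
      definition of a generator places \<open>w\<close> in \<open>A (2 * n)\<close>.\<close>
    have "kscale c w \<in> A (2 * n)"
    proof (cases "c = 0")
      case True
      then show ?thesis using kv.subspace_0[OF sub] by simp
    next
      case False
      then have "w \<in> A (2 * n)" using u(3) s w n2 by (auto simp: generators_def)
      then show ?thesis by (rule kv.subspace_scale[OF sub])
    qed
    then have "x \<in> A (2 * n)" unfolding u(2) by (rule kv.subspace_add[OF sub Gr_D(4)[OF A u(1)]])
    then show "y \<in> ?U (2 * n)" using sA[OF v(2)] x(2) by blast
  qed
  have "?U \<in> Gr n (string_rep n i (Suc l)) (a + tail_vec n s)"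
    unfolding Gr_string_rep_iff[OF n2] string_dim_Suc using subU U_D dim mono sh
    by (auto simp: lift_def)
  then show "?U \<in> level (a + tail_vec n s) s" using act by (simp add: level_def)
  show "lower ?U = A"
  proof
    fix j
    show "lower ?U j = A j"
    proof (cases "j \<in> vertices n")
      case True
      have "{u \<in> D j. shift u \<in> ?U j} = A j"
      proof (intro equalityI subsetI)
        fix u assume u: "u \<in> {u \<in> D j. shift u \<in> ?U j}"
        then have "shift u \<in> shift ` A j" using U0[OF True] by auto
        then show "u \<in> A j" using u Gr_D(2)[OF A True] shift_inj by blast
      next
        fix u assume "u \<in> A j"
        then show "u \<in> {u \<in> D j. shift u \<in> ?U j}" using Gr_D(2)[OF A True] sA[OF True] by auto
      qed
      then show ?thesis using True by (simp add: lower_def)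
    next
      case False
      then show ?thesis using False extensional_arb[OF Gr_D(5)[OF A] False] by (simp add: lower_def del: vertices_iff)
    qed
  qed
  show "w \<in> ?U s" if "s \<le> 2 * n" using w_in[of s] that s by simp
qed

text \<open>Subtracting the multiple of \<open>w\<close> with the same constant term leaves a
  multiple of x, which the lower part already records. Hence a subrepresentation is recovered from
  its lower part and any one generator.\<close>

lemma lift_lower:
  assumes N: "N \<in> level e s" and s: "1 \<le> s" and w: "s \<le> 2 * n \<Longrightarrow> w \<in> N s \<and> w [0] = 1"
  shows "s \<le> 2 * n \<Longrightarrow> w \<in> generators s (lower N)" "N = lift s (lower N) w"
proof -
  have G: "N \<in> Gr n (string_rep n i (Suc l)) e" and act: "\<And>j. j \<in> vertices n \<Longrightarrow> active N j \<longleftrightarrow> s \<le> j"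
    using N by (auto simp: level_def)
  show "w \<in> generators s (lower N)" if s2: "s \<le> 2 * n"
  proof -
    have wN: "w \<in> N s" "w [0] = 1" using w[OF s2] by auto
    have wD: "w \<in> D' s" using Gr_D(2)[OF G, of s] wN s s2 string_dim_Suc by auto
    moreover have "w \<in> lower N (2 * n)" if "s = 1"
    proof -
      have "shift w \<in> N (2 * n)" using Gr_D(4)[OF G] wN that by simp
      moreover have "w \<in> D (2 * n)" using wD that i by (simp add: string_dim_def)
      ultimately show ?thesis using n2 by (simp add: lower_def)
    qed
    ultimately show ?thesis using wN by (simp add: generators_def)
  qed
  have A: "lower N \<in> Gr n (string_rep n i l) (e - tail_vec n s)" by (rule lower_in_Gr[OF N])
  show "N = lift s (lower N) w"
  proof
    fix j
    show "N j = lift s (lower N) w j"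
    proof (cases "j \<in> vertices n")
      case False
      then show ?thesis using False extensional_arb[OF Gr_D(5)[OF G] False] by (simp add: lift_def del: vertices_iff)
    next
      case j: True
      show ?thesis
      proof (cases "s \<le> j")
        case False
        then have "N j = {x \<in> N j. x [0] = 0}" using act[OF j] by (auto simp: active_def)
        then show ?thesis unfolding lift_eq(1)[OF A j False] shift_lower[OF G j] .
      next
        case True
        then have wN: "w \<in> N j" "w [0] = 1" using w Gr_mono[OF G s True] j by auto
        have sub: "kv.subspace (N j)" by (rule Gr_D(1)[OF G j])
        show ?thesis unfolding lift_eq(2)[OF A j True] shift_lower[OF G j]
        proof (intro equalityI subsetI)
          fix x assume x: "x \<in> N j"
          have "x - kscale (x [0]) w \<in> N j"
            by (rule kv.subspace_diff[OF sub x kv.subspace_scale[OF sub wN(1)]])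
          moreover have "(x - kscale (x [0]) w) [0] = 0" using wN(2) by (simp add: kscale_apply)
          ultimately have "x - kscale (x [0]) w \<in> {x \<in> N j. x [0] = 0}" by simp
          then show "x \<in> {x + y |x y. x \<in> {x \<in> N j. x [0] = 0} \<and> y \<in> range (\<lambda>c. kscale c w)}"
            by (intro CollectI exI[of _ "x - kscale (x [0]) w"] exI[of _ "kscale (x [0]) w"] conjI rangeI)
               simp_all
        next
          fix x assume "x \<in> {x + y |x y. x \<in> {x \<in> N j. x [0] = 0} \<and> y \<in> range (\<lambda>c. kscale c w)}"
          then show "x \<in> N j" using kv.subspace_add[OF sub] kv.subspace_scale[OF sub wN(1)] by blast
        qed
      qed
    qed
  qed
qed

section \<open>Counting the levels\<close>

lemma finite_level: "finite (level e s)"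
  unfolding level_def by (rule finite_subset[OF _ finite_Gr_string_rep[OF n2]]) blast

text \<open>A generator determines the subrepresentation with given lower part that contains it, and
  each such subrepresentation contains \<open>CARD('k) ^ dim (A s)\<close> generators.\<close>

lemma card_level_fibre:
  assumes A: "A \<in> Gr n (string_rep n i l) (e - tail_vec n s)" and s: "1 \<le> s" "s \<le> 2 * n"
  shows "card {N \<in> level e s. lower N = A} * CARD('k) ^ kv.dim (A s) = card (generators s A)"
proof -
  let ?F = "{N \<in> level e s. lower N = A}"
  let ?g = "\<lambda>N :: nat \<Rightarrow> 'k kvec set. {w \<in> N s. w [0] = 1}"
  have sv: "s \<in> vertices n" using s by simp
  have ee: "e - tail_vec n s + tail_vec n s = e" by simp
  have un: "generators s A = (\<Union>N\<in>?F. ?g N)"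
  proof (intro equalityI subsetI)
    fix w assume w: "w \<in> generators s A"
    have "lift s A w \<in> ?F" "w \<in> lift s A w s"
      using lift_in_level[OF A s(1) w] s(2) unfolding ee by auto
    then show "w \<in> (\<Union>N\<in>?F. ?g N)" using w by (auto simp: generators_def)
  next
    fix w assume "w \<in> (\<Union>N\<in>?F. ?g N)"
    then show "w \<in> generators s A" using lift_lower(1)[OF _ s(1)] s(2) by auto
  qed
  have c: "card (?g N) = CARD('k) ^ kv.dim (A s)" if N: "N \<in> ?F" for N
  proof -
    have G: "N \<in> Gr n (string_rep n i (Suc l)) e" and act: "active N s"
      using N sv by (auto simp: level_def)
    have fN: "finite (N s)" using Gr_D(2)[OF G sv] finite_subset by fastforce
    obtain x where x: "x \<in> N s" "x [0] \<noteq> 0" using act by (auto simp: active_def)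
    have "card (?g N) * CARD('k) = CARD('k) ^ kv.dim (N s)"
      using card_constant_one(1)[OF Gr_D(1)[OF G sv] fN x] card_subspace[OF Gr_D(1)[OF G sv] fN] by simp
    moreover have "int (kv.dim (A s)) = int (kv.dim (N s)) - 1"
      using Gr_D(3)[OF A sv] Gr_D(3)[OF G sv] sv by (simp add: tail_vec_def)
    then have "kv.dim (N s) = Suc (kv.dim (A s))" by simp
    ultimately show ?thesis by simp
  qed
  have disj: "?g N \<inter> ?g N' = {}" if "N \<in> ?F" "N' \<in> ?F" "N \<noteq> N'" for N N'
  proof (rule ccontr)
    assume "?g N \<inter> ?g N' \<noteq> {}"
    then obtain w where "w \<in> N s" "w \<in> N' s" "w [0] = 1" by auto
    then have "N = lift s A w" "N' = lift s A w"
      using lift_lower(2)[OF _ s(1), of N e w] lift_lower(2)[OF _ s(1), of N' e w] that by auto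
    then show False using that(3) by simp
  qed
  have fin: "finite (?g N)" if "N \<in> ?F" for N
  proof -
    have "N \<in> Gr n (string_rep n i (Suc l)) e" using that by (simp add: level_def)
    then have "finite (N s)" using Gr_D(2)[of N "Suc l" e s] sv finite_subset by fastforce
    then show ?thesis by simp
  qed
  have "card (\<Union>N\<in>?F. ?g N) = (\<Sum>N\<in>?F. card (?g N))"
    using finite_level fin disj by (intro card_UN_disjoint) auto
  also have "\<dots> = (\<Sum>N\<in>?F. CARD('k) ^ kv.dim (A s))" by (rule sum.cong[OF refl c])
  finally show ?thesis unfolding un by simp
qed

text \<open>The quotient stays under the sum because for \<open>s = 1\<close> the number of
  generators depends on \<open>A\<close>.\<close>

lemma card_level:
  assumes s: "1 \<le> s" "s \<le> 2 * n"
  shows "real (card (level e s)) = (\<Sum>A\<in>Gr n (string_rep n i l) (e - tail_vec n s).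
    real (card (generators s A)) / real CARD('k) ^ kv.dim (A s))"
proof -
  let ?G = "Gr n (string_rep n i l) (e - tail_vec n s) :: (nat \<Rightarrow> 'k kvec set) set"
  have "level e s = (\<Union>A\<in>?G. {N \<in> level e s. lower N = A})" using lower_in_Gr by blast
  then have "card (level e s) = card (\<Union>A\<in>?G. {N \<in> level e s. lower N = A})" by simp
  also have "\<dots> = (\<Sum>A\<in>?G. card {N \<in> level e s. lower N = A})"
    using finite_level finite_Gr_string_rep[OF n2] by (intro card_UN_disjoint) auto
  finally have "real (card (level e s)) = (\<Sum>A\<in>?G. real (card {N \<in> level e s. lower N = A}))" by simp
  also have "\<dots> = (\<Sum>A\<in>?G. real (card (generators s A)) / real CARD('k) ^ kv.dim (A s))"
  proof (rule sum.cong[OF refl])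
    fix A assume "A \<in> ?G"
    from arg_cong[OF card_level_fibre[OF this s], of real]
    show "real (card {N \<in> level e s. lower N = A}) = real (card (generators s A)) / real CARD('k) ^ kv.dim (A s)"
      using card_field_ge_2[where ?'k='k] by (simp add: field_simps)
  qed
  finally show ?thesis .
qed

text \<open>Without an active vertex nothing has to be chosen; the vector 0 passed to
  \<open>lift\<close> is a dummy value.\<close>

lemma card_level_top: "card (level e (Suc (2 * n))) = card (Gr n (string_rep n i l :: 'k rep) e)"
proof -
  have t: "tail_vec n (Suc (2 * n)) = 0" by (auto simp: tail_vec_def fun_eq_iff)
  have "bij_betw lower (level e (Suc (2 * n))) (Gr n (string_rep n i l) e)"
  proof (rule bij_betw_byWitness[where f' = "\<lambda>A. lift (Suc (2 * n)) A 0"])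
    show "\<forall>N\<in>level e (Suc (2 * n)). lift (Suc (2 * n)) (lower N) 0 = N"
      using lift_lower(2)[of _ e "Suc (2 * n)" 0] by simp
    show "\<forall>A\<in>Gr n (string_rep n i l) e. lower (lift (Suc (2 * n)) A 0) = A"
      using lift_in_level(2)[of _ e "Suc (2 * n)" 0] by simp
    show "lower ` level e (Suc (2 * n)) \<subseteq> Gr n (string_rep n i l) e"
      using lower_in_Gr[of _ e "Suc (2 * n)"] t by auto
    show "(\<lambda>A. lift (Suc (2 * n)) A 0) ` Gr n (string_rep n i l) e \<subseteq> level e (Suc (2 * n))"
      using lift_in_level(1)[of _ e "Suc (2 * n)" 0] t by auto
  qed
  then show ?thesis by (rule bij_betw_same_card)
qed

lemma Gr_eq_Union_level: "Gr n (string_rep n i (Suc l)) e = (\<Union>s\<in>{1..Suc (2 * n)}. level e s)"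
proof (intro equalityI subsetI)
  fix N :: "nat \<Rightarrow> 'k kvec set" assume N: "N \<in> Gr n (string_rep n i (Suc l)) e"
  \<comment> \<open>Admitting \<open>Suc (2 * n)\<close> guarantees that a least element exists when
    no vertex is active.\<close>
  define s where "s = (LEAST s. 1 \<le> s \<and> (s = Suc (2 * n) \<or> active N s))"
  have P: "1 \<le> s \<and> (s = Suc (2 * n) \<or> active N s)"
    unfolding s_def by (rule LeastI[of _ "Suc (2 * n)"]) simp
  have le: "s \<le> t" if "1 \<le> t" "t = Suc (2 * n) \<or> active N t" for t
    unfolding s_def by (rule Least_le) (use that in simp)
  have "active N j \<longleftrightarrow> s \<le> j" if j: "j \<in> vertices n" for j
  proof
    assume "s \<le> j"
    then have "active N s" using P j by auto
    then show "active N j" using Gr_mono[OF N, of s j] P \<open>s \<le> j\<close> j unfolding active_def by auto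
  qed (use le j in auto)
  then have "N \<in> level e s" using N by (simp add: level_def)
  moreover have "s \<in> {1..Suc (2 * n)}" using P le[of "Suc (2 * n)"] by simp
  ultimately show "N \<in> (\<Union>s\<in>{1..Suc (2 * n)}. level e s)" by blast
qed (auto simp: level_def)

lemma card_Gr_eq_sum_level:
  "card (Gr n (string_rep n i (Suc l) :: 'k rep) e) = (\<Sum>s\<in>{1..Suc (2 * n)}. card (level e s))"
  unfolding Gr_eq_Union_level
proof (rule card_UN_disjoint)
  show "\<forall>s\<in>{1..Suc (2 * n)}. \<forall>t\<in>{1..Suc (2 * n)}. s \<noteq> t \<longrightarrow> level e s \<inter> level e t = {}"
  proof (intro ballI impI)
    fix s t :: nat assume s: "s \<in> {1..Suc (2 * n)}" and t: "t \<in> {1..Suc (2 * n)}" and st: "s \<noteq> t"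
    have m: "min s t \<in> vertices n" using s t st by (auto simp: min_def)
    have "\<not> (s \<le> min s t \<longleftrightarrow> t \<le> min s t)" using st by auto
    then show "level e s \<inter> level e t = {}" using m unfolding level_def by blast
  qed
qed (auto simp: finite_level)

lemma card_generators:
  assumes "2 \<le> s" shows "card (generators s A) = CARD('k) ^ d s"
proof -
  have "generators s A = {w \<in> D' s. w [0] = 1}" using assms by (auto simp: generators_def)
  moreover have "(\<lambda>p. if p = [0] then 1 else 0) \<in> D' s" by (simp add: coord_space_iff)
  then have "card {w \<in> D' s. w [0] = 1} * CARD('k) = CARD('k) ^ Suc (d s)"
    unfolding card_coord_space[symmetric] by (rule card_constant_one(1)[rotated 2]) simp_all
  ultimately show ?thesis by simp
qed

lemma card_generators_1:
  assumes A: "A \<in> Gr n (string_rep n i l) a"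
  shows "real (card (generators 1 A)) =
    (if active A (2 * n) then real CARD('k) ^ kv.dim (A (2 * n)) / real CARD('k) else 0)"
proof -
  have v: "2 * n \<in> vertices n" using n2 by simp
  \<comment> \<open>The degree bound for a generator at the vertex 1 coincides with the bound for
    \<open>A (2 * n)\<close>, so the generators are exactly the elements of \<open>A (2 * n)\<close>
    with constant term 1.\<close>
  have "d (2 * n) = Suc (d 1)" using i by (simp add: string_dim_def)
  then have AD: "A (2 * n) \<subseteq> D' 1" using Gr_D(2)[OF A v] by simp
  then have g: "generators 1 A = {w \<in> A (2 * n). w [0] = 1}" by (auto simp: generators_def)
  have fin: "finite (A (2 * n))" using AD finite_subset by fastforce
  show ?thesis
  proof (cases "active A (2 * n)")
    case True
    then obtain x where "x \<in> A (2 * n)" "x [0] \<noteq> 0" by (auto simp: active_def)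
    from card_constant_one(1)[OF Gr_D(1)[OF A v] fin this]
    have "card (generators 1 A) * CARD('k) = CARD('k) ^ kv.dim (A (2 * n))"
      unfolding g card_subspace[OF Gr_D(1)[OF A v] fin] .
    from arg_cong[OF this, of real]
    have "real (card (generators 1 A)) * real CARD('k) = real CARD('k) ^ kv.dim (A (2 * n))" by simp
    then show ?thesis using True card_field_ge_2[where ?'k='k] by (simp add: field_simps)
  next
    case False
    then have "generators 1 A = {}" unfolding g by (auto simp: active_def)
    then show ?thesis using False by simp
  qed
qed

text \<open>The number of subrepresentations of M(l-1), where M(-1) is read as the zero
  representation; that value leads to the initial variable X_i in the recursion.\<close>

definition lower_count :: "(nat \<Rightarrow> int) \<Rightarrow> real" where
  "lower_count a = (if l = 0 then (if \<forall>j\<in>vertices n. a j = 0 then 1 else 0)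
     else string_count ty n i (l - 1) a)"

lemma inactive_iff:
  assumes A: "A \<in> Gr n (string_rep n i m) a"
  shows "\<not> active A (2 * n) \<longleftrightarrow> (\<forall>j\<in>vertices n. \<not> active A j)"
proof
  assume *: "\<not> active A (2 * n)"
  show "\<forall>j\<in>vertices n. \<not> active A j"
  proof
    fix j assume "j \<in> vertices n"
    then have "A j \<subseteq> A (2 * n)" using Gr_mono[OF A, of j "2 * n"] by simp
    then show "\<not> active A j" using * unfolding active_def by blast
  qed
qed (use n2 in simp)

text \<open>For positive \<open>l\<close> these subrepresentations form the top level of the
  preceding step, that is, they are x times subrepresentations of M(l-1). For \<open>l = 0\<close>
  the spaces contain only constants, so the zero subrepresentation alone remains.\<close>

lemma card_inactive:
  "real (card {A \<in> Gr n (string_rep n i l) a. \<not> active A (2 * n)}) = lower_count a"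
proof (cases l)
  case 0
  define Z :: "nat \<Rightarrow> 'k kvec set" where "Z = (\<lambda>j\<in>vertices n. {0})"
  have dz: "kv.dim {0 :: 'k kvec} = 0" by (simp add: dim_zero_subspace_iff)
  have s0: "shift 0 = (0 :: 'k kvec)" using shift_scale[of 0 0] by simp
  have Z: "Z \<in> Gr n (string_rep n i l) a \<longleftrightarrow> (\<forall>j\<in>vertices n. a j = 0)"
  proof -
    have "shift ` Z 1 \<subseteq> Z (2 * n)" using n2 s0 by (simp add: Z_def)
    moreover have "\<forall>j. 1 \<le> j \<and> j < 2 * n \<longrightarrow> Z j \<subseteq> Z (Suc j)" by (simp add: Z_def)
    moreover have "\<forall>j\<in>vertices n. kv.subspace (Z j) \<and> Z j \<subseteq> D j \<and> kv.dim (Z j) = 0"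
      using kv.subspace_0[OF D_subspace] by (simp add: Z_def dz)
    moreover have "Z \<in> extensional (vertices n)" by (simp add: Z_def)
    ultimately show ?thesis unfolding Gr_string_rep_iff[OF n2]
      by (metis of_nat_0)
  qed
  have uniq: "A = Z" if A: "A \<in> Gr n (string_rep n i l) a" and na: "\<not> active A (2 * n)" for A
  proof
    fix j show "A j = Z j"
    proof (cases "j \<in> vertices n")
      case True
      have "x = 0" if x: "x \<in> A j" for x
      proof (rule kvec_eqI)
        have "x \<in> D j" using Gr_D(2)[OF A True] x by blast
        then have xD: "x \<in> coord_space 1"
          using 0 coord_space_mono[of "d j" 1] by (auto simp: string_dim_def split: if_splits)
        have "\<not> active A j" using inactive_iff[OF A] na True by simp
        then have "x [0] = 0" using x by (auto simp: active_def)
        then show "x [t] = 0 [t]" for t using xD by (cases t) (simp_all add: coord_space_iff)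
        show "x [] = 0 []" "x (u # v # p) = 0 (u # v # p)" for u v p using xD by (simp_all add: coord_space_iff)
      qed
      moreover have "0 \<in> A j" by (rule kv.subspace_0[OF Gr_D(1)[OF A True]])
      ultimately show ?thesis using True by (auto simp: Z_def)
    next
      case False
      then show ?thesis using extensional_arb[OF Gr_D(5)[OF A] False] by (simp add: Z_def del: vertices_iff)
    qed
  qed
  have "\<not> active Z (2 * n)" using n2 by (simp add: Z_def active_def)
  then have "{A \<in> Gr n (string_rep n i l) a. \<not> active A (2 * n)} = (if \<forall>j\<in>vertices n. a j = 0 then {Z} else {})"
    using Z uniq by (auto simp del: vertices_iff)
  then show ?thesis unfolding lower_count_def using 0 by (simp del: vertices_iff)
next
  case (Suc l')
  interpret prev: string_step n i l' ty by unfold_locales (use n2 i in auto)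
  have "{A \<in> Gr n (string_rep n i l) a. \<not> active A (2 * n)} = prev.level a (Suc (2 * n))"
  proof (intro equalityI subsetI)
    fix A assume A: "A \<in> {A \<in> Gr n (string_rep n i l) a. \<not> active A (2 * n)}"
    then have "\<forall>j\<in>vertices n. \<not> active A j" using inactive_iff by blast
    then show "A \<in> prev.level a (Suc (2 * n))" using A unfolding prev.level_def Suc by auto
  next
    fix A assume "A \<in> prev.level a (Suc (2 * n))"
    moreover have "2 * n \<in> vertices n" using n2 by simp
    ultimately show "A \<in> {A \<in> Gr n (string_rep n i l) a. \<not> active A (2 * n)}"
      unfolding prev.level_def Suc by (auto simp del: vertices_iff)
  qed
  then show ?thesis unfolding lower_count_def using prev.card_level_top[of a] Suc
    by (simp add: string_count_def)
qed

text \<open>The three summands belong to s = 2n + 1, to 2 \<le> s \<le> 2n and to s = 1. Each power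
  of the order of k is the number of generators divided by the number of them in one
  subrepresentation, where \<open>A s\<close> has dimension \<open>e s - 1\<close>. At s = 1 the
  lower parts without a nonzero constant term admit no generator and are subtracted.\<close>

lemma string_count_Suc:
  "string_count ty n i (Suc l) e = string_count ty n i l e
   + (\<Sum>s\<in>{2..2 * n}. real CARD('k) powr of_int (int (d s) - (e s - 1)) * string_count ty n i l (e - tail_vec n s))
   + real CARD('k) powr of_int (e (2 * n) - e 1 - 1)
     * (string_count ty n i l (e - tail_vec n 1) - lower_count (e - tail_vec n 1))"
proof -
  have Q0: "real CARD('k) > 0" using card_field_ge_2[where ?'k='k] by simp
  have pw: "real CARD('k) ^ m = real CARD('k) powr of_int (int m)" for m
    using Q0 by (simp add: powr_realpow)
  have middle: "real (card (level e s)) =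
      real CARD('k) powr of_int (int (d s) - (e s - 1)) * string_count ty n i l (e - tail_vec n s)"
    if s: "s \<in> {2..2 * n}" for s
  proof -
    have sv: "s \<in> vertices n" using s by simp
    have "real (card (generators s A)) / real CARD('k) ^ kv.dim (A s)
        = real CARD('k) powr of_int (int (d s) - (e s - 1))"
      if A: "A \<in> Gr n (string_rep n i l) (e - tail_vec n s)" for A
    proof -
      have "int (kv.dim (A s)) = e s - 1" using Gr_D(3)[OF A sv] sv by (simp add: tail_vec_def)
      then show ?thesis using s by (simp add: card_generators pw powr_diff del: of_int_of_nat_eq of_int_diff)
          (simp add: powr_diff)
    qed
    then show ?thesis using card_level[of s e] s by (simp add: string_count_def)
  qed
  let ?a = "e - tail_vec n 1"
  let ?G = "Gr n (string_rep n i l) ?a :: (nat \<Rightarrow> 'k kvec set) set"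
  have "real (card (level e 1)) = (\<Sum>A\<in>?G. if active A (2 * n) then real CARD('k) powr of_int (e (2 * n) - e 1 - 1) else 0)"
  proof -
    have v: "1 \<in> vertices n" "2 * n \<in> vertices n" using n2 by auto
    have "real (card (generators 1 A)) / real CARD('k) ^ kv.dim (A 1)
        = (if active A (2 * n) then real CARD('k) powr of_int (e (2 * n) - e 1 - 1) else 0)"
      if A: "A \<in> ?G" for A
    proof -
      have 1: "int (kv.dim (A 1)) = e 1 - 1" and 2: "int (kv.dim (A (2 * n))) = e (2 * n) - 1"
        using Gr_D(3)[OF A] v by (simp_all add: tail_vec_def)
      have "real CARD('k) ^ kv.dim (A (2 * n)) / real CARD('k) / real CARD('k) ^ kv.dim (A 1)
        = real CARD('k) powr (of_int (e (2 * n) - 1) - 1 - of_int (e 1 - 1))"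
        unfolding pw 1 2 using Q0 by (simp add: powr_diff del: of_int_diff)
      also have "(of_int (e (2 * n) - 1) - 1 - of_int (e 1 - 1) :: real) = of_int (e (2 * n) - e 1 - 1)" by simp
      finally show ?thesis using card_generators_1[OF A] by simp
    qed
    then show ?thesis using card_level[of 1 e] n2 by simp
  qed
  also have "\<dots> = real CARD('k) powr of_int (e (2 * n) - e 1 - 1) * real (card {A \<in> ?G. active A (2 * n)})"
    unfolding sum.inter_filter[OF finite_Gr_string_rep[OF n2], symmetric] by (simp add: mult.commute)
  also have "real (card {A \<in> ?G. active A (2 * n)}) = string_count ty n i l ?a - lower_count ?a"
  proof -
    have "?G = {A \<in> ?G. active A (2 * n)} \<union> {A \<in> ?G. \<not> active A (2 * n)}" by blast
    then have "card ?G = card ({A \<in> ?G. active A (2 * n)} \<union> {A \<in> ?G. \<not> active A (2 * n)})" by simp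
    also have "\<dots> = card {A \<in> ?G. active A (2 * n)} + card {A \<in> ?G. \<not> active A (2 * n)}"
      by (intro card_Un_disjoint finite_subset[OF _ finite_Gr_string_rep[OF n2]]) auto
    finally show ?thesis using card_inactive[of ?a] by (simp add: string_count_def)
  qed
  finally have first: "real (card (level e 1)) = real CARD('k) powr of_int (e (2 * n) - e 1 - 1)
     * (string_count ty n i l ?a - lower_count ?a)" .
  have "{1..Suc (2 * n)} = insert 1 (insert (Suc (2 * n)) {2..2 * n})" using n2 by auto
  then have "string_count ty n i (Suc l) e = real (card (level e 1))
      + (real (card (level e (Suc (2 * n)))) + (\<Sum>s\<in>{2..2 * n}. real (card (level e s))))"
    unfolding string_count_def card_Gr_eq_sum_level using n2 by simp
  also have "(\<Sum>s\<in>{2..2 * n}. real (card (level e s))) = (\<Sum>s\<in>{2..2 * n}.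
      real CARD('k) powr of_int (int (d s) - (e s - 1)) * string_count ty n i l (e - tail_vec n s))"
    by (rule sum.cong[OF refl middle])
  finally show ?thesis unfolding first card_level_top by (simp add: string_count_def)
qed

end

section \<open>Duality\<close>

lemma card_direct_sum:
  fixes A B :: "'k::field kvec set"
  assumes A: "kv.subspace A" and B: "kv.subspace B" and int: "A \<inter> B = {0}"
  shows "card {x + y |x y. x \<in> A \<and> y \<in> B} = card A * card B"
proof -
  have "{x + y |x y. x \<in> A \<and> y \<in> B} = (\<lambda>(x, y). x + y) ` (A \<times> B)" by auto
  moreover have "inj_on (\<lambda>(x, y). x + y) (A \<times> B)"
  proof (rule inj_onI, clarify)
    fix x y x' y' assume m: "x \<in> A" "y \<in> B" "x' \<in> A" "y' \<in> B" and eq: "x + y = x' + y'"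
    have "x - x' = y' - y" using eq by (simp add: algebra_simps)
    moreover have "x - x' \<in> A" "y' - y \<in> B" using m kv.subspace_diff A B by blast+
    ultimately have "x - x' \<in> A \<inter> B" by simp
    then have "x - x' = 0" unfolding int by simp
    then show "x = x' \<and> y = y'" using eq by simp
  qed
  ultimately show ?thesis by (simp add: card_image card_cartesian_product)
qed

text \<open>The space \<open>F\<close> stands in for the dual of \<open>S\<close>, because both have
  to be subspaces of the same ambient space. The hypotheses are symmetric, so each result on
  annihilators is available in both directions.\<close>

locale pairing =
  fixes F S :: "'k::{field,finite} kvec set" and p :: "'k kvec \<Rightarrow> 'k kvec \<Rightarrow> 'k"
  assumes F: "kv.subspace F" "finite F" and S: "kv.subspace S" "finite S"
    and card_eq: "card F = card S"
    and add1: "f \<in> F \<Longrightarrow> g \<in> F \<Longrightarrow> x \<in> S \<Longrightarrow> p (f + g) x = p f x + p g x"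
    and add2: "f \<in> F \<Longrightarrow> x \<in> S \<Longrightarrow> y \<in> S \<Longrightarrow> p f (x + y) = p f x + p f y"
    and scale1: "f \<in> F \<Longrightarrow> x \<in> S \<Longrightarrow> p (kscale c f) x = c * p f x"
    and scale2: "f \<in> F \<Longrightarrow> x \<in> S \<Longrightarrow> p f (kscale c x) = c * p f x"
    and nondeg1: "f \<in> F \<Longrightarrow> f \<noteq> 0 \<Longrightarrow> \<exists>x\<in>S. p f x \<noteq> 0"
    and nondeg2: "x \<in> S \<Longrightarrow> x \<noteq> 0 \<Longrightarrow> \<exists>f\<in>F. p f x \<noteq> 0"
begin

definition perp :: "'k kvec set \<Rightarrow> 'k kvec set" where
  "perp U = {f \<in> F. \<forall>x\<in>U. p f x = 0}"

lemma flip: "pairing S F (\<lambda>x f. p f x)"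
  by unfold_locales (use F S card_eq add1 add2 scale1 scale2 nondeg1 nondeg2 in \<open>simp_all\<close>)

lemma zero1: "x \<in> S \<Longrightarrow> p 0 x = 0"
  using scale1[of 0 x 0] kv.subspace_0[OF F(1)] by simp

lemma perp_subspace: "U \<subseteq> S \<Longrightarrow> kv.subspace (perp U)"
proof (rule kv.subspaceI)
  assume U: "U \<subseteq> S"
  show "0 \<in> perp U" using U zero1 kv.subspace_0[OF F(1)] by (auto simp: perp_def)
  show "f + g \<in> perp U" if "f \<in> perp U" "g \<in> perp U" for f g
  proof -
    have fg: "f \<in> F" "g \<in> F" using that by (auto simp: perp_def)
    have "p (f + g) x = 0" if x: "x \<in> U" for x
    proof -
      have "p f x = 0" "p g x = 0" using x \<open>f \<in> perp U\<close> \<open>g \<in> perp U\<close> by (auto simp: perp_def)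
      then show ?thesis using add1[OF fg, of x] x U by auto
    qed
    then show ?thesis using kv.subspace_add[OF F(1) fg] by (simp add: perp_def)
  qed
  show "kscale c f \<in> perp U" if "f \<in> perp U" for c f
  proof -
    have f: "f \<in> F" using that by (auto simp: perp_def)
    have "p (kscale c f) x = 0" if x: "x \<in> U" for x
    proof -
      have "p f x = 0" using x \<open>f \<in> perp U\<close> by (auto simp: perp_def)
      then show ?thesis using scale1[OF f, of x c] x U by auto
    qed
    then show ?thesis using kv.subspace_scale[OF F(1) f] by (simp add: perp_def)
  qed
qed

text \<open>Count the pairs \<open>(f, x)\<close> with \<open>x \<in> U\<close> and \<open>p f x = 0\<close> in two ways.\<close>

lemma card_perp:
  assumes U: "kv.subspace U" "U \<subseteq> S"
  shows "card U * card (perp U) = card F"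
proof -
  let ?Q = "CARD('k)"
  have Q: "?Q \<ge> 2" by (rule card_field_ge_2)
  have finU: "finite U" using U S finite_subset by blast
  have pF: "perp U \<subseteq> F" by (auto simp: perp_def)
  have finP: "finite (perp U)" using pF F finite_subset by blast
  have zU: "0 \<in> U" by (rule kv.subspace_0[OF U(1)])
  have US: "x \<in> S" if "x \<in> U" for x using that U by blast
  \<comment> \<open>For nonzero \<open>x\<close> this is a hyperplane of \<open>F\<close>;
    multiplication by \<open>?Q\<close> avoids a division.\<close>
  have c1: "?Q * card {f \<in> F. p f x = 0} = (if x = 0 then ?Q * card F else card F)" if x: "x \<in> U" for x
  proof (cases "x = 0")
    case True
    have "{f \<in> F. p f x = 0} = F" using True scale2[of _ 0 0] kv.subspace_0[OF S(1)] by auto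
    then show ?thesis using True by simp
  next
    case False
    have xS: "x \<in> S" using x U by blast
    obtain f where "f \<in> F" "p f x \<noteq> 0" using nondeg2[OF xS False] by blast
    then have "card {f \<in> F. p f x = 0} * ?Q = card F"
      using xS by (intro card_functional_fibre[OF F]) (simp_all add: add1 scale1)
    then show ?thesis using False by (simp add: mult.commute)
  qed
  have c2: "?Q * card {x \<in> U. p f x = 0} = (if f \<in> perp U then ?Q * card U else card U)" if f: "f \<in> F" for f
  proof (cases "f \<in> perp U")
    case True
    then have "{x \<in> U. p f x = 0} = U" by (auto simp: perp_def)
    then show ?thesis using True by simp
  next
    case False
    then obtain x where "x \<in> U" "p f x \<noteq> 0" using f by (auto simp: perp_def)
    then have "card {x \<in> U. p f x = 0} * ?Q = card U"
      using f U(2) by (intro card_functional_fibre[OF U(1) finU]) (simp_all add: add2 scale2 US)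
    then show ?thesis using False by (simp add: mult.commute)
  qed
  have "(\<Sum>x\<in>U. card {f \<in> F. p f x = 0}) = (\<Sum>f\<in>F. card {x \<in> U. p f x = 0})"
  proof -
    have "(\<Sum>x\<in>U. card {f \<in> F. p f x = 0}) = (\<Sum>x\<in>U. \<Sum>f\<in>F. if p f x = 0 then 1 else 0)"
      using F(2) by (simp add: sum.inter_filter[symmetric])
    also have "\<dots> = (\<Sum>f\<in>F. \<Sum>x\<in>U. if p f x = 0 then 1 else 0)" by (rule sum.swap)
    also have "\<dots> = (\<Sum>f\<in>F. card {x \<in> U. p f x = 0})"
      using finU by (simp add: sum.inter_filter[symmetric])
    finally show ?thesis .
  qed
  then have "(\<Sum>x\<in>U. ?Q * card {f \<in> F. p f x = 0}) = (\<Sum>f\<in>F. ?Q * card {x \<in> U. p f x = 0})"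
    by (simp add: sum_distrib_left[symmetric])
  then have eq: "(\<Sum>x\<in>U. if x = 0 then ?Q * card F else card F) = (\<Sum>f\<in>F. if f \<in> perp U then ?Q * card U else card U)"
    using c1 c2 by simp
  have l: "(\<Sum>x\<in>U. if x = 0 then ?Q * card F else card F) = ?Q * card F + (card U - 1) * card F"
    using finU zU by (simp add: sum.remove[OF finU zU])
  have r: "(\<Sum>f\<in>F. if f \<in> perp U then ?Q * card U else card U) = card (perp U) * (?Q * card U) + (card F - card (perp U)) * card U"
  proof -
    have "F \<inter> perp U = perp U" using pF by blast
    moreover have "F \<inter> - perp U = F - perp U" by blast
    ultimately show ?thesis using F(2) finP pF by (simp add: sum.If_cases card_Diff_subset)
  qed
  have e: "?Q * card F + (card U - 1) * card F = card (perp U) * (?Q * card U) + (card F - card (perp U)) * card U"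
    using eq unfolding l r .
  \<comment> \<open>These bounds make the truncated subtractions honest, so that over the reals the
    equation factors as (Q - 1) times the desired difference.\<close>
  have "card U \<ge> 1" using zU finU by (metis One_nat_def Suc_leI card_gt_0_iff empty_iff)
  moreover have "card (perp U) \<le> card F" using pF F(2) card_mono by blast
  ultimately have "real ?Q * card F + (real (card U) - 1) * card F
      = card (perp U) * (real ?Q * card U) + (real (card F) - card (perp U)) * card U"
    using arg_cong[OF e, of real] by (simp add: of_nat_diff)
  then have "(real ?Q - 1) * (real (card U) * real (card (perp U)) - card F) = 0"
    by (simp add: algebra_simps)
  then have "real (card U) * real (card (perp U)) = card F" using Q by simp
  then show ?thesis by (metis of_nat_eq_iff of_nat_mult)
qed

end

sublocale pairing \<subseteq> flipped: pairing S F "\<lambda>x f. p f x"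
  by (rule flip)

context pairing begin

lemma perp_perp:
  assumes U: "kv.subspace U" "U \<subseteq> S"
  shows "flipped.perp (perp U) = U"
proof -
  have P: "kv.subspace (perp U)" "perp U \<subseteq> F" using perp_subspace U by (auto simp: perp_def)
  have sub: "U \<subseteq> flipped.perp (perp U)" using U by (auto simp: perp_def flipped.perp_def)
  have fin: "finite (flipped.perp (perp U))" using S(2) finite_subset by (auto simp: flipped.perp_def)
  have "card (perp U) * card U = card (perp U) * card (flipped.perp (perp U))"
    using card_perp[OF U] flipped.card_perp[OF P] card_eq by (simp add: mult.commute)
  moreover have "card (perp U) \<noteq> 0"
    using card_perp[OF U] F kv.subspace_0[OF F(1)] by (metis card_0_eq empty_iff mult_is_0)
  ultimately have "card U = card (flipped.perp (perp U))" by simp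
  then show ?thesis using card_subset_eq[OF fin sub] by simp
qed

lemma dim_perp:
  assumes U: "kv.subspace U" "U \<subseteq> S"
  shows "kv.dim (perp U) = kv.dim S - kv.dim U" and "kv.dim U \<le> kv.dim S"
proof -
  have P: "kv.subspace (perp U)" "finite (perp U)" using perp_subspace U F finite_subset
    by (auto simp: perp_def)
  have "finite U" using U S finite_subset by blast
  then have "CARD('k) ^ (kv.dim U + kv.dim (perp U)) = CARD('k) ^ kv.dim S"
    using card_perp[OF U] card_eq card_subspace[OF S] card_subspace[OF U(1)] card_subspace[OF P]
    by (simp add: power_add)
  then have "kv.dim U + kv.dim (perp U) = kv.dim S" unfolding card_field_power_eq_iff .
  then show "kv.dim (perp U) = kv.dim S - kv.dim U" "kv.dim U \<le> kv.dim S" by auto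
qed

text \<open>A vector that annihilates both summands annihilates \<open>S\<close>, so the
  annihilators meet trivially, and counting shows that they fill \<open>F\<close>. The third claim
  carries the triviality of a summand back through duality.\<close>

lemma perp_direct_sum:
  assumes A: "kv.subspace A" "A \<subseteq> S" and B: "kv.subspace B" "B \<subseteq> S"
    and sum: "{x + y |x y. x \<in> A \<and> y \<in> B} = S" and int: "A \<inter> B = {0}"
  shows "{x + y |x y. x \<in> perp A \<and> y \<in> perp B} = F" "perp A \<inter> perp B = {0}"
    and "perp A = {0} \<Longrightarrow> B = {0}"
proof -
  have PA: "kv.subspace (perp A)" and PB: "kv.subspace (perp B)" using perp_subspace A B by auto
  show i: "perp A \<inter> perp B = {0}"
  proof -
    have "f = 0" if f: "f \<in> perp A" "f \<in> perp B" for f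
    proof (rule ccontr)
      assume "f \<noteq> 0"
      moreover have fF: "f \<in> F" using f by (simp add: perp_def)
      ultimately obtain z where z: "z \<in> S" "p f z \<noteq> 0" using nondeg1 by blast
      then obtain x y where "z = x + y" "x \<in> A" "y \<in> B" using sum by blast
      then have "p f z = 0" using f fF A B add2[OF fF, of x y] by (auto simp: perp_def)
      then show False using z by simp
    qed
    then show ?thesis using kv.subspace_0[OF PA] kv.subspace_0[OF PB] by blast
  qed
  have c: "card A * card B = card S" using card_direct_sum[OF A(1) B(1) int] sum by simp
  have nz: "card S \<noteq> 0" using S kv.subspace_0[OF S(1)] by auto
  have "card {x + y |x y. x \<in> perp A \<and> y \<in> perp B} = card (perp A) * card (perp B)"
    by (rule card_direct_sum[OF PA PB i])
  also have "\<dots> = card F"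
  proof -
    have "card S * (card (perp A) * card (perp B)) = (card A * card (perp A)) * (card B * card (perp B))"
      unfolding c[symmetric] by simp
    also have "\<dots> = card S * card F" using card_perp[OF A] card_perp[OF B] card_eq by simp
    finally show ?thesis using nz by simp
  qed
  finally have cc: "card {x + y |x y. x \<in> perp A \<and> y \<in> perp B} = card F" .
  have "{x + y |x y. x \<in> perp A \<and> y \<in> perp B} \<subseteq> F"
    using kv.subspace_add[OF F(1)] by (auto simp: perp_def)
  then show "{x + y |x y. x \<in> perp A \<and> y \<in> perp B} = F" using cc F(2) by (intro card_subset_eq) auto
  assume "perp A = {0}"
  then have "card A = card S" using card_perp[OF A] card_eq by simp
  then have "A = S" using A(2) S(2) by (intro card_subset_eq) auto
  then show "B = {0}" using int B(2) by blast
qed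

lemma pairing_eqI:
  assumes "f \<in> F" "g \<in> F" "\<And>x. x \<in> S \<Longrightarrow> p f x = p g x"
  shows "f = g"
proof (rule ccontr)
  assume "f \<noteq> g"
  moreover have fg: "f - g \<in> F" by (rule kv.subspace_diff[OF F(1) assms(1,2)])
  ultimately obtain x where x: "x \<in> S" "p (f - g) x \<noteq> 0" using nondeg1[of "f - g"] by auto
  have "p f x = p (f - g) x + p g x" using add1[OF fg assms(2) x(1)] by simp
  then show False using assms(3)[OF x(1)] x(2) by simp
qed

end

text \<open>Pair coordinates with respect to a chosen basis. That every functional on
  \<open>S\<close> is represented in \<open>F\<close> is what later provides the transposes of the
  arrows.\<close>

lemma exists_pairing:
  fixes S :: "'k::{field,finite} kvec set"
  assumes S: "kv.subspace S" "finite S"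
  obtains p where "pairing (coord_space (kv.dim S)) S p"
    and "\<And>l. (\<And>x y. x \<in> S \<Longrightarrow> y \<in> S \<Longrightarrow> l (x + y) = l x + l y) \<Longrightarrow>
        (\<And>c x. x \<in> S \<Longrightarrow> l (kscale c x) = c * l x) \<Longrightarrow>
        \<exists>g\<in>coord_space (kv.dim S). \<forall>x\<in>S. p g x = l x"
proof -
  let ?d = "kv.dim S"
  obtain B where B: "finite B" "B \<subseteq> S" "kv.independent B" "kv.span B = S" "card B = ?d"
    by (rule finite_subspace_basis[OF S])
  obtain b where b: "bij_betw b {..<?d} B"
    using ex_bij_betw_nat_finite[OF B(1)] B(5) by (auto simp: atLeast0LessThan)
  have bS: "b t \<in> S" if "t < ?d" for t using b that B(2) by (auto simp: bij_betw_def)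
  define co where "co = (\<lambda>x t. kv.representation B x (b t))"
  have co_add: "co (x + y) t = co x t + co y t" if "x \<in> S" "y \<in> S" for x y t
    unfolding co_def using kv.representation_add[OF B(3)] that B(4) by simp
  have co_scale: "co (kscale c x) t = c * co x t" if "x \<in> S" for c x t
    unfolding co_def using kv.representation_scale[OF B(3)] that B(4) by simp
  have co_b: "co (b s) t = (if s = t then 1 else 0)" if "s < ?d" "t < ?d" for s t
  proof -
    have "b s \<in> B" using b that by (auto simp: bij_betw_def)
    moreover have "b s = b t \<longleftrightarrow> s = t" using b that by (auto simp: bij_betw_def dest: inj_onD)
    ultimately show ?thesis unfolding co_def by (auto simp: kv.representation_basis[OF B(3)])
  qed
  have expand: "(\<Sum>t<?d. kscale (co x t) (b t)) = x" if "x \<in> S" for x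
  proof -
    have "(\<Sum>t<?d. kscale (co x t) (b t)) = (\<Sum>v\<in>B. kscale (kv.representation B x v) v)"
      unfolding co_def using sum.reindex_bij_betw[OF b, of "\<lambda>v. kscale (kv.representation B x v) v"] by simp
    also have "\<dots> = x" using kv.sum_representation_eq[OF B(3) _ B(1) order_refl] that B(4) by simp
    finally show ?thesis .
  qed
  define p where "p = (\<lambda>f x. \<Sum>t<?d. f [t] * co x t)"
  have "pairing (coord_space ?d) S p"
  proof
    show "card (coord_space ?d :: 'k kvec set) = card S" by (simp add: card_coord_space card_subspace[OF S])
    show "p (f + g) x = p f x + p g x" for f g x
      by (simp add: p_def algebra_simps sum.distrib)
    show "p f (x + y) = p f x + p f y" if "x \<in> S" "y \<in> S" for f x y
      using that by (simp add: p_def co_add algebra_simps sum.distrib)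
    show "p (kscale c f) x = c * p f x" for c f x
      by (simp add: p_def kscale_apply sum_distrib_left mult.assoc)
    show "p f (kscale c x) = c * p f x" if "x \<in> S" for c f x
      using that by (simp add: p_def co_scale sum_distrib_left mult.left_commute)
    show "\<exists>x\<in>S. p f x \<noteq> 0" if f: "f \<in> coord_space ?d" "f \<noteq> 0" for f
    proof -
      have "\<exists>t<?d. f [t] \<noteq> 0"
      proof (rule ccontr)
        assume *: "\<not> (\<exists>t<?d. f [t] \<noteq> 0)"
        have "f = 0"
        proof (rule kvec_eqI)
          fix t show "f [t] = 0 [t]" using * f(1) by (cases "t < ?d") (simp_all add: coord_space_iff)
        qed (use f(1) in \<open>simp_all add: coord_space_iff\<close>)
        then show False using f(2) by simp
      qed
      then obtain t where t: "t < ?d" "f [t] \<noteq> 0" by blast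
      have "p f (b t) = (\<Sum>s<?d. if s = t then f [t] else 0)"
        unfolding p_def using co_b[OF t(1)] by (intro sum.cong) auto
      then have "p f (b t) = f [t]" using t(1) by simp
      then show ?thesis using t(2) bS[OF t(1)] by (intro bexI[of _ "b t"]) simp_all
    qed
    show "\<exists>f\<in>coord_space ?d. p f x \<noteq> 0" if x: "x \<in> S" "x \<noteq> 0" for x
    proof -
      have "\<exists>t<?d. co x t \<noteq> 0"
      proof (rule ccontr)
        assume "\<not> (\<exists>t<?d. co x t \<noteq> 0)"
        then have "(\<Sum>t<?d. kscale (co x t) (b t)) = 0" by (intro sum.neutral) simp
        then show False using expand[OF x(1)] x(2) by simp
      qed
      then obtain t where t: "t < ?d" "co x t \<noteq> 0" by blast
      define f :: "'k kvec" where "f = (\<lambda>q. if q = [t] then 1 else 0)"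
      have "f \<in> coord_space ?d" using t(1) by (simp add: f_def coord_space_iff)
      moreover have "p f x = (\<Sum>s<?d. if s = t then co x t else 0)"
        unfolding p_def f_def by (intro sum.cong) auto
      then have "p f x = co x t" using t(1) by simp
      ultimately show ?thesis using t(2) by metis
    qed
  qed (use S in simp_all)
  moreover have "\<exists>g\<in>coord_space ?d. \<forall>x\<in>S. p g x = l x"
    if add: "\<And>x y. x \<in> S \<Longrightarrow> y \<in> S \<Longrightarrow> l (x + y) = l x + l y"
      and sc: "\<And>c x. x \<in> S \<Longrightarrow> l (kscale c x) = c * l x" for l
  proof -
    define g :: "'k kvec" where "g = (\<lambda>q. case q of [t] \<Rightarrow> if t < ?d then l (b t) else 0 | _ \<Rightarrow> 0)"
    have l0: "l 0 = 0" using sc[of 0 0] kv.subspace_0[OF S(1)] by simp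
    \<comment> \<open>As \<open>l\<close> is known to be additive only on \<open>S\<close>,
      membership of the partial sums is carried along in the induction.\<close>
    have lsum: "l (\<Sum>t<m. kscale (c t) (b t)) = (\<Sum>t<m. c t * l (b t)) \<and> (\<Sum>t<m. kscale (c t) (b t)) \<in> S"
      if "m \<le> ?d" for m c
      using that
    proof (induction m)
      case 0
      show ?case using l0 kv.subspace_0[OF S(1)] by (simp only: lessThan_0 sum.empty simp_thms)
    next
      case (Suc m)
      then have IH: "l (\<Sum>t<m. kscale (c t) (b t)) = (\<Sum>t<m. c t * l (b t))" "(\<Sum>t<m. kscale (c t) (b t)) \<in> S"
        by auto
      have bm: "b m \<in> S" using bS Suc.prems by simp
      have cb: "kscale (c m) (b m) \<in> S" by (rule kv.subspace_scale[OF S(1) bm])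
      show ?case
        using add[OF IH(2) cb] sc[OF bm, of "c m"] IH(1) kv.subspace_add[OF S(1) IH(2) cb]
        by (simp only: sum.lessThan_Suc simp_thms)
    qed
    have "p g x = l x" if x: "x \<in> S" for x
    proof -
      have "p g x = (\<Sum>t<?d. co x t * l (b t))"
        unfolding p_def g_def by (intro sum.cong) (auto simp: mult.commute)
      also have "\<dots> = l (\<Sum>t<?d. kscale (co x t) (b t))" using lsum[of ?d "co x"] by simp
      finally show ?thesis using expand[OF x] by simp
    qed
    moreover have "g \<in> coord_space ?d" by (simp add: g_def coord_space_iff)
    ultimately show ?thesis by blast
  qed
  ultimately show ?thesis using that by blast
qed

section \<open>The dual representation\<close>

lemma arrows_reverse:
  assumes "(i, j) \<in> arrows n" "n \<ge> 1"
  shows "i \<in> vertices n" "j \<in> vertices n" "(2 * n + 1 - j, 2 * n + 1 - i) \<in> arrows n"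
  using assms unfolding arrows_def by auto

text \<open>Dualising reverses the arrows, and the renumbering
  \<open>j \<mapsto> 2 * n + 1 - j\<close> restores their direction. Annihilators of
  subrepresentations are subrepresentations of complementary dimension, which gives the last
  conclusion; applied to the two parts of a decomposition they give the statement on
  indecomposability.\<close>

lemma exists_dual_rep:
  fixes V :: "'k::{field,finite} rep"
  assumes n1: "n \<ge> 1" and V: "is_rep n V"
  obtains V' :: "'k rep" where "is_rep n V'"
    "\<And>j. j \<in> vertices n \<Longrightarrow> kv.dim (space V' j) = kv.dim (space V (2 * n + 1 - j))"
    "indecomposable n V \<Longrightarrow> indecomposable n V'"
    "\<And>e. card (Gr n V e) =
       card (Gr n V' (\<lambda>j. int (kv.dim (space V (2 * n + 1 - j))) - e (2 * n + 1 - j)))"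
proof -
  let ?r = "\<lambda>j. 2 * n + 1 - j"
  let ?F = "\<lambda>j. coord_space (kv.dim (space V j)) :: 'k kvec set"
  have rv: "?r j \<in> vertices n" "?r (?r j) = j" if "j \<in> vertices n" for j using that by auto
  have subV: "kv.subspace (space V j)" and finV: "finite (space V j)" if "j \<in> vertices n" for j
    using that V unfolding is_rep_iff[OF n1] by blast+
  have lin: "linear_on (space V i) (space V j) (arr V (i, j))" if "(i, j) \<in> arrows n" for i j
    using that V unfolding is_rep_def by blast
  let ?R = "\<lambda>j p. \<forall>l. (\<forall>x\<in>space V j. \<forall>y\<in>space V j. l (x + y) = l x + l y) \<longrightarrow>
        (\<forall>c. \<forall>x\<in>space V j. l (kscale c x) = c * l x) \<longrightarrow> (\<exists>g\<in>?F j. \<forall>x\<in>space V j. p g x = l x)"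
  have ex: "\<exists>p. pairing (?F j) (space V j) p \<and> ?R j p" if j: "j \<in> vertices n" for j
  proof (rule exists_pairing[OF subV[OF j] finV[OF j]])
    fix p assume p: "pairing (?F j) (space V j) p" and
      rep: "\<And>l. (\<And>x y. x \<in> space V j \<Longrightarrow> y \<in> space V j \<Longrightarrow> l (x + y) = l x + l y) \<Longrightarrow>
        (\<And>c x. x \<in> space V j \<Longrightarrow> l (kscale c x) = c * l x) \<Longrightarrow> \<exists>g\<in>?F j. \<forall>x\<in>space V j. p g x = l x"
    have "?R j p" by (intro allI impI rep) simp_all
    with p show ?thesis by blast
  qed
  define p where "p = (\<lambda>j. SOME p. pairing (?F j) (space V j) p \<and> ?R j p)"
  have p: "pairing (?F j) (space V j) (p j) \<and> ?R j (p j)" if "j \<in> vertices n" for j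
    unfolding p_def by (rule someI_ex[OF ex[OF that]])
  have pair: "pairing (?F j) (space V j) (p j)" if "j \<in> vertices n" for j using p[OF that] by blast
  have tr: "\<exists>g\<in>?F i. \<forall>x\<in>space V i. p i g x = p j f (arr V (i, j) x)"
    if a: "(i, j) \<in> arrows n" and f: "f \<in> ?F j" for i j f
  proof -
    note ij = arrows_reverse(1,2)[OF a n1]
    have L: "arr V (i, j) x \<in> space V j" "arr V (i, j) (x + y) = arr V (i, j) x + arr V (i, j) y"
      "arr V (i, j) (kscale c x) = kscale c (arr V (i, j) x)" if "x \<in> space V i" "y \<in> space V i" for x y c
      using lin[OF a] that unfolding linear_on_def by blast+
    have 1: "\<forall>x\<in>space V i. \<forall>y\<in>space V i. p j f (arr V (i, j) (x + y)) = p j f (arr V (i, j) x) + p j f (arr V (i, j) y)"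
      using L pairing.add2[OF pair[OF ij(2)] f] by simp
    have 2: "\<forall>c. \<forall>x\<in>space V i. p j f (arr V (i, j) (kscale c x)) = c * p j f (arr V (i, j) x)"
      using L pairing.scale2[OF pair[OF ij(2)] f] by simp
    have "?R i (p i)" using p[OF ij(1)] by blast
    from this[rule_format, of "\<lambda>x. p j f (arr V (i, j) x)"] show ?thesis using 1 2 by blast
  qed
  \<comment> \<open>The transpose of the arrow, chosen separately for each \<open>f\<close>; its
    linearity is forced afterwards by nondegeneracy.\<close>
  define T where "T = (\<lambda>i j f. SOME g. g \<in> ?F i \<and> (\<forall>x\<in>space V i. p i g x = p j f (arr V (i, j) x)))"
  have T: "T i j f \<in> ?F i" "x \<in> space V i \<Longrightarrow> p i (T i j f) x = p j f (arr V (i, j) x)"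
    if a: "(i, j) \<in> arrows n" and f: "f \<in> ?F j" for i j f x
  proof -
    have "\<exists>g. g \<in> ?F i \<and> (\<forall>x\<in>space V i. p i g x = p j f (arr V (i, j) x))" using tr[OF a f] by blast
    from someI_ex[OF this] show "T i j f \<in> ?F i" "x \<in> space V i \<Longrightarrow> p i (T i j f) x = p j f (arr V (i, j) x)"
      unfolding T_def by blast+
  qed
  have T_lin: "linear_on (?F j) (?F i) (T i j)" if a: "(i, j) \<in> arrows n" for i j
  proof -
    note ij = arrows_reverse(1,2)[OF a n1]
    have av: "arr V (i, j) x \<in> space V j" if "x \<in> space V i" for x
      using lin[OF a] that unfolding linear_on_def by blast
    have Fs: "kv.subspace (?F i)" "kv.subspace (?F j)" by simp_all
    have "T i j (f + g) = T i j f + T i j g" if f: "f \<in> ?F j" and g: "g \<in> ?F j" for f g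
    proof (rule pairing.pairing_eqI[OF pair[OF ij(1)]])
      have fg: "f + g \<in> ?F j" by (rule kv.subspace_add[OF Fs(2) f g])
      show "T i j (f + g) \<in> ?F i" by (rule T(1)[OF a fg])
      show "T i j f + T i j g \<in> ?F i" by (rule kv.subspace_add[OF Fs(1) T(1)[OF a f] T(1)[OF a g]])
      fix x assume x: "x \<in> space V i"
      show "p i (T i j (f + g)) x = p i (T i j f + T i j g) x"
        unfolding pairing.add1[OF pair[OF ij(1)] T(1)[OF a f] T(1)[OF a g] x]
          T(2)[OF a f x] T(2)[OF a g x] T(2)[OF a fg x]
        by (rule pairing.add1[OF pair[OF ij(2)] f g av[OF x]])
    qed
    moreover have "T i j (kscale c f) = kscale c (T i j f)" if f: "f \<in> ?F j" for c f
    proof (rule pairing.pairing_eqI[OF pair[OF ij(1)]])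
      have cf: "kscale c f \<in> ?F j" by (rule kv.subspace_scale[OF Fs(2) f])
      show "T i j (kscale c f) \<in> ?F i" by (rule T(1)[OF a cf])
      show "kscale c (T i j f) \<in> ?F i" by (rule kv.subspace_scale[OF Fs(1) T(1)[OF a f]])
      fix x assume x: "x \<in> space V i"
      show "p i (T i j (kscale c f)) x = p i (kscale c (T i j f)) x"
        unfolding pairing.scale1[OF pair[OF ij(1)] T(1)[OF a f] x] T(2)[OF a f x] T(2)[OF a cf x]
        by (rule pairing.scale1[OF pair[OF ij(2)] f av[OF x]])
    qed
    ultimately show ?thesis unfolding linear_on_def using T(1)[OF a] by blast
  qed
  define V' where "V' = \<lparr>space = (\<lambda>j. ?F (?r j)), arr = (\<lambda>(i, j). T (?r j) (?r i))\<rparr>"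
  have spV': "space V' j = ?F (?r j)" for j by (simp add: V'_def)
  have arV': "arr V' (i, j) = T (?r j) (?r i)" for i j by (simp add: V'_def)
  have V': "is_rep n V'"
    unfolding is_rep_def finitely_spanned_iff
  proof (intro conjI ballI)
    fix a assume "a \<in> arrows n"
    then show "case a of (i, j) \<Rightarrow> linear_on (space V' i) (space V' j) (arr V' (i, j))"
      unfolding spV' using T_lin arrows_reverse(3)[OF _ n1] arV' by (cases a) simp
  qed (simp_all add: V'_def)
  define up where "up = (\<lambda>j. pairing.perp (?F j) (p j))"
  define dn where "dn = (\<lambda>j. pairing.perp (space V j) (\<lambda>x f. p j f x))"
  have up_iff: "f \<in> up j U \<longleftrightarrow> f \<in> ?F j \<and> (\<forall>x\<in>U. p j f x = 0)" if "j \<in> vertices n" for j f U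
    unfolding up_def pairing.perp_def[OF pair[OF that]] by simp
  have dn_iff: "x \<in> dn j W \<longleftrightarrow> x \<in> space V j \<and> (\<forall>f\<in>W. p j f x = 0)" if "j \<in> vertices n" for j x W
    unfolding dn_def pairing.perp_def[OF pairing.flip[OF pair[OF that]]] by simp
  have dn_up: "dn j (up j U) = U" if "j \<in> vertices n" "kv.subspace U" "U \<subseteq> space V j" for j U
    unfolding up_def dn_def by (rule pairing.perp_perp[OF pair[OF that(1)] that(2,3)])
  have up_dn: "up j (dn j W) = W" if "j \<in> vertices n" "kv.subspace W" "W \<subseteq> ?F j" for j W
    unfolding up_def dn_def by (rule pairing.perp_perp[OF pairing.flip[OF pair[OF that(1)]] that(2,3)])
  define U where "U = (\<lambda>N. \<lambda>j\<in>vertices n. up (?r j) (N (?r j)))"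
  define L where "L = (\<lambda>N. \<lambda>j\<in>vertices n. dn j (N (?r j)))"
  have U_sub: "subrep n V' (U N)" if N: "subrep n V N" for N
  proof -
    have sN: "kv.subspace (N j)" "N j \<subseteq> space V j" if "j \<in> vertices n" for j
      using N that unfolding subrep_def by blast+
    have aN: "arr V (i, j) x \<in> N j" if "(i, j) \<in> arrows n" "x \<in> N i" for i j x
      using N that unfolding subrep_def by blast
    have "kv.subspace (U N j) \<and> U N j \<subseteq> space V' j" if j: "j \<in> vertices n" for j
    proof -
      have e: "U N j = up (?r j) (N (?r j))" using j by (simp add: U_def del: vertices_iff)
      have "kv.subspace (up (?r j) (N (?r j)))"
        unfolding up_def by (rule pairing.perp_subspace[OF pair[OF rv(1)[OF j]] sN(2)[OF rv(1)[OF j]]])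
      then show ?thesis unfolding e spV' using up_iff[OF rv(1)[OF j]] by blast
    qed
    moreover have "arr V' (i, j) ` U N i \<subseteq> U N j" if a: "(i, j) \<in> arrows n" for i j
    proof
      note ij = arrows_reverse(1,2)[OF a n1] and a' = arrows_reverse(3)[OF a n1]
      fix g assume "g \<in> arr V' (i, j) ` U N i"
      then obtain f where f: "f \<in> up (?r i) (N (?r i))" "g = T (?r j) (?r i) f"
        using ij unfolding arV' U_def by (auto simp del: vertices_iff)
      have fF: "f \<in> ?F (?r i)" and f0: "\<And>x. x \<in> N (?r i) \<Longrightarrow> p (?r i) f x = 0"
        using f(1) unfolding up_iff[OF rv(1)[OF ij(1)]] by blast+
      have "p (?r j) g x = 0" if x: "x \<in> N (?r j)" for x
      proof -
        have xV: "x \<in> space V (?r j)" using x sN(2)[OF rv(1)[OF ij(2)]] by blast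
        show ?thesis unfolding f(2) T(2)[OF a' fF xV] by (rule f0[OF aN[OF a' x]])
      qed
      then have "g \<in> up (?r j) (N (?r j))"
        unfolding up_iff[OF rv(1)[OF ij(2)]] f(2) using T(1)[OF a' fF] by blast
      then show "g \<in> U N j" using ij by (simp add: U_def del: vertices_iff)
    qed
    moreover have "U N \<in> extensional (vertices n)" by (simp add: U_def)
    ultimately show ?thesis unfolding subrep_def by blast
  qed
  have L_sub: "subrep n V (L N)" if N: "subrep n V' N" for N
  proof -
    have sN: "kv.subspace (N j)" "N j \<subseteq> ?F (?r j)" if "j \<in> vertices n" for j
      using N that spV' unfolding subrep_def by blast+
    have aN: "T (?r j) (?r i) f \<in> N j" if "(i, j) \<in> arrows n" "f \<in> N i" for i j f
    proof -
      have "arr V' (i, j) ` N i \<subseteq> N j" using N that(1) unfolding subrep_def by blast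
      then show ?thesis using that(2) unfolding arV' by blast
    qed
    have "kv.subspace (L N j) \<and> L N j \<subseteq> space V j" if j: "j \<in> vertices n" for j
    proof -
      have e: "L N j = dn j (N (?r j))" using j by (simp add: L_def del: vertices_iff)
      have "N (?r j) \<subseteq> ?F j" using sN(2)[OF rv(1)[OF j]] unfolding rv(2)[OF j] .
      then have "kv.subspace (dn j (N (?r j)))"
        unfolding dn_def by (rule pairing.perp_subspace[OF pairing.flip[OF pair[OF j]]])
      then show ?thesis unfolding e using dn_iff[OF j] by blast
    qed
    moreover have "arr V (i, j) ` L N i \<subseteq> L N j" if a: "(i, j) \<in> arrows n" for i j
    proof
      note ij = arrows_reverse(1,2)[OF a n1] and a' = arrows_reverse(3)[OF a n1]
      fix y assume "y \<in> arr V (i, j) ` L N i"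
      then obtain x where x: "x \<in> dn i (N (?r i))" "y = arr V (i, j) x"
        using ij unfolding L_def by (auto simp del: vertices_iff)
      have xS: "x \<in> space V i" and x0: "\<And>f. f \<in> N (?r i) \<Longrightarrow> p i f x = 0"
        using x(1) unfolding dn_iff[OF ij(1)] by blast+
      have yS: "y \<in> space V j" using lin[OF a] xS unfolding x(2) linear_on_def by blast
      have "p j f y = 0" if f: "f \<in> N (?r j)" for f
      proof -
        have fF: "f \<in> ?F j" using f sN(2)[OF rv(1)[OF ij(2)]] unfolding rv(2)[OF ij(2)] by blast
        have "T i j f \<in> N (?r i)" using aN[OF a' f] unfolding rv(2)[OF ij(1)] rv(2)[OF ij(2)] .
        then show ?thesis using x0 T(2)[OF a fF xS] x(2) by simp
      qed
      then have "y \<in> dn j (N (?r j))" unfolding dn_iff[OF ij(2)] using yS by blast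
      then show "y \<in> L N j" using ij by (simp add: L_def del: vertices_iff)
    qed
    moreover have "L N \<in> extensional (vertices n)" by (simp add: L_def)
    ultimately show ?thesis unfolding subrep_def by blast
  qed
  have LU: "L (U N) = N" if N: "subrep n V N" for N
  proof
    fix j show "L (U N) j = N j"
    proof (cases "j \<in> vertices n")
      case True
      have "kv.subspace (N j)" "N j \<subseteq> space V j" using N True unfolding subrep_def by blast+
      from dn_up[OF True this] show ?thesis
        using True rv[OF True] by (simp add: L_def U_def del: vertices_iff)
    next
      case False
      have "N \<in> extensional (vertices n)" using N unfolding subrep_def by blast
      from extensional_arb[OF this False] show ?thesis using False by (simp add: L_def del: vertices_iff)
    qed
  qed
  have UL: "U (L N) = N" if N: "subrep n V' N" for N
  proof
    fix j show "U (L N) j = N j"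
    proof (cases "j \<in> vertices n")
      case True
      have "kv.subspace (N j)" "N j \<subseteq> ?F (?r j)" using N True spV' unfolding subrep_def by blast+
      from up_dn[OF rv(1)[OF True] this] show ?thesis
        using True rv[OF True] by (simp add: L_def U_def del: vertices_iff)
    next
      case False
      have "N \<in> extensional (vertices n)" using N unfolding subrep_def by blast
      from extensional_arb[OF this False] show ?thesis using False by (simp add: U_def del: vertices_iff)
    qed
  qed
  have U_dim: "int (kv.dim (U N j)) = int (kv.dim (space V (?r j))) - int (kv.dim (N (?r j)))"
    if N: "subrep n V N" and j: "j \<in> vertices n" for N j
  proof -
    have "kv.subspace (N (?r j))" "N (?r j) \<subseteq> space V (?r j)"
      using N rv(1)[OF j] unfolding subrep_def by blast+
    from pairing.dim_perp[OF pair[OF rv(1)[OF j]] this] show ?thesis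
      using j by (simp add: U_def up_def of_nat_diff del: vertices_iff)
  qed
  have gr: "card (Gr n V e) = card (Gr n V' (\<lambda>j. int (kv.dim (space V (?r j))) - e (?r j)))" for e
  proof (rule bij_betw_same_card[of U], rule bij_betw_byWitness[where f' = L])
    show "\<forall>N\<in>Gr n V e. L (U N) = N" using LU unfolding Gr_def by blast
    show "\<forall>N\<in>Gr n V' (\<lambda>j. int (kv.dim (space V (?r j))) - e (?r j)). U (L N) = N"
      using UL unfolding Gr_def by blast
    show "U ` Gr n V e \<subseteq> Gr n V' (\<lambda>j. int (kv.dim (space V (?r j))) - e (?r j))"
    proof
      fix M assume "M \<in> U ` Gr n V e"
      then obtain N where M: "M = U N" and N: "subrep n V N" "\<And>j. j \<in> vertices n \<Longrightarrow> int (kv.dim (N j)) = e j"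
        unfolding Gr_def by blast
      have "int (kv.dim (U N j)) = int (kv.dim (space V (?r j))) - e (?r j)" if "j \<in> vertices n" for j
        using U_dim[OF N(1) that] N(2)[OF rv(1)[OF that]] by simp
      then show "M \<in> Gr n V' (\<lambda>j. int (kv.dim (space V (?r j))) - e (?r j))"
        unfolding Gr_def M using U_sub[OF N(1)] by blast
    qed
    show "L ` Gr n V' (\<lambda>j. int (kv.dim (space V (?r j))) - e (?r j)) \<subseteq> Gr n V e"
    proof
      fix M assume "M \<in> L ` Gr n V' (\<lambda>j. int (kv.dim (space V (?r j))) - e (?r j))"
      then obtain N where M: "M = L N" and N: "subrep n V' N"
        "\<And>j. j \<in> vertices n \<Longrightarrow> int (kv.dim (N j)) = int (kv.dim (space V (?r j))) - e (?r j)"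
        unfolding Gr_def by blast
      have "int (kv.dim (L N j)) = e j" if j: "j \<in> vertices n" for j
        using U_dim[OF L_sub[OF N(1)] rv(1)[OF j]] N(2)[OF rv(1)[OF j]] unfolding UL[OF N(1)] rv(2)[OF j]
        by simp
      then show "M \<in> Gr n V e" unfolding Gr_def M using L_sub[OF N(1)] by blast
    qed
  qed
  have ind: "indecomposable n V'" if I: "indecomposable n V"
    unfolding indecomposable_def
  proof (intro conjI allI impI)
    obtain j where j: "j \<in> vertices n" "space V j \<noteq> {0}" using I unfolding indecomposable_def by blast
    have "card (?F j) = card (space V j)" by (rule pairing.card_eq[OF pair[OF j(1)]])
    moreover have "card (space V j) \<noteq> 1"
    proof
      assume "card (space V j) = 1"
      then obtain z where "space V j = {z}" by (rule card_1_singletonE)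
      then show False using j(2) kv.subspace_0[OF subV[OF j(1)]] by simp
    qed
    ultimately have "?F j \<noteq> {0}" by auto
    then show "\<exists>i\<in>vertices n. space V' i \<noteq> {0}"
      using rv[OF j(1)] by (intro bexI[of _ "?r j"]) (simp_all add: spV' del: vertices_iff)
  next
    fix A B assume asm: "subrep n V' A \<and> subrep n V' B \<and>
      (\<forall>i\<in>vertices n. {x + y |x y. x \<in> A i \<and> y \<in> B i} = space V' i \<and> A i \<inter> B i = {0})"
    have sA: "subrep n V' A" and sB: "subrep n V' B" using asm by blast+
    have dir: "{x + y |x y. x \<in> A (?r j) \<and> y \<in> B (?r j)} = ?F j" "A (?r j) \<inter> B (?r j) = {0}"
      "kv.subspace (A (?r j))" "A (?r j) \<subseteq> ?F j" "kv.subspace (B (?r j))" "B (?r j) \<subseteq> ?F j"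
      if j: "j \<in> vertices n" for j
    proof -
      have sp: "space V' (?r j) = ?F j" unfolding spV' rv(2)[OF j] ..
      show "{x + y |x y. x \<in> A (?r j) \<and> y \<in> B (?r j)} = ?F j" "A (?r j) \<inter> B (?r j) = {0}"
        using asm rv(1)[OF j] unfolding sp[symmetric] by blast+
      show "kv.subspace (A (?r j))" "A (?r j) \<subseteq> ?F j" "kv.subspace (B (?r j))" "B (?r j) \<subseteq> ?F j"
        using sA sB rv(1)[OF j] unfolding sp[symmetric] subrep_def by blast+
    qed
    have LA: "L A j = pairing.perp (space V j) (\<lambda>x f. p j f x) (A (?r j))"
      and LB: "L B j = pairing.perp (space V j) (\<lambda>x f. p j f x) (B (?r j))" if "j \<in> vertices n" for j
      using that by (simp_all add: L_def dn_def del: vertices_iff)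
    have d1: "{x + y |x y. x \<in> L A j \<and> y \<in> L B j} = space V j" and d2: "L A j \<inter> L B j = {0}"
      and d3: "L A j = {0} \<Longrightarrow> B (?r j) = {0}" if j: "j \<in> vertices n" for j
      unfolding LA[OF j] LB[OF j]
      using pairing.perp_direct_sum[OF pairing.flip[OF pair[OF j]] dir(3,4,5,6,1,2)[OF j]] by blast+
    have d4: "A (?r j) = {0}" if j: "j \<in> vertices n" and z: "L B j = {0}" for j
    proof (rule pairing.perp_direct_sum(3)[OF pairing.flip[OF pair[OF j]] dir(5,6,3,4)[OF j]])
      have "{x + y |x y. x \<in> B (?r j) \<and> y \<in> A (?r j)} = {x + y |x y. x \<in> A (?r j) \<and> y \<in> B (?r j)}"
        by (metis (no_types, opaque_lifting) add.commute)
      then show "{x + y |x y. x \<in> B (?r j) \<and> y \<in> A (?r j)} = ?F j" using dir(1)[OF j] by simp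
      show "B (?r j) \<inter> A (?r j) = {0}" using dir(2)[OF j] by (simp add: Int_commute)
      show "pairing.perp (space V j) (\<lambda>x f. p j f x) (B (?r j)) = {0}" using z LB[OF j] by simp
    qed
    have "(\<forall>i\<in>vertices n. L A i = {0}) \<or> (\<forall>i\<in>vertices n. L B i = {0})"
      by (rule indecomposableD[OF I L_sub[OF sA] L_sub[OF sB] d1 d2])
    then show "(\<forall>i\<in>vertices n. A i = {0}) \<or> (\<forall>i\<in>vertices n. B i = {0})"
    proof
      assume *: "\<forall>i\<in>vertices n. L A i = {0}"
      have "B i = {0}" if i: "i \<in> vertices n" for i
        using d3[OF rv(1)[OF i]] * rv[OF i] by simp
      then show ?thesis by blast
    next
      assume *: "\<forall>i\<in>vertices n. L B i = {0}"
      have "A i = {0}" if i: "i \<in> vertices n" for i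
        using d4[OF rv(1)[OF i]] * rv[OF i] by simp
      then show ?thesis by blast
    qed
  qed
  have "kv.dim (space V' j) = kv.dim (space V (?r j))" for j by (simp add: spV' dim_coord_space)
  then show ?thesis using that V' ind gr by blast
qed

section \<open>The representations of the statement\<close>

lemma card_degree_two_extension:
  fixes h :: "'f::{field,finite} \<Rightarrow> 'k::{field,finite}"
  assumes "degree_two_extension h"
  shows "CARD('k) = CARD('f)\<^sup>2"
proof -
  have h: "h 1 = 1" "\<And>x y. h (x + y) = h x + h y" "\<And>x y. h (x * y) = h x * h y"
    and d: "vector_space.dim (\<lambda>c x. h c * x) (UNIV :: 'k set) = 2"
    using assms unfolding degree_two_extension_def by auto
  interpret E: vector_space "\<lambda>c x :: 'k. h c * x"
    by unfold_locales (simp_all add: h algebra_simps)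
  obtain B where B: "B \<subseteq> UNIV" "E.independent B" "UNIV \<subseteq> E.span B" "card B = E.dim UNIV"
    by (rule E.basis_exists)
  have "E.span B = UNIV" using B(3) by blast
  then show ?thesis using E.card_span_independent[OF finite B(2)] B(4) d by simp
qed

subsection \<open>Paths\<close>

lemma is_path_singleton: "is_path n i j [x] \<longleftrightarrow> i = x \<and> j = x \<and> x \<in> vertices n"
  by (auto simp: is_path_def)

lemma is_path_Cons: "is_path n i j (x # y # p) \<longleftrightarrow>
    i = x \<and> x \<in> vertices n \<and> (x, y) \<in> arrows n \<and> is_path n y j (y # p)"
  by (auto simp: is_path_def)

lemma arrows_less: "(x, y) \<in> arrows n \<Longrightarrow> n \<ge> 1 \<Longrightarrow> x < y"
  by (auto simp: arrows_def)

lemma is_path_le: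
  assumes "is_path n i j p" "n \<ge> 1"
  shows "i \<le> j" "length p \<ge> 2 \<Longrightarrow> i < j" "distinct p"
proof -
  have "successively (<) p"
    using assms arrows_less unfolding is_path_def by (auto elim!: successively_mono)
  then have s: "sorted_wrt (<) p" by (subst (asm) successively_conv_sorted_wrt) (auto intro: transpI)
  then show "distinct p" by (simp add: strict_sorted_iff)
  have p: "p \<noteq> []" "hd p = i" "last p = j" using assms(1) by (auto simp: is_path_def)
  show lt: "i < j" if "length p \<ge> 2"
    using sorted_wrt_nth_less[OF s, of 0 "length p - 1"] that p by (simp add: hd_conv_nth last_conv_nth)
  show "i \<le> j"
  proof (cases "length p \<ge> 2")
    case False
    then have "length p = 1" using p(1) by (simp add: Suc_le_eq le_less_Suc_eq not_le less_2_cases_iff)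
    then show ?thesis using p by (auto simp: length_Suc_conv)
  qed (use lt in simp)
qed

lemma finite_paths: "n \<ge> 1 \<Longrightarrow> finite {p. is_path n i j p}"
  by (rule finite_subset[OF _ finite_subset_distinct[of "vertices n"]])
     (auto simp: is_path_le(3) is_path_def vertices_def)

text \<open>The long arrow occurs only in a path from 1 to 2n, and that is excluded; along the path
  of short arrows the list is unique. The hypothesis fits the projectives starting at
  \<open>i + 1 \<ge> 2\<close> and the injectives ending at \<open>i - 1 < 2 * n\<close>.\<close>

lemma is_path_linear:
  assumes n: "n \<ge> 1" and ab: "2 \<le> a \<or> b < 2 * n"
  shows "is_path n a b p \<longleftrightarrow> p = [a..<Suc b] \<and> a \<le> b \<and> a \<in> vertices n \<and> b \<in> vertices n"
proof
  show "p = [a..<Suc b] \<and> a \<le> b \<and> a \<in> vertices n \<and> b \<in> vertices n" if "is_path n a b p"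
    using that ab
  proof (induction p arbitrary: a rule: induct_list012)
    case 1
    then show ?case by (simp add: is_path_def)
  next
    case (2 x)
    then show ?case by (simp add: is_path_singleton)
  next
    case (3 x y p)
    have xy: "(a, y) \<in> arrows n" and p: "is_path n y b (y # p)" and a: "x = a" "a \<in> vertices n"
      using 3(3) by (auto simp: is_path_Cons)
    \<comment> \<open>After one step the vertex 1 has been left behind, so the induction hypothesis
      applies.\<close>
    have y: "2 \<le> y" using arrows_less[OF xy n] a by simp
    then have IH: "y # p = [y..<Suc b]" "y \<le> b" "b \<in> vertices n" using 3(2)[OF p] by auto
    have "y = Suc a" using xy 3(4) IH(2,3) unfolding arrows_def by auto
    then show ?case using IH a by (auto simp: upt_conv_Cons)
  qed
next
  assume asm: "p = [a..<Suc b] \<and> a \<le> b \<and> a \<in> vertices n \<and> b \<in> vertices n"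
  have "successively (\<lambda>x y. (x, y) \<in> arrows n) [a..<Suc b]"
    unfolding successively_conv_nth
  proof (intro allI impI)
    fix t assume "Suc t < length [a..<Suc b]"
    then have "a + t < b" by (simp del: upt_Suc)
    then show "([a..<Suc b] ! t, [a..<Suc b] ! Suc t) \<in> arrows n"
      using asm unfolding arrows_def by (auto simp del: upt_Suc)
  qed
  then show "is_path n a b p" using asm unfolding is_path_def by (auto simp del: upt_Suc)
qed

lemma line_subspace:
  fixes q :: "nat list"
  shows "kv.subspace {v :: 'k::{field,finite} kvec. \<forall>p. p \<noteq> q \<longrightarrow> v p = 0}"
    "finite {v :: 'k kvec. \<forall>p. p \<noteq> q \<longrightarrow> v p = 0}"
    "kv.dim {v :: 'k kvec. \<forall>p. p \<noteq> q \<longrightarrow> v p = 0} = 1"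
proof -
  let ?L = "{v :: 'k kvec. \<forall>p. p \<noteq> q \<longrightarrow> v p = 0}"
  show s: "kv.subspace ?L" by (rule kv.subspaceI) (simp_all add: kscale_apply)
  have b: "bij_betw (\<lambda>v. v q) ?L UNIV"
  proof (rule bij_betwI[where g = "\<lambda>c p. if p = q then c else 0"])
    fix v :: "'k kvec" assume "v \<in> ?L"
    then show "(\<lambda>p. if p = q then v q else 0) = v" by (simp add: fun_eq_iff)
  qed simp_all
  show f: "finite ?L" using bij_betw_finite[OF b] by simp
  show "kv.dim ?L = 1" using bij_betw_same_card[OF b] by (intro dim_eq_card_power[OF s f]) simp
qed

lemma dim_path_space_linear:
  assumes n: "n \<ge> 1" and ab: "2 \<le> a \<or> b < 2 * n" and v: "a \<in> vertices n" "b \<in> vertices n"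
  shows "kv.dim {v :: 'k::{field,finite} kvec. \<forall>p. \<not> is_path n a b p \<longrightarrow> v p = 0} = (if a \<le> b then 1 else 0)"
proof (cases "a \<le> b")
  case True
  then have eq: "{v :: 'k kvec. \<forall>p. \<not> is_path n a b p \<longrightarrow> v p = 0} = {v. \<forall>p. p \<noteq> [a..<Suc b] \<longrightarrow> v p = 0}"
    using v by (simp only: is_path_linear[OF n ab]) blast
  show ?thesis unfolding eq line_subspace(3) using True by simp
next
  case False
  then have "{v :: 'k kvec. \<forall>p. \<not> is_path n a b p \<longrightarrow> v p = 0} = {0}"
    unfolding is_path_linear[OF n ab] by (simp add: fun_eq_iff set_eq_iff)
  then show ?thesis using False dim_zero_subspace_iff[of "{0 :: 'k kvec}"] by simp
qed

subsection \<open>Counting subrepresentations of the preprojective and preinjective modules\<close>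

lemma Gr_cong: "(\<And>j. j \<in> vertices n \<Longrightarrow> e j = e' j) \<Longrightarrow> Gr n V e = Gr n V e'"
  unfolding Gr_def by auto

lemma is_M_string:
  fixes V :: "'k::{field,finite} rep"
  assumes n2: "n \<ge> 2" and i: "1 \<le> i" "i < 2 * n" and M: "is_M n i l V"
  shows "dimvec n V = (\<lambda>j. if j \<in> vertices n then int (string_dim i l j) else 0)"
    and "real (card (Gr n V e)) = string_count TYPE('k) n i l e"
proof -
  have n1: "n \<ge> 1" using n2 by simp
  have V: "is_rep n V" "indecomposable n V"
    and d: "dimvec n V = dimvec n (P_rep n (i + 1) :: 'k rep) + (\<lambda>j. int l * delta n j)"
    using M unfolding is_M_def by blast+
  show dv: "dimvec n V = (\<lambda>j. if j \<in> vertices n then int (string_dim i l j) else 0)"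
  proof
    fix j
    have "i + 1 \<in> vertices n" "2 \<le> i + 1" using i by auto
    then show "dimvec n V j = (if j \<in> vertices n then int (string_dim i l j) else 0)"
      unfolding d using dim_path_space_linear[OF n1, of "i + 1" j, where ?'k='k]
      by (auto simp: dimvec_def delta_def P_rep_def string_dim_def)
  qed
  have "kv.dim (space V j) = string_dim i l j" if "j \<in> vertices n" for j
    using fun_cong[OF dv, of j] that by (simp add: dimvec_def)
  then obtain f where "rep_iso n (string_rep n i l) V f"
    using indecomposable_iso_string_rep[OF n2 i V] by blast
  then show "real (card (Gr n V e)) = string_count TYPE('k) n i l e"
    using Gr_iso_card[OF n1 string_rep_is_rep[OF n2 i] V(1)] by (simp add: string_count_def)
qed

text \<open>Indexed by the dual module: the dual of N_{2n+1-i}(l), with the vertices reversed, has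
  the dimension vector of M_i(l), so the classification applies to it.\<close>

lemma is_N_string:
  fixes V :: "'k::{field,finite} rep"
  assumes n2: "n \<ge> 2" and i: "1 \<le> i" "i < 2 * n" and N: "is_N n (2 * n + 1 - i) l V"
  shows "dimvec n V = (\<lambda>j. if j \<in> vertices n then int (string_dim i l (2 * n + 1 - j)) else 0)"
    and "real (card (Gr n V e)) = string_count TYPE('k) n i l (\<lambda>j. int (string_dim i l j) - e (2 * n + 1 - j))"
proof -
  have n1: "n \<ge> 1" using n2 by simp
  have V: "is_rep n V" "indecomposable n V"
    and d: "dimvec n V = dimvec n (I_rep n (2 * n + 1 - i - 1) :: 'k rep) + (\<lambda>j. int l * delta n j)"
    using N unfolding is_N_def by blast+
  show dv: "dimvec n V = (\<lambda>j. if j \<in> vertices n then int (string_dim i l (2 * n + 1 - j)) else 0)"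
  proof
    fix j
    have "2 * n - i \<in> vertices n" "2 * n - i < 2 * n" using i by auto
    then show "dimvec n V j = (if j \<in> vertices n then int (string_dim i l (2 * n + 1 - j)) else 0)"
      unfolding d using dim_path_space_linear[OF n1, of j "2 * n - i", where ?'k='k] i
      by (auto simp: dimvec_def delta_def I_rep_def string_dim_def)
  qed
  have dimV: "kv.dim (space V (2 * n + 1 - j)) = string_dim i l j" if j: "j \<in> vertices n" for j
  proof -
    have "2 * n + 1 - j \<in> vertices n" "2 * n + 1 - (2 * n + 1 - j) = j" using j by auto
    then show ?thesis using fun_cong[OF dv, of "2 * n + 1 - j"] by (simp add: dimvec_def)
  qed
  obtain V' :: "'k rep" where V': "is_rep n V'"
    "\<And>j. j \<in> vertices n \<Longrightarrow> kv.dim (space V' j) = kv.dim (space V (2 * n + 1 - j))"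
    "indecomposable n V \<Longrightarrow> indecomposable n V'"
    "\<And>e. card (Gr n V e) =
       card (Gr n V' (\<lambda>j. int (kv.dim (space V (2 * n + 1 - j))) - e (2 * n + 1 - j)))"
    by (rule exists_dual_rep[OF n1 V(1)]) blast
  have "kv.dim (space V' j) = string_dim i l j" if "j \<in> vertices n" for j
    using V'(2) dimV that by simp
  then obtain f where "rep_iso n (string_rep n i l) V' f"
    using indecomposable_iso_string_rep[OF n2 i V'(1) V'(3)[OF V(2)]] by blast
  then have "real (card (Gr n V' e)) = string_count TYPE('k) n i l e" for e
    using Gr_iso_card[OF n1 string_rep_is_rep[OF n2 i] V'(1)] by (simp add: string_count_def)
  moreover have "Gr n V' (\<lambda>j. int (kv.dim (space V (2 * n + 1 - j))) - e (2 * n + 1 - j))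
      = Gr n V' (\<lambda>j. int (string_dim i l j) - e (2 * n + 1 - j))"
    by (rule Gr_cong) (simp only: dimV)
  ultimately show "real (card (Gr n V e)) = string_count TYPE('k) n i l (\<lambda>j. int (string_dim i l j) - e (2 * n + 1 - j))"
    using V'(4)[of e] by simp
qed

text \<open>Each space is a line or zero and the path arrows are injective from \<open>s0\<close>
  on, so a subrepresentation is everything from its first nonzero vertex on. It then contains the
  whole space at 2n unless it is zero, so the value of the long arrow is immaterial: this is why the
  character of E(c) is independent of c.\<close>

lemma card_Gr_thin:
  fixes V :: "'k::{field,finite} rep"
  assumes n1: "n \<ge> 1" and V: "is_rep n V" and s0: "1 \<le> s0" "s0 \<le> 2 * n"
    and d: "\<And>j. j \<in> vertices n \<Longrightarrow> kv.dim (space V j) = (if s0 \<le> j then 1 else 0)"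
    and inj: "\<And>j x. s0 \<le> j \<Longrightarrow> j < 2 * n \<Longrightarrow> x \<in> space V j \<Longrightarrow> arr V (j, Suc j) x = 0 \<Longrightarrow> x = 0"
  shows "real (card (Gr n V e)) =
    (if \<exists>s\<in>{s0..Suc (2 * n)}. \<forall>j\<in>vertices n. e j = tail_vec n s j then 1 else 0)"
proof -
  have subV: "kv.subspace (space V j)" and finV: "finite (space V j)" if "j \<in> vertices n" for j
    using that V unfolding is_rep_iff[OF n1] by blast+
  have lin: "linear_on (space V j) (space V (Suc j)) (arr V (j, Suc j))" if "1 \<le> j" "j < 2 * n" for j
    using V that unfolding is_rep_iff[OF n1] by blast
  have line: "W = {0} \<or> W = space V j" if j: "j \<in> vertices n" and W: "kv.subspace W" "W \<subseteq> space V j" for j W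
  proof -
    have fW: "finite W" using W finV[OF j] finite_subset by blast
    have "kv.dim W \<le> 1" using subspace_dim_mono[OF W(1) subV[OF j] finV[OF j] W(2)] d[OF j] by (simp split: if_splits)
    then consider "kv.dim W = 0" | "kv.dim W = 1" by linarith
    then show ?thesis
    proof cases
      case 1
      then show ?thesis using dim_zero_subspace_iff[OF W(1) fW] by simp
    next
      case 2
      then have "kv.dim W = kv.dim (space V j)"
        using subspace_dim_mono[OF W(1) subV[OF j] finV[OF j] W(2)] d[OF j] by (simp split: if_splits)
      then show ?thesis using subspace_eq_if_dim_eq[OF W(1) subV[OF j] finV[OF j] W(2)] by simp
    qed
  qed
  have z: "space V j = {0}" if "j \<in> vertices n" "\<not> s0 \<le> j" for j
    using d[OF that(1)] that dim_zero_subspace_iff[OF subV finV, of j] by simp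
  have nz: "space V j \<noteq> {0}" if "j \<in> vertices n" "s0 \<le> j" for j
    using d[OF that(1)] that dim_zero_subspace_iff[OF subV finV, of j] by simp
  define N where "N = (\<lambda>s. \<lambda>j\<in>vertices n. if s \<le> j then space V j else {0})"
  have N_sub: "subrep n V (N s)" if s: "s0 \<le> s" for s
    unfolding subrep_iff[OF n1]
  proof (intro conjI ballI allI impI)
    fix j assume j: "j \<in> vertices n"
    show "kv.subspace (N s j)" "N s j \<subseteq> space V j"
      using j subV[OF j] kv.subspace_0[OF subV[OF j]] by (simp_all add: N_def del: vertices_iff)
  next
    fix j assume j: "1 \<le> j \<and> j < 2 * n"
    then have jv: "j \<in> vertices n" "Suc j \<in> vertices n" by auto
    show "arr V (j, Suc j) ` N s j \<subseteq> N s (Suc j)"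
    proof (cases "s \<le> j")
      case True
      then show ?thesis using lin[of j] j jv by (auto simp: N_def linear_on_def)
    next
      case False
      then have "N s j = {0}" using jv by (simp add: N_def del: vertices_iff)
      moreover have "0 \<in> N s (Suc j)"
        using jv kv.subspace_0[OF subV[OF jv(2)]] by (simp add: N_def del: vertices_iff)
      ultimately show ?thesis using linear_on_0[OF lin subV[OF jv(1)]] j by simp
    qed
  next
    have v: "1 \<in> vertices n" "2 * n \<in> vertices n" using n1 by auto
    have l: "linear_on (space V 1) (space V (2 * n)) (arr V (1, 2 * n))"
      using V unfolding is_rep_iff[OF n1] by blast
    show "arr V (1, 2 * n) ` N s 1 \<subseteq> N s (2 * n)"
    proof (cases "s \<le> 1")
      case True
      then have "s \<le> 2 * n" using n1 by simp
      then have "N s 1 = space V 1" "N s (2 * n) = space V (2 * n)" using True v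
        by (simp_all add: N_def del: vertices_iff One_nat_def)
      then show ?thesis using l by (auto simp: linear_on_def)
    next
      case False
      then have "N s 1 = {0}" using v by (simp add: N_def del: vertices_iff)
      moreover have "0 \<in> N s (2 * n)"
        using v kv.subspace_0[OF subV[OF v(2)]] by (simp add: N_def del: vertices_iff)
      ultimately show ?thesis using linear_on_0[OF l subV[OF v(1)]] by simp
    qed
  qed (simp add: N_def)
  have dz: "kv.dim {0 :: 'k kvec} = 0" by (simp add: dim_zero_subspace_iff)
  have N_dim: "int (kv.dim (N s j)) = tail_vec n s j" if s: "s0 \<le> s" and j: "j \<in> vertices n" for s j
    using d[OF j] s j dz by (simp add: N_def tail_vec_def del: vertices_iff)
  have N_only: "\<exists>s\<in>{s0..Suc (2 * n)}. M = N s" if M: "subrep n V M" for M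
  proof -
    have sM: "kv.subspace (M j)" "M j \<subseteq> space V j" if "j \<in> vertices n" for j
      using M that unfolding subrep_def by blast+
    have aM: "arr V (j, Suc j) ` M j \<subseteq> M (Suc j)" if "1 \<le> j" "j < 2 * n" for j
      using M that unfolding subrep_iff[OF n1] by blast
    define s where "s = (LEAST s. s0 \<le> s \<and> (s = Suc (2 * n) \<or> M s \<noteq> {0}))"
    have P: "s0 \<le> s \<and> (s = Suc (2 * n) \<or> M s \<noteq> {0})"
      unfolding s_def by (rule LeastI[of _ "Suc (2 * n)"]) (use s0 in simp)
    have le: "s \<le> t" if "s0 \<le> t" "t = Suc (2 * n) \<or> M t \<noteq> {0}" for t
      unfolding s_def by (rule Least_le) (use that in simp)
    have full: "M j = space V j" if "s \<le> j" "j \<le> 2 * n" for j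
      using that
    proof (induction j rule: dec_induct)
      case base
      then have sv: "s \<in> vertices n" using P s0 by simp
      then show ?case using P line[OF sv sM[OF sv]] base by auto
    next
      case (step j)
      have j: "1 \<le> j" "j < 2 * n" "s0 \<le> j" using step P s0 by auto
      have jv: "j \<in> vertices n" "Suc j \<in> vertices n" using j by auto
      have "space V j \<noteq> {0}" by (rule nz[OF jv(1) j(3)])
      then obtain x where x: "x \<in> space V j" "x \<noteq> 0" using kv.subspace_0[OF subV[OF jv(1)]] by blast
      have "arr V (j, Suc j) x \<noteq> 0" using inj[OF j(3,2) x(1)] x(2) by blast
      moreover have "arr V (j, Suc j) x \<in> M (Suc j)" using aM[OF j(1,2)] x(1) step by auto
      ultimately have "M (Suc j) \<noteq> {0}" by blast
      then show ?case using line[OF jv(2) sM[OF jv(2)]] by blast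
    qed
    have "M = N s"
    proof
      fix j show "M j = N s j"
      proof (cases "j \<in> vertices n")
        case True
        show ?thesis
        proof (cases "s \<le> j")
          case True
          then show ?thesis using full[of j] \<open>j \<in> vertices n\<close> by (simp add: N_def)
        next
          case False
          have "M j = {0}"
          proof (cases "s0 \<le> j")
            case True
            then show ?thesis using le[of j] False by blast
          next
            case f2: False
            have "M j \<subseteq> {0}" using sM(2)[OF True] z[OF True f2] by simp
            then show ?thesis using kv.subspace_0[OF sM(1)[OF True]] by blast
          qed
          then show ?thesis using False True by (simp add: N_def)
        qed
      next
        case False
        have "M \<in> extensional (vertices n)" using M unfolding subrep_def by blast
        from extensional_arb[OF this False] show ?thesis using False by (simp add: N_def del: vertices_iff)
      qed
    qed
    moreover have "s \<in> {s0..Suc (2 * n)}" using P le[of "Suc (2 * n)"] s0 by simp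
    ultimately show ?thesis by blast
  qed
  show ?thesis
  proof (cases "\<exists>s\<in>{s0..Suc (2 * n)}. \<forall>j\<in>vertices n. e j = tail_vec n s j")
    case True
    then obtain s where s: "s \<in> {s0..Suc (2 * n)}" "\<forall>j\<in>vertices n. e j = tail_vec n s j" by blast
    have "Gr n V e = {N s}"
    proof (intro equalityI subsetI)
      fix M assume M: "M \<in> Gr n V e"
      then obtain t where t: "t \<in> {s0..Suc (2 * n)}" "M = N t" using N_only unfolding Gr_def by blast
      have eq: "tail_vec n t j = tail_vec n s j" if j: "j \<in> vertices n" for j
        using M N_dim[of t j] t s(2) j unfolding Gr_def by auto
      have "t = s"
      proof (rule ccontr)
        assume "t \<noteq> s"
        moreover have "min s t \<in> vertices n" using s(1) t(1) s0 \<open>t \<noteq> s\<close> by (auto simp: min_def)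
        ultimately show False using eq[of "min s t"] by (auto simp: tail_vec_def min_def split: if_splits)
      qed
      then show "M \<in> {N s}" using t by simp
    next
      fix M assume "M \<in> {N s}"
      then show "M \<in> Gr n V e" using N_sub[of s] N_dim[of s] s unfolding Gr_def by simp
    qed
    then show ?thesis using True by simp
  next
    case False
    have "Gr n V e = {}"
    proof (rule ccontr)
      assume "Gr n V e \<noteq> {}"
      then obtain M where M: "subrep n V M" "\<forall>j\<in>vertices n. int (kv.dim (M j)) = e j" unfolding Gr_def by blast
      obtain s where s: "s \<in> {s0..Suc (2 * n)}" "M = N s" using N_only[OF M(1)] by blast
      then have "\<forall>j\<in>vertices n. e j = tail_vec n s j" using M(2) N_dim[of s] by auto
      then show False using False s(1) by blast
    qed
    then show ?thesis using False by simp
  qed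
qed

lemma string_count_0:
  assumes n2: "n \<ge> 2" and i: "1 \<le> i" "i < 2 * n"
  shows "string_count TYPE('k::{field,finite}) n i 0 e =
    (if \<exists>s\<in>{Suc i..Suc (2 * n)}. \<forall>j\<in>vertices n. e j = tail_vec n s j then 1 else 0)"
  unfolding string_count_def
proof (rule card_Gr_thin[OF _ string_rep_is_rep[OF n2 i]])
  show "kv.dim (space (string_rep n i 0 :: 'k rep) j) = (if Suc i \<le> j then 1 else 0)" for j
    by (auto simp: string_rep_def dim_coord_space string_dim_def)
  show "x = 0" if "arr (string_rep n i 0 :: 'k rep) (j, Suc j) x = 0" for j x
    using that n2 by (auto simp: string_rep_def split: if_splits)
qed (use n2 i in auto)

lemma E_rep_is_rep: "n \<ge> 1 \<Longrightarrow> is_rep n (E_rep n c :: 'k::{field,finite} rep)"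
  using line_subspace(1,2)[of "[]", where ?'k='k]
  by (subst is_rep_iff) (auto simp: E_rep_def linear_on_def kscale_apply algebra_simps kv.scale_right_distrib)

lemma dim_E_rep: "kv.dim (space (E_rep n c :: 'k::{field,finite} rep) j) = 1"
  using line_subspace(3)[of "[]", where ?'k='k] by (simp add: E_rep_def)

lemma card_Gr_E_rep:
  assumes n2: "n \<ge> 2"
  shows "real (card (Gr n (E_rep n (c :: 'k::{field,finite})) e)) =
    (if \<exists>s\<in>{1..Suc (2 * n)}. \<forall>j\<in>vertices n. e j = tail_vec n s j then 1 else 0)"
proof (rule card_Gr_thin[OF _ E_rep_is_rep])
  show "kv.dim (space (E_rep n c) j) = (if 1 \<le> j then 1 else 0)" if "j \<in> vertices n" for j
    using that dim_E_rep by simp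
  show "x = 0" if "1 \<le> j" "arr (E_rep n c) (j, Suc j) x = 0" for j x
    using that n2 by (auto simp: E_rep_def split: if_splits)
qed (use n2 in auto)

subsection \<open>The top of the indecomposable projectives\<close>

definition path_vec :: "nat list \<Rightarrow> 'k::field kvec" where
  "path_vec p = (\<lambda>q. if q = p then 1 else 0)"

lemma P_rep_space: "v \<in> space (P_rep n i) j \<longleftrightarrow> (\<forall>p. \<not> is_path n i j p \<longrightarrow> v p = 0)"
  by (simp add: P_rep_def)

lemma P_rep_subspace: "kv.subspace (space (P_rep n i :: 'k::field rep) j)"
  by (rule kv.subspaceI) (simp_all add: P_rep_space kscale_apply)

lemma path_vec_in: "is_path n i j p \<Longrightarrow> path_vec p \<in> space (P_rep n i) j"
  by (auto simp: P_rep_space path_vec_def)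

lemma P_rep_arr: "arr (P_rep n i) (j, j') v p = (if p \<noteq> [] \<and> last p = j' then v (butlast p) else 0)"
  by (simp add: P_rep_def)

lemma P_rep_arr_in:
  assumes a: "(j, j') \<in> arrows n" and v: "v \<in> space (P_rep n i) j" and n: "n \<ge> 1"
  shows "arr (P_rep n i) (j, j') v \<in> space (P_rep n i) j'"
  unfolding P_rep_space
proof (intro allI impI)
  fix p assume np: "\<not> is_path n i j' p"
  show "arr (P_rep n i) (j, j') v p = 0"
  proof (rule ccontr)
    assume "arr (P_rep n i) (j, j') v p \<noteq> 0"
    then have p: "p \<noteq> []" "last p = j'" "v (butlast p) \<noteq> 0" by (auto simp: P_rep_arr split: if_splits)
    then have b: "is_path n i j (butlast p)" using v unfolding P_rep_space by blast
    have pp: "p = butlast p @ [j']" using p(1,2) by (metis append_butlast_last_id)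
    have "j' \<in> vertices n" using arrows_reverse(2)[OF a n] .
    then have "is_path n i j' (butlast p @ [j'])"
      using b a unfolding is_path_def by (auto simp: successively_append_iff)
    then show False using np pp by simp
  qed
qed

text \<open>Every path vector arises from the trivial path at \<open>i\<close> by applying arrows,
  so the representation is generated by its space at \<open>i\<close>.\<close>

lemma P_rep_generated:
  assumes n: "n \<ge> 1" and N: "subrep n (P_rep n i :: 'k::{field,finite} rep) N"
    and Ni: "N i = space (P_rep n i) i" and j: "j \<in> vertices n"
  shows "N j = space (P_rep n i) j"
proof -
  have sN: "kv.subspace (N j)" "N j \<subseteq> space (P_rep n i) j" if "j \<in> vertices n" for j
    using N that unfolding subrep_def by blast+
  have path: "path_vec p \<in> N j" if "is_path n i j p" "j \<in> vertices n" for j p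
    using that
  proof (induction p arbitrary: j rule: rev_induct)
    case Nil
    then show ?case by (simp add: is_path_def)
  next
    case (snoc x p)
    then have x: "x = j" by (simp add: is_path_def)
    show ?case
    proof (cases "p = []")
      case True
      then have "i = j" using snoc.prems by (simp add: is_path_def)
      then show ?thesis using path_vec_in[OF snoc.prems(1)] Ni by simp
    next
      case False
      have p: "is_path n i (last p) p" and a: "(last p, j) \<in> arrows n"
        using snoc.prems False x unfolding is_path_def by (auto simp: successively_append_iff)
      have "path_vec p \<in> N (last p)" by (rule snoc.IH[OF p arrows_reverse(1)[OF a n]])
      moreover have "arr (P_rep n i) (last p, j) ` N (last p) \<subseteq> N j"
        using N a unfolding subrep_def by blast
      moreover have "arr (P_rep n i) (last p, j) (path_vec p) = (path_vec (p @ [x]) :: 'k kvec)"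
      proof
        fix q
        show "arr (P_rep n i) (last p, j) (path_vec p) q = (path_vec (p @ [x]) q :: 'k)"
          unfolding P_rep_arr path_vec_def x by (cases q rule: rev_cases) auto
      qed
      ultimately show ?thesis by (metis image_subset_iff)
    qed
  qed
  have "v \<in> N j" if v: "v \<in> space (P_rep n i) j" for v
  proof -
    let ?P = "{p. is_path n i j p}"
    have fin: "finite ?P" by (rule finite_paths[OF n])
    have "(\<Sum>p\<in>?P. kscale (v p) (path_vec p)) \<in> N j"
      by (rule kv.subspace_sum[OF sN(1)[OF j]]) (use path j in \<open>auto intro: kv.subspace_scale[OF sN(1)[OF j]]\<close>)
    moreover have "(\<Sum>p\<in>?P. kscale (v p) (path_vec p)) = v"
    proof
      fix q
      have "(\<Sum>p\<in>?P. kscale (v p) (path_vec p)) q = (\<Sum>p\<in>?P. kscale (v p) (path_vec p) q)"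
        by (induction rule: finite_induct[OF fin]) simp_all
      also have "\<dots> = (\<Sum>p\<in>?P. if q = p then v p else 0)"
        by (rule sum.cong) (simp_all add: kscale_apply path_vec_def)
      also have "\<dots> = v q" using fin v by (simp add: P_rep_space)
      finally show "(\<Sum>p\<in>?P. kscale (v p) (path_vec p)) q = v q" .
    qed
    ultimately show ?thesis by simp
  qed
  then show ?thesis using sN(2)[OF j] by blast
qed

text \<open>The space at \<open>i\<close> is a line that generates everything, so a proper
  subrepresentation vanishes at \<open>i\<close>. The largest such family, \<open>N\<close>, is
  therefore the only maximal subrepresentation and equals the radical.\<close>

lemma top_dimvec_P_rep:
  assumes n: "n \<ge> 1" and i: "i \<in> vertices n"
  shows "top_dimvec n (P_rep n i :: 'k::{field,finite} rep) = (\<lambda>j. if j = i then 1 else 0)"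
proof -
  let ?P = "P_rep n i :: 'k rep"
  have pi: "is_path n i i p \<longleftrightarrow> p = [i]" for p
  proof
    assume p: "is_path n i i p"
    then have "\<not> length p \<ge> 2" using is_path_le(2)[OF p n] by blast
    moreover have "p \<noteq> []" "hd p = i" using p by (auto simp: is_path_def)
    ultimately show "p = [i]" by (cases p rule: remdups_adj.cases) auto
  qed (use i in \<open>simp add: is_path_singleton\<close>)
  have sp_i: "space ?P i = {v. \<forall>p. p \<noteq> [i] \<longrightarrow> v p = 0}"
    unfolding P_rep_def by (simp add: pi)
  have dim_i: "kv.dim (space ?P i) = 1" and fin_i: "finite (space ?P i)"
    unfolding sp_i by (rule line_subspace)+
  have zero: "space ?P j = {0}" if "j < i" for j
  proof -
    have "\<not> is_path n i j p" for p using is_path_le(1)[of n i j p] n that by auto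
    then show ?thesis by (auto simp: P_rep_def fun_eq_iff)
  qed
  define N where "N = (\<lambda>j\<in>vertices n. if j = i then {0} else space ?P j)"
  have dz: "kv.dim {0 :: 'k kvec} = 0" by (simp add: dim_zero_subspace_iff)
  have ne: "space ?P i \<noteq> {0}" using dim_i dz by auto
  have N_sub: "subrep n ?P N"
    unfolding subrep_def
  proof (intro conjI ballI)
    fix j assume "j \<in> vertices n"
    then show "kv.subspace (N j)" "N j \<subseteq> space ?P j"
      using P_rep_subspace[of n i j, where ?'k='k] kv.subspace_0[OF P_rep_subspace, of n i j]
      by (auto simp: N_def simp del: vertices_iff)
  next
    fix a assume "a \<in> arrows n"
    moreover obtain x y where a: "a = (x, y)" by (cases a)
    ultimately have xy: "(x, y) \<in> arrows n" by simp
    note v = arrows_reverse(1,2)[OF xy n]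
    have sub: "N x \<subseteq> space ?P x"
      using v kv.subspace_0[OF P_rep_subspace, of n i x] by (auto simp: N_def simp del: vertices_iff)
    have "arr ?P (x, y) w \<in> N y" if w: "w \<in> N x" for w
    proof (cases "y = i")
      case True
      then have "x < i" using arrows_less[OF xy n] by simp
      then have "w = 0" using w sub zero by auto
      moreover have "arr ?P (x, y) 0 = 0" by (rule ext) (simp add: P_rep_arr)
      ultimately show ?thesis using v True by (simp add: N_def del: vertices_iff)
    next
      case False
      then show ?thesis using P_rep_arr_in[OF xy _ n, of w i] w sub v by (auto simp: N_def simp del: vertices_iff)
    qed
    then show "case a of (x, y) \<Rightarrow> arr ?P (x, y) ` N x \<subseteq> N y" unfolding a by auto
  qed (simp add: N_def)
  have i_cases: "N' i = {0} \<or> (\<forall>j\<in>vertices n. N' j = space ?P j)" if N': "subrep n ?P N'" for N'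
  proof -
    have s: "kv.subspace (N' i)" "N' i \<subseteq> space ?P i" using N' i unfolding subrep_def by blast+
    have f: "finite (N' i)" using s fin_i finite_subset by blast
    have "kv.dim (N' i) \<le> 1" using subspace_dim_mono[OF s(1) P_rep_subspace fin_i s(2)] dim_i by simp
    then consider "kv.dim (N' i) = 0" | "kv.dim (N' i) = 1" by linarith
    then show ?thesis
    proof cases
      case 1
      then show ?thesis using dim_zero_subspace_iff[OF s(1) f] by simp
    next
      case 2
      then have "N' i = space ?P i"
        using subspace_eq_if_dim_eq[OF s(1) P_rep_subspace fin_i s(2)] dim_i by simp
      then show ?thesis using P_rep_generated[OF n N'] by blast
    qed
  qed
  have below: "N' j \<subseteq> N j" if N': "subrep n ?P N'" "N' i = {0}" and j: "j \<in> vertices n" for N' j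
    using N' j unfolding subrep_def N_def by (auto simp del: vertices_iff)
  have ext_eq: "A = B" if "subrep n ?P A" "subrep n ?P B" "\<And>j. j \<in> vertices n \<Longrightarrow> A j = B j" for A B
  proof -
    have "A \<in> extensional (vertices n)" "B \<in> extensional (vertices n)" using that(1,2) unfolding subrep_def by blast+
    then show ?thesis by (rule extensionalityI) (rule that(3))
  qed
  have N_max: "maximal_subrep n ?P N"
    unfolding maximal_subrep_def
  proof (intro conjI allI impI)
    show "\<exists>j\<in>vertices n. N j \<noteq> space ?P j"
      using i ne by (intro bexI[of _ i]) (auto simp: N_def simp del: vertices_iff)
    fix N' assume N': "subrep n ?P N' \<and> (\<forall>j\<in>vertices n. N j \<subseteq> N' j)"
    show "N' = N \<or> (\<forall>j\<in>vertices n. N' j = space ?P j)"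
    proof (cases "N' i = {0}")
      case True
      have "N' j = N j" if "j \<in> vertices n" for j using below[OF conjunct1[OF N'] True that] conjunct2[OF N'] that by blast
      then show ?thesis using ext_eq[of N' N] N' N_sub by blast
    qed (use i_cases N' in blast)
  qed (rule N_sub)
  have max_only: "M = N" if M: "maximal_subrep n ?P M" for M
  proof -
    have sM: "subrep n ?P M" and pM: "\<exists>j\<in>vertices n. M j \<noteq> space ?P j"
      and mM: "\<And>N'. subrep n ?P N' \<Longrightarrow> (\<forall>j\<in>vertices n. M j \<subseteq> N' j) \<Longrightarrow> N' = M \<or> (\<forall>j\<in>vertices n. N' j = space ?P j)"
      using M unfolding maximal_subrep_def by blast+
    have Mi: "M i = {0}" using i_cases[OF sM] pM by blast
    have "\<forall>j\<in>vertices n. M j \<subseteq> N j" using below[OF sM Mi] by blast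
    then have "N = M \<or> (\<forall>j\<in>vertices n. N j = space ?P j)" by (rule mM[OF N_sub])
    moreover have "N i \<noteq> space ?P i" using i ne by (auto simp: N_def simp del: vertices_iff)
    ultimately show ?thesis using i by blast
  qed
  have rad: "rad n ?P j = N j" if j: "j \<in> vertices n" for j
  proof -
    have "N j \<subseteq> space ?P j" using N_sub j unfolding subrep_def by blast
    then show ?thesis unfolding rad_def using N_max max_only by blast
  qed
  show ?thesis
  proof
    fix j
    show "top_dimvec n ?P j = (if j = i then 1 else 0)"
    proof (cases "j \<in> vertices n")
      case True
      then show ?thesis using rad[OF True] dim_i dz
        by (auto simp: top_dimvec_def N_def simp del: vertices_iff)
    next
      case False
      then show ?thesis using i by (auto simp: top_dimvec_def simp del: vertices_iff)
    qed
  qed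
qed

lemma zero_rep_facts:
  assumes n: "n \<ge> 1"
  shows "top_dimvec n (zero_rep :: 'k::{field,finite} rep) = 0" "dimvec n (zero_rep :: 'k rep) = 0"
    and "card (Gr n (zero_rep :: 'k rep) 0) = 1"
proof -
  have dz: "kv.dim {0 :: 'k kvec} = 0" by (simp add: dim_zero_subspace_iff)
  have sp: "space (zero_rep :: 'k rep) j = {0}" for j by (simp add: zero_rep_def)
  show "dimvec n (zero_rep :: 'k rep) = 0" by (auto simp: dimvec_def sp dz fun_eq_iff)
  have rad: "rad n (zero_rep :: 'k rep) j = {0}" if j: "j \<in> vertices n" for j
  proof -
    have "0 \<in> N j" if "maximal_subrep n (zero_rep :: 'k rep) N" for N
      using that subrep_zero[OF _ j] unfolding maximal_subrep_def by blast
    then show ?thesis by (auto simp: rad_def sp)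
  qed
  show "top_dimvec n (zero_rep :: 'k rep) = 0"
    using rad by (auto simp: top_dimvec_def sp fun_eq_iff simp del: vertices_iff)
  have "Gr n (zero_rep :: 'k rep) 0 = {\<lambda>j\<in>vertices n. {0}}"
  proof (intro equalityI subsetI)
    fix N assume N: "N \<in> Gr n (zero_rep :: 'k rep) 0"
    then have s: "subrep n (zero_rep :: 'k rep) N" unfolding Gr_def by blast
    have "N j = (\<lambda>j\<in>vertices n. {0}) j" if j: "j \<in> vertices n" for j
    proof -
      have "N j \<subseteq> {0}" using s j unfolding subrep_def sp by blast
      then show ?thesis using subrep_zero[OF s j] j by auto
    qed
    moreover have "N \<in> extensional (vertices n)" using s unfolding subrep_def by blast
    ultimately have "N = (\<lambda>j\<in>vertices n. {0})" by (intro extensionalityI[of N "vertices n"]) auto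
    then show "N \<in> {\<lambda>j\<in>vertices n. {0}}" by simp
  next
    fix N :: "nat \<Rightarrow> 'k kvec set" assume N: "N \<in> {\<lambda>j\<in>vertices n. {0}}"
    have "subrep n (zero_rep :: 'k rep) N"
      unfolding subrep_def sp
    proof (intro conjI ballI)
      fix a assume "a \<in> arrows n"
      moreover obtain x y where a: "a = (x, y)" by (cases a)
      ultimately have xy: "(x, y) \<in> arrows n" by simp
      moreover have "arr (zero_rep :: 'k rep) (x, y) 0 = 0" by (simp add: zero_rep_def)
      ultimately show "case a of (i, j) \<Rightarrow> arr (zero_rep :: 'k rep) (i, j) ` N i \<subseteq> N j"
        using N arrows_reverse(1,2)[OF xy n] unfolding a by (simp del: vertices_iff)
    qed (use N in \<open>simp_all del: vertices_iff\<close>)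
    then show "N \<in> Gr n (zero_rep :: 'k rep) 0" unfolding Gr_def using N dz by (simp del: vertices_iff)
  qed
  then show "card (Gr n (zero_rep :: 'k rep) 0) = 1" by simp
qed

section \<open>The forms and the exponent vectors\<close>

lemma sum_vertices: "(\<Sum>j\<in>vertices n. f j) = (\<Sum>j = 1..2 * n. f j)"
  by (simp add: vertices_def)

lemma finite_vertices [simp]: "finite (vertices n)"
  by (simp add: vertices_def)

lemma mat_vec_add: "mat_vec n A (v + w) = mat_vec n A v + mat_vec n A w"
  by (simp add: mat_vec_def fun_eq_iff algebra_simps sum.distrib)

lemma mat_vec_diff: "mat_vec n A (v - w) = mat_vec n A v - mat_vec n A w"
  by (simp add: mat_vec_def fun_eq_iff algebra_simps sum_subtractf)

lemma bilin_add_left: "bilin n A (v + w) u = bilin n A v u + bilin n A w u"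
  by (simp add: bilin_def algebra_simps sum.distrib)

lemma bilin_add_right: "bilin n A u (v + w) = bilin n A u v + bilin n A u w"
  by (simp add: bilin_def algebra_simps sum.distrib)

lemma bilin_diff_left: "bilin n A (v - w) u = bilin n A v u - bilin n A w u"
  by (simp add: bilin_def algebra_simps sum_subtractf)

lemma bilin_diff_right: "bilin n A u (v - w) = bilin n A u v - bilin n A u w"
  by (simp add: bilin_def algebra_simps sum_subtractf)

lemma bilin_minus_left: "bilin n A (- v) u = - bilin n A v u"
  by (simp add: bilin_def sum_negf)

lemma bilin_mat_vec: "bilin n A v w = (\<Sum>i = 1..2 * n. v i * mat_vec n A w i)"
  unfolding bilin_def sum_vertices
  by (rule sum.cong) (simp_all add: mat_vec_def sum_vertices sum_distrib_left mult.assoc)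

lemma sum_two_points:
  fixes f :: "nat \<Rightarrow> int"
  assumes "finite S" "a \<in> S" "b \<in> S" "a \<noteq> b" "\<And>j. j \<in> S \<Longrightarrow> j \<noteq> a \<Longrightarrow> j \<noteq> b \<Longrightarrow> f j = 0"
  shows "(\<Sum>j\<in>S. f j) = f a + f b"
proof -
  have "(\<Sum>j\<in>S. f j) = (\<Sum>j\<in>{a, b}. f j)" using assms by (intro sum.mono_neutral_right) auto
  then show ?thesis using assms(4) by simp
qed

lemma B_row:
  assumes n2: "n \<ge> 2"
  shows "mat_vec n (B_mat n) e 1 = e 2 + e (2 * n)"
    and "2 \<le> j \<Longrightarrow> j < 2 * n \<Longrightarrow> mat_vec n (B_mat n) e j = e (Suc j) - e (j - 1)"
    and "mat_vec n (B_mat n) e (2 * n) = - e (2 * n - 1) - e 1"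
proof -
  have "(\<Sum>j\<in>vertices n. B_mat n 1 j * e j) = B_mat n 1 2 * e 2 + B_mat n 1 (2 * n) * e (2 * n)"
    using n2 by (intro sum_two_points) (auto simp: B_mat_def)
  moreover have "B_mat n 1 2 = 1" "B_mat n 1 (2 * n) = 1" using n2 by (auto simp: B_mat_def)
  ultimately show "mat_vec n (B_mat n) e 1 = e 2 + e (2 * n)"
    using n2 by (simp add: mat_vec_def)
  have "(\<Sum>j\<in>vertices n. B_mat n (2 * n) j * e j) = B_mat n (2 * n) (2 * n - 1) * e (2 * n - 1) + B_mat n (2 * n) 1 * e 1"
    using n2 by (intro sum_two_points) (auto simp: B_mat_def)
  moreover have "B_mat n (2 * n) (2 * n - 1) = -1" "B_mat n (2 * n) 1 = -1"
    using n2 by (auto simp: B_mat_def)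
  ultimately show "mat_vec n (B_mat n) e (2 * n) = - e (2 * n - 1) - e 1"
    using n2 by (simp add: mat_vec_def)
  assume j: "2 \<le> j" "j < 2 * n"
  have "(\<Sum>t\<in>vertices n. B_mat n j t * e t) = B_mat n j (Suc j) * e (Suc j) + B_mat n j (j - 1) * e (j - 1)"
    using j by (intro sum_two_points) (auto simp: B_mat_def)
  moreover have "B_mat n j (Suc j) = 1" "B_mat n j (j - 1) = -1" using j by (auto simp: B_mat_def)
  ultimately show "mat_vec n (B_mat n) e j = e (Suc j) - e (j - 1)" using j by (simp add: mat_vec_def)
qed

lemma I_minus_Rtr_eq: "I_minus_Rtr n i j = (if i = j then 1 else 0) - (if (i, j) \<in> arrows n then 1 else 0)"
proof -
  have "{a \<in> arrows n. a = (i, j)} = (if (i, j) \<in> arrows n then {(i, j)} else {})" by auto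
  then show ?thesis by (simp add: I_minus_Rtr_def R_mat_def)
qed

lemma E_row:
  assumes n2: "n \<ge> 2"
  shows "mat_vec n (I_minus_Rtr n) v 1 = v 1 - v 2 - v (2 * n)"
    and "2 \<le> j \<Longrightarrow> j < 2 * n \<Longrightarrow> mat_vec n (I_minus_Rtr n) v j = v j - v (Suc j)"
    and "mat_vec n (I_minus_Rtr n) v (2 * n) = v (2 * n)"
proof -
  have e: "(\<Sum>t\<in>vertices n. I_minus_Rtr n j t * v t)
      = v j - (\<Sum>t\<in>vertices n. if (j, t) \<in> arrows n then v t else 0)" if "j \<in> vertices n" for j
  proof -
    have "(\<Sum>t\<in>vertices n. I_minus_Rtr n j t * v t) = (\<Sum>t\<in>vertices n. (if j = t then v t else 0)
        - (if (j, t) \<in> arrows n then v t else 0))"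
      by (rule sum.cong) (auto simp: I_minus_Rtr_eq)
    then show ?thesis using that by (simp add: sum_subtractf del: vertices_iff)
  qed
  have "(\<Sum>t\<in>vertices n. if (1, t) \<in> arrows n then v t else 0)
      = (if (1, 2) \<in> arrows n then v 2 else 0) + (if (1, 2 * n) \<in> arrows n then v (2 * n) else 0)"
    using n2 by (intro sum_two_points) (auto simp: arrows_def)
  moreover have "(1, 2) \<in> arrows n" "(1, 2 * n) \<in> arrows n" using n2 by (auto simp: arrows_def)
  ultimately show "mat_vec n (I_minus_Rtr n) v 1 = v 1 - v 2 - v (2 * n)"
    using e[of 1] n2 by (simp add: mat_vec_def)
  have "(\<Sum>t\<in>vertices n. if (2 * n, t) \<in> arrows n then v t else 0) = 0"
    using n2 by (intro sum.neutral) (auto simp: arrows_def)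
  then show "mat_vec n (I_minus_Rtr n) v (2 * n) = v (2 * n)"
    using e[of "2 * n"] n2 by (simp add: mat_vec_def)
  assume j: "2 \<le> j" "j < 2 * n"
  have "(\<Sum>t\<in>vertices n. if (j, t) \<in> arrows n then v t else 0) = (\<Sum>t\<in>vertices n. if t = Suc j then v t else 0)"
    using j by (intro sum.cong) (auto simp: arrows_def)
  then show "mat_vec n (I_minus_Rtr n) v j = v j - v (Suc j)" using e[of j] j by (simp add: mat_vec_def)
qed

text \<open>The rows are differences along the path and telescope. Partial sums are needed because
  Lambda against an exponent of X_delta is a sum of coordinates whose sign changes at
  \<open>s\<close>.\<close>

lemma prefix_B:
  assumes n2: "n \<ge> 2" and s: "2 \<le> s" "s \<le> 2 * n"
  shows "(\<Sum>t = 1..<s. mat_vec n (B_mat n) a t) = a (2 * n) + a s + a (s - 1) - a 1"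
  using s
proof (induction s rule: dec_induct)
  case base
  have "{1..<2 :: nat} = {1}" by auto
  then show ?case using B_row(1)[OF n2, of a] by simp
next
  case (step s)
  then have "(\<Sum>t = 1..<Suc s. mat_vec n (B_mat n) a t)
      = (\<Sum>t = 1..<s. mat_vec n (B_mat n) a t) + mat_vec n (B_mat n) a s" by simp
  then show ?case using step B_row(2)[OF n2, of s a] by simp
qed

lemma prefix_E:
  assumes n2: "n \<ge> 2" and s: "2 \<le> s" "s \<le> 2 * n"
  shows "(\<Sum>t = 1..<s. mat_vec n (I_minus_Rtr n) v t) = v 1 - v (2 * n) - v s"
  using s
proof (induction s rule: dec_induct)
  case base
  have "{1..<2 :: nat} = {1}" by auto
  then show ?case using E_row(1)[OF n2, of v] by simp
next
  case (step s)
  then have "(\<Sum>t = 1..<Suc s. mat_vec n (I_minus_Rtr n) v t)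
      = (\<Sum>t = 1..<s. mat_vec n (I_minus_Rtr n) v t) + mat_vec n (I_minus_Rtr n) v s" by simp
  then show ?case using step E_row(2)[OF n2, of s v] by simp
qed

lemma total_B:
  assumes n2: "n \<ge> 2"
  shows "(\<Sum>t = 1..2 * n. mat_vec n (B_mat n) a t) = 2 * (a (2 * n) - a 1)"
proof -
  have "{1..2 * n} = insert (2 * n) {1..<2 * n}" using n2 by auto
  then show ?thesis using prefix_B[OF n2, of "2 * n" a] B_row(3)[OF n2, of a] n2 by simp
qed

lemma total_E:
  assumes n2: "n \<ge> 2"
  shows "(\<Sum>t = 1..2 * n. mat_vec n (I_minus_Rtr n) v t) = v 1 - v (2 * n)"
proof -
  have "{1..2 * n} = insert (2 * n) {1..<2 * n}" using n2 by auto
  then show ?thesis using prefix_E[OF n2, of "2 * n" v] E_row(3)[OF n2, of v] n2 by simp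
qed

definition unit_vec :: "nat \<Rightarrow> nat \<Rightarrow> int" where
  "unit_vec i = (\<lambda>j. if j = i then 1 else 0)"

text \<open>The subrepresentations of \<open>E(c)\<close> have the dimension vectors \<open>tail_vec n s\<close> with \<open>1 \<le> s \<le> 2 * n + 1\<close>,
  where \<open>s = 2 * n + 1\<close> gives the zero vector; each occurs once.\<close>

definition delta_exp :: "nat \<Rightarrow> nat \<Rightarrow> nat \<Rightarrow> int" where
  "delta_exp n s = - mat_vec n (B_mat n) (tail_vec n s) - mat_vec n (I_minus_Rtr n) (delta n)"

lemma tail_vec_1: "tail_vec n 1 = delta n"
  by (auto simp: tail_vec_def delta_def fun_eq_iff)

lemma tail_vec_top: "tail_vec n (Suc (2 * n)) = 0"
  by (auto simp: tail_vec_def fun_eq_iff)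

lemma mat_vec_outside: "j \<notin> vertices n \<Longrightarrow> mat_vec n A v j = 0"
  by (simp add: mat_vec_def del: vertices_iff)

lemma vertex_cases:
  assumes "j \<in> vertices n"
  obtains "j = 1" | "2 \<le> j" "j < 2 * n" | "j = 2 * n"
  using assms by fastforce

lemma mat_vec_eqI:
  assumes "\<And>j. j \<notin> vertices n \<Longrightarrow> f j = 0" "f 1 = mat_vec n A v 1" "f (2 * n) = mat_vec n A v (2 * n)"
    "\<And>j. 2 \<le> j \<Longrightarrow> j < 2 * n \<Longrightarrow> f j = mat_vec n A v j"
  shows "mat_vec n A v = f"
proof
  fix j show "mat_vec n A v j = f j"
  proof (cases "j \<in> vertices n")
    case True
    then show ?thesis by (cases rule: vertex_cases) (use assms in simp_all)
  qed (simp add: mat_vec_outside assms(1) del: vertices_iff)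
qed

lemma E_delta:
  assumes n2: "n \<ge> 2"
  shows "mat_vec n (I_minus_Rtr n) (delta n) = unit_vec (2 * n) - unit_vec 1"
  by (rule mat_vec_eqI) (use n2 in \<open>auto simp: E_row(1)[OF n2, unfolded One_nat_def] E_row(2,3)[OF n2] delta_def unit_vec_def\<close>)

lemma B_delta:
  assumes n2: "n \<ge> 2"
  shows "mat_vec n (B_mat n) (delta n) = 2 * unit_vec 1 - 2 * unit_vec (2 * n)"
  by (rule mat_vec_eqI) (use n2 in \<open>auto simp: B_row(1)[OF n2, unfolded One_nat_def] B_row(2,3)[OF n2] delta_def unit_vec_def\<close>)

lemma B_tail:
  assumes n2: "n \<ge> 2" and s: "2 \<le> s" "s \<le> 2 * n"
  shows "mat_vec n (B_mat n) (tail_vec n s) = unit_vec 1 + unit_vec (s - 1) + unit_vec s - unit_vec (2 * n)"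
  by (rule mat_vec_eqI)
     (use n2 s in \<open>auto simp: B_row(1)[OF n2, unfolded One_nat_def] B_row(2,3)[OF n2] tail_vec_def unit_vec_def\<close>)

lemma delta_exp_eq:
  assumes n2: "n \<ge> 2"
  shows "delta_exp n 1 = unit_vec (2 * n) - unit_vec 1"
    "delta_exp n (Suc (2 * n)) = unit_vec 1 - unit_vec (2 * n)"
    "2 \<le> s \<Longrightarrow> s \<le> 2 * n \<Longrightarrow> delta_exp n s = - unit_vec (s - 1) - unit_vec s"
proof -
  have "mat_vec n (B_mat n) 0 = 0" by (simp add: mat_vec_def fun_eq_iff)
  then show "delta_exp n (Suc (2 * n)) = unit_vec 1 - unit_vec (2 * n)"
    by (simp add: delta_exp_def tail_vec_top E_delta[OF n2])
  show "delta_exp n 1 = unit_vec (2 * n) - unit_vec 1"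
    unfolding delta_exp_def tail_vec_1 B_delta[OF n2] E_delta[OF n2] by (simp add: fun_eq_iff)
  show "delta_exp n s = - unit_vec (s - 1) - unit_vec s" if "2 \<le> s" "s \<le> 2 * n"
    unfolding delta_exp_def B_tail[OF n2 that] E_delta[OF n2] by (simp add: fun_eq_iff)
qed

section \<open>Lambda against the exponents of X_delta\<close>

lemma sum_unit_vec: "i \<in> vertices n \<Longrightarrow> (\<Sum>j\<in>vertices n. unit_vec i j * f j) = f i"
proof -
  assume i: "i \<in> vertices n"
  have "(\<Sum>j\<in>vertices n. unit_vec i j * f j) = (\<Sum>j\<in>vertices n. if j = i then f j else 0)"
    by (rule sum.cong) (auto simp: unit_vec_def)
  then show ?thesis using i by (simp del: vertices_iff)
qed

lemma Lambda_unit_left: "i \<in> vertices n \<Longrightarrow> bilin n Lambda_mat (unit_vec i) y = (\<Sum>j\<in>vertices n. Lambda_mat i j * y j)"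
  unfolding bilin_def by (subst sum.swap) (simp add: mult.assoc sum_unit_vec)

text \<open>Of two adjacent vertices exactly one has odd distance from \<open>t\<close>, so the sum
  of their two rows is constant on either side of \<open>s\<close>. In the extreme cases the rows of
  1 and 2n combine in the same way, as 2n - 1 is odd.\<close>

lemma Lambda_delta_exp:
  assumes n2: "n \<ge> 2" and s: "1 \<le> s" "s \<le> Suc (2 * n)"
  shows "bilin n Lambda_mat (delta_exp n s) y = (\<Sum>t\<in>vertices n. if t < s then y t else - y t)"
proof -
  consider "s = 1" | "s = Suc (2 * n)" | "2 \<le> s" "s \<le> 2 * n" using s by linarith
  then show ?thesis
  proof cases
    case 1
    have "bilin n Lambda_mat (delta_exp n s) y = (\<Sum>t\<in>vertices n. Lambda_mat (2 * n) t * y t - Lambda_mat 1 t * y t)"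
      using n2 by (simp add: 1 delta_exp_eq[OF n2, unfolded One_nat_def] bilin_diff_left Lambda_unit_left sum_subtractf)
    also have "\<dots> = (\<Sum>t\<in>vertices n. if t < s then y t else - y t)"
      by (rule sum.cong) (auto simp: 1 Lambda_mat_def)
    finally show ?thesis .
  next
    case 2
    have "bilin n Lambda_mat (delta_exp n s) y = (\<Sum>t\<in>vertices n. Lambda_mat 1 t * y t - Lambda_mat (2 * n) t * y t)"
      using n2 by (simp add: 2 delta_exp_eq[OF n2, unfolded One_nat_def] bilin_diff_left Lambda_unit_left sum_subtractf)
    also have "\<dots> = (\<Sum>t\<in>vertices n. if t < s then y t else - y t)"
      by (rule sum.cong) (auto simp: 2 Lambda_mat_def)
    finally show ?thesis .
  next
    case 3
    have "bilin n Lambda_mat (delta_exp n s) y = - bilin n Lambda_mat (unit_vec (s - 1)) y - bilin n Lambda_mat (unit_vec s) y"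
      unfolding delta_exp_eq(3)[OF n2 3] bilin_diff_left bilin_minus_left ..
    moreover have "s - 1 \<in> vertices n" "s \<in> vertices n" using 3 by auto
    ultimately have "bilin n Lambda_mat (delta_exp n s) y
        = (\<Sum>t\<in>vertices n. - Lambda_mat (s - 1) t * y t - Lambda_mat s t * y t)"
      by (simp add: Lambda_unit_left sum_subtractf sum_negf del: vertices_iff)
    also have "\<dots> = (\<Sum>t\<in>vertices n. if t < s then y t else - y t)"
    proof (rule sum.cong)
      fix t assume t: "t \<in> vertices n"
      show "- Lambda_mat (s - 1) t * y t - Lambda_mat s t * y t = (if t < s then y t else - y t)"
      proof (cases "t < s")
        case True
        then have "Lambda_mat (s - 1) t + Lambda_mat s t = -1"
          using 3 by (cases "t = s - 1") (auto simp: Lambda_mat_def)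
        then have "(Lambda_mat (s - 1) t + Lambda_mat s t) * y t = - y t" by simp
        then show ?thesis using True by (simp add: algebra_simps)
      next
        case False
        then have "Lambda_mat (s - 1) t + Lambda_mat s t = 1"
          using 3 by (cases "t = s") (auto simp: Lambda_mat_def)
        then have "(Lambda_mat (s - 1) t + Lambda_mat s t) * y t = y t" by simp
        then show ?thesis using False by (simp add: algebra_simps)
      qed
    qed simp
    finally show ?thesis .
  qed
qed

lemma sum_signed_prefix:
  fixes y :: "nat \<Rightarrow> int"
  assumes s: "1 \<le> s" "s \<le> Suc (2 * n)"
  shows "(\<Sum>t\<in>vertices n. if t < s then y t else - y t) = 2 * (\<Sum>t = 1..<s. y t) - (\<Sum>t = 1..2 * n. y t)"
proof -
  have "(\<Sum>t\<in>vertices n. if t < s then y t else - y t) = (\<Sum>t\<in>vertices n. 2 * (if t \<in> {1..<s} then y t else 0) - y t)"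
    by (rule sum.cong) auto
  also have "\<dots> = 2 * (\<Sum>t\<in>vertices n. if t \<in> {1..<s} then y t else 0) - (\<Sum>t\<in>vertices n. y t)"
    by (simp add: sum_subtractf sum_distrib_left)
  also have "(\<Sum>t\<in>vertices n. if t \<in> {1..<s} then y t else 0) = (\<Sum>t = 1..<s. y t)"
  proof -
    have "vertices n \<inter> {1..<s} = {1..<s}" using s by (auto simp: vertices_def)
    then show ?thesis by (metis finite_vertices sum.inter_restrict)
  qed
  finally show ?thesis by (simp add: sum_vertices)
qed

definition char_exp :: "nat \<Rightarrow> (nat \<Rightarrow> int) \<Rightarrow> (nat \<Rightarrow> int) \<Rightarrow> nat \<Rightarrow> int" where
  "char_exp n v e = - mat_vec n (B_mat n) e - mat_vec n (I_minus_Rtr n) v"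

lemma Lambda_delta_exp_char_exp:
  assumes n2: "n \<ge> 2"
  shows "bilin n Lambda_mat (delta_exp n 1) (char_exp n v a) = 2 * (a (2 * n) - a 1) + (v 1 - v (2 * n))"
    and "bilin n Lambda_mat (delta_exp n (Suc (2 * n))) (char_exp n v a) = - 2 * (a (2 * n) - a 1) - (v 1 - v (2 * n))"
    and "2 \<le> s \<Longrightarrow> s \<le> 2 * n \<Longrightarrow> bilin n Lambda_mat (delta_exp n s) (char_exp n v a)
      = 2 * (v s - a s - a (s - 1)) - (v 1 - v (2 * n))"
proof -
  have tot: "(\<Sum>t = 1..2 * n. char_exp n v a t) = - 2 * (a (2 * n) - a 1) - (v 1 - v (2 * n))"
    using total_B[OF n2, of a] total_E[OF n2, of v] by (simp add: char_exp_def sum_subtractf sum_negf)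
  show "bilin n Lambda_mat (delta_exp n 1) (char_exp n v a) = 2 * (a (2 * n) - a 1) + (v 1 - v (2 * n))"
    using Lambda_delta_exp[OF n2, of 1] sum_signed_prefix[of 1 n] tot by simp
  have "{1..<Suc (2 * n)} = {1..2 * n}" by auto
  then show "bilin n Lambda_mat (delta_exp n (Suc (2 * n))) (char_exp n v a) = - 2 * (a (2 * n) - a 1) - (v 1 - v (2 * n))"
    using Lambda_delta_exp[OF n2, of "Suc (2 * n)"] sum_signed_prefix[of "Suc (2 * n)" n] tot by simp
  assume s: "2 \<le> s" "s \<le> 2 * n"
  have pre: "(\<Sum>t = 1..<s. char_exp n v a t) = - (a (2 * n) + a s + a (s - 1) - a 1) - (v 1 - v (2 * n) - v s)"
    using prefix_B[OF n2 s, of a] prefix_E[OF n2 s, of v] by (simp add: char_exp_def sum_subtractf sum_negf)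
  show "bilin n Lambda_mat (delta_exp n s) (char_exp n v a) = 2 * (v s - a s - a (s - 1)) - (v 1 - v (2 * n))"
    using Lambda_delta_exp[OF n2, of s "char_exp n v a"] sum_signed_prefix[of s n "char_exp n v a"] tot pre s
    by simp
qed

section \<open>The Euler form against tail vectors\<close>

lemma euler_add_left: "euler_form n (v + w) u = euler_form n v u + euler_form n w u"
  and euler_add_right: "euler_form n u (v + w) = euler_form n u v + euler_form n u w"
  and euler_diff_left: "euler_form n (v - w) u = euler_form n v u - euler_form n w u"
  and euler_diff_right: "euler_form n u (v - w) = euler_form n u v - euler_form n u w"
  by (simp_all add: euler_form_def bilin_add_left bilin_add_right bilin_diff_left bilin_diff_right)

lemma euler_delta_left: "n \<ge> 2 \<Longrightarrow> euler_form n (delta n) w = 2 * (w 1 - w (2 * n))"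
proof -
  assume n2: "n \<ge> 2"
  have "(\<Sum>i = 1..2 * n. delta n i * mat_vec n (I_minus_Rtr n) w i) = (\<Sum>i = 1..2 * n. mat_vec n (I_minus_Rtr n) w i)"
    by (rule sum.cong) (auto simp: delta_def)
  then show ?thesis using total_E[OF n2, of w] by (simp add: euler_form_def bilin_mat_vec)
qed

lemma euler_tail_left:
  assumes n2: "n \<ge> 2" and s: "2 \<le> s" "s \<le> 2 * n"
  shows "euler_form n (tail_vec n s) w = 2 * w s"
proof -
  have "(\<Sum>i = 1..2 * n. tail_vec n s i * mat_vec n (I_minus_Rtr n) w i)
      = (\<Sum>i = 1..2 * n. mat_vec n (I_minus_Rtr n) w i - (if i \<in> {1..<s} then mat_vec n (I_minus_Rtr n) w i else 0))"
    by (rule sum.cong) (auto simp: tail_vec_def)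
  also have "\<dots> = (\<Sum>i = 1..2 * n. mat_vec n (I_minus_Rtr n) w i) - (\<Sum>i = 1..2 * n. if i \<in> {1..<s} then mat_vec n (I_minus_Rtr n) w i else 0)"
    by (rule sum_subtractf)
  also have "(\<Sum>i = 1..2 * n. if i \<in> {1..<s} then mat_vec n (I_minus_Rtr n) w i else 0) = (\<Sum>i = 1..<s. mat_vec n (I_minus_Rtr n) w i)"
  proof -
    have "{1..2 * n} \<inter> {1..<s} = {1..<s}" using s by auto
    then show ?thesis by (metis finite_atLeastAtMost sum.inter_restrict)
  qed
  finally show ?thesis using total_E[OF n2, of w] prefix_E[OF n2 s, of w] by (simp add: euler_form_def bilin_mat_vec)
qed

lemma E_tail:
  assumes n2: "n \<ge> 2" and s: "2 \<le> s" "s \<le> 2 * n"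
  shows "mat_vec n (I_minus_Rtr n) (tail_vec n s) = unit_vec (2 * n) - unit_vec 1 - unit_vec (s - 1)"
  by (rule mat_vec_eqI)
     (use n2 s in \<open>auto simp: E_row(1)[OF n2, unfolded One_nat_def] E_row(2,3)[OF n2] tail_vec_def unit_vec_def\<close>)

lemma euler_tail_right:
  assumes n2: "n \<ge> 2"
  shows "euler_form n a (delta n) = 2 * (a (2 * n) - a 1)"
    and "2 \<le> s \<Longrightarrow> s \<le> 2 * n \<Longrightarrow> euler_form n a (tail_vec n s) = 2 * (a (2 * n) - a 1 - a (s - 1))"
proof -
  have u: "(\<Sum>i = 1..2 * n. a i * unit_vec t i) = a t" if "t \<in> vertices n" for t
    using sum_unit_vec[OF that, of a] by (simp add: sum_vertices mult.commute)
  have v: "1 \<in> vertices n" "2 * n \<in> vertices n" using n2 by auto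
  show "euler_form n a (delta n) = 2 * (a (2 * n) - a 1)"
    using u[OF v(1)] u[OF v(2)]
    by (simp add: euler_form_def bilin_mat_vec E_delta[OF n2] right_diff_distrib sum_subtractf)
  assume s: "2 \<le> s" "s \<le> 2 * n"
  then have "s - 1 \<in> vertices n" by auto
  then show "euler_form n a (tail_vec n s) = 2 * (a (2 * n) - a 1 - a (s - 1))"
    using u[OF v(1)] u[OF v(2)] u[of "s - 1"]
    by (simp add: euler_form_def bilin_mat_vec E_tail[OF n2 s] right_diff_distrib sum_subtractf del: vertices_iff)
qed

section \<open>The quantum torus\<close>

definition half_power :: "nat \<Rightarrow> int \<Rightarrow> real" where
  "half_power q k = real q powr (of_int k / 2)"

definition torus_scale :: "real \<Rightarrow> torus_elem \<Rightarrow> torus_elem" where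
  "torus_scale c = Poly_Mapping.map ((*) c)"

lemma lookup_torus_scale: "Poly_Mapping.lookup (torus_scale c f) d = c * Poly_Mapping.lookup f d"
  unfolding torus_scale_def by (transfer fixing: c d) (simp add: when_def)

lemma torus_scale_single: "torus_scale c (Poly_Mapping.single d a) = Poly_Mapping.single d (c * a)"
  by (rule poly_mapping_eqI) (simp add: lookup_torus_scale lookup_single when_def)

text \<open>The identities are derived for arbitrary real coefficients. Membership in the carrier
  matters for the sums and differences of the module record, which agree with the ordinary ones only
  there.\<close>

global_interpretation tv: vector_space torus_scale
  by unfold_locales (auto intro!: poly_mapping_eqI simp: lookup_torus_scale lookup_add algebra_simps)

lemma poly_mapping_sum_singles: "(\<Sum>d\<in>Poly_Mapping.keys f. Poly_Mapping.single d (Poly_Mapping.lookup f d)) = f"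
  for f :: torus_elem
proof (rule poly_mapping_eqI)
  fix e
  have "Poly_Mapping.lookup (\<Sum>d\<in>Poly_Mapping.keys f. Poly_Mapping.single d (Poly_Mapping.lookup f d)) e
      = (\<Sum>d\<in>Poly_Mapping.keys f. if d = e then Poly_Mapping.lookup f e else 0)"
    unfolding lookup_sum by (rule sum.cong) (auto simp: lookup_single when_def)
  then show "Poly_Mapping.lookup (\<Sum>d\<in>Poly_Mapping.keys f. Poly_Mapping.single d (Poly_Mapping.lookup f d)) e
      = Poly_Mapping.lookup f e"
    by (simp add: in_keys_iff)
qed

section \<open>The algebra structure of the torus\<close>

locale torus =
  fixes n q :: nat
  assumes n2: "n \<ge> 2" and q0: "q > 0"
begin

abbreviation "hp \<equiv> half_power q"
abbreviation "\<Lambda> \<equiv> bilin n Lambda_mat"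
abbreviation tmult (infixl "\<star>" 70) where "f \<star> g \<equiv> torus_mult n q f g"
abbreviation "T \<equiv> quantum_torus n q"
abbreviation "monom d c \<equiv> (Poly_Mapping.single d c :: torus_elem)"

lemma hp_add: "hp (a + b) = hp a * hp b"
  by (simp add: half_power_def powr_add add_divide_distrib)

lemma hp_0: "hp 0 = 1" using q0 by (simp add: half_power_def)

text \<open>Frees the product from the exact supports, which may shrink under addition, so that
  distributivity becomes a statement about sums over common index sets.\<close>

lemma mult_superset:
  assumes "finite A" "finite B" "Poly_Mapping.keys f \<subseteq> A" "Poly_Mapping.keys g \<subseteq> B"
  shows "f \<star> g = (\<Sum>d\<in>A. \<Sum>e\<in>B. monom (d + e)
    (Poly_Mapping.lookup f d * Poly_Mapping.lookup g e * hp (\<Lambda> d e)))"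
proof -
  have "f \<star> g = (\<Sum>d\<in>Poly_Mapping.keys f. \<Sum>e\<in>B. monom (d + e)
      (Poly_Mapping.lookup f d * Poly_Mapping.lookup g e * hp (\<Lambda> d e)))"
    unfolding torus_mult_def half_power_def
    by (intro sum.cong refl sum.mono_neutral_left) (use assms in \<open>auto simp: in_keys_iff\<close>)
  also have "\<dots> = (\<Sum>d\<in>A. \<Sum>e\<in>B. monom (d + e)
      (Poly_Mapping.lookup f d * Poly_Mapping.lookup g e * hp (\<Lambda> d e)))"
    by (rule sum.mono_neutral_left) (use assms in \<open>auto simp: in_keys_iff\<close>)
  finally show ?thesis .
qed

lemma mult_add_left: "(f + g) \<star> h = f \<star> h + g \<star> h"
proof -
  let ?A = "Poly_Mapping.keys f \<union> Poly_Mapping.keys g"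
  have "(f + g) \<star> h = (\<Sum>d\<in>?A. \<Sum>e\<in>Poly_Mapping.keys h. monom (d + e)
    (Poly_Mapping.lookup (f + g) d * Poly_Mapping.lookup h e * hp (\<Lambda> d e)))"
    by (rule mult_superset) (use Poly_Mapping.keys_add[of f g] in auto)
  also have "\<dots> = (\<Sum>d\<in>?A. \<Sum>e\<in>Poly_Mapping.keys h. monom (d + e)
      (Poly_Mapping.lookup f d * Poly_Mapping.lookup h e * hp (\<Lambda> d e))) +
    (\<Sum>d\<in>?A. \<Sum>e\<in>Poly_Mapping.keys h. monom (d + e)
      (Poly_Mapping.lookup g d * Poly_Mapping.lookup h e * hp (\<Lambda> d e)))"
    by (simp add: lookup_add distrib_right single_add sum.distrib)
  also have "\<dots> = f \<star> h + g \<star> h"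
    by (intro arg_cong2[where f = "(+)"] mult_superset[symmetric]) auto
  finally show ?thesis .
qed

lemma mult_add_right: "h \<star> (f + g) = h \<star> f + h \<star> g"
proof -
  let ?A = "Poly_Mapping.keys f \<union> Poly_Mapping.keys g"
  have "h \<star> (f + g) = (\<Sum>d\<in>Poly_Mapping.keys h. \<Sum>e\<in>?A. monom (d + e)
    (Poly_Mapping.lookup h d * Poly_Mapping.lookup (f + g) e * hp (\<Lambda> d e)))"
    by (rule mult_superset) (use Poly_Mapping.keys_add[of f g] in auto)
  also have "\<dots> = (\<Sum>d\<in>Poly_Mapping.keys h. \<Sum>e\<in>?A. monom (d + e)
      (Poly_Mapping.lookup h d * Poly_Mapping.lookup f e * hp (\<Lambda> d e))) +
    (\<Sum>d\<in>Poly_Mapping.keys h. \<Sum>e\<in>?A. monom (d + e)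
      (Poly_Mapping.lookup h d * Poly_Mapping.lookup g e * hp (\<Lambda> d e)))"
    by (simp add: lookup_add distrib_right distrib_left single_add sum.distrib)
  also have "\<dots> = h \<star> f + h \<star> g"
    by (intro arg_cong2[where f = "(+)"] mult_superset[symmetric]) auto
  finally show ?thesis .
qed

lemma mult_0_left [simp]: "0 \<star> f = 0" and mult_0_right [simp]: "f \<star> 0 = 0"
  by (simp_all add: torus_mult_def)

lemma mult_single: "monom d a \<star> monom e b = monom (d + e) (a * b * hp (\<Lambda> d e))"
  by (subst mult_superset[of "{d}" "{e}"]) auto

lemma mult_sum_left: "(\<Sum>x\<in>A. f x) \<star> g = (\<Sum>x\<in>A. f x \<star> g)"
  by (induction A rule: infinite_finite_induct) (simp_all add: mult_add_left)

lemma mult_sum_right: "g \<star> (\<Sum>x\<in>A. f x) = (\<Sum>x\<in>A. g \<star> f x)"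
  by (induction A rule: infinite_finite_induct) (simp_all add: mult_add_right)

text \<open>Reduces scalar rules, associativity and the behaviour of the reversal to monomials, one
  factor at a time.\<close>

lemma additive_eqI:
  assumes "\<And>f g. P (f + g) = P f + P g" "\<And>f g. R (f + g) = R f + R g" "P 0 = 0" "R 0 = 0"
    "\<And>d c. P (monom d c) = (R (monom d c) :: torus_elem)"
  shows "P f = R f"
proof -
  have s: "S (\<Sum>x\<in>A. g x) = (\<Sum>x\<in>A. S (g x))" if "\<And>f g. S (f + g) = S f + S g" "S 0 = 0"
    for S :: "torus_elem \<Rightarrow> torus_elem" and A :: "(nat \<Rightarrow> int) set" and g
    by (induction A rule: infinite_finite_induct) (simp_all add: that)
  have "P (\<Sum>d\<in>Poly_Mapping.keys f. monom d (Poly_Mapping.lookup f d))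
      = R (\<Sum>d\<in>Poly_Mapping.keys f. monom d (Poly_Mapping.lookup f d))"
    using s[of P] s[of R] assms by simp
  then show ?thesis unfolding poly_mapping_sum_singles .
qed

lemma mult_scale_left: "torus_scale c f \<star> g = torus_scale c (f \<star> g)"
proof (rule additive_eqI[where P = "\<lambda>f. torus_scale c f \<star> g" and R = "\<lambda>f. torus_scale c (f \<star> g)"])
  fix d a
  show "torus_scale c (monom d a) \<star> g = torus_scale c (monom d a \<star> g)"
    by (rule additive_eqI[where P = "\<lambda>g. torus_scale c (monom d a) \<star> g" and R = "\<lambda>g. torus_scale c (monom d a \<star> g)"])
       (simp_all add: mult_add_right tv.scale_right_distrib torus_scale_single mult_single mult.assoc)
qed (simp_all add: mult_add_left tv.scale_right_distrib)

lemma mult_scale_right: "f \<star> torus_scale c g = torus_scale c (f \<star> g)"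
proof (rule additive_eqI[where P = "\<lambda>f. f \<star> torus_scale c g" and R = "\<lambda>f. torus_scale c (f \<star> g)"])
  fix d a
  show "monom d a \<star> torus_scale c g = torus_scale c (monom d a \<star> g)"
    by (rule additive_eqI[where P = "\<lambda>g. monom d a \<star> torus_scale c g" and R = "\<lambda>g. torus_scale c (monom d a \<star> g)"])
       (simp_all add: mult_add_right tv.scale_right_distrib torus_scale_single mult_single mult_ac)
qed (simp_all add: mult_add_left tv.scale_right_distrib)

lemma mult_assoc: "(f \<star> g) \<star> h = f \<star> (g \<star> h)"
proof (rule additive_eqI[where P = "\<lambda>f. (f \<star> g) \<star> h" and R = "\<lambda>f. f \<star> (g \<star> h)"])
  fix d a
  show "(monom d a \<star> g) \<star> h = monom d a \<star> (g \<star> h)"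
  proof (rule additive_eqI[where P = "\<lambda>g. (monom d a \<star> g) \<star> h" and R = "\<lambda>g. monom d a \<star> (g \<star> h)"])
    fix e b
    show "(monom d a \<star> monom e b) \<star> h = monom d a \<star> (monom e b \<star> h)"
      by (rule additive_eqI[where P = "\<lambda>h. (monom d a \<star> monom e b) \<star> h" and R = "\<lambda>h. monom d a \<star> (monom e b \<star> h)"])
         (simp_all add: mult_add_right mult_single bilin_add_left bilin_add_right hp_add add.assoc mult_ac)
  qed (simp_all add: mult_add_left mult_add_right)
qed (simp_all add: mult_add_left)

lemma mult_minus_left: "(- f) \<star> g = - (f \<star> g)"
  using mult_add_left[of f "- f" g] by (simp add: eq_neg_iff_add_eq_0 add.commute)

lemma mult_minus_right: "f \<star> (- g) = - (f \<star> g)"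
  using mult_add_right[of f g "- g"] by (simp add: eq_neg_iff_add_eq_0 add.commute)

lemma mult_diff_left: "(f - g) \<star> h = f \<star> h - g \<star> h"
  using mult_add_left[of f "- g" h] by (simp add: mult_minus_left)

lemma mult_diff_right: "h \<star> (f - g) = h \<star> f - h \<star> g"
  using mult_add_right[of h f "- g"] by (simp add: mult_minus_right)

lemma one_left: "1 \<star> f = f" and one_right: "f \<star> 1 = f"
proof -
  have z: "\<Lambda> 0 d = 0" "\<Lambda> d 0 = 0" for d by (simp_all add: bilin_def)
  show "1 \<star> f = f" unfolding single_one[symmetric]
    by (rule additive_eqI[where P = "\<lambda>f. monom 0 1 \<star> f" and R = "\<lambda>f. f"])
       (simp_all add: mult_add_right mult_single z hp_0 del: single_one)
  show "f \<star> 1 = f" unfolding single_one[symmetric]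
    by (rule additive_eqI[where P = "\<lambda>f. f \<star> monom 0 1" and R = "\<lambda>f. f"])
       (simp_all add: mult_add_left mult_single z hp_0 del: single_one)
qed

subsection \<open>The carrier\<close>

lemma coeff_hp: "of_int c * hp k \<in> half_power_coeffs q"
  unfolding half_power_def by (rule half_power_coeffs.monom)

lemma coeff_0: "0 \<in> half_power_coeffs q"
  using coeff_hp[of 0 0] by simp

lemma coeff_1: "1 \<in> half_power_coeffs q"
  using coeff_hp[of 1 0] by (simp add: hp_0)

lemma coeff_minus: "x \<in> half_power_coeffs q \<Longrightarrow> - x \<in> half_power_coeffs q"
proof (induction rule: half_power_coeffs.induct)
  case (monom c k)
  then show ?case using half_power_coeffs.monom[of "- c" q k] by simp
next
  case (add x y)
  then show ?case using half_power_coeffs.add[of "- x" q "- y"] by simp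
qed

lemma coeff_mult:
  assumes "x \<in> half_power_coeffs q" "y \<in> half_power_coeffs q"
  shows "x * y \<in> half_power_coeffs q"
  using assms(1)
proof (induction rule: half_power_coeffs.induct)
  case (monom c k)
  show ?case using assms(2)
  proof (induction rule: half_power_coeffs.induct)
    case (monom c' k')
    have "of_int (c * c') * hp (k + k') \<in> half_power_coeffs q" by (rule coeff_hp)
    then show ?case unfolding hp_add by (simp add: half_power_def mult_ac)
  next
    case (add y y')
    then show ?case by (simp add: distrib_left half_power_coeffs.add)
  qed
next
  case (add x x')
  then show ?case by (simp add: distrib_right half_power_coeffs.add)
qed

lemma carrier_iff: "f \<in> carrier T \<longleftrightarrow> (\<forall>e\<in>Poly_Mapping.keys f. \<forall>i. i \<notin> vertices n \<longrightarrow> e i = 0)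
    \<and> (\<forall>e. Poly_Mapping.lookup f e \<in> half_power_coeffs q)"
  by (simp add: quantum_torus_def)

lemma T_simps: "\<zero>\<^bsub>T\<^esub> = 0" "\<one>\<^bsub>T\<^esub> = 1" "f \<oplus>\<^bsub>T\<^esub> g = f + g" "f \<otimes>\<^bsub>T\<^esub> g = f \<star> g"
  "c \<odot>\<^bsub>T\<^esub> f = torus_scale c f"
  by (simp_all add: quantum_torus_def torus_scale_def)

lemma carrier_add: "f \<in> carrier T \<Longrightarrow> g \<in> carrier T \<Longrightarrow> f + g \<in> carrier T"
  unfolding carrier_iff using Poly_Mapping.keys_add[of f g]
  by (auto simp: lookup_add half_power_coeffs.add)

lemma carrier_minus: "f \<in> carrier T \<Longrightarrow> - f \<in> carrier T"
  unfolding carrier_iff by (auto simp: coeff_minus)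

lemma carrier_0: "0 \<in> carrier T"
  by (simp add: carrier_iff coeff_0)

lemma carrier_single:
  "(\<And>i. i \<notin> vertices n \<Longrightarrow> d i = 0) \<Longrightarrow> c \<in> half_power_coeffs q \<Longrightarrow> monom d c \<in> carrier T"
  unfolding carrier_iff by (auto simp: lookup_single when_def coeff_0 split: if_splits)

lemma carrier_sum: "(\<And>x. x \<in> A \<Longrightarrow> f x \<in> carrier T) \<Longrightarrow> (\<Sum>x\<in>A. f x) \<in> carrier T"
  by (induction A rule: infinite_finite_induct) (simp_all add: carrier_0 carrier_add)

lemma carrier_mult:
  assumes f: "f \<in> carrier T" and g: "g \<in> carrier T"
  shows "f \<star> g \<in> carrier T"
  unfolding mult_superset[OF finite_keys finite_keys order_refl order_refl]
proof (intro carrier_sum carrier_single)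
  fix d e assume d: "d \<in> Poly_Mapping.keys f" and e: "e \<in> Poly_Mapping.keys g"
  show "(d + e) i = 0" if i: "i \<notin> vertices n" for i
  proof -
    have "d i = 0" "e i = 0" using f g d e i unfolding carrier_iff by blast+
    then show ?thesis by simp
  qed
  have "1 * hp (\<Lambda> d e) \<in> half_power_coeffs q" using coeff_hp[of 1] by simp
  then show "Poly_Mapping.lookup f d * Poly_Mapping.lookup g e * hp (\<Lambda> d e) \<in> half_power_coeffs q"
    using f g unfolding carrier_iff by (simp add: coeff_mult)
qed

lemma T_abelian_group: "abelian_group T"
proof (rule abelian_groupI)
  fix x assume "x \<in> carrier T"
  then show "\<exists>y\<in>carrier T. y \<oplus>\<^bsub>T\<^esub> x = \<zero>\<^bsub>T\<^esub>"
    using carrier_minus by (intro bexI[of _ "- x"]) (simp_all add: T_simps)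
qed (simp_all add: T_simps carrier_add carrier_0 add_ac)

lemma T_minus:
  assumes "f \<in> carrier T" "g \<in> carrier T" shows "f \<ominus>\<^bsub>T\<^esub> g = f - g"
proof -
  interpret abelian_group T by (rule T_abelian_group)
  have "\<ominus>\<^bsub>T\<^esub> g = - g"
    using minus_equality[of "- g" g] assms carrier_minus by (simp add: T_simps)
  then show ?thesis by (simp add: a_minus_def T_simps)
qed

lemma T_finsum:
  assumes "finite A" "\<And>x. x \<in> A \<Longrightarrow> f x \<in> carrier T"
  shows "(\<Oplus>\<^bsub>T\<^esub>x\<in>A. f x) = (\<Sum>x\<in>A. f x)"
proof -
  interpret abelian_group T by (rule T_abelian_group)
  show ?thesis using assms
  proof (induction A rule: finite_induct)
    case empty
    then show ?case by (simp add: T_simps)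
  next
    case (insert x A)
    then show ?case by (subst finsum_insert) (auto simp: T_simps)
  qed
qed

subsection \<open>Chebyshev polynomials\<close>

text \<open>The second polynomial subtracts 2, whereas the general recursion with F_0 = 1 would
  subtract 1; hence the separate claim for 2 and the exclusion of \<open>m = 0\<close> in the
  third.\<close>

lemma chebyshev_rec:
  assumes x: "x \<in> carrier T"
  shows "chebyshev_F T m x \<in> carrier T"
    and "chebyshev_F T 2 x = x \<star> x - torus_scale 2 1"
    and "m \<ge> 1 \<Longrightarrow> chebyshev_F T (Suc (Suc m)) x = chebyshev_F T (Suc m) x \<star> x - chebyshev_F T m x
      \<or> m = 0"
proof -
  have one: "1 \<in> carrier T" unfolding single_one[symmetric]
    by (rule carrier_single) (simp_all add: coeff_1)
  have two: "1 + 1 \<in> carrier T" by (rule carrier_add[OF one one])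
  have s2: "torus_scale 2 1 = 1 + 1" using tv.scale_left_distrib[of 1 1 1] by simp
  have diff: "f - g \<in> carrier T" if "f \<in> carrier T" "g \<in> carrier T" for f g
    using carrier_add[OF that(1) carrier_minus[OF that(2)]] by simp
  have mem: "chebyshev_F T m x \<in> carrier T" for m
  proof (induction m rule: induct_nat_012)
    case 0
    then show ?case using one by (simp add: T_simps)
  next
    case 1
    then show ?case using x by simp
  next
    case (ge2 m)
    show ?case
    proof (cases m)
      case 0
      then show ?thesis using T_minus[OF carrier_mult[OF x x] two] diff[OF carrier_mult[OF x x] two]
        by (simp add: T_simps)
    next
      case (Suc k)
      then show ?thesis using T_minus[OF carrier_mult[OF ge2(2) x] ge2(1)] diff[OF carrier_mult[OF ge2(2) x] ge2(1)]
        by (simp add: T_simps)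
    qed
  qed
  then show "chebyshev_F T m x \<in> carrier T" .
  show "chebyshev_F T 2 x = x \<star> x - torus_scale 2 1"
    using T_minus[OF carrier_mult[OF x x] two]
    unfolding s2 by (simp add: T_simps numeral_2_eq_2)
  show "m \<ge> 1 \<Longrightarrow> chebyshev_F T (Suc (Suc m)) x = chebyshev_F T (Suc m) x \<star> x - chebyshev_F T m x \<or> m = 0"
    using T_minus[OF carrier_mult[OF mem x] mem] by (cases m) (simp_all add: T_simps)
qed

text \<open>Moves the new factor \<open>x\<close> of the recursion to the outside, where it can
  multiply the identity for the smaller index from the left.\<close>

lemma chebyshev_commute:
  assumes x: "x \<in> carrier T"
  shows "chebyshev_F T m x \<star> x = x \<star> chebyshev_F T m x"
proof (induction m rule: induct_nat_012)
  case 0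
  then show ?case by (simp add: T_simps one_left one_right)
next
  case 1
  then show ?case by simp
next
  case (ge2 m)
  show ?case
  proof (cases m)
    case 0
    then show ?thesis using chebyshev_rec(2)[OF x]
      by (simp add: numeral_2_eq_2 mult_diff_left mult_diff_right mult_assoc mult_scale_left mult_scale_right one_left one_right)
  next
    case (Suc k)
    then have "chebyshev_F T (Suc (Suc m)) x = chebyshev_F T (Suc m) x \<star> x - chebyshev_F T m x"
      using chebyshev_rec(3)[OF x, of m] by simp
    then show ?thesis using ge2 by (simp only: mult_diff_left mult_diff_right) (metis mult_assoc)
  qed
qed

text \<open>Both sequences are solutions of the recursion of the \<open>F\<^sub>m\<close>, rescaled by powers of \<open>q\<close>.\<close>

lemma chebyshev_mult:
  assumes x: "x \<in> carrier T" and Y0: "Y 0 = w" and Z0: "Z 0 = w"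
    and base: "x \<star> w = torus_scale (hp 1) (Y 1) + torus_scale (hp (-1)) (Z 1)"
    and Y: "\<And>l. x \<star> Y (Suc l) = torus_scale (hp 1) (Y (Suc (Suc l))) + torus_scale (hp (-1)) (Y l)"
    and Z: "\<And>l. x \<star> Z (Suc l) = torus_scale (hp (-1)) (Z (Suc (Suc l))) + torus_scale (hp 1) (Z l)"
  shows "chebyshev_F T (Suc m) x \<star> w
    = torus_scale (hp (int (Suc m))) (Y (Suc m)) + torus_scale (hp (- int (Suc m))) (Z (Suc m))"
proof (induction m rule: induct_nat_012)
  case 0
  then show ?case using base by simp
next
  case 1
  have "chebyshev_F T 2 x \<star> w = x \<star> (x \<star> w) - torus_scale 2 w"
    unfolding chebyshev_rec(2)[OF x] by (simp add: mult_diff_left mult_assoc mult_scale_left one_left)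
  also have "\<dots> = torus_scale (hp 1) (x \<star> Y (Suc 0)) + torus_scale (hp (-1)) (x \<star> Z (Suc 0)) - torus_scale 2 w"
    unfolding base by (simp add: mult_add_right mult_scale_right)
  \<comment> \<open>Both boundary terms \<open>Y 0\<close> and \<open>Z 0\<close> equal
    \<open>w\<close>, and together they cancel the constant 2 of F_2.\<close>
  also have "\<dots> = torus_scale (hp 2) (Y 2) + torus_scale (hp (-2)) (Z 2)"
  proof -
    have "hp 1 * hp 1 = hp 2" "hp (-1) * hp (-1) = hp (-2)" "hp 1 * hp (-1) = 1" "hp (-1) * hp 1 = 1"
      by (simp_all add: hp_add[symmetric] hp_0)
    moreover have "torus_scale 2 w = w + w"
      using tv.scale_left_distrib[of 1 1 w] by simp
    ultimately show ?thesis
      unfolding Y Z by (simp add: tv.scale_right_distrib Y0 Z0 numeral_2_eq_2)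
  qed
  finally show ?case by (simp add: numeral_2_eq_2)
next
  case (ge2 m)
  let ?k = "int (Suc (Suc m))"
  have "chebyshev_F T (Suc (Suc (Suc m))) x \<star> w
      = x \<star> (chebyshev_F T (Suc (Suc m)) x \<star> w) - chebyshev_F T (Suc m) x \<star> w"
    using chebyshev_rec(3)[OF x, of "Suc m"] chebyshev_commute[OF x, of "Suc (Suc m)"]
    by (simp add: mult_diff_left mult_assoc del: chebyshev_F.simps)
  also have "\<dots> = torus_scale (hp ?k) (x \<star> Y (Suc (Suc m))) + torus_scale (hp (- ?k)) (x \<star> Z (Suc (Suc m)))
      - (torus_scale (hp (?k - 1)) (Y (Suc m)) + torus_scale (hp (1 - ?k)) (Z (Suc m)))"
    unfolding ge2 by (simp add: mult_add_right mult_scale_right del: of_nat_Suc) simp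
  also have "\<dots> = torus_scale (hp (?k + 1)) (Y (Suc (Suc (Suc m)))) + torus_scale (hp (- ?k - 1)) (Z (Suc (Suc (Suc m))))"
  proof -
    have "hp ?k * hp 1 = hp (?k + 1)" "hp ?k * hp (-1) = hp (?k - 1)"
      "hp (- ?k) * hp (-1) = hp (- ?k - 1)" "hp (- ?k) * hp 1 = hp (1 - ?k)"
      unfolding hp_add[symmetric] by (simp_all add: add.commute)
    then show ?thesis unfolding Y Z by (simp add: tv.scale_right_distrib del: of_nat_Suc)
  qed
  finally show ?case by (simp add: algebra_simps)
qed

text \<open>By comparing \<open>x (Y\<^sub>l x)\<close> with \<open>(x Y\<^sub>l) x\<close> the recursion for left multiplication by \<open>x\<close> determines
  right multiplication by \<open>x\<close> from its first two values.\<close>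

lemma right_recursion:
  assumes L: "\<And>l. x \<star> Y (Suc l) = torus_scale (hp 1) (Y (Suc (Suc l))) + torus_scale (hp (-1)) (Y l)"
    and R0: "Y 1 \<star> x = torus_scale (hp (-1)) (Y 2) + torus_scale (hp 1) (Y 0)"
    and R1: "Y 2 \<star> x = torus_scale (hp (-1)) (Y 3) + torus_scale (hp 1) (Y 1)"
  shows "Y (Suc l) \<star> x = torus_scale (hp (-1)) (Y (Suc (Suc l))) + torus_scale (hp 1) (Y l)"
proof (induction l rule: induct_nat_012)
  case 0
  then show ?case using R0 by (simp add: numeral_2_eq_2)
next
  case 1
  then show ?case using R1 by (simp add: numeral_2_eq_2 numeral_3_eq_3)
next
  case (ge2 l)
  let ?s = torus_scale
  have h: "hp 1 * hp 1 = hp 2" "hp (-1) * hp (-1) = hp (-2)" "hp 1 * hp (-1) = 1" "hp (-1) * hp 1 = 1"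
    "hp (-2) * hp 1 = hp (-1)" "hp (-1) * hp 2 = hp 1"
    by (simp_all add: hp_add[symmetric] hp_0)
  have "(x \<star> Y (Suc (Suc l))) \<star> x = x \<star> (Y (Suc (Suc l)) \<star> x)" by (rule mult_assoc)
  then have "?s (hp 1) (Y (Suc (Suc (Suc l))) \<star> x) + ?s (hp (-1)) (Y (Suc l) \<star> x)
      = ?s (hp (-1)) (x \<star> Y (Suc (Suc (Suc l)))) + ?s (hp 1) (x \<star> Y (Suc l))"
    unfolding L ge2(2) by (simp add: mult_add_left mult_add_right mult_scale_left mult_scale_right L)
  then have "?s (hp 1) (Y (Suc (Suc (Suc l))) \<star> x)
      = Y (Suc (Suc (Suc (Suc l)))) + ?s (hp (-2)) (Y (Suc (Suc l)))
        + (?s (hp 2) (Y (Suc (Suc l))) + Y l) - (?s (hp (-2)) (Y (Suc (Suc l))) + Y l)"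
    unfolding L ge2(1) by (simp add: tv.scale_right_distrib h algebra_simps)
  then have "?s (hp 1) (Y (Suc (Suc (Suc l))) \<star> x) = Y (Suc (Suc (Suc (Suc l)))) + ?s (hp 2) (Y (Suc (Suc l)))"
    by simp
  then have "?s (hp (-1)) (?s (hp 1) (Y (Suc (Suc (Suc l))) \<star> x))
      = ?s (hp (-1)) (Y (Suc (Suc (Suc (Suc l)))) + ?s (hp 2) (Y (Suc (Suc l))))" by simp
  then show ?case by (simp add: tv.scale_right_distrib h)
qed

subsection \<open>Reversal of the vertices\<close>

definition flip_vertex :: "nat \<Rightarrow> nat" where
  "flip_vertex j = (if j \<in> vertices n then 2 * n + 1 - j else j)"

lemma flip_flip [simp]: "flip_vertex (flip_vertex j) = j"
  by (auto simp: flip_vertex_def)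

lemma bij_flip: "bij_betw flip_vertex (vertices n) (vertices n)"
  by (rule bij_betw_byWitness[where f' = flip_vertex]) (auto simp: flip_vertex_def)

lemma flip_comp [simp]: "(e \<circ> flip_vertex) \<circ> flip_vertex = (e :: nat \<Rightarrow> int)"
  by (simp add: fun_eq_iff)

lemma flip_add: "(d + e) \<circ> flip_vertex = (d \<circ> flip_vertex) + (e \<circ> flip_vertex :: nat \<Rightarrow> int)"
  by (simp add: fun_eq_iff)

lemma bilin_flip: "bilin n A (d \<circ> flip_vertex) (e \<circ> flip_vertex)
    = bilin n (\<lambda>i j. A (flip_vertex i) (flip_vertex j)) d e"
proof -
  have "bilin n A (d \<circ> flip_vertex) (e \<circ> flip_vertex)
      = (\<Sum>i\<in>vertices n. \<Sum>j\<in>vertices n. d (flip_vertex i) * A i j * e (flip_vertex j))"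
    by (simp add: bilin_def)
  also have "\<dots> = (\<Sum>i\<in>vertices n. \<Sum>j\<in>vertices n. d i * A (flip_vertex i) j * e (flip_vertex j))"
    using sum.reindex_bij_betw[OF bij_flip,
        of "\<lambda>i. \<Sum>j\<in>vertices n. d i * A (flip_vertex i) j * e (flip_vertex j)"] by simp
  also have "\<dots> = (\<Sum>i\<in>vertices n. \<Sum>j\<in>vertices n. d i * A (flip_vertex i) (flip_vertex j) * e j)"
  proof (rule sum.cong[OF refl])
    fix i
    show "(\<Sum>j\<in>vertices n. d i * A (flip_vertex i) j * e (flip_vertex j))
        = (\<Sum>j\<in>vertices n. d i * A (flip_vertex i) (flip_vertex j) * e j)"
      using sum.reindex_bij_betw[OF bij_flip,
          of "\<lambda>j. d i * A (flip_vertex i) (flip_vertex j) * e j"] by simp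
  qed
  finally show ?thesis by (simp add: bilin_def)
qed

text \<open>Reversal keeps distances and inverts the order, so it transposes Lambda; this is what
  makes the induced map an anti-automorphism.\<close>

lemma Lambda_flip: "\<Lambda> (d \<circ> flip_vertex) (e \<circ> flip_vertex) = \<Lambda> e d"
proof -
  have "Lambda_mat (flip_vertex i) (flip_vertex j) = Lambda_mat j i" if "i \<in> vertices n" "j \<in> vertices n" for i j
  proof -
    have "2 * n + 1 - i < 2 * n + 1 - j \<longleftrightarrow> j < i" "2 * n + 1 - j < 2 * n + 1 - i \<longleftrightarrow> i < j" using that by auto
    moreover have "(2 * n + 1 - i) - (2 * n + 1 - j) = j - i" "(2 * n + 1 - j) - (2 * n + 1 - i) = i - j" using that by auto
    ultimately show ?thesis using that unfolding flip_vertex_def Lambda_mat_def by simp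
  qed
  then have "bilin n (\<lambda>i j. Lambda_mat (flip_vertex i) (flip_vertex j)) d e = (\<Sum>i\<in>vertices n. \<Sum>j\<in>vertices n. d i * Lambda_mat j i * e j)"
    unfolding bilin_def by (intro sum.cong refl) simp
  also have "\<dots> = \<Lambda> e d" unfolding bilin_def by (subst sum.swap) (simp add: mult_ac)
  finally show ?thesis unfolding bilin_flip .
qed

definition flip :: "torus_elem \<Rightarrow> torus_elem" where
  "flip = Poly_Mapping.map_key (\<lambda>e. e \<circ> flip_vertex)"

lemma inj_comp_flip: "inj (\<lambda>e :: nat \<Rightarrow> int. e \<circ> flip_vertex)"
  by (rule injI) (metis flip_comp)

lemma flip_single: "flip (monom d c) = monom (d \<circ> flip_vertex) c"
  using map_key_single[OF inj_comp_flip, of "d \<circ> flip_vertex" c] by (simp add: flip_def)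

lemma flip_plus: "flip (f + g) = flip f + flip g"
  unfolding flip_def by (rule map_key_plus[OF inj_comp_flip])

lemma flip_0: "flip 0 = 0"
  using flip_single[of 0 0] by simp

lemma flip_sum: "flip (\<Sum>x\<in>A. f x) = (\<Sum>x\<in>A. flip (f x))"
  by (induction A rule: infinite_finite_induct) (simp_all add: flip_plus flip_0)

lemma flip_scale: "flip (torus_scale c f) = torus_scale c (flip f)"
  by (rule additive_eqI[where P = "\<lambda>f. flip (torus_scale c f)" and R = "\<lambda>f. torus_scale c (flip f)"])
     (simp_all add: tv.scale_right_distrib flip_plus flip_0 torus_scale_single flip_single)

lemma flip_mult: "flip (f \<star> g) = flip g \<star> flip f"
proof (rule additive_eqI[where P = "\<lambda>f. flip (f \<star> g)" and R = "\<lambda>f. flip g \<star> flip f"])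
  fix d a
  show "flip (monom d a \<star> g) = flip g \<star> flip (monom d a)"
    by (rule additive_eqI[where P = "\<lambda>g. flip (monom d a \<star> g)" and R = "\<lambda>g. flip g \<star> flip (monom d a)"])
       (simp_all add: mult_add_left mult_add_right flip_plus flip_0 mult_single flip_single flip_add
          Lambda_flip add.commute mult_ac)
qed (simp_all add: mult_add_left mult_add_right flip_plus flip_0)

end

section \<open>Characters\<close>

lemma finite_sub_dimvecs: "finite (sub_dimvecs n v)"
proof (rule finite_subset)
  show "sub_dimvecs n v \<subseteq> (\<lambda>f j. if j \<in> vertices n then f j else 0) ` (\<Pi>\<^sub>E j\<in>vertices n. {0..v j})"
  proof
    fix e assume e: "e \<in> sub_dimvecs n v"
    have "e = (\<lambda>j. if j \<in> vertices n then (\<lambda>j\<in>vertices n. e j) j else 0)"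
      using e by (simp add: sub_dimvecs_def fun_eq_iff)
    moreover have "(\<lambda>j\<in>vertices n. e j) \<in> (\<Pi>\<^sub>E j\<in>vertices n. {0..v j})"
      using e by (simp add: sub_dimvecs_def PiE_iff)
    ultimately show "e \<in> (\<lambda>f j. if j \<in> vertices n then f j else 0) ` (\<Pi>\<^sub>E j\<in>vertices n. {0..v j})" by blast
  qed
  show "finite ((\<lambda>f j. if j \<in> vertices n then f j else 0) ` (\<Pi>\<^sub>E j\<in>vertices n. {0..v j}))"
    by (intro finite_imageI finite_PiE) simp_all
qed

text \<open>Matches the exponents on the two sides of the multiplication formula, so that only
  coefficients remain to be compared.\<close>

lemma char_exp_shift: "delta_exp n s + char_exp n v a = char_exp n (v + delta n) (a + tail_vec n s)"
  by (simp add: delta_exp_def char_exp_def mat_vec_add fun_eq_iff)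

section \<open>Characters of the objects in question\<close>

context torus begin

text \<open>The counting function is an argument, so that string counts can be substituted for the
  sizes of Grassmannians.\<close>

definition character :: "((nat \<Rightarrow> int) \<Rightarrow> real) \<Rightarrow> (nat \<Rightarrow> int) \<Rightarrow> torus_elem" where
  "character c v = (\<Sum>a\<in>sub_dimvecs n v. monom (char_exp n v a) (c a * hp (- euler_form n a (v - a))))"

lemma X_char_eq:
  fixes V P :: "'k::field rep"
  shows "X_char n q (V, P) = (\<Sum>a\<in>sub_dimvecs n (dimvec n V).
    monom (char_exp n (dimvec n V) a + top_dimvec n P)
      (real (card (Gr n V a)) * hp (- euler_form n a (dimvec n V - a))))"
  unfolding X_char_def Let_def prod.case
proof (subst T_finsum[OF finite_sub_dimvecs])
  fix a
  show "(real (card (Gr n V a)) * real q powr (- of_int (euler_form n a (dimvec n V - a)) / 2)) \<odot>\<^bsub>T\<^esub>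
      torus_monom (- mat_vec n (B_mat n) a - mat_vec n (I_minus_Rtr n) (dimvec n V) + top_dimvec n P) \<in> carrier T"
    unfolding T_simps torus_monom_def torus_scale_single
  proof (rule carrier_single)
    show "(- mat_vec n (B_mat n) a - mat_vec n (I_minus_Rtr n) (dimvec n V) + top_dimvec n P) i = 0"
      if "i \<notin> vertices n" for i
      using that by (simp add: mat_vec_outside top_dimvec_def del: vertices_iff)
    show "real (card (Gr n V a)) * real q powr (- of_int (euler_form n a (dimvec n V - a)) / 2) * 1 \<in> half_power_coeffs q"
      using coeff_hp[of "int (card (Gr n V a))" "- euler_form n a (dimvec n V - a)"]
      by (simp add: half_power_def)
  qed
qed (simp add: T_simps torus_monom_def torus_scale_single half_power_def char_exp_def)

lemma X_char_of_rep:
  fixes V :: "'k::{field,finite} rep"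
  shows "X_char n q (of_rep V) = character (\<lambda>e. real (card (Gr n V e))) (dimvec n V)"
proof -
  have "top_dimvec n (zero_rep :: 'k rep) = 0" by (rule zero_rep_facts(1)) (use n2 in simp)
  then show ?thesis unfolding of_rep_def X_char_eq character_def by simp
qed

lemma X_char_carrier:
  fixes V :: "'k::{field,finite} rep"
  shows "X_char n q (of_rep V) \<in> carrier T"
proof -
  have "monom (char_exp n (dimvec n V) a) (real (card (Gr n V a)) * hp (- euler_form n a (dimvec n V - a))) \<in> carrier T" for a
  proof (rule carrier_single)
    show "char_exp n (dimvec n V) a i = 0" if "i \<notin> vertices n" for i
      using that by (simp add: char_exp_def mat_vec_outside del: vertices_iff)
    show "real (card (Gr n V a)) * hp (- euler_form n a (dimvec n V - a)) \<in> half_power_coeffs q"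
      using coeff_hp[of "int (card (Gr n V a))"] by simp
  qed
  then show ?thesis unfolding X_char_of_rep character_def by (intro carrier_sum)
qed

lemma sub_dimvecs_0: "sub_dimvecs n 0 = {0}"
proof (intro equalityI subsetI)
  fix e assume e: "e \<in> sub_dimvecs n 0"
  have "e j = 0" for j
  proof (cases "j \<in> vertices n")
    case True
    then have "0 \<le> e j \<and> e j \<le> 0" using e unfolding sub_dimvecs_def by auto
    then show ?thesis by simp
  next
    case False
    then show ?thesis using e unfolding sub_dimvecs_def by blast
  qed
  then show "e \<in> {0}" by (simp add: fun_eq_iff)
qed (simp add: sub_dimvecs_def)

lemma X_char_I_shift:
  assumes i: "i \<in> vertices n"
  shows "X_char n q (I_shift n i :: 'k::{field,finite} cluster_obj) = monom (unit_vec i) 1"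
proof -
  have n1: "n \<ge> 1" using n2 by simp
  have z: "dimvec n (zero_rep :: 'k rep) = 0" "card (Gr n (zero_rep :: 'k rep) 0) = 1"
    using zero_rep_facts[OF n1] by auto
  have "mat_vec n A 0 = 0" for A by (simp add: mat_vec_def fun_eq_iff)
  then have "char_exp n 0 0 = 0" by (simp add: char_exp_def)
  moreover have "euler_form n 0 (0 - 0) = 0" by (simp add: euler_form_def bilin_def)
  moreover have "top_dimvec n (P_rep n i :: 'k rep) = unit_vec i"
    using top_dimvec_P_rep[OF n1 i] by (simp add: unit_vec_def)
  ultimately show ?thesis unfolding I_shift_def X_char_eq z sub_dimvecs_0 using z(2) hp_0 by simp
qed

lemma tail_vec_sub:
  assumes "s0 \<le> s" shows "tail_vec n s \<in> sub_dimvecs n (tail_vec n s0)"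
  using assms by (simp add: sub_dimvecs_def tail_vec_def)

lemma inj_tail_vec: "inj_on (tail_vec n) {1..Suc (2 * n)}"
proof (rule inj_onI)
  fix s t assume s: "s \<in> {1..Suc (2 * n)}" and t: "t \<in> {1..Suc (2 * n)}" and eq: "tail_vec n s = tail_vec n t"
  show "s = t"
  proof (rule ccontr)
    assume ne: "s \<noteq> t"
    then have "min s t \<in> vertices n" using s t by (auto simp: min_def)
    then show False using fun_cong[OF eq, of "min s t"] ne by (auto simp: tail_vec_def min_def split: if_splits)
  qed
qed

text \<open>All coefficients are 1: for 2 \<le> s \<le> 2n the Euler form of
  \<open>tail_vec n s\<close> against its complement is twice the value of the complement at
  \<open>s\<close>, which is 0; for the extreme values of \<open>s\<close> one of the two vectors is
  zero.\<close>

lemma thin_character: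
  assumes s0: "1 \<le> s0"
    and c: "\<And>e. c e = (if \<exists>s\<in>{s0..Suc (2 * n)}. \<forall>j\<in>vertices n. e j = tail_vec n s j then 1 else 0)"
  shows "character c (tail_vec n s0) = (\<Sum>s\<in>{s0..Suc (2 * n)}. monom (char_exp n (tail_vec n s0) (tail_vec n s)) 1)"
proof -
  let ?v = "tail_vec n s0"
  let ?f = "\<lambda>a. monom (char_exp n ?v a) (c a * hp (- euler_form n a (?v - a)))"
  have sub: "tail_vec n ` {s0..Suc (2 * n)} \<subseteq> sub_dimvecs n ?v" using tail_vec_sub by auto
  have "character c ?v = (\<Sum>a\<in>tail_vec n ` {s0..Suc (2 * n)}. ?f a)"
    unfolding character_def
  proof (rule sum.mono_neutral_right[OF finite_sub_dimvecs sub], rule ballI)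
    fix a assume a: "a \<in> sub_dimvecs n ?v - tail_vec n ` {s0..Suc (2 * n)}"
    have "\<not> (\<exists>s\<in>{s0..Suc (2 * n)}. \<forall>j\<in>vertices n. a j = tail_vec n s j)"
    proof
      assume "\<exists>s\<in>{s0..Suc (2 * n)}. \<forall>j\<in>vertices n. a j = tail_vec n s j"
      then obtain s where s: "s \<in> {s0..Suc (2 * n)}" "\<forall>j\<in>vertices n. a j = tail_vec n s j" by blast
      have "a = tail_vec n s"
      proof
        fix j show "a j = tail_vec n s j"
          using s(2) a by (cases "j \<in> vertices n") (simp_all add: sub_dimvecs_def tail_vec_def del: vertices_iff)
      qed
      then show False using s(1) a by blast
    qed
    then have "c a = 0" unfolding c by (rule if_not_P)
    then show "?f a = 0" by simp
  qed
  also have "\<dots> = (\<Sum>s\<in>{s0..Suc (2 * n)}. ?f (tail_vec n s))"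
    by (subst sum.reindex) (use s0 in \<open>auto intro: inj_on_subset[OF inj_tail_vec]\<close>)
  also have "\<dots> = (\<Sum>s\<in>{s0..Suc (2 * n)}. monom (char_exp n ?v (tail_vec n s)) 1)"
  proof (rule sum.cong[OF refl])
    fix s assume s: "s \<in> {s0..Suc (2 * n)}"
    have "c (tail_vec n s) = 1" using s unfolding c by auto
    moreover have "euler_form n (tail_vec n s) (?v - tail_vec n s) = 0"
    proof -
      consider "s = 1" | "s = Suc (2 * n)" | "2 \<le> s" "s \<le> 2 * n" using s s0 by force
      then show ?thesis
      proof cases
        case 1
        then have "s0 = s" using s s0 by simp
        then show ?thesis by (simp add: euler_form_def bilin_def)
      next
        case 2
        then show ?thesis by (simp add: tail_vec_top euler_form_def bilin_def)
      next
        case 3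
        then show ?thesis using euler_tail_left[OF n2 3] s by (simp add: tail_vec_def)
      qed
    qed
    ultimately show "?f (tail_vec n s) = monom (char_exp n ?v (tail_vec n s)) 1" by (simp add: hp_0)
  qed
  finally show ?thesis .
qed

definition x_delta :: torus_elem where
  "x_delta = (\<Sum>s\<in>{1..Suc (2 * n)}. monom (delta_exp n s) 1)"

lemma X_char_E_rep: "X_char n q (of_rep (E_rep n (c :: 'k::{field,finite}))) = x_delta"
proof -
  have d: "dimvec n (E_rep n c) = tail_vec n 1"
    unfolding tail_vec_1 by (auto simp: dimvec_def delta_def dim_E_rep fun_eq_iff)
  have "char_exp n (tail_vec n 1) (tail_vec n s) = delta_exp n s" for s
    by (simp only: char_exp_def delta_exp_def tail_vec_1)
  then show ?thesis
    unfolding X_char_of_rep d x_delta_def by (subst thin_character[OF _ card_Gr_E_rep[OF n2]]) simp_all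
qed

subsection \<open>Reversal\<close>

lemma arrows_flip:
  assumes "i \<in> vertices n" "j \<in> vertices n"
  shows "(flip_vertex i, flip_vertex j) \<in> arrows n \<longleftrightarrow> (j, i) \<in> arrows n"
proof -
  have n1: "n \<ge> 1" using n2 by simp
  have *: "(flip_vertex b, flip_vertex a) \<in> arrows n" if "(a, b) \<in> arrows n" for a b
    using arrows_reverse[OF that n1] by (simp add: flip_vertex_def del: vertices_iff)
  show ?thesis using *[of j i] *[of "flip_vertex i" "flip_vertex j"] by auto
qed

lemma I_minus_Rtr_flip:
  assumes "i \<in> vertices n" "j \<in> vertices n"
  shows "I_minus_Rtr n (flip_vertex i) (flip_vertex j) = I_minus_Rtr n j i"
proof -
  have "flip_vertex i = flip_vertex j \<longleftrightarrow> j = i"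
  proof
    assume "flip_vertex i = flip_vertex j"
    then have "flip_vertex (flip_vertex i) = flip_vertex (flip_vertex j)" by (rule arg_cong)
    then show "j = i" by simp
  qed simp
  then show ?thesis unfolding I_minus_Rtr_eq arrows_flip[OF assms] by simp
qed

lemma B_mat_eq:
  "B_mat n i j = (if (i, j) \<in> arrows n then 1 else 0) - (if (j, i) \<in> arrows n then 1 else 0)"
  using n2 by (auto simp: B_mat_def arrows_def)

lemma mat_vec_flip:
  assumes j: "j \<in> vertices n"
  shows "mat_vec n A (v \<circ> flip_vertex) (flip_vertex j) = (\<Sum>t\<in>vertices n. A (flip_vertex j) (flip_vertex t) * v t)"
proof -
  have "flip_vertex j \<in> vertices n" using j by (auto simp: flip_vertex_def)
  then have "mat_vec n A (v \<circ> flip_vertex) (flip_vertex j)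
      = (\<Sum>t\<in>vertices n. A (flip_vertex j) t * v (flip_vertex t))" by (simp add: mat_vec_def)
  then show ?thesis
    using sum.reindex_bij_betw[OF bij_flip, of "\<lambda>t. A (flip_vertex j) t * v (flip_vertex t)"] by simp
qed

text \<open>Reversal transposes the Euler matrix, which differs from its transpose by B. This
  difference is absorbed by the passage from \<open>a\<close> to \<open>v - a\<close>, since
  reversal also changes the sign of B.\<close>

lemma char_exp_flip:
  "char_exp n (v \<circ> flip_vertex) ((v - a) \<circ> flip_vertex) = char_exp n v a \<circ> flip_vertex"
proof -
  have "char_exp n (v \<circ> flip_vertex) ((v - a) \<circ> flip_vertex) (flip_vertex j) = char_exp n v a j" for j
  proof (cases "j \<in> vertices n")
    case True
    have B: "mat_vec n (B_mat n) ((v - a) \<circ> flip_vertex) (flip_vertex j) = - mat_vec n (B_mat n) (v - a) j"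
      unfolding mat_vec_flip[OF True]
      using True by (simp add: mat_vec_def B_mat_eq arrows_flip sum_negf[symmetric] algebra_simps del: vertices_iff
          cong: sum.cong)
    have E: "mat_vec n (I_minus_Rtr n) (v \<circ> flip_vertex) (flip_vertex j)
        = mat_vec n (B_mat n) v j + mat_vec n (I_minus_Rtr n) v j"
    proof -
      have "mat_vec n (I_minus_Rtr n) (v \<circ> flip_vertex) (flip_vertex j) = (\<Sum>t\<in>vertices n. I_minus_Rtr n t j * v t)"
        unfolding mat_vec_flip[OF True] by (rule sum.cong) (simp_all add: I_minus_Rtr_flip True del: vertices_iff)
      also have "\<dots> = (\<Sum>t\<in>vertices n. B_mat n j t * v t + I_minus_Rtr n j t * v t)"
        by (rule sum.cong) (auto simp: B_mat_eq I_minus_Rtr_eq)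
      finally show ?thesis using True by (simp add: mat_vec_def sum.distrib del: vertices_iff)
    qed
    show ?thesis using B E by (simp add: char_exp_def mat_vec_diff)
  next
    case False
    then have "flip_vertex j \<notin> vertices n" by (simp add: flip_vertex_def del: vertices_iff)
    then show ?thesis using False by (simp add: char_exp_def mat_vec_outside del: vertices_iff)
  qed
  from this[of "flip_vertex _"] show ?thesis by (simp add: fun_eq_iff)
qed

lemma euler_flip: "euler_form n (x \<circ> flip_vertex) (y \<circ> flip_vertex) = euler_form n y x"
proof -
  have "bilin n (\<lambda>i j. I_minus_Rtr n (flip_vertex i) (flip_vertex j)) x y
      = (\<Sum>i\<in>vertices n. \<Sum>j\<in>vertices n. x i * I_minus_Rtr n j i * y j)"
    unfolding bilin_def by (intro sum.cong refl) (simp add: I_minus_Rtr_flip del: vertices_iff)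
  also have "\<dots> = bilin n (I_minus_Rtr n) y x" unfolding bilin_def by (subst sum.swap) (simp add: mult_ac)
  finally show ?thesis by (simp add: euler_form_def bilin_flip)
qed

text \<open>Annihilators have complementary dimension vectors, so the term \<open>a\<close>
  corresponds to \<open>v - a\<close> with reversed vertices. The reversal also exchanges the two
  arguments of the Euler form, and the coefficients agree.\<close>

lemma flip_character:
  assumes v: "\<And>j. j \<notin> vertices n \<Longrightarrow> v j = 0"
    and c: "\<And>a. a \<in> sub_dimvecs n v \<Longrightarrow> c' ((v - a) \<circ> flip_vertex) = c a"
  shows "character c' (v \<circ> flip_vertex) = flip (character c v)"
proof -
  let ?h = "\<lambda>a. (v - a) \<circ> flip_vertex"
  have fv: "flip_vertex j \<in> vertices n \<longleftrightarrow> j \<in> vertices n" for j by (auto simp: flip_vertex_def)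
  have h_in: "?h a \<in> sub_dimvecs n (v \<circ> flip_vertex)" if a: "a \<in> sub_dimvecs n v" for a
  proof -
    have "0 \<le> a j" "a j \<le> v j" if "j \<in> vertices n" for j using a that unfolding sub_dimvecs_def by blast+
    moreover have "a j = 0" if "j \<notin> vertices n" for j using a that unfolding sub_dimvecs_def by blast
    ultimately show ?thesis unfolding sub_dimvecs_def using fv v by (simp del: vertices_iff)
  qed
  have bij: "bij_betw ?h (sub_dimvecs n v) (sub_dimvecs n (v \<circ> flip_vertex))"
  proof (rule bij_betw_byWitness[where f' = "\<lambda>b. v - (b \<circ> flip_vertex)"])
    show "(\<lambda>b. v - (b \<circ> flip_vertex)) ` sub_dimvecs n (v \<circ> flip_vertex) \<subseteq> sub_dimvecs n v"
    proof (rule image_subsetI)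
      fix b assume b: "b \<in> sub_dimvecs n (v \<circ> flip_vertex)"
      have 1: "0 \<le> b j" "b j \<le> v (flip_vertex j)" if "j \<in> vertices n" for j
        using b that unfolding sub_dimvecs_def by auto
      have 2: "b j = 0" if "j \<notin> vertices n" for j using b that unfolding sub_dimvecs_def by blast
      have "0 \<le> b (flip_vertex j)" "b (flip_vertex j) \<le> v j" if "j \<in> vertices n" for j
        using 1[of "flip_vertex j"] that fv[of j] by (simp_all del: vertices_iff)
      then show "v - (b \<circ> flip_vertex) \<in> sub_dimvecs n v"
        unfolding sub_dimvecs_def using 2 fv v by (simp del: vertices_iff)
    qed
    show "?h ` sub_dimvecs n v \<subseteq> sub_dimvecs n (v \<circ> flip_vertex)" using h_in by blast
  qed (simp_all add: fun_eq_iff)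
  have "character c' (v \<circ> flip_vertex) = (\<Sum>a\<in>sub_dimvecs n v.
      monom (char_exp n (v \<circ> flip_vertex) (?h a)) (c' (?h a) * hp (- euler_form n (?h a) ((v \<circ> flip_vertex) - ?h a))))"
    unfolding character_def using sum.reindex_bij_betw[OF bij,
      of "\<lambda>b. monom (char_exp n (v \<circ> flip_vertex) b) (c' b * hp (- euler_form n b ((v \<circ> flip_vertex) - b)))"] by simp
  also have "\<dots> = (\<Sum>a\<in>sub_dimvecs n v. flip (monom (char_exp n v a) (c a * hp (- euler_form n a (v - a)))))"
  proof (rule sum.cong[OF refl])
    fix a assume a: "a \<in> sub_dimvecs n v"
    have "(v \<circ> flip_vertex) - ?h a = a \<circ> flip_vertex" by (simp add: fun_eq_iff)
    then show "monom (char_exp n (v \<circ> flip_vertex) (?h a)) (c' (?h a) * hp (- euler_form n (?h a) ((v \<circ> flip_vertex) - ?h a)))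
        = flip (monom (char_exp n v a) (c a * hp (- euler_form n a (v - a))))"
      using c[OF a] euler_flip[of "v - a" a] by (simp add: char_exp_flip flip_single)
  qed
  finally show ?thesis unfolding character_def flip_sum .
qed

lemma unit_vec_flip: "i \<in> vertices n \<Longrightarrow> unit_vec i \<circ> flip_vertex = unit_vec (2 * n + 1 - i)"
  by (auto simp: unit_vec_def flip_vertex_def fun_eq_iff)

lemma delta_exp_flip:
  assumes s: "s \<in> {1..Suc (2 * n)}"
  shows "delta_exp n s \<circ> flip_vertex = delta_exp n (2 * n + 2 - s)"
proof -
  have d: "(f - g) \<circ> flip_vertex = (f \<circ> flip_vertex) - (g \<circ> flip_vertex)" "(- f) \<circ> flip_vertex = - (f \<circ> flip_vertex)"
    for f g :: "nat \<Rightarrow> int" by (simp_all add: fun_eq_iff)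
  have v: "1 \<in> vertices n" "2 * n \<in> vertices n" using n2 by auto
  have u: "unit_vec 1 \<circ> flip_vertex = unit_vec (2 * n)" "unit_vec (2 * n) \<circ> flip_vertex = unit_vec 1"
    using unit_vec_flip[OF v(1)] unit_vec_flip[OF v(2)] by simp_all
  consider "s = 1" | "s = Suc (2 * n)" | "2 \<le> s" "s \<le> 2 * n" using s by force
  then show ?thesis
  proof cases
    case 1
    have "2 * n + 2 - s = Suc (2 * n)" using 1 by simp
    then show ?thesis unfolding 1 by (simp only: delta_exp_eq[OF n2] d u)
  next
    case 2
    have "2 * n + 2 - s = 1" using 2 by simp
    then show ?thesis unfolding 2 by (simp only: delta_exp_eq[OF n2] d u)
  next
    case 3
    then have s': "2 \<le> 2 * n + 2 - s" "2 * n + 2 - s \<le> 2 * n" "s - 1 \<in> vertices n" "s \<in> vertices n" by auto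
    have e: "2 * n + 1 - (s - 1) = 2 * n + 2 - s" "2 * n + 1 - s = 2 * n + 2 - s - 1" using 3 by auto
    show ?thesis unfolding delta_exp_eq(3)[OF n2 3] delta_exp_eq(3)[OF n2 s'(1,2)] d
      unit_vec_flip[OF s'(3)] unit_vec_flip[OF s'(4)] e by (simp add: fun_eq_iff)
  qed
qed

lemma bij_reverse_interval: "1 \<le> a \<Longrightarrow> b \<le> Suc (2 * n) \<Longrightarrow>
    bij_betw (\<lambda>s. 2 * n + 2 - s) {a..b} {2 * n + 2 - b..2 * n + 2 - a}"
  by (rule bij_betw_byWitness[where f' = "\<lambda>s. 2 * n + 2 - s"]) auto

lemma flip_x_delta: "flip x_delta = x_delta"
proof -
  have "flip x_delta = (\<Sum>s\<in>{1..Suc (2 * n)}. monom (delta_exp n (2 * n + 2 - s)) 1)"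
    unfolding x_delta_def flip_sum by (rule sum.cong) (simp_all add: flip_single delta_exp_flip)
  also have "\<dots> = x_delta" unfolding x_delta_def
    using sum.reindex_bij_betw[OF bij_reverse_interval[of 1 "Suc (2 * n)"], of "\<lambda>s. monom (delta_exp n s) 1"] by simp
  finally show ?thesis .
qed

end

section \<open>Multiplication by \<open>X\<^sub>\<delta>\<close>\<close>

lemma string_count_eq_0:
  assumes n2: "n \<ge> 2" and a: "\<exists>j\<in>vertices n. a j < 0 \<or> int (string_dim i l j) < a j"
  shows "string_count (ty :: 'k::{field,finite} itself) n i l a = 0"
proof -
  have "Gr n (string_rep n i l :: 'k rep) a = {}"
  proof (rule ccontr)
    assume "Gr n (string_rep n i l :: 'k rep) a \<noteq> {}"
    then obtain N where N: "N \<in> Gr n (string_rep n i l :: 'k rep) a" by blast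
    obtain j where j: "j \<in> vertices n" "a j < 0 \<or> int (string_dim i l j) < a j" using a by blast
    have "kv.subspace (N j)" "N j \<subseteq> coord_space (string_dim i l j)" "int (kv.dim (N j)) = a j"
      using N j(1) unfolding Gr_string_rep_iff[OF n2] by blast+
    then have "kv.dim (N j) \<le> string_dim i l j"
      using subspace_dim_mono[of "N j" "coord_space (string_dim i l j)"] dim_coord_space[where ?'k='k] by simp
    then show False using j(2) \<open>int (kv.dim (N j)) = a j\<close> by linarith
  qed
  then show ?thesis by (simp add: string_count_def)
qed

definition string_vec :: "nat \<Rightarrow> nat \<Rightarrow> nat \<Rightarrow> nat \<Rightarrow> int" where
  "string_vec n i l = (\<lambda>j. if j \<in> vertices n then int (string_dim i l j) else 0)"

lemma string_vec_Suc: "string_vec n i (Suc l) = string_vec n i l + delta n"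
  by (auto simp: string_vec_def delta_def string_dim_def fun_eq_iff)

lemma string_vec_0: "string_vec n i 0 = tail_vec n (Suc i)"
  by (auto simp: string_vec_def tail_vec_def string_dim_def fun_eq_iff)

lemma sub_dimvecs_iff: "a \<in> sub_dimvecs n v \<longleftrightarrow> (\<forall>j\<in>vertices n. 0 \<le> a j \<and> a j \<le> v j) \<and> (\<forall>j. j \<notin> vertices n \<longrightarrow> a j = 0)"
  by (simp add: sub_dimvecs_def)

text \<open>Lets the sums for all \<open>s\<close> run over one common range of \<open>e\<close>:
  the shifted box lies inside the larger one and the hypothesis kills what is left.\<close>

lemma sum_sub_dimvecs_shift:
  fixes \<phi> :: "(nat \<Rightarrow> int) \<Rightarrow> torus_elem"
  assumes z: "\<And>a. (\<And>j. j \<notin> vertices n \<Longrightarrow> a j = 0) \<Longrightarrow> a \<notin> sub_dimvecs n v \<Longrightarrow> \<phi> a = 0"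
  shows "(\<Sum>e\<in>sub_dimvecs n (v + delta n). \<phi> (e - tail_vec n s)) = (\<Sum>a\<in>sub_dimvecs n v. \<phi> a)"
proof -
  let ?t = "\<lambda>a. a + tail_vec n s"
  have inj: "inj_on ?t (sub_dimvecs n v)" by (rule inj_onI) simp
  have "?t ` sub_dimvecs n v \<subseteq> sub_dimvecs n (v + delta n)"
  proof (rule image_subsetI)
    fix a assume a: "a \<in> sub_dimvecs n v"
    show "?t a \<in> sub_dimvecs n (v + delta n)"
      unfolding sub_dimvecs_iff
    proof (intro conjI ballI allI impI)
      fix j assume j: "j \<in> vertices n"
      have "0 \<le> a j \<and> a j \<le> v j" using a j unfolding sub_dimvecs_iff by blast
      then show "0 \<le> ?t a j" "?t a j \<le> (v + delta n) j" using j by (auto simp: tail_vec_def delta_def)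
    next
      fix j assume j: "j \<notin> vertices n"
      have "a j = 0" using a j unfolding sub_dimvecs_iff by blast
      then show "?t a j = 0" using j by (simp add: tail_vec_def del: vertices_iff)
    qed
  qed
  moreover have "\<phi> (e - tail_vec n s) = 0" if e: "e \<in> sub_dimvecs n (v + delta n) - ?t ` sub_dimvecs n v" for e
  proof (rule z)
    show "(e - tail_vec n s) j = 0" if "j \<notin> vertices n" for j
    proof -
      have "e \<in> sub_dimvecs n (v + delta n)" using e by (rule DiffD1)
      then have "e j = 0" using that unfolding sub_dimvecs_iff by blast
      then show ?thesis using that by (simp add: tail_vec_def del: vertices_iff)
    qed
    show "e - tail_vec n s \<notin> sub_dimvecs n v"
    proof
      assume "e - tail_vec n s \<in> sub_dimvecs n v"
      then have "?t (e - tail_vec n s) \<in> ?t ` sub_dimvecs n v" by (rule imageI)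
      then show False using e by simp
    qed
  qed
  ultimately have "(\<Sum>e\<in>sub_dimvecs n (v + delta n). \<phi> (e - tail_vec n s))
      = (\<Sum>e\<in>?t ` sub_dimvecs n v. \<phi> (e - tail_vec n s))"
    by (intro sum.mono_neutral_right finite_sub_dimvecs) auto
  also have "\<dots> = (\<Sum>a\<in>sub_dimvecs n v. \<phi> a)" by (simp add: sum.reindex[OF inj])
  finally show ?thesis .
qed

section \<open>Products of X_delta with the initial variables\<close>

context torus begin

text \<open>The terms of X_delta X_i to which the torus product gives the factor q^(1/2);
  \<open>x_below\<close> collects those with q^(-1/2). They will turn out to be the characters of
  M_i(0) for i < 2n and of N_i(0) for i \<ge> 2.\<close>

definition x_above :: "nat \<Rightarrow> torus_elem" where
  "x_above i = (\<Sum>s\<in>{Suc i..Suc (2 * n)}. monom (delta_exp n s + unit_vec i) 1)"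

definition x_below :: "nat \<Rightarrow> torus_elem" where
  "x_below i = (\<Sum>s\<in>{1..i}. monom (delta_exp n s + unit_vec i) 1)"

lemma Lambda_antisym: "\<Lambda> x y = - \<Lambda> y x"
proof -
  have "\<Lambda> x y = (\<Sum>i\<in>vertices n. \<Sum>j\<in>vertices n. - (y j * Lambda_mat j i * x i))"
    unfolding bilin_def by (intro sum.cong refl) (simp add: Lambda_mat_def)
  also have "\<dots> = - \<Lambda> y x" unfolding bilin_def by (subst sum.swap) (simp add: sum_negf)
  finally show ?thesis .
qed

lemma Lambda_delta_unit:
  assumes s: "s \<in> {1..Suc (2 * n)}" and i: "i \<in> vertices n"
  shows "\<Lambda> (delta_exp n s) (unit_vec i) = (if i < s then 1 else -1)"
proof -
  have "\<Lambda> (delta_exp n s) (unit_vec i) = (\<Sum>t\<in>vertices n. if t < s then unit_vec i t else - unit_vec i t)"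
    using Lambda_delta_exp[OF n2] s by simp
  also have "\<dots> = (\<Sum>t\<in>vertices n. unit_vec i t * (if t < s then 1 else -1))" by (rule sum.cong) auto
  finally show ?thesis unfolding sum_unit_vec[OF i] .
qed

lemma x_delta_split:
  assumes "i \<in> vertices n"
  shows "(\<Sum>s\<in>{1..Suc (2 * n)}. f s) = (\<Sum>s\<in>{Suc i..Suc (2 * n)}. f s) + (\<Sum>s\<in>{1..i}. f s :: torus_elem)"
proof -
  have "{1..Suc (2 * n)} = {Suc i..Suc (2 * n)} \<union> {1..i}" using assms by auto
  then show ?thesis by (metis (no_types, lifting) sum.union_disjoint finite_atLeastAtMost
        disjoint_iff atLeastAtMost_iff not_less_eq_eq)
qed

lemma base_left:
  assumes i: "i \<in> vertices n"
  shows "x_delta \<star> monom (unit_vec i) 1 = torus_scale (hp 1) (x_above i) + torus_scale (hp (-1)) (x_below i)"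
proof -
  have "x_delta \<star> monom (unit_vec i) 1
      = (\<Sum>s\<in>{1..Suc (2 * n)}. monom (delta_exp n s + unit_vec i) (hp (if i < s then 1 else -1)))"
    unfolding x_delta_def mult_sum_left by (rule sum.cong) (simp_all add: mult_single Lambda_delta_unit[OF _ i])
  also have "\<dots> = torus_scale (hp 1) (x_above i) + torus_scale (hp (-1)) (x_below i)"
    unfolding x_delta_split[OF i] x_above_def x_below_def tv.scale_sum_right torus_scale_single
    by (intro arg_cong2[where f = "(+)"] sum.cong) auto
  finally show ?thesis .
qed

lemma base_right:
  assumes i: "i \<in> vertices n"
  shows "monom (unit_vec i) 1 \<star> x_delta = torus_scale (hp (-1)) (x_above i) + torus_scale (hp 1) (x_below i)"
proof -
  have "monom (unit_vec i) 1 \<star> x_delta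
      = (\<Sum>s\<in>{1..Suc (2 * n)}. monom (delta_exp n s + unit_vec i) (hp (if i < s then -1 else 1)))"
    unfolding x_delta_def mult_sum_right
  proof (rule sum.cong)
    fix s assume s: "s \<in> {1..Suc (2 * n)}"
    have "\<Lambda> (unit_vec i) (delta_exp n s) = (if i < s then -1 else 1)"
      using Lambda_antisym[of "unit_vec i"] Lambda_delta_unit[OF s i] by simp
    then show "monom (unit_vec i) 1 \<star> monom (delta_exp n s) 1
        = monom (delta_exp n s + unit_vec i) (hp (if i < s then -1 else 1))"
      by (simp add: mult_single add.commute)
  qed simp
  also have "\<dots> = torus_scale (hp (-1)) (x_above i) + torus_scale (hp 1) (x_below i)"
    unfolding x_delta_split[OF i] x_above_def x_below_def tv.scale_sum_right torus_scale_single
    by (intro arg_cong2[where f = "(+)"] sum.cong) auto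
  finally show ?thesis .
qed

lemma Lambda_delta_delta:
  assumes t: "1 \<le> t" "t < s" and s: "s \<le> Suc (2 * n)"
  shows "\<Lambda> (delta_exp n s) (delta_exp n t) = (if t = 1 \<and> s = Suc (2 * n) then 0 else -2)"
proof -
  have s': "s \<in> {1..Suc (2 * n)}" using t s by simp
  have v: "1 \<in> vertices n" "2 * n \<in> vertices n" using n2 by auto
  have U: "\<Lambda> (delta_exp n s) (unit_vec k) = (if k < s then 1 else -1)" if "k \<in> vertices n" for k
    by (rule Lambda_delta_unit[OF s' that])
  show ?thesis
  proof (cases "t = 1")
    case True
    then show ?thesis
      unfolding True delta_exp_eq(1)[OF n2] bilin_diff_right U[OF v(1)] U[OF v(2)] using t s by auto
  next
    case False
    then have t2: "2 \<le> t" "t \<le> 2 * n" using t s by auto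
    have tv: "t - 1 \<in> vertices n" "t \<in> vertices n" using t2 by auto
    have "delta_exp n t = 0 - unit_vec (t - 1) - unit_vec t" using delta_exp_eq(3)[OF n2 t2] by simp
    moreover have "\<Lambda> (delta_exp n s) 0 = 0" by (simp add: bilin_def)
    ultimately have "\<Lambda> (delta_exp n s) (delta_exp n t) = 0 - (if t - 1 < s then 1 else -1) - (if t < s then 1 else -1)"
      by (simp only: bilin_diff_right U[OF tv(1)] U[OF tv(2)])
    then show ?thesis using t False by auto
  qed
qed

text \<open>The two products have the same terms: those from \<open>s, t > i\<close> cancel in pairs, and those from
  \<open>t \<le> i < s\<close> cancel individually, except for the extreme pair whose exponents are opposite.\<close>

lemma x_above_commutator:
  assumes i: "i \<in> vertices n"
  shows "x_above i \<star> x_delta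
    = torus_scale (hp (-2)) (x_delta \<star> x_above i) + torus_scale (hp 1 - hp (-3)) (monom (unit_vec i) 1)"
proof -
  let ?f = "delta_exp n" and ?u = "unit_vec i"
  let ?A = "{Suc i..Suc (2 * n)}"
  have i12: "1 \<le> i" "i \<le> 2 * n" using i by auto
  define G where "G = (\<lambda>s t. monom (?f s + ?u + ?f t) (hp (\<Lambda> (?f s + ?u) (?f t)) - hp (-2 - \<Lambda> (?f s + ?u) (?f t))))"
  have l1: "x_above i \<star> x_delta = (\<Sum>s\<in>?A. \<Sum>t\<in>{1..Suc (2 * n)}. monom (?f s + ?u + ?f t) (hp (\<Lambda> (?f s + ?u) (?f t))))"
    unfolding x_above_def mult_sum_left unfolding x_delta_def mult_sum_right
    by (intro sum.cong refl) (simp add: mult_single)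
  have l2: "torus_scale (hp (-2)) (x_delta \<star> x_above i)
      = (\<Sum>s\<in>?A. \<Sum>t\<in>{1..Suc (2 * n)}. monom (?f s + ?u + ?f t) (hp (-2 - \<Lambda> (?f s + ?u) (?f t))))"
  proof -
    have "torus_scale (hp (-2)) (x_delta \<star> x_above i)
        = (\<Sum>s\<in>?A. \<Sum>t\<in>{1..Suc (2 * n)}. torus_scale (hp (-2)) (monom (?f t) 1 \<star> monom (?f s + ?u) 1))"
      unfolding x_above_def mult_sum_right unfolding x_delta_def mult_sum_left tv.scale_sum_right by (rule refl)
    also have "\<dots> = (\<Sum>s\<in>?A. \<Sum>t\<in>{1..Suc (2 * n)}. monom (?f s + ?u + ?f t) (hp (-2 - \<Lambda> (?f s + ?u) (?f t))))"
    proof (intro sum.cong refl)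
      fix s t
      have "hp (-2) * hp (\<Lambda> (?f t) (?f s + ?u)) = hp (-2 - \<Lambda> (?f s + ?u) (?f t))"
        unfolding hp_add[symmetric] Lambda_antisym[of "?f t"] by simp
      then show "torus_scale (hp (-2)) (monom (?f t) 1 \<star> monom (?f s + ?u) 1)
          = monom (?f s + ?u + ?f t) (hp (-2 - \<Lambda> (?f s + ?u) (?f t)))"
        by (simp add: mult_single torus_scale_single add.commute[of "?f t"])
    qed
    finally show ?thesis .
  qed
  have "x_above i \<star> x_delta - torus_scale (hp (-2)) (x_delta \<star> x_above i) = (\<Sum>s\<in>?A. \<Sum>t\<in>{1..Suc (2 * n)}. G s t)"
    unfolding l1 l2 sum_subtractf[symmetric] G_def single_diff ..
  also have "\<dots> = (\<Sum>s\<in>?A. \<Sum>t\<in>?A. G s t) + (\<Sum>s\<in>?A. \<Sum>t\<in>{1..i}. G s t)"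
    unfolding x_delta_split[OF i] sum.distrib ..
  also have "(\<Sum>s\<in>?A. \<Sum>t\<in>?A. G s t) = 0"
  proof -
    have anti: "G s t = - G t s" if s: "s \<in> ?A" and t: "t \<in> ?A" for s t
    proof -
      have L: "\<Lambda> (?f s + ?u) (?f t) = \<Lambda> (?f s) (?f t) - 1" if "s \<in> ?A" "t \<in> ?A" for s t
      proof -
        have "\<Lambda> (?f t) ?u = 1" using Lambda_delta_unit[of t i] that i by auto
        then show ?thesis unfolding bilin_add_left using Lambda_antisym[of ?u "?f t"] by simp
      qed
      have 1: "- 2 - (\<Lambda> (?f s) (?f t) - 1) = \<Lambda> (?f t) (?f s) - 1"
        and 2: "- 2 - (\<Lambda> (?f t) (?f s) - 1) = \<Lambda> (?f s) (?f t) - 1"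
        using Lambda_antisym[of "?f s" "?f t"] by simp_all
      have 3: "?f s + ?u + ?f t = ?f t + ?u + ?f s" by (simp add: add_ac)
      show ?thesis unfolding G_def L[OF s t] L[OF t s] 1 2 3 single_uminus[symmetric] minus_diff_eq ..
    qed
    let ?S = "\<Sum>s\<in>?A. \<Sum>t\<in>?A. G s t"
    have "?S = (\<Sum>t\<in>?A. \<Sum>s\<in>?A. G s t)" by (rule sum.swap)
    also have "\<dots> = (\<Sum>t\<in>?A. \<Sum>s\<in>?A. - G t s)" by (intro sum.cong refl) (rule anti)
    also have "\<dots> = - ?S" unfolding sum_negf ..
    finally have "torus_scale 2 ?S = 0"
      using tv.scale_left_distrib[of 1 1 ?S] by (simp add: eq_neg_iff_add_eq_0)
    then show ?thesis by simp
  qed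
  also have "(\<Sum>s\<in>?A. \<Sum>t\<in>{1..i}. G s t) = torus_scale (hp 1 - hp (-3)) (monom ?u 1)"
  proof -
    have G: "G s t = (if s = Suc (2 * n) then if t = 1 then torus_scale (hp 1 - hp (-3)) (monom ?u 1) else 0 else 0)"
      if s: "s \<in> ?A" and t: "t \<in> {1..i}" for s t
    proof -
      have st: "1 \<le> t" "t < s" "s \<le> Suc (2 * n)" using s t by auto
      \<comment> \<open>The exponent is 1 for the extreme pair and -1 otherwise; -1 is the fixed
        point of \<open>z \<mapsto> -2 - z\<close>, so the other coefficients vanish.\<close>
      have "\<Lambda> ?u (?f t) = 1" using Lambda_antisym[of ?u "?f t"] Lambda_delta_unit[of t i] t i by auto
      then have L: "\<Lambda> (?f s + ?u) (?f t) = (if t = 1 \<and> s = Suc (2 * n) then 1 else -1)"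
        unfolding bilin_add_left Lambda_delta_delta[OF st] by simp
      show ?thesis
      proof (cases "t = 1 \<and> s = Suc (2 * n)")
        case True
        have e: "?f s + ?u + ?f t = ?u"
          using True delta_exp_eq(1,2)[OF n2] by (simp add: fun_eq_iff)
        show ?thesis unfolding G_def L e using True by (simp add: torus_scale_single)
      next
        case False
        have "(hp (- 1) - hp (- 2 - - 1)) = 0" by simp
        then show ?thesis unfolding G_def L using False by auto
      qed
    qed
    have "(\<Sum>s\<in>?A. \<Sum>t\<in>{1..i}. G s t) = (\<Sum>s\<in>?A. \<Sum>t\<in>{1..i}.
        if s = Suc (2 * n) then if t = 1 then torus_scale (hp 1 - hp (-3)) (monom ?u 1) else 0 else 0)"
      by (intro sum.cong refl) (rule G)
    also have "\<dots> = (\<Sum>s\<in>?A. if s = Suc (2 * n) then torus_scale (hp 1 - hp (-3)) (monom ?u 1) else 0)"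
      using i12 by (intro sum.cong refl) simp
    also have "\<dots> = torus_scale (hp 1 - hp (-3)) (monom ?u 1)" using i12 by simp
    finally show ?thesis .
  qed
  finally show ?thesis by (simp add: algebra_simps)
qed

end

section \<open>Left multiplication of the string characters by X_delta\<close>

locale torus_field = torus n q for n q +
  fixes ty :: "'k::{field,finite} itself"
  assumes card_k: "CARD('k) = q\<^sup>2"
begin

definition x_string :: "nat \<Rightarrow> nat \<Rightarrow> torus_elem" where
  "x_string i l = character (string_count ty n i l) (string_vec n i l)"

text \<open>The order of k is the square of q and \<open>hp\<close> counts half powers, whence the
  factor 4.\<close>

lemma powr_card: "real CARD('k) powr of_int z = hp (4 * z)"
proof -
  have "real CARD('k) = real q powr 2" using q0 unfolding card_k by (simp add: powr_realpow[of "real q" 2])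
  then have "real CARD('k) powr of_int z = real q powr (2 * of_int z)" by (simp only: powr_powr)
  then show ?thesis by (simp add: half_power_def)
qed

lemma x_string_0:
  assumes i: "1 \<le> i" "i < 2 * n"
  shows "x_string i 0 = x_above i"
proof -
  have "character (string_count ty n i 0) (tail_vec n (Suc i))
      = (\<Sum>s\<in>{Suc i..Suc (2 * n)}. monom (char_exp n (tail_vec n (Suc i)) (tail_vec n s)) 1)"
    by (rule thin_character) (use string_count_0[OF n2 i, where ?'k='k] in \<open>simp_all add: string_count_def\<close>)
  moreover have "char_exp n (tail_vec n (Suc i)) (tail_vec n s) = delta_exp n s + unit_vec i" for s
    using E_tail[OF n2, of "Suc i"] E_delta[OF n2] i by (simp add: char_exp_def delta_exp_def fun_eq_iff)
  ultimately show ?thesis by (simp add: x_string_def string_vec_0 x_above_def)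
qed

text \<open>Coefficients are compared after the substitution \<open>a = e - tail_vec n s\<close>.
  \<open>K s a\<close> is the power of q^(1/2) carried by the product of the term \<open>s\<close>
  of X_delta and the term \<open>a\<close> of the character; A, B and C below, for s = 2n + 1, s = 1
  and the remaining s, identify it with the power in the character of M(l+1) times the number of
  choices. The part of the counting recursion with \<open>lower_count\<close> is collected in
  \<open>\<psi>\<close>.\<close>

lemma left_mult:
  assumes i: "1 \<le> i" "i < 2 * n"
  shows "x_delta \<star> x_string i l = torus_scale (hp 1) (x_string i (Suc l))
    + torus_scale (hp (-1)) (if l = 0 then monom (unit_vec i) 1 else x_string i (l - 1))"
proof -
  interpret st: string_step n i l ty by unfold_locales (use n2 i in auto)
  let ?v = "string_vec n i l" and ?c = "string_count ty n i l" and ?b = st.lower_count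
  let ?t = "tail_vec n"
  let ?H = "char_exp n (?v + delta n)"
  define K where "K = (\<lambda>s a. \<Lambda> (delta_exp n s) (char_exp n ?v a) - euler_form n a (?v - a))"
  define \<phi> where "\<phi> = (\<lambda>s a. monom (?H (a + ?t s)) (?c a * hp (K s a)))"
  define \<psi> where "\<psi> = (\<lambda>a. monom (?H (a + ?t 1)) (?b a * hp (K 1 a)))"
  have v1: "1 \<in> vertices n" "2 * n \<in> vertices n" using n2 by auto
  \<comment> \<open>This defect between the ends of the quiver is the origin of the factors
    \<open>hp 1\<close> and \<open>hp (-1)\<close> in the recursion.\<close>
  have v12: "?v 1 - ?v (2 * n) = -1"
    using i v1 by (simp add: string_vec_def string_dim_def)
  have K1: "K 1 a = 2 * (a (2 * n) - a 1) - 1 - euler_form n a (?v - a)" for a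
    unfolding K_def Lambda_delta_exp_char_exp(1)[OF n2] v12 by simp
  have Ktop: "K (Suc (2 * n)) a = 1 - 2 * (a (2 * n) - a 1) - euler_form n a (?v - a)" for a
    unfolding K_def Lambda_delta_exp_char_exp(2)[OF n2] v12 by simp
  have Kmid: "K s a = 2 * (?v s - a s - a (s - 1)) + 1 - euler_form n a (?v - a)" if "2 \<le> s" "s \<le> 2 * n" for s a
    unfolding K_def Lambda_delta_exp_char_exp(3)[OF n2 that] v12 by simp
  have lhs: "x_delta \<star> x_string i l = (\<Sum>s\<in>{1..Suc (2 * n)}. \<Sum>a\<in>sub_dimvecs n ?v. \<phi> s a)"
    unfolding x_delta_def mult_sum_left unfolding x_string_def character_def mult_sum_right
  proof (intro sum.cong refl)
    fix s a
    have "hp (K s a) = hp (- euler_form n a (?v - a)) * hp (\<Lambda> (delta_exp n s) (char_exp n ?v a))"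
      unfolding K_def hp_add[symmetric] by simp
    then show "monom (delta_exp n s) 1 \<star> monom (char_exp n ?v a) (?c a * hp (- euler_form n a (?v - a))) = \<phi> s a"
      unfolding mult_single char_exp_shift \<phi>_def by (simp add: mult.assoc)
  qed
  have coeff: "hp 1 * (string_count ty n i (Suc l) e * hp (- euler_form n e (?v + delta n - e)))
      = (\<Sum>s\<in>{1..Suc (2 * n)}. ?c (e - ?t s) * hp (K s (e - ?t s))) - ?b (e - ?t 1) * hp (K 1 (e - ?t 1))"
    if e: "e \<in> sub_dimvecs n (?v + delta n)" for e
  proof -
    let ?x = "1 - euler_form n e (?v + delta n - e)"
    have A: "?x = K (Suc (2 * n)) (e - ?t (Suc (2 * n)))"
      unfolding Ktop tail_vec_top by (simp add: euler_add_right euler_diff_right euler_tail_right(1)[OF n2])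
    have B: "4 * (e (2 * n) - e 1 - 1) + ?x = K 1 (e - ?t 1)"
    proof -
      have 1: "?v + delta n - e = ?v - (e - delta n)" by simp
      have 2: "euler_form n e (?v - (e - delta n)) = euler_form n (e - delta n) (?v - (e - delta n))
          + euler_form n (delta n) (?v - (e - delta n))"
        unfolding euler_add_left[symmetric] by simp
      have 3: "euler_form n (delta n) (?v - (e - delta n)) = 2 * (-1 - (e 1 - 1) + (e (2 * n) - 1))"
        unfolding euler_delta_left[OF n2] using v12 v1 by (simp add: delta_def)
      have 4: "(e - delta n) (2 * n) - (e - delta n) 1 = e (2 * n) - e 1" using v1 by (simp add: delta_def)
      show ?thesis unfolding K1 tail_vec_1 1 2 3 4 by simp
    qed
    have C: "4 * (int (string_dim i l s) - (e s - 1)) + ?x = K s (e - ?t s)" if s: "2 \<le> s" "s \<le> 2 * n" for s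
    proof -
      define a where "a = e - ?t s"
      have e: "e = a + ?t s" by (simp add: a_def)
      have ts: "?t s s = 1" "?t s (s - 1) = 0" using s by (auto simp: tail_vec_def)
      have dl: "delta n s = 1" using s by (simp add: delta_def)
      have vs: "?v s = int (string_dim i l s)" using s by (simp add: string_vec_def)
      have "?v + delta n - e = (?v - a) + delta n - ?t s" by (simp add: e)
      then have "euler_form n e (?v + delta n - e) = euler_form n a (?v - a) + euler_form n a (delta n) - euler_form n a (?t s)
          + euler_form n (?t s) ((?v - a) + delta n - ?t s)"
        by (simp add: e euler_add_left euler_add_right euler_diff_right)
      also have "euler_form n (?t s) ((?v - a) + delta n - ?t s) = 2 * (?v s - a s)"
        unfolding euler_tail_left[OF n2 s] using ts dl by simp
      finally have F: "euler_form n e (?v + delta n - e)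
        = euler_form n a (?v - a) + euler_form n a (delta n) - euler_form n a (?t s) + 2 * (?v s - a s)" .
      have es: "e s = a s + 1" using ts by (simp add: e)
      show ?thesis
        unfolding Kmid[OF s] a_def[symmetric] F euler_tail_right(1)[OF n2] euler_tail_right(2)[OF n2 s] vs es
        by simp
    qed
    have "hp 1 * (string_count ty n i (Suc l) e * hp (- euler_form n e (?v + delta n - e)))
        = string_count ty n i (Suc l) e * hp ?x"
      using hp_add[of 1 "- euler_form n e (?v + delta n - e)"] by simp
    also have "\<dots> = ?c e * hp ?x
        + (\<Sum>s\<in>{2..2 * n}. ?c (e - ?t s) * hp (4 * (int (string_dim i l s) - (e s - 1)) + ?x))
        + (?c (e - ?t 1) - ?b (e - ?t 1)) * hp (4 * (e (2 * n) - e 1 - 1) + ?x)"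
      unfolding st.string_count_Suc powr_card hp_add[of _ ?x]
      by (simp only: distrib_right distrib_left sum_distrib_right sum_distrib_left mult_ac)
    also have "\<dots> = ?c (e - ?t (Suc (2 * n))) * hp (K (Suc (2 * n)) (e - ?t (Suc (2 * n))))
        + (\<Sum>s\<in>{2..2 * n}. ?c (e - ?t s) * hp (K s (e - ?t s)))
        + (?c (e - ?t 1) - ?b (e - ?t 1)) * hp (K 1 (e - ?t 1))"
    proof -
      have top: "e - ?t (Suc (2 * n)) = e" unfolding tail_vec_top by simp
      have mid: "(\<Sum>s\<in>{2..2 * n}. ?c (e - ?t s) * hp (4 * (int (string_dim i l s) - (e s - 1)) + ?x))
          = (\<Sum>s\<in>{2..2 * n}. ?c (e - ?t s) * hp (K s (e - ?t s)))"
      proof (rule sum.cong[OF refl])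
        fix s assume "s \<in> {2..2 * n}"
        then have "2 \<le> s" "s \<le> 2 * n" by auto
        from C[OF this] show "?c (e - ?t s) * hp (4 * (int (string_dim i l s) - (e s - 1)) + ?x)
            = ?c (e - ?t s) * hp (K s (e - ?t s))" by (rule arg_cong)
      qed
      show ?thesis unfolding mid B unfolding A top ..
    qed
    also have "\<dots> = (\<Sum>s\<in>{1..Suc (2 * n)}. ?c (e - ?t s) * hp (K s (e - ?t s))) - ?b (e - ?t 1) * hp (K 1 (e - ?t 1))"
    proof -
      have "{1..Suc (2 * n)} = insert 1 (insert (Suc (2 * n)) {2..2 * n})" using n2 by auto
      then have "(\<Sum>s\<in>{1..Suc (2 * n)}. ?c (e - ?t s) * hp (K s (e - ?t s))) = ?c (e - ?t 1) * hp (K 1 (e - ?t 1))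
         + (?c (e - ?t (Suc (2 * n))) * hp (K (Suc (2 * n)) (e - ?t (Suc (2 * n))))
         + (\<Sum>s\<in>{2..2 * n}. ?c (e - ?t s) * hp (K s (e - ?t s))))"
        using n2 by simp
      then show ?thesis by (simp add: algebra_simps)
    qed
    finally show ?thesis .
  qed
  have H: "?H (e - ?t s + ?t s) = ?H e" for e s by simp
  have c0: "?c a = 0" if a: "\<And>j. j \<notin> vertices n \<Longrightarrow> a j = 0" "a \<notin> sub_dimvecs n ?v" for a
  proof (rule string_count_eq_0[OF n2])
    obtain j where "j \<in> vertices n" "\<not> (0 \<le> a j \<and> a j \<le> ?v j)" using a unfolding sub_dimvecs_iff by blast
    then show "\<exists>j\<in>vertices n. a j < 0 \<or> int (string_dim i l j) < a j"
      by (intro bexI[of _ j]) (auto simp: string_vec_def)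
  qed
  have b0: "?b a = 0" if a: "\<And>j. j \<notin> vertices n \<Longrightarrow> a j = 0" "a \<notin> sub_dimvecs n ?v" for a
  proof (cases "l = 0")
    case True
    have "\<not> (\<forall>j\<in>vertices n. a j = 0)"
    proof
      assume "\<forall>j\<in>vertices n. a j = 0"
      then have "a \<in> sub_dimvecs n ?v" using a(1) unfolding sub_dimvecs_iff by (simp add: string_vec_def del: vertices_iff)
      then show False using a(2) by simp
    qed
    then show ?thesis unfolding st.lower_count_def using True by simp
  next
    case False
    obtain j where j: "j \<in> vertices n" "\<not> (0 \<le> a j \<and> a j \<le> ?v j)" using a unfolding sub_dimvecs_iff by blast
    have "string_dim i (l - 1) j \<le> string_dim i l j" by (simp add: string_dim_def)
    then have "\<exists>j\<in>vertices n. a j < 0 \<or> int (string_dim i (l - 1) j) < a j"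
      using j by (intro bexI[of _ j]) (auto simp: string_vec_def)
    then show ?thesis unfolding st.lower_count_def using False string_count_eq_0[OF n2, of a i "l - 1" ty] by simp
  qed
  have "torus_scale (hp 1) (x_string i (Suc l)) = (\<Sum>e\<in>sub_dimvecs n (?v + delta n).
      monom (?H e) (hp 1 * (string_count ty n i (Suc l) e * hp (- euler_form n e (?v + delta n - e)))))"
    unfolding x_string_def character_def string_vec_Suc tv.scale_sum_right torus_scale_single ..
  also have "\<dots> = (\<Sum>e\<in>sub_dimvecs n (?v + delta n). (\<Sum>s\<in>{1..Suc (2 * n)}. \<phi> s (e - ?t s)) - \<psi> (e - ?t 1))"
  proof (rule sum.cong[OF refl])
    fix e assume e: "e \<in> sub_dimvecs n (?v + delta n)"
    have ms: "monom d (\<Sum>s\<in>S. g s) = (\<Sum>s\<in>S. monom d (g s))" for d and S :: "nat set" and g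
      by (induction S rule: infinite_finite_induct) (simp_all add: single_add)
    show "monom (?H e) (hp 1 * (string_count ty n i (Suc l) e * hp (- euler_form n e (?v + delta n - e))))
        = (\<Sum>s\<in>{1..Suc (2 * n)}. \<phi> s (e - ?t s)) - \<psi> (e - ?t 1)"
      unfolding coeff[OF e] \<phi>_def \<psi>_def H single_diff ms ..
  qed
  also have "\<dots> = (\<Sum>s\<in>{1..Suc (2 * n)}. \<Sum>e\<in>sub_dimvecs n (?v + delta n). \<phi> s (e - ?t s))
      - (\<Sum>e\<in>sub_dimvecs n (?v + delta n). \<psi> (e - ?t 1))"
    unfolding sum_subtractf by (subst sum.swap) (rule refl)
  also have "\<dots> = x_delta \<star> x_string i l - (\<Sum>a\<in>sub_dimvecs n ?v. \<psi> a)"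
  proof -
    have "(\<Sum>e\<in>sub_dimvecs n (?v + delta n). \<phi> s (e - ?t s)) = (\<Sum>a\<in>sub_dimvecs n ?v. \<phi> s a)" for s
      by (rule sum_sub_dimvecs_shift) (simp add: \<phi>_def c0 del: vertices_iff)
    moreover have "(\<Sum>e\<in>sub_dimvecs n (?v + delta n). \<psi> (e - ?t 1)) = (\<Sum>a\<in>sub_dimvecs n ?v. \<psi> a)"
      by (rule sum_sub_dimvecs_shift) (simp add: \<psi>_def b0 del: vertices_iff)
    ultimately show ?thesis unfolding lhs by simp
  qed
  finally have main: "torus_scale (hp 1) (x_string i (Suc l)) = x_delta \<star> x_string i l - (\<Sum>a\<in>sub_dimvecs n ?v. \<psi> a)" .
  have "(\<Sum>a\<in>sub_dimvecs n ?v. \<psi> a)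
      = torus_scale (hp (-1)) (if l = 0 then monom (unit_vec i) 1 else x_string i (l - 1))"
  proof (cases "l = 0")
    case True
    \<comment> \<open>For \<open>l = 0\<close> only the zero vector contributes, and its exponent is
      the unit vector at \<open>i\<close>: formally M_i(-1) is replaced by the initial
      variable.\<close>
    have z: "0 \<in> sub_dimvecs n ?v" by (simp add: sub_dimvecs_iff string_vec_def)
    have "(\<Sum>a\<in>sub_dimvecs n ?v. \<psi> a) = (\<Sum>a\<in>{0}. \<psi> a)"
    proof (rule sum.mono_neutral_right[OF finite_sub_dimvecs])
      show "\<forall>a\<in>sub_dimvecs n ?v - {0}. \<psi> a = 0"
      proof
        fix a assume a: "a \<in> sub_dimvecs n ?v - {0}"
        have "\<not> (\<forall>j\<in>vertices n. a j = 0)"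
        proof
          assume 0: "\<forall>j\<in>vertices n. a j = 0"
          have "a \<in> sub_dimvecs n ?v" using a by (rule DiffD1)
          then have "\<forall>j. j \<notin> vertices n \<longrightarrow> a j = 0" unfolding sub_dimvecs_iff by (rule conjunct2)
          then have "a = 0" using 0 by (simp add: fun_eq_iff del: vertices_iff) blast
          then show False using a by blast
        qed
        then have "?b a = 0" unfolding st.lower_count_def using True by simp
        then show "\<psi> a = 0" by (simp add: \<psi>_def)
      qed
    qed (use z in simp)
    moreover have "?b 0 = 1" unfolding st.lower_count_def using True by simp
    moreover have "K 1 0 = -1" unfolding K1 by (simp add: euler_form_def bilin_def)
    moreover have "?H (0 + ?t 1) = unit_vec i"
    proof -
      have "?H (0 + ?t 1) = delta_exp n 1 + char_exp n ?v 0" unfolding char_exp_shift ..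
      also have "char_exp n ?v 0 = - mat_vec n (I_minus_Rtr n) (tail_vec n (Suc i))"
        unfolding char_exp_def True string_vec_0 by (simp add: mat_vec_def fun_eq_iff)
      finally have F: "?H (0 + ?t 1) = delta_exp n 1 + - mat_vec n (I_minus_Rtr n) (tail_vec n (Suc i))" .
      have "2 \<le> Suc i" "Suc i \<le> 2 * n" using i by auto
      then show ?thesis unfolding F delta_exp_eq(1)[OF n2] by (simp add: E_tail[OF n2])
    qed
    ultimately show ?thesis using True by (simp add: \<psi>_def torus_scale_single)
  next
    case False
    let ?w = "string_vec n i (l - 1)"
    have vw: "?v = ?w + delta n" using string_vec_Suc[of n i "l - 1"] False by simp
    have sub: "sub_dimvecs n ?w \<subseteq> sub_dimvecs n ?v"
    proof
      fix a assume a: "a \<in> sub_dimvecs n ?w"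
      have "0 \<le> a j \<and> a j \<le> ?v j" if j: "j \<in> vertices n" for j
      proof -
        have "0 \<le> a j \<and> a j \<le> ?w j" using a j unfolding sub_dimvecs_iff by blast
        then show ?thesis using j by (simp add: vw delta_def)
      qed
      then show "a \<in> sub_dimvecs n ?v" using a unfolding sub_dimvecs_iff by blast
    qed
    have "(\<Sum>a\<in>sub_dimvecs n ?v. \<psi> a) = (\<Sum>a\<in>sub_dimvecs n ?w. \<psi> a)"
    proof (rule sum.mono_neutral_right[OF finite_sub_dimvecs sub])
      show "\<forall>a\<in>sub_dimvecs n ?v - sub_dimvecs n ?w. \<psi> a = 0"
      proof
        fix a assume a: "a \<in> sub_dimvecs n ?v - sub_dimvecs n ?w"
        have out: "\<forall>j. j \<notin> vertices n \<longrightarrow> a j = 0"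
          using DiffD1[OF a] unfolding sub_dimvecs_iff by (rule conjunct2)
        have "\<not> (\<forall>j\<in>vertices n. 0 \<le> a j \<and> a j \<le> ?w j)"
          using DiffD2[OF a] out unfolding sub_dimvecs_iff by blast
        then obtain j where j: "j \<in> vertices n" "\<not> (0 \<le> a j \<and> a j \<le> ?w j)" by blast
        then have "\<exists>j\<in>vertices n. a j < 0 \<or> int (string_dim i (l - 1) j) < a j"
          by (intro bexI[of _ j]) (auto simp: string_vec_def)
        then have "?b a = 0" unfolding st.lower_count_def using False string_count_eq_0[OF n2, of a i "l - 1" ty] by simp
        then show "\<psi> a = 0" by (simp add: \<psi>_def)
      qed
    qed
    also have "\<dots> = (\<Sum>a\<in>sub_dimvecs n ?w. torus_scale (hp (-1))
        (monom (char_exp n ?w a) (string_count ty n i (l - 1) a * hp (- euler_form n a (?w - a)))))"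
    proof (rule sum.cong[OF refl])
      fix a
      \<comment> \<open>Adding delta to \<open>a\<close> and 2 delta to \<open>?w\<close> does not
        change the exponent, because B delta is -2 times the image of delta under the Euler
        matrix.\<close>
      have "?H (a + ?t 1) = char_exp n ?w a"
        unfolding tail_vec_1 vw char_exp_def mat_vec_add B_delta[OF n2] E_delta[OF n2] by (simp add: fun_eq_iff)
      moreover have "?b a = string_count ty n i (l - 1) a" unfolding st.lower_count_def using False by simp
      moreover have "K 1 a = -1 - euler_form n a (?w - a)"
        unfolding K1 using euler_tail_right(1)[OF n2, of a] by (simp add: vw euler_add_right euler_diff_right)
      moreover have "hp (-1 - x) = hp (-1) * hp (- x)" for x using hp_add[of "-1" "- x"] by simp
      ultimately show "\<psi> a = torus_scale (hp (-1))
          (monom (char_exp n ?w a) (string_count ty n i (l - 1) a * hp (- euler_form n a (?w - a))))"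
        by (simp add: \<psi>_def torus_scale_single mult.left_commute)
    qed
    also have "\<dots> = torus_scale (hp (-1)) (x_string i (l - 1))"
      unfolding x_string_def character_def tv.scale_sum_right ..
    finally show ?thesis using False by simp
  qed
  then show ?thesis using main by (simp add: algebra_simps)
qed

end

section \<open>Reversal of the first terms and the exceptional vertices\<close>

context torus begin

lemma flip_x_above:
  assumes i: "i \<in> vertices n"
  shows "flip (x_above (2 * n + 1 - i)) = x_below i"
proof -
  have i': "2 * n + 1 - i \<in> vertices n" "2 * n + 1 - (2 * n + 1 - i) = i" using i by auto
  let ?A = "{Suc (2 * n + 1 - i)..Suc (2 * n)}"
  have "flip (x_above (2 * n + 1 - i)) = (\<Sum>s\<in>?A. monom (delta_exp n (2 * n + 2 - s) + unit_vec i) 1)"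
    unfolding x_above_def flip_sum
  proof (rule sum.cong[OF refl])
    fix s assume s: "s \<in> ?A"
    then have s': "s \<in> {1..Suc (2 * n)}" by auto
    show "flip (monom (delta_exp n s + unit_vec (2 * n + 1 - i)) 1) = monom (delta_exp n (2 * n + 2 - s) + unit_vec i) 1"
      unfolding flip_single flip_add delta_exp_flip[OF s'] unit_vec_flip[OF i'(1)] i'(2) ..
  qed
  also have "\<dots> = (\<Sum>s\<in>{1..i}. monom (delta_exp n s + unit_vec i) 1)"
  proof -
    have "2 * n + 2 - Suc (2 * n) = 1" "2 * n + 2 - Suc (2 * n + 1 - i) = i" using i by auto
    then have "bij_betw (\<lambda>s. 2 * n + 2 - s) ?A {1..i}"
      using bij_reverse_interval[of "Suc (2 * n + 1 - i)" "Suc (2 * n)"] by simp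
    then show ?thesis by (rule sum.reindex_bij_betw)
  qed
  finally show ?thesis by (simp add: x_below_def)
qed

text \<open>At the two ends one half of the product with X_delta degenerates to a single initial
  variable; this causes the index shifts in (1) and (3).\<close>

lemma x_below_1: "x_below 1 = monom (unit_vec (2 * n)) 1"
  unfolding x_below_def using delta_exp_eq(1)[OF n2] by simp

lemma x_above_top: "x_above (2 * n) = monom (unit_vec 1) 1"
  unfolding x_above_def using delta_exp_eq(2)[OF n2] by simp

end

context torus_field begin

text \<open>X_i followed by the characters of M_i(0), M_i(1), ...; \<open>z_seq\<close> is its
  mirror image, X_i followed by those of N_i(0), N_i(1), ....\<close>

definition y_seq :: "nat \<Rightarrow> nat \<Rightarrow> torus_elem" where
  "y_seq i m = (if m = 0 then monom (unit_vec i) 1 else x_string i (m - 1))"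

definition z_seq :: "nat \<Rightarrow> nat \<Rightarrow> torus_elem" where
  "z_seq i m = flip (y_seq (2 * n + 1 - i) m)"

lemma y_seq_left:
  assumes i: "1 \<le> i" "i < 2 * n"
  shows "x_delta \<star> y_seq i (Suc l) = torus_scale (hp 1) (y_seq i (Suc (Suc l))) + torus_scale (hp (-1)) (y_seq i l)"
  using left_mult[OF i, of l] by (simp add: y_seq_def)

lemma y_seq_right:
  assumes i: "1 \<le> i" "i < 2 * n"
  shows "y_seq i (Suc l) \<star> x_delta = torus_scale (hp (-1)) (y_seq i (Suc (Suc l))) + torus_scale (hp 1) (y_seq i l)"
proof -
  \<comment> \<open>Prolonging the sequence backwards by \<open>x_below i\<close> makes the products
    of X_i and of M_i(0) with X_delta the two initial values of the right recursion.\<close>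
  define Y where "Y = (\<lambda>m. if m = 0 then x_below i else y_seq i (m - 1))"
  have v: "i \<in> vertices n" using i by simp
  have y1: "y_seq i 1 = x_above i" using x_string_0[OF i] by (simp add: y_seq_def)
  have y0: "y_seq i 0 = monom (unit_vec i) 1" by (simp add: y_seq_def)
  have "Y (Suc (Suc l)) \<star> x_delta = torus_scale (hp (-1)) (Y (Suc (Suc (Suc l)))) + torus_scale (hp 1) (Y (Suc l))"
  proof (rule right_recursion)
    show "x_delta \<star> Y (Suc l) = torus_scale (hp 1) (Y (Suc (Suc l))) + torus_scale (hp (-1)) (Y l)" for l
    proof (cases l)
      case 0
      then show ?thesis using base_left[OF v] y1 y0 by (simp add: Y_def)
    next
      case (Suc k)
      then show ?thesis using y_seq_left[OF i, of k] by (simp add: Y_def)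
    qed
    show "Y 1 \<star> x_delta = torus_scale (hp (-1)) (Y 2) + torus_scale (hp 1) (Y 0)"
      using base_right[OF v] y1 y0 by (simp add: Y_def)
    \<comment> \<open>The left recursion is inserted into the commutator formula; its contribution
      with \<open>hp (-3)\<close> cancels, leaving \<open>hp 1\<close> times X_i.\<close>
    have h: "hp (-2) * hp 1 = hp (-1)" "hp (-2) * hp (-1) = hp (-3)" by (simp_all add: hp_add[symmetric])
    have "x_delta \<star> x_above i = torus_scale (hp 1) (y_seq i 2) + torus_scale (hp (-1)) (monom (unit_vec i) 1)"
      using y_seq_left[OF i, of 0] y1 y0 by (simp add: numeral_2_eq_2)
    then have "x_above i \<star> x_delta = torus_scale (hp (-1)) (y_seq i 2)
        + (torus_scale (hp (-3)) (monom (unit_vec i) 1) + torus_scale (hp 1 - hp (-3)) (monom (unit_vec i) 1))"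
      unfolding x_above_commutator[OF v] by (simp add: tv.scale_right_distrib h add.assoc)
    also have "torus_scale (hp (-3)) (monom (unit_vec i) 1) + torus_scale (hp 1 - hp (-3)) (monom (unit_vec i) 1)
        = torus_scale (hp 1) (monom (unit_vec i) 1)"
      unfolding tv.scale_left_distrib[symmetric] by simp
    finally show "Y 2 \<star> x_delta = torus_scale (hp (-1)) (Y 3) + torus_scale (hp 1) (Y 1)"
      using y1 y0 by (simp add: Y_def numeral_3_eq_3 numeral_2_eq_2)
  qed
  then show ?thesis by (simp add: Y_def)
qed

lemma z_seq_left:
  assumes i: "2 \<le> i" "i \<le> 2 * n"
  shows "x_delta \<star> z_seq i (Suc l) = torus_scale (hp (-1)) (z_seq i (Suc (Suc l))) + torus_scale (hp 1) (z_seq i l)"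
proof -
  have i': "1 \<le> 2 * n + 1 - i" "2 * n + 1 - i < 2 * n" using i by auto
  have "x_delta \<star> z_seq i (Suc l) = flip (y_seq (2 * n + 1 - i) (Suc l) \<star> x_delta)"
    unfolding z_seq_def flip_mult flip_x_delta ..
  then show ?thesis unfolding y_seq_right[OF i'] flip_plus flip_scale z_seq_def .
qed

lemma z_seq_0: "i \<in> vertices n \<Longrightarrow> z_seq i 0 = monom (unit_vec i) 1"
proof -
  assume i: "i \<in> vertices n"
  then have "2 * n + 1 - i \<in> vertices n" "2 * n + 1 - (2 * n + 1 - i) = i" by auto
  then show ?thesis using unit_vec_flip[of "2 * n + 1 - i"] by (simp add: z_seq_def y_seq_def flip_single)
qed

lemma z_seq_1:
  assumes i: "2 \<le> i" "i \<le> 2 * n" shows "z_seq i 1 = x_below i"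
proof -
  have i': "1 \<le> 2 * n + 1 - i" "2 * n + 1 - i < 2 * n" "i \<in> vertices n" using i by auto
  show ?thesis using flip_x_above[OF i'(3)] x_string_0[OF i'(1,2)] by (simp add: z_seq_def y_seq_def)
qed

lemma y_seq_1: "1 \<le> i \<Longrightarrow> i < 2 * n \<Longrightarrow> y_seq i 1 = x_above i"
  using x_string_0 by (simp add: y_seq_def)

lemma X_char_M:
  fixes V :: "'k rep"
  assumes i: "1 \<le> i" "i < 2 * n" and M: "is_M n i l V"
  shows "X_char n q (of_rep V) = y_seq i (Suc l)"
proof -
  have "(\<lambda>e. real (card (Gr n V e))) = string_count ty n i l"
    using is_M_string(2)[OF n2 i M] by (simp add: fun_eq_iff string_count_def)
  then show ?thesis unfolding X_char_of_rep is_M_string(1)[OF n2 i M]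
    by (simp add: y_seq_def x_string_def string_vec_def)
qed

lemma X_char_N:
  fixes V :: "'k rep"
  assumes i: "2 \<le> i" "i \<le> 2 * n" and N: "is_N n i l V"
  shows "X_char n q (of_rep V) = z_seq i (Suc l)"
proof -
  let ?i = "2 * n + 1 - i"
  let ?v = "string_vec n ?i l"
  have i': "1 \<le> ?i" "?i < 2 * n" "2 * n + 1 - ?i = i" using i by auto
  have N': "is_N n (2 * n + 1 - ?i) l V" using N unfolding i'(3) .
  have d: "dimvec n V = ?v \<circ> flip_vertex"
    unfolding is_N_string(1)[OF n2 i'(1,2) N'] by (auto simp: string_vec_def flip_vertex_def fun_eq_iff)
  have "X_char n q (of_rep V) = flip (character (string_count ty n ?i l) ?v)"
    unfolding X_char_of_rep d
  proof (rule flip_character)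
    show "?v j = 0" if "j \<notin> vertices n" for j using that by (simp add: string_vec_def del: vertices_iff)
    \<comment> \<open>Complementing and reversing the dimension vector twice returns
      \<open>a\<close>, so the count for N at the image of \<open>a\<close> is the string count at
      \<open>a\<close>.\<close>
    fix a assume "a \<in> sub_dimvecs n ?v"
    have "Gr n (string_rep n ?i l :: 'k rep) (\<lambda>j. int (string_dim ?i l j) - ((?v - a) \<circ> flip_vertex) (2 * n + 1 - j))
        = Gr n (string_rep n ?i l) a"
    proof (rule Gr_cong)
      fix j assume j: "j \<in> vertices n"
      then have "flip_vertex (2 * n + 1 - j) = j" by (auto simp: flip_vertex_def)
      then show "int (string_dim ?i l j) - ((?v - a) \<circ> flip_vertex) (2 * n + 1 - j) = a j"
        using j by (simp add: string_vec_def del: vertices_iff)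
    qed
    then show "real (card (Gr n V ((?v - a) \<circ> flip_vertex))) = string_count ty n ?i l a"
      unfolding is_N_string(2)[OF n2 i'(1,2) N'] string_count_def by simp
  qed
  then show ?thesis by (simp add: z_seq_def y_seq_def x_string_def)
qed

end

theorem theorem3p8:
  fixes n m q :: nat
    and h :: "'f::{field, finite} \<Rightarrow> 'k::{field, finite}"
    and c :: 'k
    and T :: "(real, torus_elem) module" (structure)
    and M N :: "nat \<Rightarrow> int \<Rightarrow> 'k cluster_obj"
    and X :: "'k cluster_obj \<Rightarrow> torus_elem"
    and X\<^sub>\<delta> :: torus_elem
  assumes n: "n \<ge> 2" and m: "m \<ge> 1"
    and q: "q = card (UNIV :: 'f set)"
    and ext: "degree_two_extension h"
    and M: "\<And>i l. 1 \<le> i \<Longrightarrow> i \<le> 2*n - 1 \<Longrightarrow> \<exists>V. is_M n i l V \<and> M i (int l) = of_rep V"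
    and M_shift: "M 1 (-1) = I_shift n 1"
    and N: "\<And>i l. 2 \<le> i \<Longrightarrow> i \<le> 2*n \<Longrightarrow> \<exists>V. is_N n i l V \<and> N i (int l) = of_rep V"
    and N_shift: "N (2*n) (-1) = I_shift n (2*n)"
  defines "T \<equiv> quantum_torus n q"
    and "X \<equiv> X_char n q"
    and "X\<^sub>\<delta> \<equiv> X (of_rep (E_rep n c))"
  shows "chebyshev_F T m X\<^sub>\<delta> \<otimes> X (I_shift n 1)
           = (real q powr (real m / 2) \<odot> X (M 1 (int m - 1)))
             \<oplus> (real q powr (- real m / 2) \<odot> X (N (2*n) (int m - 2)))
       \<and> (\<forall>i. 2 \<le> i \<and> i \<le> 2*n - 1 \<longrightarrow>
           chebyshev_F T m X\<^sub>\<delta> \<otimes> X (I_shift n i)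
             = (real q powr (real m / 2) \<odot> X (M i (int m - 1)))
               \<oplus> (real q powr (- real m / 2) \<odot> X (N i (int m - 1))))
       \<and> chebyshev_F T m X\<^sub>\<delta> \<otimes> X (I_shift n (2*n))
           = (real q powr (real m / 2) \<odot> X (M 1 (int m - 2)))
             \<oplus> (real q powr (- real m / 2) \<odot> X (N (2*n) (int m - 1)))"
proof -
  interpret torus_field n q "TYPE('k)"
  proof
    show "CARD('k) = q\<^sup>2" unfolding q by (rule card_degree_two_extension[OF ext])
    show "q > 0" unfolding q by (simp add: card_gt_0_iff)
  qed (rule n)
  have X\<^sub>\<delta>: "X\<^sub>\<delta> = x_delta" unfolding X\<^sub>\<delta>_def X_def by (rule X_char_E_rep)
  have xc: "x_delta \<in> carrier (quantum_torus n q)"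
    using X_char_carrier[of "E_rep n c"] unfolding X_char_E_rep .
  have XI: "X (I_shift n i) = monom (unit_vec i) 1" if "i \<in> vertices n" for i
    unfolding X_def by (rule X_char_I_shift[OF that])
  have XM: "X (M i (int l)) = y_seq i (Suc l)" if i: "1 \<le> i" "i < 2 * n" for i l
  proof -
    have "i \<le> 2 * n - 1" using i by simp
    then obtain V where V: "is_M n i l V" "M i (int l) = of_rep V" using M[OF i(1)] by blast
    show ?thesis unfolding V(2) X_def by (rule X_char_M[OF i V(1)])
  qed
  have XN: "X (N i (int l)) = z_seq i (Suc l)" if i: "2 \<le> i" "i \<le> 2 * n" for i l
  proof -
    obtain V where V: "is_N n i l V" "N i (int l) = of_rep V" using N[OF i] by blast
    show ?thesis unfolding V(2) X_def by (rule X_char_N[OF i V(1)])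
  qed
  obtain k where k: "m = Suc k" using m by (cases m) auto
  have im: "int m - 1 = int k" by (simp add: k)
  have hp: "real q powr (real m / 2) = half_power q (int (Suc k))"
    "real q powr (- real m / 2) = half_power q (- int (Suc k))"
    by (simp_all add: half_power_def k)
  have v: "1 \<in> vertices n" "2 * n \<in> vertices n" using n by auto
  have n1: "1 < 2 * n" "2 \<le> 2 * n" using n by auto
  have first: "chebyshev_F (quantum_torus n q) (Suc k) x_delta \<star> monom (unit_vec 1) 1
      = torus_scale (half_power q (int (Suc k))) (y_seq 1 (Suc k))
        + torus_scale (half_power q (- int (Suc k))) (z_seq (2 * n) k)"
  proof -
    \<comment> \<open>X_1, X_{2n}, N_{2n}(0), ...: the N-sequence of the vertex 2n prolonged
      backwards. The start fits since \<open>x_below 1\<close> is X_{2n}, and the first step of the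
      recursion since \<open>x_above (2 * n)\<close> is X_1.\<close>
    define Z where "Z = (\<lambda>l. if l = 0 then monom (unit_vec 1) 1 else z_seq (2 * n) (l - 1))"
    have "chebyshev_F (quantum_torus n q) (Suc k) x_delta \<star> monom (unit_vec 1) 1
      = torus_scale (half_power q (int (Suc k))) (y_seq 1 (Suc k))
        + torus_scale (half_power q (- int (Suc k))) (Z (Suc k))"
    proof (rule chebyshev_mult[OF xc])
      show "y_seq 1 0 = monom (unit_vec 1) 1" by (simp add: y_seq_def)
      show "Z 0 = monom (unit_vec 1) 1" by (simp add: Z_def)
      show "x_delta \<star> monom (unit_vec 1) 1
          = torus_scale (half_power q 1) (y_seq 1 1) + torus_scale (half_power q (- 1)) (Z 1)"
        unfolding base_left[OF v(1)] y_seq_1[OF order_refl n1(1)] x_below_1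
        using z_seq_0[OF v(2)] by (simp add: Z_def)
      show "x_delta \<star> y_seq 1 (Suc l)
          = torus_scale (half_power q 1) (y_seq 1 (Suc (Suc l))) + torus_scale (half_power q (- 1)) (y_seq 1 l)" for l
        by (rule y_seq_left[OF order_refl n1(1)])
      show "x_delta \<star> Z (Suc l)
          = torus_scale (half_power q (- 1)) (Z (Suc (Suc l))) + torus_scale (half_power q 1) (Z l)" for l
      proof (cases l)
        case 0
        have "x_delta \<star> z_seq (2 * n) 0 = torus_scale (half_power q 1) (monom (unit_vec 1) 1)
            + torus_scale (half_power q (- 1)) (z_seq (2 * n) 1)"
          unfolding z_seq_0[OF v(2)] base_left[OF v(2)] x_above_top z_seq_1[OF n1(2) order_refl] ..
        then show ?thesis using 0 by (simp add: Z_def add.commute)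
      next
        case (Suc l')
        then show ?thesis using z_seq_left[OF n1(2) order_refl, of l'] by (simp add: Z_def)
      qed
    qed
    then show ?thesis by (simp add: Z_def)
  qed
  have middle: "chebyshev_F (quantum_torus n q) (Suc k) x_delta \<star> monom (unit_vec i) 1
      = torus_scale (half_power q (int (Suc k))) (y_seq i (Suc k))
        + torus_scale (half_power q (- int (Suc k))) (z_seq i (Suc k))" if i: "2 \<le> i" "i < 2 * n" for i
  proof (rule chebyshev_mult[OF xc])
    have i': "1 \<le> i" "i \<le> 2 * n" "i \<in> vertices n" using i by auto
    show "y_seq i 0 = monom (unit_vec i) 1" by (simp add: y_seq_def)
    show "z_seq i 0 = monom (unit_vec i) 1" by (rule z_seq_0[OF i'(3)])
    show "x_delta \<star> monom (unit_vec i) 1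
        = torus_scale (half_power q 1) (y_seq i 1) + torus_scale (half_power q (- 1)) (z_seq i 1)"
      unfolding base_left[OF i'(3)] y_seq_1[OF i'(1) i(2)] z_seq_1[OF i(1) i'(2)] ..
    show "x_delta \<star> y_seq i (Suc l)
        = torus_scale (half_power q 1) (y_seq i (Suc (Suc l))) + torus_scale (half_power q (- 1)) (y_seq i l)" for l
      by (rule y_seq_left[OF i'(1) i(2)])
    show "x_delta \<star> z_seq i (Suc l)
        = torus_scale (half_power q (- 1)) (z_seq i (Suc (Suc l))) + torus_scale (half_power q 1) (z_seq i l)" for l
      by (rule z_seq_left[OF i(1) i'(2)])
  qed
  have last: "chebyshev_F (quantum_torus n q) (Suc k) x_delta \<star> monom (unit_vec (2 * n)) 1
      = torus_scale (half_power q (int (Suc k))) (y_seq 1 k)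
        + torus_scale (half_power q (- int (Suc k))) (z_seq (2 * n) (Suc k))"
  proof -
    \<comment> \<open>X_{2n}, X_1, M_1(0), ...: the mirror image of the prolongation used for the
      vertex 1.\<close>
    define Y where "Y = (\<lambda>l. if l = 0 then monom (unit_vec (2 * n)) 1 else y_seq 1 (l - 1))"
    have "chebyshev_F (quantum_torus n q) (Suc k) x_delta \<star> monom (unit_vec (2 * n)) 1
      = torus_scale (half_power q (int (Suc k))) (Y (Suc k))
        + torus_scale (half_power q (- int (Suc k))) (z_seq (2 * n) (Suc k))"
    proof (rule chebyshev_mult[OF xc])
      show "Y 0 = monom (unit_vec (2 * n)) 1" by (simp add: Y_def)
      show "z_seq (2 * n) 0 = monom (unit_vec (2 * n)) 1" by (rule z_seq_0[OF v(2)])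
      have y0: "y_seq 1 0 = monom (unit_vec 1) 1" by (simp add: y_seq_def)
      show "x_delta \<star> monom (unit_vec (2 * n)) 1
          = torus_scale (half_power q 1) (Y 1) + torus_scale (half_power q (- 1)) (z_seq (2 * n) 1)"
        unfolding base_left[OF v(2)] z_seq_1[OF n1(2) order_refl] x_above_top
        using y0 by (simp add: Y_def)
      show "x_delta \<star> z_seq (2 * n) (Suc l) = torus_scale (half_power q (- 1)) (z_seq (2 * n) (Suc (Suc l)))
          + torus_scale (half_power q 1) (z_seq (2 * n) l)" for l
        by (rule z_seq_left[OF n1(2) order_refl])
      show "x_delta \<star> Y (Suc l)
          = torus_scale (half_power q 1) (Y (Suc (Suc l))) + torus_scale (half_power q (- 1)) (Y l)" for l
      proof (cases l)
        case 0
        have "x_delta \<star> y_seq 1 0 = torus_scale (half_power q 1) (y_seq 1 1)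
            + torus_scale (half_power q (- 1)) (monom (unit_vec (2 * n)) 1)"
          unfolding y0 base_left[OF v(1)] y_seq_1[OF order_refl n1(1)] x_below_1 ..
        then show ?thesis using 0 by (simp add: Y_def)
      next
        case (Suc l')
        then show ?thesis using y_seq_left[OF order_refl n1(1), of l'] by (simp add: Y_def)
      qed
    qed
    then show ?thesis by (simp add: Y_def)
  qed
  \<comment> \<open>For m = 1 the index is -1, and the shifted injective supplies term 0 of the
    sequence.\<close>
  have XN2: "X (N (2 * n) (int m - 2)) = z_seq (2 * n) k"
  proof (cases k)
    case 0
    then have "int m - 2 = -1" by (simp add: k)
    then show ?thesis using N_shift XI[OF v(2)] z_seq_0[OF v(2)] 0 by simp
  next
    case (Suc k')
    then have "int m - 2 = int k'" by (simp add: k)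
    then show ?thesis using XN[OF n1(2) order_refl, of k'] Suc by simp
  qed
  have XM2: "X (M 1 (int m - 2)) = y_seq 1 k"
  proof (cases k)
    case 0
    then have "int m - 2 = -1" by (simp add: k)
    then show ?thesis using M_shift XI[OF v(1)] 0 by (simp add: y_seq_def)
  next
    case (Suc k')
    then have "int m - 2 = int k'" by (simp add: k)
    then show ?thesis using XM[OF order_refl n1(1), of k'] Suc by simp
  qed
  show ?thesis
    unfolding T_def T_simps X\<^sub>\<delta> XI[OF v(1)] XI[OF v(2)] XN2 XM2 im hp
    unfolding k
  proof (intro conjI allI impI)
    show "chebyshev_F (quantum_torus n q) (Suc k) x_delta \<star> monom (unit_vec 1) 1
      = torus_scale (half_power q (int (Suc k))) (X (M 1 (int k)))
        + torus_scale (half_power q (- int (Suc k))) (z_seq (2 * n) k)"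
      using first XM[OF order_refl n1(1), of k] by simp
    show "chebyshev_F (quantum_torus n q) (Suc k) x_delta \<star> X (I_shift n i)
      = torus_scale (half_power q (int (Suc k))) (X (M i (int k)))
        + torus_scale (half_power q (- int (Suc k))) (X (N i (int k)))" if "2 \<le> i \<and> i \<le> 2 * n - 1" for i
    proof -
      have i: "2 \<le> i" "i < 2 * n" "1 \<le> i" "i \<le> 2 * n" "i \<in> vertices n" using that n by auto
      show ?thesis unfolding XI[OF i(5)] XM[OF i(3,2)] XN[OF i(1,4)] by (rule middle[OF i(1,2)])
    qed
    show "chebyshev_F (quantum_torus n q) (Suc k) x_delta \<star> monom (unit_vec (2 * n)) 1
      = torus_scale (half_power q (int (Suc k))) (y_seq 1 k)
        + torus_scale (half_power q (- int (Suc k))) (X (N (2 * n) (int k)))"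
      using last XN[OF n1(2) order_refl, of k] by simp
  qed
qed

end
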